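(* Let $c_v=\tfrac32$ and $T>0$. There exist constant states $(\varrho_\pm,\vartheta_\pm,\mathbf v_\pm)\in(0,\infty)\times(0,\infty)\times\mathbb R^2$ such that, for the Riemann initial data $$(\varrho_0,\vartheta_0,\mathbf v_0)(x_1,x_2)=\begin{cases}(\varrho_-,\vartheta_-,\mathbf v_-)&\text{if }x_1\in\mathbb R,\ x_2<0,\\(\varrho_+,\vartheta_+,\mathbf v_+)&\text{if }x_1\in\mathbb R,\ x_2>0,\end{cases}$$ the 1-D self-similar solution of the Euler system in $(0,T)\times\mathbb R^2$ with these initial data is not entropy rate admissible; that is, it is not maximal with respect to the relation $\prec$ (defined in the context) among the entropy admissible weak solutions in $(0,T)\times\mathbb R^2$ with these initial data.
   Context: **Euler system.** The unknowns are the density $\varrho=\varrho(t,x)>0$, the temperature $\vartheta=\vartheta(t,x)>0$ and the velocity $\mathbf v=\mathbf v(t,x)\in\mathbb R^2$, for $(t,x)\in(0,T)\times\mathbb R^2$: $$\partial_t\varrho+\mathrm{div}_x(\varrho\mathbf v)=0,$$ $$\partial_t(\varrho\mathbf v)+\mathrm{div}_x(\varrho\mathbf v\otimes\mathbf v)+\nabla_x p=0,$$ $$\partial_t\big(\tfrac12\varrho|\mathbf v|^2+\varrho e\big)+\mathrm{div}_x\big[\big(\tfrac12\varrho|\mathbf v|^2+\varrho e+p\big)\mathbf v\big]=0,$$ with $p=\varrho\vartheta$, $e=c_v\vartheta$, and initial conditions $\varrho(0,\cdot)=\varrho_0$, $\vartheta(0,\cdot)=\vartheta_0$, $\mathbf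 v(0,\cdot)=\mathbf v_0$. The entropy is $s(\varrho,\vartheta)=c_v\log\vartheta-\log\varrho$. **Entropy admissible weak solution.** A triple $(\varrho,\vartheta,\mathbf v)$ of measurable functions on $(0,T)\times\mathbb R^2$ with $\varrho,\vartheta>0$ a.e. and all quantities appearing in the equations locally integrable, which satisfies the three equations in the sense of distributions with the given initial data (test functions in $C^1_c([0,T)\times\mathbb R^2)$), and which satisfies the entropy inequality $$\partial_t(\varrho s(\varrho,\vartheta))+\mathrm{div}_x(\varrho s(\varrho,\vartheta)\mathbf v)\ge0$$ in the sense of distributions, with initial value $\varrho_0s(\varrho_0,\vartheta_0)$ (non-negative test functions in $C^1_c([0,T)\times\mathbb R^2)$). **1-D self-similar solution.** For Riemann data as in the claim, this is the unique entropy admissible weak solution given by the classical theory of 1-D hyperbolic conservation laws which is independent of $x_1$, is a function of $x_2/t$ only, and consists of constant states connected by shocks, rarefaction waves or contact discontinuities. **Relation $\prec$.** For two such solutions with the same initial data, $(\varrho^1,\vartheta^1,\mathbf v^1)\prec(\varrho^2,\vartheta^2,\mathbf v^2)$ if and only if there exists $\tau\ge0$ such that $(\varrho^1,\vartheta^1,\mathbf v^1)(t,\cdot)=(\varrho^2,\vartheta^2,\mathbf v^2)(t,\cdot)$ for $0\le t<\tau$, and there exists $\underline L$ such that for all $L\ge\underline L$ $$\frac{\mathrm d^+}{\mathrm dt}\int_{-L}^L\int_{-L}^L\varrho^1s(\varrho^1,\vartheta^1)(\tau,\cdot)\,\mathrm dx_1\mathrm dx_2<\frac{\mathrm d^+}{\mathrm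 dt}\int_{-L}^L\int_{-L}^L\varrho^2s(\varrho^2,\vartheta^2)(\tau,\cdot)\,\mathrm dx_1\mathrm dx_2,$$ where $\frac{\mathrm d^+}{\mathrm dt}$ denotes the right derivative with respect to time at $t=\tau$ (at $\tau=0$ the value of the integral at time $0$ is the one determined by the initial data). **Entropy rate admissible** (also called Dafermos admissible). A solution is entropy rate admissible if it is maximal with respect to $\prec$, i.e. there is no entropy admissible weak solution with the same initial data that is strictly larger with respect to $\prec$. *)

theory Defs
  imports "HOL-Analysis.Analysis"
begin

section \<open>States and constitutive relations\<close>

text \<open>A state is a triple of density, temperature and velocity.  The specific heat at constant
  volume \<open>cv\<close> is a parameter throughout.\<close>

type_synonym state = "real \<times> real \<times> (real^2)"

abbreviation dens :: "state \<Rightarrow> real" where "dens u \<equiv> fst u"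
abbreviation temp :: "state \<Rightarrow> real" where "temp u \<equiv> fst (snd u)"
abbreviation vel :: "state \<Rightarrow> real^2" where "vel u \<equiv> snd (snd u)"

definition pressure :: "state \<Rightarrow> real" where
  "pressure u = dens u * temp u"

definition internal_energy :: "real \<Rightarrow> state \<Rightarrow> real" where
  "internal_energy cv u = cv * temp u"

definition energy :: "real \<Rightarrow> state \<Rightarrow> real" where
  "energy cv u = 1/2 * dens u * (norm (vel u))\<^sup>2 + dens u * internal_energy cv u"

definition entropy :: "real \<Rightarrow> state \<Rightarrow> real" where
  "entropy cv u = cv * ln (temp u) - ln (dens u)"

definition entropy_density :: "real \<Rightarrow> state \<Rightarrow> real" where
  "entropy_density cv u = dens u * entropy cv u"

text \<open>Fluxes are given contracted with a covector \<open>\<xi>\<close>: a law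
  \<open>\<partial>\<^sub>t q + div\<^sub>x f = 0\<close> is represented by \<open>q\<close> and \<open>F u \<xi> = f(u) \<cdot> \<xi>\<close>.\<close>

definition mass_flux :: "state \<Rightarrow> real^2 \<Rightarrow> real" where
  "mass_flux u \<xi> = dens u * (vel u \<bullet> \<xi>)"

definition momentum :: "state \<Rightarrow> real^2" where
  "momentum u = dens u *\<^sub>R vel u"

definition momentum_flux :: "state \<Rightarrow> real^2 \<Rightarrow> real^2" where
  "momentum_flux u \<xi> = (dens u * (vel u \<bullet> \<xi>)) *\<^sub>R vel u + pressure u *\<^sub>R \<xi>"

definition energy_flux :: "real \<Rightarrow> state \<Rightarrow> real^2 \<Rightarrow> real" where
  "energy_flux cv u \<xi> = (energy cv u + pressure u) * (vel u \<bullet> \<xi>)"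

definition entropy_flux :: "real \<Rightarrow> state \<Rightarrow> real^2 \<Rightarrow> real" where
  "entropy_flux cv u \<xi> = entropy_density cv u * (vel u \<bullet> \<xi>)"

section \<open>Entropy admissible weak solutions\<close>

text \<open>Space-time fields take arguments \<open>(t, x)\<close>; only their values for \<open>0 < t < T\<close> matter.\<close>

type_synonym field = "real \<times> (real^2) \<Rightarrow> state"

text \<open>Functions in \<open>C\<^sup>1\<^sub>c([0,T) \<times> \<real>\<^sup>2)\<close> together with their space-time gradient
  \<open>G = (\<partial>\<^sub>t \<phi>, \<nabla>\<^sub>x \<phi>)\<close>; the time derivative at \<open>t = 0\<close> is one-sided, and the support may meet
  \<open>t = 0\<close> but stays away from \<open>t = T\<close>.\<close>

definition test_function ::
  "real \<Rightarrow> (real \<times> (real^2) \<Rightarrow> real) \<Rightarrow> (real \<times> (real^2) \<Rightarrow> real \<times> (real^2)) \<Rightarrow> bool" where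
  "test_function T \<phi> G \<longleftrightarrow>
     (\<forall>z \<in> {0..<T} \<times> UNIV. (\<phi> has_derivative (\<lambda>h. G z \<bullet> h)) (at z within {0..<T} \<times> UNIV)) \<and>
     continuous_on ({0..<T} \<times> UNIV) G \<and>
     (\<exists>K. compact K \<and> K \<subseteq> {0..<T} \<times> UNIV \<and> (\<forall>z \<in> {0..<T} \<times> UNIV - K. \<phi> z = 0))"

text \<open>The distribution \<open>-(\<partial>\<^sub>t q(U) + div\<^sub>x f(U))\<close> with initial value \<open>q(U\<^sub>0)\<close>, tested against \<open>\<phi>\<close>.\<close>

definition weak_pairing ::
  "real \<Rightarrow> (state \<Rightarrow> 'a::euclidean_space) \<Rightarrow> (state \<Rightarrow> real^2 \<Rightarrow> 'a) \<Rightarrow> (real^2 \<Rightarrow> state) \<Rightarrow> field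
    \<Rightarrow> (real \<times> (real^2) \<Rightarrow> real) \<Rightarrow> (real \<times> (real^2) \<Rightarrow> real \<times> (real^2)) \<Rightarrow> 'a" where
  "weak_pairing T q F U0 U \<phi> G =
     (LINT z : {0<..<T} \<times> UNIV | lebesgue. fst (G z) *\<^sub>R q (U z) + F (U z) (snd (G z)))
     + (LINT x | lebesgue. \<phi> (0, x) *\<^sub>R q (U0 x))"

definition locally_integrable ::
  "real \<Rightarrow> (real \<times> (real^2) \<Rightarrow> 'a::euclidean_space) \<Rightarrow> bool" where
  "locally_integrable T f \<longleftrightarrow>
     (\<forall>K. compact K \<and> K \<subseteq> {0..<T} \<times> UNIV \<longrightarrow> set_integrable lebesgue (K \<inter> {0<..<T} \<times> UNIV) f)"

definition entropy_admissible :: "real \<Rightarrow> real \<Rightarrow> (real^2 \<Rightarrow> state) \<Rightarrow> field \<Rightarrow> bool" where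
  "entropy_admissible cv T U0 U \<longleftrightarrow>
     U \<in> borel_measurable (lebesgue_on ({0<..<T} \<times> UNIV)) \<and>
     (AE z in lebesgue_on ({0<..<T} \<times> UNIV). dens (U z) > 0 \<and> temp (U z) > 0) \<and>
     locally_integrable T (\<lambda>z. dens (U z)) \<and>
     locally_integrable T (\<lambda>z. momentum (U z)) \<and>
     (\<forall>i j. locally_integrable T (\<lambda>z. dens (U z) * vel (U z) $ i * vel (U z) $ j)) \<and>
     locally_integrable T (\<lambda>z. pressure (U z)) \<and>
     locally_integrable T (\<lambda>z. energy cv (U z)) \<and>
     locally_integrable T (\<lambda>z. (energy cv (U z) + pressure (U z)) *\<^sub>R vel (U z)) \<and>
     locally_integrable T (\<lambda>z. entropy_density cv (U z)) \<and>
     locally_integrable T (\<lambda>z. entropy_density cv (U z) *\<^sub>R vel (U z)) \<and>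
     (\<forall>\<phi> G. test_function T \<phi> G \<longrightarrow>
        weak_pairing T dens mass_flux U0 U \<phi> G = 0 \<and>
        weak_pairing T momentum momentum_flux U0 U \<phi> G = 0 \<and>
        weak_pairing T (energy cv) (energy_flux cv) U0 U \<phi> G = 0) \<and>
     (\<forall>\<phi> G. test_function T \<phi> G \<and> (\<forall>z \<in> {0..<T} \<times> UNIV. \<phi> z \<ge> 0) \<longrightarrow>
        weak_pairing T (entropy_density cv) (entropy_flux cv) U0 U \<phi> G \<le> 0)"

section \<open>Riemann data and the 1-D self-similar solution\<close>

definition riemann_data :: "state \<Rightarrow> state \<Rightarrow> real^2 \<Rightarrow> state" where
  "riemann_data ul ur x = (if x $ 2 < 0 then ul else ur)"

definition positive_state :: "state \<Rightarrow> bool" where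
  "positive_state u \<longleftrightarrow> dens u > 0 \<and> temp u > 0"

text \<open>\<open>c\<^sup>2 = \<gamma> p / \<rho>\<close> with adiabatic exponent \<open>\<gamma> = 1 + 1/c\<^sub>v\<close>.\<close>

definition sound_speed :: "real \<Rightarrow> state \<Rightarrow> real" where
  "sound_speed cv u = sqrt ((1 + 1/cv) * temp u)"

definition rankine_hugoniot :: "real \<Rightarrow> real \<Rightarrow> state \<Rightarrow> state \<Rightarrow> bool" where
  "rankine_hugoniot cv \<sigma> l r \<longleftrightarrow>
     (let e2 = axis 2 1 in
       \<sigma> * (dens r - dens l) = mass_flux r e2 - mass_flux l e2 \<and>
       \<sigma> *\<^sub>R (momentum r - momentum l) = momentum_flux r e2 - momentum_flux l e2 \<and>
       \<sigma> * (energy cv r - energy cv l) = energy_flux cv r e2 - energy_flux cv l e2)"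

text \<open>A shock is a discontinuity crossed by the fluid across which entropy is produced; no fluid
  crosses a contact discontinuity (the tangential velocity may jump there).\<close>

definition shock :: "real \<Rightarrow> real \<Rightarrow> state \<Rightarrow> state \<Rightarrow> bool" where
  "shock cv \<sigma> l r \<longleftrightarrow>
     l \<noteq> r \<and> rankine_hugoniot cv \<sigma> l r \<and> vel l $ 2 \<noteq> \<sigma> \<and> vel r $ 2 \<noteq> \<sigma> \<and>
     \<sigma> * (entropy_density cv r - entropy_density cv l)
       \<le> entropy_flux cv r (axis 2 1) - entropy_flux cv l (axis 2 1)"

definition contact_discontinuity :: "real \<Rightarrow> real \<Rightarrow> state \<Rightarrow> state \<Rightarrow> bool" where
  "contact_discontinuity cv \<sigma> l r \<longleftrightarrow>
     l \<noteq> r \<and> rankine_hugoniot cv \<sigma> l r \<and> vel l $ 2 = \<sigma> \<and> vel r $ 2 = \<sigma>"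

text \<open>Centred rarefaction of the family with characteristic speed \<open>v\<^sub>2 + \<epsilon> c\<close>, \<open>\<epsilon> = \<plusminus>1\<close>: the speed
  equals \<open>\<xi> = x\<^sub>2/t\<close> and the Riemann invariants \<open>s\<close>, \<open>v\<^sub>1\<close> and \<open>v\<^sub>2 - \<epsilon> 2c/(\<gamma>-1)\<close> of this family are
  constant, where \<open>1/(\<gamma>-1) = c\<^sub>v\<close>.\<close>

definition rarefaction_on :: "real \<Rightarrow> real set \<Rightarrow> (real \<Rightarrow> state) \<Rightarrow> bool" where
  "rarefaction_on cv I W \<longleftrightarrow>
     (\<forall>\<xi>\<in>I. positive_state (W \<xi>)) \<and>
     (\<exists>\<epsilon>\<in>{-1, 1}. 
        (\<forall>\<xi>\<in>I. vel (W \<xi>) $ 2 + \<epsilon> * sound_speed cv (W \<xi>) = \<xi>) \<and>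
        (\<lambda>\<xi>. entropy cv (W \<xi>)) constant_on I \<and>
        (\<lambda>\<xi>. vel (W \<xi>) $ 1) constant_on I \<and>
        (\<lambda>\<xi>. vel (W \<xi>) $ 2 - \<epsilon> * 2 * cv * sound_speed cv (W \<xi>)) constant_on I)"

text \<open>\<open>X\<close> is the set of speeds of shocks, contact discontinuities and edges of rarefactions.  At an
  edge of a rarefaction the profile has equal one-sided limits.\<close>

definition wave_fan :: "real \<Rightarrow> state \<Rightarrow> state \<Rightarrow> (real \<Rightarrow> state) \<Rightarrow> bool" where
  "wave_fan cv ul ur W \<longleftrightarrow>
     (\<exists>X. finite X \<and>
        (\<forall>\<xi>. (\<forall>a\<in>X. \<xi> < a) \<longrightarrow> W \<xi> = ul) \<and>
        (\<forall>\<xi>. (\<forall>a\<in>X. a < \<xi>) \<longrightarrow> W \<xi> = ur) \<and>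
        (\<forall>a\<in>X. \<forall>b\<in>X. a < b \<and> {a<..<b} \<inter> X = {} \<longrightarrow>
            W constant_on {a<..<b} \<or> rarefaction_on cv {a<..<b} W) \<and>
        (\<forall>a\<in>X. \<exists>l r. (W \<longlongrightarrow> l) (at_left a) \<and> (W \<longlongrightarrow> r) (at_right a) \<and>
            positive_state l \<and> positive_state r \<and>
            (l = r \<or> shock cv a l r \<or> contact_discontinuity cv a l r)))"

definition self_similar_1D_solution :: "real \<Rightarrow> real \<Rightarrow> state \<Rightarrow> state \<Rightarrow> field \<Rightarrow> bool" where
  "self_similar_1D_solution cv T ul ur U \<longleftrightarrow>
     entropy_admissible cv T (riemann_data ul ur) U \<and>
     (\<exists>W. wave_fan cv ul ur W \<and> (\<forall>t x. 0 < t \<and> t < T \<longrightarrow> U (t, x) = W (x $ 2 / t)))"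

section \<open>The entropy rate criterion\<close>

definition square_entropy ::
  "real \<Rightarrow> (real^2 \<Rightarrow> state) \<Rightarrow> field \<Rightarrow> real \<Rightarrow> real \<Rightarrow> real" where
  "square_entropy cv U0 U L t =
     (LINT x : {x. \<bar>x $ 1\<bar> \<le> L \<and> \<bar>x $ 2\<bar> \<le> L} | lebesgue.
        entropy_density cv (if t = 0 then U0 x else U (t, x)))"

text \<open>Both right derivatives are required to exist as real numbers.  Since the entropy of a weak
  solution is determined only for almost every time, this also forces the value at \<open>\<tau>\<close> to agree
  with the limit from the right, so that no unsuitable choice of representative at time \<open>\<tau>\<close> counts.\<close>

definition entropy_rate_less ::
  "real \<Rightarrow> real \<Rightarrow> (real^2 \<Rightarrow> state) \<Rightarrow> field \<Rightarrow> field \<Rightarrow> bool" where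
  "entropy_rate_less cv T U0 U V \<longleftrightarrow>
     (\<exists>\<tau>. 0 \<le> \<tau> \<and> \<tau> < T \<and>
        (\<forall>t. 0 < t \<and> t < \<tau> \<longrightarrow> (AE x in lebesgue. U (t, x) = V (t, x))) \<and>
        (\<exists>L0. \<forall>L \<ge> L0. \<exists>d d'.
            (square_entropy cv U0 U L has_real_derivative d) (at_right \<tau>) \<and>
            (square_entropy cv U0 V L has_real_derivative d') (at_right \<tau>) \<and>
            d < d'))"

definition entropy_rate_admissible ::
  "real \<Rightarrow> real \<Rightarrow> (real^2 \<Rightarrow> state) \<Rightarrow> field \<Rightarrow> bool" where
  "entropy_rate_admissible cv T U0 U \<longleftrightarrow>
     entropy_admissible cv T U0 U \<and>
     \<not> (\<exists>V. entropy_admissible cv T U0 V \<and> entropy_rate_less cv T U0 U V)"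

end

theory Submission
  imports Defs
begin

text \<open>The data are a vortex sheet: equal density and temperature, vanishing normal velocity and
  opposite tangential velocities.  Its wave fan is unique and produces no entropy: the relative
  entropy with respect to the data is nonnegative because the tangential velocity only takes the
  two values \<open>\<plusminus>2\<close>, and its flux through the rays \<open>x\<^sub>2 = \<xi> t\<close> is nonincreasing in \<open>\<xi>\<close> and vanishes at
  both ends.

  The competitor consists of two outgoing shocks \<open>x\<^sub>2 = \<plusminus>3t/4\<close> and a turbulent zone \<open>\<bar>x\<^sub>2\<bar> < 2t/5\<close>
  in which density, temperature and \<open>\<bar>v\<bar>\<^sup>2\<close> are constant.  There \<open>v\<close> is obtained by convex integration,
  so that \<open>v\<close> and \<open>v \<otimes> v\<close> have prescribed averages and the jump conditions at the edges of the zone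
  only involve these averages.  Kinetic energy of the sheet is turned into heat, so entropy is produced
  at a rate proportional to \<open>L\<close>.\<close>

section \<open>Localised plane waves\<close>

text \<open>Once density, temperature and |v|^2 are constant in the zone, the balances of mass,
  energy and entropy there all reduce to div v = 0, and the momentum balance asks for a prescribed
  average of v tensor v. The zone therefore acts as one constant layer whose momentum flux comes
  from no single velocity. Free choices are data with sound speed 1/2, the Mach number, the edge
  speed 2/5, |v|^2 = 2 and mean velocity zero. The jump conditions at the edge then fix density 3/8,
  temperature 187/480 and the average 47/96 - 4/5 i of v^2/2. The one inequality to respect is that
  this average has modulus below 1: the averaged v tensor v, the identity plus a traceless part, is
  then positive definite and oscillations can realise it. Two obstacles shape the work. Test
  functions do not vanish on the edges of the zone, so every building block must solve its equations
  weakly up to its own boundary; this is why the waves derive from a compactly supported potential.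
  And the claim concerns every self-similar solution, so the wave fan has to be shown unique in the
  whole class allowed by \<open>wave_fan\<close>.\<close>

lemma integrable_continuous_support:
  fixes f :: "'a::euclidean_space \<Rightarrow> 'b::euclidean_space"
  assumes "continuous_on UNIV f" "compact K" "\<And>y. y \<notin> K \<Longrightarrow> f y = 0"
  shows "integrable lborel f"
proof -
  have "integrable lborel (\<lambda>x. indicator K x *\<^sub>R f x)"
    by (rule borel_integrable_compact) (use assms in \<open>auto intro: continuous_on_subset\<close>)
  moreover have "(\<lambda>x. indicator K x *\<^sub>R f x) = f"
    using assms(3) by (auto simp: indicator_def)
  ultimately show ?thesis by simp
qed

section \<open>Integrals of directional derivatives\<close>

lemma lborel_integral_translate:
  fixes f :: "'a::euclidean_space \<Rightarrow> 'b::{banach,second_countable_topology}"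
  assumes [measurable]: "f \<in> borel_measurable borel"
  shows "integral\<^sup>L lborel (\<lambda>y. f (y + a)) = integral\<^sup>L lborel f"
    and "integrable lborel (\<lambda>y. f (y + a)) \<longleftrightarrow> integrable lborel f"
proof -
  have eq: "distr lborel borel (\<lambda>y. y + a) = (lborel :: 'a measure)"
    using lborel_distr_plus[of a] by (simp add: add.commute[of _ a])
  show "integral\<^sup>L lborel (\<lambda>y. f (y + a)) = integral\<^sup>L lborel f"
    by (subst eq[symmetric], subst integral_distr) auto
  show "integrable lborel (\<lambda>y. f (y + a)) \<longleftrightarrow> integrable lborel f"
    by (subst (2) eq[symmetric], subst integrable_distr_eq) auto
qed

lemma dirderiv_diff_bound:
  fixes f D :: "'a::euclidean_space \<Rightarrow> real"
  assumes der: "\<And>y. ((\<lambda>h. f (y + h *\<^sub>R w)) has_real_derivative D y) (at 0)"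
    and bd: "\<And>y. \<bar>D y\<bar> \<le> M"
  shows "\<bar>f (y + h *\<^sub>R w) - f y\<bar> \<le> M * \<bar>h\<bar>"
proof -
  have d: "((\<lambda>h. f (y + h *\<^sub>R w)) has_real_derivative D (y + h *\<^sub>R w)) (at h)" for h
    using der[of "y + h *\<^sub>R w"] DERIV_shift[of "\<lambda>h. f (y + h *\<^sub>R w)" "D (y + h *\<^sub>R w)" 0 h]
    by (simp add: algebra_simps)
  have "norm (f (y + h *\<^sub>R w) - f (y + 0 *\<^sub>R w)) \<le> M * norm (h - 0)"
    by (rule field_differentiable_bound[where S=UNIV and f'="\<lambda>h. D (y + h *\<^sub>R w)"])
       (use d bd in \<open>auto\<close>)
  then show ?thesis by simp
qed

text \<open>The difference quotients are bounded by \<open>M\<close> (mean value along a line) and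
  live on one fixed ball, since the steps are at most 1, so dominated convergence applies.
  Smoothness is asked in direction \<open>w\<close> alone: the zero extension of a test function,
  which may jump at t = 0, is a later case.\<close>

lemma integral_dirderiv_limit:
  fixes f D :: "'a::euclidean_space \<Rightarrow> real"
  assumes der: "\<And>y. ((\<lambda>h. f (y + h *\<^sub>R w)) has_real_derivative D y) (at 0)"
    and bd: "\<And>y. \<bar>D y\<bar> \<le> M"
    and meas[measurable]: "f \<in> borel_measurable borel"
    and K: "compact K" "\<And>y. y \<notin> K \<Longrightarrow> f y = 0"
    and U[measurable]: "U \<in> sets borel"
  shows "(\<lambda>n. \<integral>y. indicator U y * ((f (y + (1 / real (Suc n)) *\<^sub>R w) - f y) * real (Suc n)) \<partial>lborel)
      \<longlonglongrightarrow> (\<integral>y. indicator U y * D y \<partial>lborel)"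
proof -
  have M0: "0 \<le> M" using bd[of 0] by linarith
  define q where "q n y = (f (y + (1 / real (Suc n)) *\<^sub>R w) - f y) * real (Suc n)" for n y
  have qm[measurable]: "q n \<in> borel_measurable lborel" for n unfolding q_def by measurable
  have lim: "(\<lambda>n. q n y) \<longlonglongrightarrow> D y" for y
  proof -
    have "((\<lambda>h. (f (y + h *\<^sub>R w) - f y) / h) \<longlongrightarrow> D y) (at 0)"
      using der[of y] by (simp add: has_field_derivative_iff)
    moreover have "filterlim (\<lambda>n. 1 / real (Suc n)) (at 0) sequentially"
      using LIMSEQ_Suc[OF lim_1_over_n[where 'a=real]] by (auto intro!: filterlim_atI)
    ultimately have "(\<lambda>n. (f (y + (1 / real (Suc n)) *\<^sub>R w) - f y) / (1 / real (Suc n))) \<longlonglongrightarrow> D y"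
      by (rule filterlim_compose)
    then show ?thesis by (simp add: q_def)
  qed
  obtain R where R: "\<And>y. y \<in> K \<Longrightarrow> norm y \<le> R"
    using compact_imp_bounded[OF K(1)] unfolding bounded_iff by blast
  define B where "B = cball (0::'a) (R + norm w)"
  have bdd: "norm (q n y) \<le> M * indicator B y" for n y
  proof (cases "y \<in> B")
    case True
    have "\<bar>f (y + (1 / real (Suc n)) *\<^sub>R w) - f y\<bar> \<le> M * \<bar>1 / real (Suc n)\<bar>"
      by (rule dirderiv_diff_bound[OF der bd])
    then have "\<bar>f (y + (1 / real (Suc n)) *\<^sub>R w) - f y\<bar> * real (Suc n) \<le> M"
      by (simp add: pos_le_divide_eq[symmetric] del: of_nat_Suc)
    then show ?thesis using True unfolding q_def by (simp add: abs_mult del: of_nat_Suc)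
  next
    case False
    then have ny: "norm y > R + norm w" by (simp add: B_def)
    then have "norm y > R" using norm_ge_zero[of w] by linarith
    then have 1: "f y = 0" using R K(2) by fastforce
    have "norm ((1 / real (Suc n)) *\<^sub>R w) \<le> norm w" by (simp add: field_simps mult_left_le)
    then have "norm (y + (1 / real (Suc n)) *\<^sub>R w) > R"
      using norm_triangle_ineq4[of "y + (1 / real (Suc n)) *\<^sub>R w" "(1 / real (Suc n)) *\<^sub>R w"] ny by simp
    then have "f (y + (1 / real (Suc n)) *\<^sub>R w) = 0" using R K(2) by fastforce
    then show ?thesis using 1 M0 by (simp add: q_def)
  qed
  have iB: "integrable lborel (\<lambda>y. M * indicator B y :: real)"
    unfolding B_def using emeasure_bounded_finite[OF bounded_cball, of 0 "R + norm w"]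
    by (intro integrable_mult_right integrable_real_indicator) auto
  have Dm: "D \<in> borel_measurable lborel"
    by (rule borel_measurable_LIMSEQ_real[OF lim qm])
  have ind: "norm (indicator U y * q n y) \<le> M * indicator B y" for n y
    using bdd[of n y] M0 by (auto simp: indicator_def split: if_splits)
  have "(\<lambda>n. \<integral>y. indicator U y * q n y \<partial>lborel) \<longlonglongrightarrow> (\<integral>y. indicator U y * D y \<partial>lborel)"
  proof (rule integral_dominated_convergence[where w="\<lambda>y. M * indicator B y"])
    show "AE y in lborel. (\<lambda>n. indicator U y * q n y) \<longlonglongrightarrow> indicator U y * D y"
      by (intro AE_I2 tendsto_intros lim)
    show "AE y in lborel. norm (indicator U y * q n y) \<le> M * indicator B y" for n
      using ind by simp
  qed (use Dm qm iB in measurable)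
  then show ?thesis by (simp add: q_def)
qed

text \<open>Translation invariance makes every difference quotient integrate to zero, and
  \<open>integral_dirderiv_limit\<close> passes this on to the derivative.\<close>

lemma integral_dirderiv_zero:
  fixes f D :: "'a::euclidean_space \<Rightarrow> real"
  assumes der: "\<And>y. ((\<lambda>h. f (y + h *\<^sub>R w)) has_real_derivative D y) (at 0)"
    and bd: "\<And>y. \<bar>D y\<bar> \<le> M"
    and int: "integrable lborel f" and meas[measurable]: "f \<in> borel_measurable borel"
    and K: "compact K" "\<And>y. y \<notin> K \<Longrightarrow> f y = 0"
  shows "integral\<^sup>L lborel D = 0"
proof -
  have "(\<integral>y. (f (y + (1 / real (Suc n)) *\<^sub>R w) - f y) * real (Suc n) \<partial>lborel) = 0" for n
  proof -
    have "integrable lborel (\<lambda>y. f (y + (1 / real (Suc n)) *\<^sub>R w))"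
      using int by (subst lborel_integral_translate(2)) auto
    then show ?thesis using int by (simp add: lborel_integral_translate(1))
  qed
  then show ?thesis
    using integral_dirderiv_limit[OF der bd meas K, of UNIV] by (simp add: LIMSEQ_const_iff)
qed

text \<open>Derivatives of (1 - s^2)^5. The fields are third derivatives of a potential and are
  differentiated once more, so four derivatives must be continuous at s = 1 and s = -1; the power 5
  leaves one factor 1 - s^2 in the fourth. The value 0 for \<open>k > 4\<close> is a filler that
  keeps every \<open>bump k\<close> continuous and the family uniformly bounded.\<close>

definition bump_poly :: "nat \<Rightarrow> real \<Rightarrow> real" where
  "bump_poly k s = (if k = 0 then (1 - s^2)^5 else if k = 1 then -10 * s * (1 - s^2)^4
     else if k = 2 then (1 - s^2)^3 * (90 * s^2 - 10) else if k = 3 then (1 - s^2)^2 * (240 * s - 720 * s^3)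
     else if k = 4 then (1 - s^2) * (240 - 3360 * s^2 + 5040 * s^4) else 0)"

definition bump :: "nat \<Rightarrow> real \<Rightarrow> real" where
  "bump k s = (if s \<in> {-1..1} then bump_poly k s else 0)"

lemma bump_poly_deriv:
  assumes "k \<le> 3" shows "(bump_poly k has_real_derivative bump_poly (Suc k) s) (at s within S)"
proof -
  consider "k = 0" | "k = 1" | "k = 2" | "k = 3" using assms by linarith
  then show ?thesis
  proof cases
    case 1
    have "((\<lambda>s. (1 - s^2)^5) has_real_derivative (-10 * s * (1 - s^2)^4)) (at s within S)"
      by (auto intro!: derivative_eq_intros)
    then show ?thesis using 1 by (simp add: bump_poly_def[abs_def])
  next
    case 2
    have "((\<lambda>s. -10 * s * (1 - s^2)^4) has_real_derivative ((1 - s^2)^3 * (90 * s^2 - 10))) (at s within S)"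
      by (auto intro!: derivative_eq_intros) algebra
    then show ?thesis using 2 by (simp add: bump_poly_def[abs_def])
  next
    case 3
    have "((\<lambda>s. (1 - s^2)^3 * (90 * s^2 - 10)) has_real_derivative ((1 - s^2)^2 * (240 * s
        - 720 * s^3))) (at s within S)"
      by (auto intro!: derivative_eq_intros) algebra
    then show ?thesis using 3 by (simp add: bump_poly_def[abs_def])
  next
    case 4
    have "((\<lambda>s. (1 - s^2)^2 * (240 * s - 720 * s^3)) has_real_derivative
        ((1 - s^2) * (240 - 3360 * s^2 + 5040 * s^4))) (at s within S)"
      by (auto intro!: derivative_eq_intros) algebra
    then show ?thesis using 4 by (simp add: bump_poly_def[abs_def])
  qed
qed

lemma bump_poly_pm1: "s = 1 \<or> s = -1 \<Longrightarrow> bump_poly k s = 0"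
  by (auto simp: bump_poly_def)

lemma bump_deriv:
  assumes "k \<le> 3" shows "(bump k has_real_derivative bump (Suc k) s) (at s)"
proof -
  have c: "closure (- {-1..1::real}) = {..-1} \<union> {1..}"
    by (subst closure_complement) auto
  have z: "(( \<lambda>x::real. 0::real) has_vector_derivative 0) (at s within S)" for S by simp
  have pm: "s = 1 \<or> s = -1" if "s \<in> closure {-1..1}" "s \<in> closure (- {-1..1})"
    using that unfolding c by auto
  have "((\<lambda>x. if x \<in> {-1..1} then bump_poly k x else 0) has_vector_derivative
      (if s \<in> {-1..1} then bump_poly (Suc k) s else 0)) (at s within UNIV)"
    apply (rule has_vector_derivative_If_within_closures[where T="-{-1..1}"])
         apply simp
        apply (simp add: Un_commute)
       apply (rule bump_poly_deriv[OF assms, unfolded has_real_derivative_iff_has_vector_derivative])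
      apply (rule z)
     apply (rule bump_poly_pm1, erule (1) pm)+
    done
  then show ?thesis
    by (simp add: bump_def[abs_def] has_real_derivative_iff_has_vector_derivative)
qed

lemma bump_cont: "continuous_on UNIV (bump k)"
proof -
  have c: "continuous_on {-1..1} (bump_poly k)"
  proof -
    consider "k = 0" | "k = 1" | "k = 2" | "k = 3" | "k = 4" | "k > 4" by linarith
    then show ?thesis by cases (auto simp: bump_poly_def[abs_def] intro!: continuous_intros)
  qed
  have cl: "closure (- {-1..1::real}) = {..-1} \<union> {1..}"
    by (subst closure_complement) auto
  have "continuous_on ({-1..1} \<union> ({..-1} \<union> {1..})) (\<lambda>s. if s \<in> {-1..1} then bump_poly k s else 0)"
    using c bump_poly_pm1 by (intro continuous_on_cases closed_Un) auto
  moreover have "{-1..1} \<union> ({..-1} \<union> {1..}) = (UNIV::real set)" by auto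
  ultimately show ?thesis by (simp add: bump_def[abs_def])
qed

lemma bump_bounded: "\<exists>B>0. \<forall>k s. \<bar>bump k s\<bar> \<le> B"
proof -
  have "\<exists>B. \<forall>s. \<bar>bump k s\<bar> \<le> B" for k
  proof -
    have "compact (bump k ` {-1..1})" by (intro compact_continuous_image continuous_on_subset[OF bump_cont]) auto
    then obtain B where "\<And>s. s \<in> {-1..1} \<Longrightarrow> \<bar>bump k s\<bar> \<le> B"
      using compact_imp_bounded[of "bump k ` {-1..1}"] unfolding bounded_iff by fastforce
    then have "\<bar>bump k s\<bar> \<le> max B 0" for s by (cases "s \<in> {-1..1}") (fastforce simp: bump_def)+
    then show ?thesis by blast
  qed
  then obtain B where B: "\<And>k s. \<bar>bump k s\<bar> \<le> B k" by metis
  have "\<bar>bump k s\<bar> \<le> (\<Sum>i\<le>4. \<bar>B i\<bar>) + 1" for k s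
  proof (cases "k \<le> 4")
    case True
    have "B k \<le> \<bar>B k\<bar>" by simp
    also have "\<dots> \<le> (\<Sum>i\<le>4. \<bar>B i\<bar>)" using True by (intro member_le_sum) auto
    finally show ?thesis using B[of k s] by linarith
  next
    case False
    then show ?thesis by (simp add: bump_def bump_poly_def sum_nonneg add_nonneg_nonneg)
  qed
  moreover have "(\<Sum>i\<le>4. \<bar>B i\<bar>) + 1 > 0" by (simp add: sum_nonneg add_nonneg_pos)
  ultimately show ?thesis by blast
qed

lemma bump0_bounds: "0 \<le> bump 0 s" "bump 0 s \<le> 1"
proof -
  have "s^2 \<le> 1" if "s \<in> {-1..1}" using that by (simp add: abs_square_le_1 abs_le_iff)
  then show "0 \<le> bump 0 s" "bump 0 s \<le> 1"
    by (auto simp: bump_def bump_poly_def intro!: power_le_one)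
qed

text \<open>The origin of the power 30 in \<open>wave_const\<close>: one such factor for each of
  three coordinates, then a square.\<close>

lemma bump0_lower: "\<bar>s\<bar> \<le> 1/2 \<Longrightarrow> bump 0 s \<ge> (3/4)^5"
proof -
  assume "\<bar>s\<bar> \<le> 1/2"
  then have "s^2 \<le> (1/2)^2" by (metis abs_ge_zero power2_abs power_mono)
  then have "(3/4)^5 \<le> (1 - s^2)^5" by (intro power_mono) (auto simp: power2_eq_square)
  then show ?thesis using \<open>\<bar>s\<bar> \<le> 1/2\<close> by (auto simp: bump_def bump_poly_def)
qed

section \<open>Integration by parts against functions that are C1 near the support\<close>

type_synonym spacetime = "real \<times> (real^2)"

definition C1_on :: "spacetime set \<Rightarrow> (spacetime \<Rightarrow> real) \<Rightarrow> (spacetime \<Rightarrow> spacetime) \<Rightarrow> bool" where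
  "C1_on S \<phi> G \<longleftrightarrow> (\<forall>z\<in>S. (\<phi> has_derivative (\<lambda>h. G z \<bullet> h)) (at z)) \<and> continuous_on S G"

definition cgrad :: "spacetime \<Rightarrow> complex" where
  "cgrad p = Complex (snd p $ 1) (snd p $ 2)"

text \<open>The open set \<open>S\<close>, where \<open>g\<close> is controlled, and the complement
  of \<open>K\<close>, where the product is zero, cover the space.\<close>

lemma continuous_mult_support:
  fixes f g :: "'a::topological_space \<Rightarrow> 'b::real_normed_algebra"
  assumes "continuous_on UNIV f" "closed K" "\<And>y. y \<notin> K \<Longrightarrow> f y = 0" "open S" "K \<subseteq> S" "continuous_on S g"
  shows "continuous_on UNIV (\<lambda>y. f y * g y)"
proof -
  have "continuous_on S (\<lambda>y. f y * g y)"
    by (intro continuous_on_mult continuous_on_subset[OF assms(1)] assms) auto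
  moreover have "continuous_on (-K) (\<lambda>y. f y * g y)"
    by (rule continuous_on_eq[where f="\<lambda>y. 0"]) (use assms(3) in auto)
  ultimately have "continuous_on (S \<union> -K) (\<lambda>y. f y * g y)"
    using assms by (intro continuous_on_open_Un) auto
  moreover have "S \<union> -K = UNIV" using assms by auto
  ultimately show ?thesis by simp
qed

lemma compact_support_bounded:
  fixes f :: "'a::euclidean_space \<Rightarrow> 'b::real_normed_vector"
  assumes "continuous_on UNIV f" "compact K" "\<And>y. y \<notin> K \<Longrightarrow> f y = 0"
  shows "\<exists>M. \<forall>y. norm (f y) \<le> M"
proof -
  have "compact (f ` K)" by (intro compact_continuous_image continuous_on_subset[OF assms(1)] assms) auto
  then obtain M where "\<And>y. y \<in> K \<Longrightarrow> norm (f y) \<le> M"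
    using compact_imp_bounded[of "f ` K"] unfolding bounded_iff by fastforce
  then have "norm (f y) \<le> max M 0" for y by (cases "y \<in> K") (fastforce simp: assms(3))+
  then show ?thesis by blast
qed

lemma C1_on_cont: "C1_on S \<phi> G \<Longrightarrow> open S \<Longrightarrow> continuous_on S \<phi>"
  unfolding C1_on_def by (auto intro!: continuous_at_imp_continuous_on has_derivative_continuous)

text \<open>The product of \<open>f\<close> and \<phi> has a directional derivative everywhere,
  because it vanishes near each point off \<open>K\<close>; this derivative integrates to zero. As
  \<phi> is free on the boundary of the support, equations obtained this way hold up to that
  boundary.\<close>

lemma integral_by_parts_dir:
  fixes f D :: "spacetime \<Rightarrow> real"
  assumes der: "\<And>y. ((\<lambda>h. f (y + h *\<^sub>R w)) has_real_derivative D y) (at 0)"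
    and cf: "continuous_on UNIV f" and cD: "continuous_on UNIV D"
    and K: "compact K" "\<And>y. y \<notin> K \<Longrightarrow> f y = 0" "\<And>y. y \<notin> K \<Longrightarrow> D y = 0"
    and S: "open S" "K \<subseteq> S" and C1: "C1_on S \<phi> G"
  shows "integrable lborel (\<lambda>y. D y * \<phi> y)" "integrable lborel (\<lambda>y. f y * (G y \<bullet> w))"
    "(\<integral>y. D y * \<phi> y + f y * (G y \<bullet> w) \<partial>lborel) = 0"
proof -
  have clK: "closed K" using K(1) by (rule compact_imp_closed)
  have cphi: "continuous_on S \<phi>" using C1_on_cont[OF C1 S(1)] .
  have cG: "continuous_on S (\<lambda>y. G y \<bullet> w)" using C1 by (auto simp: C1_on_def intro!: continuous_intros)
  have c1: "continuous_on UNIV (\<lambda>y. D y * \<phi> y)" by (rule continuous_mult_support[OF cD clK K(3) S cphi])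
  have c2: "continuous_on UNIV (\<lambda>y. f y * (G y \<bullet> w))" by (rule continuous_mult_support[OF cf clK K(2) S cG])
  have c3: "continuous_on UNIV (\<lambda>y. f y * \<phi> y)" by (rule continuous_mult_support[OF cf clK K(2) S cphi])
  show "integrable lborel (\<lambda>y. D y * \<phi> y)" by (rule integrable_continuous_support[OF c1 K(1)]) (simp add: K)
  show "integrable lborel (\<lambda>y. f y * (G y \<bullet> w))" by (rule integrable_continuous_support[OF c2 K(1)]) (simp add: K)
  have cs: "continuous_on UNIV (\<lambda>y. D y * \<phi> y + f y * (G y \<bullet> w))" by (intro continuous_intros c1 c2)
  obtain M where M: "\<And>y. norm (D y * \<phi> y + f y * (G y \<bullet> w)) \<le> M"
    using compact_support_bounded[OF cs K(1)] K by auto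
  show "(\<integral>y. D y * \<phi> y + f y * (G y \<bullet> w) \<partial>lborel) = 0"
  proof (rule integral_dirderiv_zero[where f="\<lambda>y. f y * \<phi> y" and w=w])
    fix y
    show "((\<lambda>h. f (y + h *\<^sub>R w) * \<phi> (y + h *\<^sub>R w)) has_real_derivative (D y * \<phi> y + f y * (G y \<bullet> w))) (at 0)"
    proof (cases "y \<in> K")
      case True
      then have yS: "y \<in> S" using S by auto
      have line: "((\<lambda>h. y + h *\<^sub>R w) has_derivative (\<lambda>h. h *\<^sub>R w)) (at 0)"
        by (auto intro!: derivative_eq_intros)
      have "(\<phi> has_derivative (\<lambda>h. G y \<bullet> h)) (at (y + 0 *\<^sub>R w))"
        using C1 yS by (simp add: C1_on_def)
      from has_derivative_compose[OF line this]
      have "((\<lambda>h. \<phi> (y + h *\<^sub>R w)) has_derivative (\<lambda>h. G y \<bullet> (h *\<^sub>R w))) (at 0)" .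
      then have "((\<lambda>h. \<phi> (y + h *\<^sub>R w)) has_real_derivative (G y \<bullet> w)) (at 0)"
        by (simp add: has_field_derivative_def mult.commute[of _ "G y \<bullet> w"] inner_scaleR_right)
      from DERIV_mult[OF der this] show ?thesis by (simp add: algebra_simps)
    next
      case False
      have "eventually (\<lambda>x. x \<in> -K) (nhds y)" using clK False by (intro eventually_nhds_in_open) auto
      moreover have "((\<lambda>h. y + h *\<^sub>R w) \<longlongrightarrow> y + 0 *\<^sub>R w) (nhds 0)"
        by (intro tendsto_intros tendsto_ident_at filterlim_ident)
      ultimately have "eventually (\<lambda>h. y + h *\<^sub>R w \<in> -K) (nhds 0)"
        by (auto dest!: filterlim_iff[THEN iffD1])
      then have ev: "eventually (\<lambda>h. f (y + h *\<^sub>R w) * \<phi> (y + h *\<^sub>R w) = 0) (nhds 0)"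
        by eventually_elim (simp add: K)
      have "((\<lambda>h. f (y + h *\<^sub>R w) * \<phi> (y + h *\<^sub>R w)) has_real_derivative 0) (at 0)"
        by (subst DERIV_cong_ev[OF refl ev refl]) simp
      then show ?thesis using False K by simp
    qed
  qed (use M c3 K integrable_continuous_support[OF c3 K(1)] borel_measurable_continuous_onI[OF c3] in auto)
qed

text \<open>With \<open>\<chi>\<close> a product \<open>f\<^sub>0(t) f\<^sub>1(x\<^sub>1) f\<^sub>2(x\<^sub>2) g(\<sigma> \<cdot> (t, x))\<close>, the entry \<open>F i j k l\<close> of a family is the
  same product with \<open>f\<^sub>0, f\<^sub>1, f\<^sub>2, g\<close> differentiated \<open>i, j, k, l\<close> times, and \<open>pd \<sigma> a\<close> acts on families as the
  partial derivative in direction \<open>a\<close>, where \<open>a = 0\<close> is time.\<close>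

type_synonym fam = "nat \<Rightarrow> nat \<Rightarrow> nat \<Rightarrow> nat \<Rightarrow> real"

definition dirv :: "nat \<Rightarrow> spacetime" where
  "dirv a = (if a = 0 then (1, 0) else if a = 1 then (0, axis 1 1) else (0, axis 2 1))"

definition pd :: "(nat \<Rightarrow> real) \<Rightarrow> nat \<Rightarrow> fam \<Rightarrow> fam" where
  "pd \<sigma> a F = (\<lambda>i j k l. F (i + of_bool (a = 0)) (j + of_bool (a = 1)) (k + of_bool (a = 2)) l
      + \<sigma> a * F i j k (Suc l))"

text \<open>The order \<open>m\<close> keeps account of the finitely many derivatives of the
  cut-off: each \<open>pd\<close> lowers it by one, and the four differentiations that occur start
  from \<open>m = 3\<close>.\<close>

definition hasD :: "(nat \<Rightarrow> real) \<Rightarrow> nat \<Rightarrow> (spacetime \<Rightarrow> fam) \<Rightarrow> bool" where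
  "hasD \<sigma> m G \<longleftrightarrow> (\<forall>z a i j k l. a \<le> 2 \<longrightarrow> i + j + k + l \<le> m \<longrightarrow>
     ((\<lambda>h. G (z + h *\<^sub>R dirv a) i j k l) has_real_derivative pd \<sigma> a (G z) i j k l) (at 0))"

text \<open>Index shifts commute, so symmetry of mixed derivatives is bookkeeping rather than
  analysis.\<close>

lemma pd_commute: "pd \<sigma> a (pd \<sigma> b F) = pd \<sigma> b (pd \<sigma> a F)"
  by (intro ext) (simp add: pd_def algebra_simps)

lemma hasD_pd:
  assumes "hasD \<sigma> (Suc m) G" "b \<le> 2" shows "hasD \<sigma> m (\<lambda>z. pd \<sigma> b (G z))"
  unfolding hasD_def
proof (intro allI impI)
  fix z and a i j k l :: nat assume a: "a \<le> 2" and s: "i + j + k + l \<le> m"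
  have 1: "((\<lambda>h. G (z + h *\<^sub>R dirv a) (i + of_bool (b = 0)) (j + of_bool (b = 1)) (k + of_bool (b = 2)) l)
     has_real_derivative pd \<sigma> a (G z) (i + of_bool (b = 0)) (j + of_bool (b = 1)) (k + of_bool (b = 2)) l) (at 0)"
    by (intro assms(1)[unfolded hasD_def, rule_format] a) (use s in \<open>auto simp: of_bool_def\<close>)
  have 2: "((\<lambda>h. G (z + h *\<^sub>R dirv a) i j k (Suc l)) has_real_derivative pd \<sigma> a (G z) i j k (Suc l)) (at 0)"
    by (intro assms(1)[unfolded hasD_def, rule_format] a) (use s in auto)
  have "((\<lambda>h. pd \<sigma> b (G (z + h *\<^sub>R dirv a)) i j k l) has_real_derivative pd \<sigma> b (pd \<sigma> a (G z)) i j k l) (at 0)"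
    unfolding pd_def[of \<sigma> b] by (intro DERIV_add DERIV_cmult 1 2)
  then show "((\<lambda>h. pd \<sigma> b (G (z + h *\<^sub>R dirv a)) i j k l) has_real_derivative pd \<sigma> a (pd \<sigma> b (G z)) i j k l) (at 0)"
    by (simp add: pd_commute)
qed

lemma hasD_lin:
  assumes "hasD \<sigma> m F" "hasD \<sigma> m G"
  shows "hasD \<sigma> m (\<lambda>z i j k l. c * F z i j k l + d * G z i j k l)"
proof -
  have "pd \<sigma> a (\<lambda>i j k l. c * F z i j k l + d * G z i j k l) i j k l
      = c * pd \<sigma> a (F z) i j k l + d * pd \<sigma> a (G z) i j k l" for z a i j k l
    by (simp add: pd_def algebra_simps)
  then show ?thesis using assms unfolding hasD_def by (auto intro!: DERIV_add DERIV_cmult)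
qed

section \<open>Localised oscillations and the fields they generate\<close>

definition cut :: "real \<Rightarrow> real \<Rightarrow> nat \<Rightarrow> real \<Rightarrow> real" where
  "cut c r k s = bump k ((s - c) / r) / r ^ k"

lemma cut_deriv: "k \<le> 3 \<Longrightarrow> r > 0 \<Longrightarrow> (cut c r k has_real_derivative cut c r (Suc k) s) (at s)"
  unfolding cut_def by (rule derivative_eq_intros DERIV_chain2[OF bump_deriv] | simp)+

lemma cut_cont: "continuous_on UNIV (cut c r k)"
proof -
  have "continuous_on UNIV (\<lambda>s. bump k ((s - c) * inverse r) * inverse (r^k))"
    by (intro continuous_intros continuous_on_compose2[OF bump_cont]) auto
  then show ?thesis unfolding cut_def[abs_def] by (simp add: divide_inverse)
qed

lemma cut_support: "r > 0 \<Longrightarrow> \<bar>s - c\<bar> \<ge> r \<Longrightarrow> cut c r k s = 0"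
proof -
  assume r: "r > 0" "\<bar>s - c\<bar> \<ge> r"
  then have "\<bar>(s - c) / r\<bar> \<ge> 1" by (simp add: abs_divide)
  then have "(s - c) / r = 1 \<or> (s - c) / r = -1 \<or> (s - c)/r \<notin> {-1..1}"
    unfolding atLeastAtMost_iff by argo
  then show ?thesis using bump_poly_pm1 by (auto simp: cut_def bump_def)
qed

text \<open>Here the profile g is s -> N^-3 sin (N s + \<theta>). Each derivative brings a factor N
  and a quarter period, see \<open>sin_quarter_shift\<close>. Hence the index \<open>l = 3\<close>
  has size one and smaller \<open>l\<close> have size at most 1/N: third derivatives of the product
  are a modulated plane wave plus small errors.\<close>

definition wavefam :: "(nat \<Rightarrow> real) \<Rightarrow> (nat \<Rightarrow> real) \<Rightarrow> (nat \<Rightarrow> real) \<Rightarrow> real \<Rightarrow> real \<Rightarrow> spacetime \<Rightarrow> fam" where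
  "wavefam c r \<sigma> N \<theta> z = (\<lambda>i j k l. cut (c 0) (r 0) i (fst z) * cut (c 1) (r 1) j (snd z $ 1) * cut (c 2) (r 2) k (snd
      z $ 2)
      * (N ^ l / N ^ 3 * sin (N * (\<sigma> 0 * fst z + \<sigma> 1 * snd z $ 1 + \<sigma> 2 * snd z $ 2) + \<theta> + real l * pi / 2)))"

lemma sin_quarter_shift: "sin (x + real (Suc l) * pi / 2) = cos (x + real l * pi / 2)"
proof -
  have "x + real (Suc l) * pi / 2 = (x + real l * pi / 2) + pi / 2" by (simp add: field_simps)
  then show ?thesis by (simp only: sin_add) simp
qed

lemma hasD_wavefam:
  assumes r: "\<And>a. r a > 0"
  shows "hasD \<sigma> 3 (wavefam c r \<sigma> N \<theta>)"
  unfolding hasD_def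
proof (intro allI impI)
  fix z :: spacetime and a i j k l :: nat
  assume a: "a \<le> 2" and s: "i + j + k + l \<le> 3"
  then have le: "i \<le> 3" "j \<le> 3" "k \<le> 3" by auto
  have d: "((\<lambda>h. cut c' r' m (x + h * \<delta>)) has_real_derivative \<delta> * cut c' r' (Suc m) x) (at 0)"
    if "m \<le> 3" "r' > 0" for c' r' m x \<delta>
  proof -
    have "((\<lambda>h. x + h * \<delta>) has_real_derivative \<delta>) (at 0)" by (auto intro!: derivative_eq_intros)
    moreover have "(cut c' r' m has_real_derivative cut c' r' (Suc m) x) (at (x + 0 * \<delta>))"
      using cut_deriv[OF that] by simp
    ultimately show ?thesis using DERIV_chain2[of "cut c' r' m"] by (fastforce simp: mult.commute)
  qed
  have w: "((\<lambda>h. N ^ l / N ^ 3 * sin (N * (x + h * \<delta>) + \<theta> + real l * pi / 2)) has_real_derivative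
      \<delta> * (N ^ Suc l / N ^ 3 * sin (N * x + \<theta> + real (Suc l) * pi / 2))) (at 0)" for x \<delta>
  proof -
    have "((\<lambda>h. sin (N * (x + h * \<delta>) + \<theta> + real l * pi / 2)) has_real_derivative
        \<delta> * N * cos (N * x + \<theta> + real l * pi / 2)) (at 0)" for x \<delta>
      by (auto intro!: derivative_eq_intros)
    from DERIV_cmult[OF this, of "N ^ l / N ^ 3"] show ?thesis
      unfolding sin_quarter_shift by (rule DERIV_cong) simp
  qed
  define \<delta> where "\<delta> b = (of_bool (a = b) :: real)" for b
  define X where "X = \<sigma> 0 * fst z + \<sigma> 1 * snd z $ 1 + \<sigma> 2 * snd z $ 2"
  have sh: "fst (z + h *\<^sub>R dirv a) = fst z + h * \<delta> 0" "snd (z + h *\<^sub>R dirv a) $ 1 = snd z $ 1 + h * \<delta> 1"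
    "snd (z + h *\<^sub>R dirv a) $ 2 = snd z $ 2 + h * \<delta> 2"
    "\<sigma> 0 * (fst z + h * \<delta> 0) + \<sigma> 1 * (snd z $ 1 + h * \<delta> 1) + \<sigma> 2 * (snd z $ 2 + h * \<delta> 2) = X + h * \<sigma> a" for h
    using a by (auto simp: dirv_def axis_def \<delta>_def X_def algebra_simps le_Suc_eq numeral_2_eq_2)
  note D = DERIV_mult[OF DERIV_mult[OF DERIV_mult[OF d[OF le(1) r[of 0], of "c 0" "fst z" "\<delta> 0"]
     d[OF le(2) r[of 1], of "c 1" "snd z $ 1" "\<delta> 1"]] d[OF le(3) r[of 2], of "c 2" "snd z $ 2" "\<delta> 2"]] w[of X "\<sigma> a"]]
  have cases: "a = 0 \<or> a = 1 \<or> a = 2" using a by linarith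
  show "((\<lambda>h. wavefam c r \<sigma> N \<theta> (z + h *\<^sub>R dirv a) i j k l) has_real_derivative
      pd \<sigma> a (wavefam c r \<sigma> N \<theta> z) i j k l) (at 0)"
    unfolding wavefam_def sh
    apply (rule DERIV_cong[OF D])
    using cases unfolding X_def[symmetric] by (elim disjE) (simp_all add: pd_def \<delta>_def algebra_simps)
qed

lemma wavefam_cont: "continuous_on UNIV (\<lambda>z. wavefam c r \<sigma> N \<theta> z i j k l)"
  unfolding wavefam_def by (intro continuous_intros continuous_on_compose2[OF cut_cont]) auto

lemma integral_complex_eq_0:
  assumes "integrable M f" "(\<integral>x. Re (f x) \<partial>M) = 0" "(\<integral>x. Im (f x) \<partial>M) = 0"
  shows "(\<integral>x. f x \<partial>M) = 0"
  using assms by (simp add: complex_eq_iff)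

lemma inner_dirv: "p \<bullet> dirv 0 = fst p" "p \<bullet> dirv 1 = snd p $ 1" "p \<bullet> dirv 2 = snd p $ 2"
  by (simp_all add: dirv_def inner_prod_def inner_axis)

text \<open>The integrations by parts in the three coordinate directions add up to the divergence
  tested against \<phi>, which is zero. A perturbation is treated as three such scalar laws.\<close>

lemma div_free_weak:
  fixes f D :: "nat \<Rightarrow> spacetime \<Rightarrow> real"
  assumes der: "\<And>a y. a \<le> 2 \<Longrightarrow> ((\<lambda>h. f a (y + h *\<^sub>R dirv a)) has_real_derivative D a y) (at 0)"
    and cf: "\<And>a. continuous_on UNIV (f a)" and cD: "\<And>a. continuous_on UNIV (D a)"
    and K: "compact K" "\<And>a y. y \<notin> K \<Longrightarrow> f a y = 0" "\<And>a y. y \<notin> K \<Longrightarrow> D a y = 0"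
    and S: "open S" "K \<subseteq> S" and C1: "C1_on S \<phi> G"
    and div: "\<And>y. D 0 y + D 1 y + D 2 y = 0"
  shows "integrable lborel (\<lambda>y. f 0 y * fst (G y) + f 1 y * (snd (G y) $ 1) + f 2 y * (snd (G y) $ 2))"
    "(\<integral>y. f 0 y * fst (G y) + f 1 y * (snd (G y) $ 1) + f 2 y * (snd (G y) $ 2) \<partial>lborel) = 0"
proof -
  note P = integral_by_parts_dir[OF der cf cD K S C1]
  have i: "integrable lborel (\<lambda>y. f a y * (G y \<bullet> dirv a))" "integrable lborel (\<lambda>y. D a y * \<phi> y)"
     "(\<integral>y. D a y * \<phi> y \<partial>lborel) + (\<integral>y. f a y * (G y \<bullet> dirv a) \<partial>lborel) = 0" if "a \<le> 2" for a
    using P[of a] that by simp_all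
  have j: "integrable lborel (\<lambda>y. f 0 y * (G y \<bullet> dirv 0))" "integrable lborel (\<lambda>y. f 1 y * (G y \<bullet> dirv 1))"
    "integrable lborel (\<lambda>y. f 2 y * (G y \<bullet> dirv 2))" using i(1)[of 0] i(1)[of 1] i(1)[of 2] by auto
  show "integrable lborel (\<lambda>y. f 0 y * fst (G y) + f 1 y * (snd (G y) $ 1) + f 2 y * (snd (G y) $ 2))"
    using j unfolding inner_dirv by auto
  have "(\<integral>y. D 0 y * \<phi> y + D 1 y * \<phi> y + D 2 y * \<phi> y \<partial>lborel) = 0"
    using div by (simp add: distrib_right[symmetric])
  then have "(\<integral>y. D 0 y * \<phi> y \<partial>lborel) + (\<integral>y. D 1 y * \<phi> y \<partial>lborel) + (\<integral>y. D 2 y * \<phi> y \<partial>lborel) = 0"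
    using i(2)[of 0] i(2)[of 1] i(2)[of 2] by simp
  then have "(\<integral>y. f 0 y * (G y \<bullet> dirv 0) \<partial>lborel) + (\<integral>y. f 1 y * (G y \<bullet> dirv 1) \<partial>lborel)
      + (\<integral>y. f 2 y * (G y \<bullet> dirv 2) \<partial>lborel) = 0"
    using i(3)[of 0] i(3)[of 1] i(3)[of 2] by simp
  then show "(\<integral>y. f 0 y * fst (G y) + f 1 y * (snd (G y) $ 1) + f 2 y * (snd (G y) $ 2) \<partial>lborel) = 0"
    using j unfolding inner_dirv by simp
qed

text \<open>Vectors in the plane are complex numbers and a traceless symmetric matrix with first row
  \<open>(p, q)\<close> is \<open>p + \<i> q\<close>, so it acts on \<open>g\<close> as \<open>(p + \<i> q) * cnj g\<close> and the traceless part of \<open>v \<otimes> v\<close> is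
  \<open>v\<^sup>2 / 2\<close>.  A perturbation solves \<open>div v = 0\<close>, \<open>\<partial>\<^sub>t v + div u = 0\<close> weakly across the boundary of \<open>B\<close>.\<close>

definition pert :: "spacetime set \<Rightarrow> (spacetime \<Rightarrow> complex) \<Rightarrow> (spacetime \<Rightarrow> complex) \<Rightarrow> bool" where
  "pert B v u \<longleftrightarrow> continuous_on UNIV v \<and> continuous_on UNIV u \<and> (\<forall>y. y \<notin> B \<longrightarrow> v y = 0 \<and> u y = 0) \<and>
    (\<forall>S \<phi> G. open S \<and> closure B \<subseteq> S \<and> C1_on S \<phi> G \<longrightarrow>
       (\<integral>y. v y \<bullet> cgrad (G y) \<partial>lborel) = 0 \<and>
       (\<integral>y. of_real (fst (G y)) * v y + u y * cnj (cgrad (G y)) \<partial>lborel) = 0)"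

lemma cgrad_cont: "continuous_on S G \<Longrightarrow> continuous_on S (\<lambda>y. cgrad (G y))"
  unfolding cgrad_def by (intro continuous_intros) auto

text \<open>The coefficient \<open>1\<close> is written out, as is \<open>-1\<close> in
  \<open>diffam\<close>, so that \<open>hasD_lin\<close> matches.\<close>

definition lapfam :: "(nat \<Rightarrow> real) \<Rightarrow> fam \<Rightarrow> fam" where
  "lapfam \<sigma> F = (\<lambda>i j k l. 1 * pd \<sigma> 1 (pd \<sigma> 1 F) i j k l + 1 * pd \<sigma> 2 (pd \<sigma> 2 F) i j k l)"

definition diffam :: "(nat \<Rightarrow> real) \<Rightarrow> fam \<Rightarrow> fam" where
  "diffam \<sigma> F = (\<lambda>i j k l. 1 * pd \<sigma> 2 (pd \<sigma> 2 F) i j k l + (-1) * pd \<sigma> 1 (pd \<sigma> 1 F) i j k l)"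

text \<open>With \<open>D = \<partial>\<^sub>1 + \<i> \<partial>\<^sub>2\<close> and \<open>\<chi>\<close> the function represented by \<open>F\<close>, these are \<open>\<i> D \<Delta>\<chi>\<close> and
  \<open>- \<i> D\<^sup>2 \<partial>\<^sub>t \<chi>\<close>; they solve the linear system for every \<open>\<chi>\<close>.\<close>

definition vfam :: "(nat \<Rightarrow> real) \<Rightarrow> fam \<Rightarrow> complex" where
  "vfam \<sigma> F = Complex (- pd \<sigma> 2 (lapfam \<sigma> F) 0 0 0 0) (pd \<sigma> 1 (lapfam \<sigma> F) 0 0 0 0)"

definition ufam :: "(nat \<Rightarrow> real) \<Rightarrow> fam \<Rightarrow> complex" where
  "ufam \<sigma> F = Complex (2 * pd \<sigma> 0 (pd \<sigma> 1 (pd \<sigma> 2 F)) 0 0 0 0) (pd \<sigma> 0 (diffam \<sigma> F) 0 0 0 0)"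

lemma pd_cont:
  assumes "\<And>i j k l. continuous_on UNIV (\<lambda>z. F z i j k l)"
  shows "continuous_on UNIV (\<lambda>z. pd \<sigma> a (F z) i j k l)"
  unfolding pd_def by (intro continuous_intros assms)

lemma pd_zero: "pd \<sigma> a (\<lambda>i j k l. 0) = (\<lambda>i j k l. 0)" by (simp add: pd_def)

text \<open>Both equations are identities between fourth derivatives of one potential and follow
  from the commutation of \<open>pd\<close>. The support in \<open>B\<close> carries them to the
  weak form without a boundary term.\<close>

lemma pert_fam:
  assumes D: "hasD \<sigma> 3 F" and c: "\<And>i j k l. continuous_on UNIV (\<lambda>z. F z i j k l)"
    and B: "bounded B" "\<And>z. z \<notin> B \<Longrightarrow> F z = (\<lambda>i j k l. 0)"
  shows "pert B (\<lambda>z. vfam \<sigma> (F z)) (\<lambda>z. ufam \<sigma> (F z))"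
proof -
  have D': "hasD \<sigma> (Suc (Suc (Suc 0))) F" using D by (simp add: numeral_3_eq_3)
  note D1 = hasD_pd[OF D'] note D2 = hasD_pd[OF D1] note D3 = hasD_pd[OF D2]
  have L: "hasD \<sigma> (Suc 0) (\<lambda>z. lapfam \<sigma> (F z))" unfolding lapfam_def by (intro hasD_lin D2) auto
  have M: "hasD \<sigma> (Suc 0) (\<lambda>z. diffam \<sigma> (F z))" unfolding diffam_def by (intro hasD_lin D2) auto
  have d0: "((\<lambda>h. H (z + h *\<^sub>R dirv a) 0 0 0 0) has_real_derivative pd \<sigma> a (H z) 0 0 0 0) (at 0)"
    if "hasD \<sigma> 0 H" "a \<le> 2" for H z a using that(1)[unfolded hasD_def, rule_format, OF that(2), of 0 0 0 0] by simp
  define vr where "vr z = - pd \<sigma> 2 (lapfam \<sigma> (F z)) 0 0 0 0" for z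
  define vi where "vi z = pd \<sigma> 1 (lapfam \<sigma> (F z)) 0 0 0 0" for z
  define ur where "ur z = 2 * pd \<sigma> 0 (pd \<sigma> 1 (pd \<sigma> 2 (F z))) 0 0 0 0" for z
  define ui where "ui z = pd \<sigma> 0 (diffam \<sigma> (F z)) 0 0 0 0" for z
  define dvr where "dvr a z = - pd \<sigma> a (pd \<sigma> 2 (lapfam \<sigma> (F z))) 0 0 0 0" for a z
  define dvi where "dvi a z = pd \<sigma> a (pd \<sigma> 1 (lapfam \<sigma> (F z))) 0 0 0 0" for a z
  define dur where "dur a z = 2 * pd \<sigma> a (pd \<sigma> 0 (pd \<sigma> 1 (pd \<sigma> 2 (F z)))) 0 0 0 0" for a z
  define dui where "dui a z = pd \<sigma> a (pd \<sigma> 0 (diffam \<sigma> (F z))) 0 0 0 0" for a z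
  have der: "((\<lambda>h. vr (z + h *\<^sub>R dirv a)) has_real_derivative dvr a z) (at 0)"
     "((\<lambda>h. vi (z + h *\<^sub>R dirv a)) has_real_derivative dvi a z) (at 0)"
     "((\<lambda>h. ur (z + h *\<^sub>R dirv a)) has_real_derivative dur a z) (at 0)"
     "((\<lambda>h. ui (z + h *\<^sub>R dirv a)) has_real_derivative dui a z) (at 0)" if "a \<le> 2" for a z
    unfolding vr_def vi_def ur_def ui_def dvr_def dvi_def dur_def dui_def
    by (intro DERIV_minus DERIV_cmult d0 hasD_pd L M D3 that; simp)+
  have cL: "continuous_on UNIV (\<lambda>z. lapfam \<sigma> (F z) i j k l)" "continuous_on UNIV (\<lambda>z. diffam \<sigma> (F z) i j k l)"
      for i j k l
    unfolding lapfam_def diffam_def by (intro continuous_intros pd_cont c)+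
  have cont: "continuous_on UNIV vr" "continuous_on UNIV vi" "continuous_on UNIV ur" "continuous_on UNIV ui"
     "continuous_on UNIV (dvr a)" "continuous_on UNIV (dvi a)" "continuous_on UNIV (dur a)"
         "continuous_on UNIV (dui a)" for a
    unfolding vr_def[abs_def] vi_def[abs_def] ur_def[abs_def] ui_def[abs_def] dvr_def dvi_def dur_def dui_def
    by (intro continuous_intros pd_cont cL c)+
  have supp: "vr z = 0" "vi z = 0" "ur z = 0" "ui z = 0" "dvr a z = 0" "dvi a z = 0" "dur a z = 0" "dui a z = 0"
    if "z \<notin> B" for z a
    unfolding vr_def vi_def ur_def ui_def dvr_def dvi_def dur_def dui_def B(2)[OF that] lapfam_def diffam_def
    by (simp_all add: pd_zero)
  have K: "compact (closure B)" using B(1) by (simp add: compact_closure)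
  have suppK: "z \<notin> closure B \<Longrightarrow> z \<notin> B" for z using closure_subset by auto
  have v: "vfam \<sigma> (F z) = Complex (vr z) (vi z)" and u: "ufam \<sigma> (F z) = Complex (ur z) (ui z)" for z
    by (simp_all add: vfam_def ufam_def vr_def vi_def ur_def ui_def)
  show ?thesis unfolding pert_def v u
  proof (intro conjI allI impI)
    show "continuous_on UNIV (\<lambda>z. Complex (vr z) (vi z))" "continuous_on UNIV (\<lambda>z. Complex (ur z) (ui z))"
      using cont by (auto intro!: continuous_intros)
    show "Complex (vr z) (vi z) = 0" "Complex (ur z) (ui z) = 0" if "z \<notin> B" for z
      using supp[OF that] by (simp_all add: complex_eq_iff)
    fix S \<phi> G assume "open S \<and> closure B \<subseteq> S \<and> C1_on S \<phi> G"
    then have S: "open S" "closure B \<subseteq> S" and C: "C1_on S \<phi> G" by auto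
    \<comment> \<open>Space-time vector fields of the three scalar laws: (0, v1, v2) for the
      divergence, then (v1, p, q) and (v2, q, -p), the rows of the momentum law when u is p + i
      q.\<close>
    define f1 where "f1 a = (if a = 0 then (\<lambda>z. 0) else if a = (1::nat) then vr else vi)" for a
    define f2 where "f2 a = (if a = 0 then vr else if a = (1::nat) then ur else ui)" for a
    define f3 where "f3 a = (if a = 0 then vi else if a = (1::nat) then ui else (\<lambda>z. - ur z))" for a
    define d1 where "d1 a = (if a = 0 then (\<lambda>z. 0) else if a = (1::nat) then dvr a else dvi a)" for a
    define d2 where "d2 a = (if a = 0 then dvr a else if a = (1::nat) then dur a else dui a)" for a
    define d3 where "d3 a = (if a = 0 then dvi a else if a = (1::nat) then dui a else (\<lambda>z. - dur a z))" for a
    have df1: "((\<lambda>h. f1 a (y + h *\<^sub>R dirv a)) has_real_derivative d1 a y) (at 0)" if "a \<le> 2" for a y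
      by (cases "a = 0"; cases "a = 1"; simp add: f1_def d1_def der that DERIV_minus)
    have cf1: "continuous_on UNIV (f1 a)" "continuous_on UNIV (d1 a)" for a
      using cont by (auto simp: f1_def d1_def intro!: continuous_intros)
    have sf1: "f1 a y = 0" "d1 a y = 0" if "y \<notin> closure B" for a y
      using supp[OF suppK[OF that]] by (auto simp: f1_def d1_def)
    have div1: "d1 0 y + d1 1 y + d1 2 y = 0" for y
      by (simp add: d1_def) (simp add: dvr_def dvi_def pd_commute[of _ 2 "Suc 0"])
    have e1: "integrable lborel (\<lambda>y. f1 0 y * fst (G y) + f1 1 y * (snd (G y) $ 1) + f1 2 y * (snd (G y) $ 2))"
      "(\<integral>y. f1 0 y * fst (G y) + f1 1 y * (snd (G y) $ 1) + f1 2 y * (snd (G y) $ 2) \<partial>lborel) = 0"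
      by (rule div_free_weak[OF df1 cf1 K sf1 S C div1]; assumption)+
    have df2: "((\<lambda>h. f2 a (y + h *\<^sub>R dirv a)) has_real_derivative d2 a y) (at 0)" if "a \<le> 2" for a y
      by (cases "a = 0"; cases "a = 1"; simp add: f2_def d2_def der that DERIV_minus)
    have cf2: "continuous_on UNIV (f2 a)" "continuous_on UNIV (d2 a)" for a
      using cont by (auto simp: f2_def d2_def intro!: continuous_intros)
    have sf2: "f2 a y = 0" "d2 a y = 0" if "y \<notin> closure B" for a y
      using supp[OF suppK[OF that]] by (auto simp: f2_def d2_def)
    have div2: "d2 0 y + d2 1 y + d2 2 y = 0" for y
      by (simp add: d2_def) (simp add: dvr_def dur_def dui_def lapfam_def diffam_def pd_def algebra_simps )
    have e2: "integrable lborel (\<lambda>y. f2 0 y * fst (G y) + f2 1 y * (snd (G y) $ 1) + f2 2 y * (snd (G y) $ 2))"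
      "(\<integral>y. f2 0 y * fst (G y) + f2 1 y * (snd (G y) $ 1) + f2 2 y * (snd (G y) $ 2) \<partial>lborel) = 0"
      by (rule div_free_weak[OF df2 cf2 K sf2 S C div2]; assumption)+
    have df3: "((\<lambda>h. f3 a (y + h *\<^sub>R dirv a)) has_real_derivative d3 a y) (at 0)" if "a \<le> 2" for a y
      by (cases "a = 0"; cases "a = 1"; simp add: f3_def d3_def der that DERIV_minus)
    have cf3: "continuous_on UNIV (f3 a)" "continuous_on UNIV (d3 a)" for a
      using cont by (auto simp: f3_def d3_def intro!: continuous_intros)
    have sf3: "f3 a y = 0" "d3 a y = 0" if "y \<notin> closure B" for a y
      using supp[OF suppK[OF that]] by (auto simp: f3_def d3_def)
    have div3: "d3 0 y + d3 1 y + d3 2 y = 0" for y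
      by (simp add: d3_def) (simp add: dvi_def dur_def dui_def lapfam_def diffam_def pd_def algebra_simps )
    have e3: "integrable lborel (\<lambda>y. f3 0 y * fst (G y) + f3 1 y * (snd (G y) $ 1) + f3 2 y * (snd (G y) $ 2))"
      "(\<integral>y. f3 0 y * fst (G y) + f3 1 y * (snd (G y) $ 1) + f3 2 y * (snd (G y) $ 2) \<partial>lborel) = 0"
      by (rule div_free_weak[OF df3 cf3 K sf3 S C div3]; assumption)+
    show "(\<integral>y. Complex (vr y) (vi y) \<bullet> cgrad (G y) \<partial>lborel) = 0"
      using e1(2) by (simp add: f1_def inner_complex_def cgrad_def)
    let ?f = "\<lambda>y. of_real (fst (G y)) * Complex (vr y) (vi y) + Complex (ur y) (ui y) * cnj (cgrad (G y))"
    let ?g2 = "\<lambda>y. f2 0 y * fst (G y) + f2 1 y * (snd (G y) $ 1) + f2 2 y * (snd (G y) $ 2)"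
    let ?g3 = "\<lambda>y. f3 0 y * fst (G y) + f3 1 y * (snd (G y) $ 1) + f3 2 y * (snd (G y) $ 2)"
    have re: "Re (?f y) = ?g2 y" and im: "Im (?f y) = ?g3 y" for y
      by (auto simp: f2_def f3_def cgrad_def)
    have "?f = (\<lambda>y. complex_of_real (?g2 y) + \<i> * complex_of_real (?g3 y))"
      unfolding re[symmetric] im[symmetric] complex_eq[symmetric] ..
    then have "integrable lborel ?f"
      using e2(1) e3(1) by (auto simp del: of_real_add of_real_mult intro!: integrable_of_real)
    then show "(\<integral>y. ?f y \<partial>lborel) = 0"
      by (rule integral_complex_eq_0) (unfold re im, rule e2(2), rule e3(2))
  qed
qed

text \<open>The three \<open>pd\<close> expand into eight terms, and only one of them leaves the
  cut-off undifferentiated. The other seven have \<open>l\<close> at most 2; with |\<sigma>| at most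
  2 they contribute at most 1 + 3 * 2 + 3 * 4 = 19 times \<kappa>, so 28 is generous.\<close>

lemma pd3_leading:
  assumes F: "\<And>i j k l. i + j + k + l = 3 \<Longrightarrow> l \<le> 2 \<Longrightarrow> \<bar>F i j k l\<bar> \<le> \<kappa>"
    and s: "\<And>a. a \<le> 2 \<Longrightarrow> \<bar>\<sigma> a\<bar> \<le> 2" and abc: "a \<le> 2" "b \<le> 2" "c \<le> 2"
  shows "\<bar>pd \<sigma> a (pd \<sigma> b (pd \<sigma> c F)) 0 0 0 0 - \<sigma> a * \<sigma> b * \<sigma> c * F 0 0 0 3\<bar> \<le> 28 * \<kappa>"
proof -
  have k0: "0 \<le> \<kappa>" using F[of 3 0 0 0] by simp
  \<comment> \<open>Each slot of \<open>f\<close> names the direction in which the cut-off is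
    differentiated; the value 9 matches no direction and marks a slot spent on the wave.\<close>
  define f where "f x y z l = F (of_bool (x = 0) + of_bool (y = 0) + of_bool (z = (0::nat)))
     (of_bool (x = 1) + of_bool (y = 1) + of_bool (z = 1)) (of_bool (x = 2) + of_bool (y = 2)
         + of_bool (z = 2)) l" for x y z l :: nat
  have ind: "of_bool (x = 0) + of_bool (x = 1) + of_bool (x = (2::nat)) = (1::nat)" if "x \<le> 2" for x
    using that by (cases "x = 0"; cases "x = 1"; auto)
  have ab0: "\<bar>\<sigma> x * y\<bar> \<le> 2 * K" if "x \<le> 2" "\<bar>y\<bar> \<le> K" for x y K
    using mult_mono[OF s[OF that(1)] that(2)] by (simp add: abs_mult)
  have e: "pd \<sigma> a (pd \<sigma> b (pd \<sigma> c F)) 0 0 0 0 - \<sigma> a * \<sigma> b * \<sigma> c * F 0 0 0 3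
    = f a b c 0 + \<sigma> a * f 9 b c 1 + \<sigma> b * f a 9 c 1 + \<sigma> c * f a b 9 1
      + \<sigma> a * (\<sigma> b * f 9 9 c 2) + \<sigma> a * (\<sigma> c * f 9 b 9 2) + \<sigma> b * (\<sigma> c * f a 9 9 2)"
    by (simp add: pd_def f_def algebra_simps numeral_2_eq_2 numeral_3_eq_3)
  have f0: "\<bar>f a b c 0\<bar> \<le> \<kappa>" unfolding f_def
    by (rule F) (use ind[OF abc(1)] ind[OF abc(2)] ind[OF abc(3)] in linarith, simp)
  have f1: "\<bar>f 9 b c 1\<bar> \<le> \<kappa>" "\<bar>f a 9 c 1\<bar> \<le> \<kappa>" "\<bar>f a b 9 1\<bar> \<le> \<kappa>"
    unfolding f_def
    by (rule F; use ind[OF abc(1)] ind[OF abc(2)] ind[OF abc(3)] in simp)+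
  have f2: "\<bar>f 9 9 c 2\<bar> \<le> \<kappa>" "\<bar>f 9 b 9 2\<bar> \<le> \<kappa>" "\<bar>f a 9 9 2\<bar> \<le> \<kappa>"
    unfolding f_def
    by (rule F; use ind[OF abc(1)] ind[OF abc(2)] ind[OF abc(3)] in simp)+
  have g1: "\<bar>\<sigma> a * f 9 b c 1\<bar> \<le> 2 * \<kappa>" "\<bar>\<sigma> b * f a 9 c 1\<bar> \<le> 2 * \<kappa>" "\<bar>\<sigma> c * f a b 9 1\<bar> \<le> 2 * \<kappa>"
    by (intro ab0 f1 abc)+
  have g2: "\<bar>\<sigma> a * (\<sigma> b * f 9 9 c 2)\<bar> \<le> 2 * (2 * \<kappa>)" "\<bar>\<sigma> a * (\<sigma> c * f 9 b 9 2)\<bar> \<le> 2 * (2 * \<kappa>)"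
    "\<bar>\<sigma> b * (\<sigma> c * f a 9 9 2)\<bar> \<le> 2 * (2 * \<kappa>)"
    by (intro ab0 f2 abc)+
  show ?thesis unfolding e using f0 g1 g2 k0 by linarith
qed

text \<open>By the choice of \<sigma>, \<sigma> 1 + i \<sigma> 2 = i e: the wave oscillates across
  e, so a velocity along e is divergence-free to leading order. Replacing D by i e and the time
  derivative by -\<beta> in the two potential operators produces e and i \<beta> e^2, both times
  minus the third derivative of the profile. The time frequency \<beta> stays free and is chosen in
  \<open>defect_direction\<close>.\<close>

lemma vufam_leading:
  assumes F: "\<And>i j k l. i + j + k + l = 3 \<Longrightarrow> l \<le> 2 \<Longrightarrow> \<bar>F i j k l\<bar> \<le> \<kappa>"
    and e: "cmod e = 1" and b: "\<bar>\<beta>\<bar> \<le> 2"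
    and \<sigma>: "\<sigma> = (\<lambda>a. if a = 0 then - \<beta> else if a = 1 then - Im e else Re e)"
  shows "cmod (vfam \<sigma> F - of_real (- F 0 0 0 3) * e) \<le> 112 * \<kappa>"
    "cmod (ufam \<sigma> F - of_real (- F 0 0 0 3) * (of_real \<beta> * \<i> * e^2)) \<le> 112 * \<kappa>"
proof -
  have e2: "(Re e)^2 + (Im e)^2 = 1" using e by (simp add: cmod_def)
  have s: "\<bar>\<sigma> a\<bar> \<le> 2" if "a \<le> 2" for a
    using b abs_Re_le_cmod[of e] abs_Im_le_cmod[of e] e unfolding \<sigma> by auto
  have sv: "\<sigma> 0 = - \<beta>" "\<sigma> 1 = - Im e" "\<sigma> (Suc 0) = - Im e" "\<sigma> 2 = Re e" by (simp_all add: \<sigma>)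
  have L: "\<bar>pd \<sigma> a (pd \<sigma> b (pd \<sigma> c F)) 0 0 0 0 - \<sigma> a * \<sigma> b * \<sigma> c * F 0 0 0 3\<bar> \<le> 28 * \<kappa>"
    if "a \<le> 2" "b \<le> 2" "c \<le> 2" for a b c by (rule pd3_leading[OF F s that])
  let ?G = "F 0 0 0 3"
  let ?R = "\<lambda>a b c. pd \<sigma> a (pd \<sigma> b (pd \<sigma> c F)) 0 0 0 0"
  have k0: "0 \<le> \<kappa>" using F[of 3 0 0 0] by simp
  have v1: "pd \<sigma> 2 (lapfam \<sigma> F) 0 0 0 0 = ?R 2 1 1 + ?R 2 2 2"
    and v2: "pd \<sigma> 1 (lapfam \<sigma> F) 0 0 0 0 = ?R 1 1 1 + ?R 1 2 2"
    and u2: "pd \<sigma> 0 (diffam \<sigma> F) 0 0 0 0 = ?R 0 2 2 - ?R 0 1 1"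
    by (simp_all add: lapfam_def diffam_def pd_def algebra_simps)
  have rv: "\<bar>?R 2 1 1 + ?R 2 2 2 - Re e * ?G\<bar> \<le> 56 * \<kappa>"
  proof -
    have "Re e * ?G = \<sigma> 2 * \<sigma> 1 * \<sigma> 1 * ?G + \<sigma> 2 * \<sigma> 2 * \<sigma> 2 * ?G"
      using e2 unfolding sv by algebra
    then show ?thesis using L[where a=2 and b=1 and c=1] L[where a=2 and b=2 and c=2] by simp
  qed
  have iv: "\<bar>?R 1 1 1 + ?R 1 2 2 + Im e * ?G\<bar> \<le> 56 * \<kappa>"
  proof -
    have "- Im e * ?G = \<sigma> 1 * \<sigma> 1 * \<sigma> 1 * ?G + \<sigma> 1 * \<sigma> 2 * \<sigma> 2 * ?G"
      using e2 unfolding sv by algebra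
    then show ?thesis using L[where a=1 and b=1 and c=1] L[where a=1 and b=2 and c=2] by simp
  qed
  have ru: "\<bar>2 * ?R 0 1 2 - 2 * \<beta> * Im e * Re e * ?G\<bar> \<le> 56 * \<kappa>"
    using L[where a=0 and b=1 and c=2] sv by simp
  have iu: "\<bar>?R 0 2 2 - ?R 0 1 1 + \<beta> * ((Re e)^2 - (Im e)^2) * ?G\<bar> \<le> 56 * \<kappa>"
  proof -
    have "- \<beta> * ((Re e)^2 - (Im e)^2) * ?G = \<sigma> 0 * \<sigma> 2 * \<sigma> 2 * ?G - \<sigma> 0 * \<sigma> 1 * \<sigma> 1 * ?G"
      unfolding sv by algebra
    then show ?thesis using L[where a=0 and b=2 and c=2] L[where a=0 and b=1 and c=1] by simp
  qed
  have "cmod (vfam \<sigma> F - of_real (- ?G) * e) \<le> \<bar>Re (vfam \<sigma> F - of_real (- ?G) * e)\<bar>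
      + \<bar>Im (vfam \<sigma> F - of_real (- ?G) * e)\<bar>"
    by (rule cmod_le)
  also have "\<dots> \<le> 112 * \<kappa>" using rv iv unfolding vfam_def v1 v2 by (simp add: algebra_simps)
  finally show "cmod (vfam \<sigma> F - of_real (- F 0 0 0 3) * e) \<le> 112 * \<kappa>" .
  let ?U = "ufam \<sigma> F - of_real (- ?G) * (of_real \<beta> * \<i> * e^2)"
  have "cmod ?U \<le> \<bar>Re ?U\<bar> + \<bar>Im ?U\<bar>" by (rule cmod_le)
  also have "\<dots> \<le> 112 * \<kappa>" using ru iu unfolding ufam_def u2
    by (simp add: algebra_simps power2_eq_square)
  finally show "cmod ?U \<le> 112 * \<kappa>" .
qed

section \<open>One wave in one box\<close>

lemma mem_box_spacetime:
  "z \<in> box a b \<longleftrightarrow> fst a < fst z \<and> fst z < fst b \<and> snd a $ 1 < snd z $ 1 \<and> snd z $ 1 < snd b $ 1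
     \<and> snd a $ 2 < snd z $ 2 \<and> snd z $ 2 < snd b $ 2"
  "z \<in> cbox a b \<longleftrightarrow> fst a \<le> fst z \<and> fst z \<le> fst b \<and> snd a $ 1 \<le> snd z $ 1 \<and> snd z $ 1 \<le> snd b $ 1
     \<and> snd a $ 2 \<le> snd z $ 2 \<and> snd z $ 2 \<le> snd b $ 2" for z a b :: spacetime
  by (cases z; cases a; cases b; auto simp: box_prod mem_box_cart forall_2)+

lemma content_spacetime:
  fixes a b :: spacetime
  assumes "fst a \<le> fst b" "snd a $ 1 \<le> snd b $ 1" "snd a $ 2 \<le> snd b $ 2"
  shows "measure lborel (cbox a b) = (fst b - fst a) * ((snd b $ 1 - snd a $ 1) * (snd b $ 2 - snd a $ 2))"
proof -
  have "cbox (snd a) (snd b) \<noteq> {}" using assms by (auto simp: interval_ne_empty_cart forall_2)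
  then have "measure lborel (cbox (snd a) (snd b)) = (snd b $ 1 - snd a $ 1) * (snd b $ 2 - snd a $ 2)"
    by (subst content_cbox_cart) (auto simp: UNIV_2)
  then show ?thesis using content_Pair[of "fst a" "snd a" "fst b" "snd b"] assms by simp
qed

lemma pert_scale: "pert B v u \<Longrightarrow> pert B (\<lambda>y. of_real c * v y) (\<lambda>y. of_real c * u y)"
  unfolding pert_def
proof (elim conjE, intro conjI allI impI)
  assume H: "\<forall>S \<phi> G. open S \<and> closure B \<subseteq> S \<and> C1_on S \<phi> G \<longrightarrow>
       (\<integral>y. v y \<bullet> cgrad (G y) \<partial>lborel) = 0 \<and>
       (\<integral>y. of_real (fst (G y)) * v y + u y * cnj (cgrad (G y)) \<partial>lborel) = 0"
  fix S \<phi> G assume "open S \<and> closure B \<subseteq> S \<and> C1_on S \<phi> G"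
  with H have h: "(\<integral>y. v y \<bullet> cgrad (G y) \<partial>lborel) = 0"
       "(\<integral>y. of_real (fst (G y)) * v y + u y * cnj (cgrad (G y)) \<partial>lborel) = 0" by blast+
  have "(\<lambda>y. (of_real c * v y) \<bullet> cgrad (G y)) = (\<lambda>y. c * (v y \<bullet> cgrad (G y)))"
    by (simp add: scaleR_conv_of_real[symmetric])
  then show "(\<integral>y. (of_real c * v y) \<bullet> cgrad (G y) \<partial>lborel) = 0" using h by simp
  have "(\<lambda>y. of_real (fst (G y)) * (of_real c * v y) + of_real c * u y * cnj (cgrad (G y)))
      = (\<lambda>y. of_real c * (of_real (fst (G y)) * v y + u y * cnj (cgrad (G y))))"
    by (simp add: algebra_simps)
  then show "(\<integral>y. of_real (fst (G y)) * (of_real c * v y) + of_real c * u y * cnj (cgrad (G y)) \<partial>lborel) = 0"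
    using h by simp
qed (auto intro!: continuous_intros)

text \<open>The cut-off is at least (3/4)^15 on the concentric box of half size, which gives
  (3/4)^30 / 8 of the volume. The better of two phases keeps half of it, passing from the plane wave
  to \<open>v\<close> halves it again, and half of the remaining (3/4)^30 / 32 pays for the
  approximation error.\<close>

definition wave_const :: real where "wave_const = (3/4)^30 / 64"

text \<open>The energy is a fixed fraction of \<open>lm^2\<close> times the volume whatever the
  shape of the box and the accuracy \<epsilon>. This uniformity lets an iteration with ever finer
  boxes make progress.\<close>

lemma wave_block:
  fixes a b :: spacetime
  assumes ne: "box a b \<noteq> {}" and e: "cmod e = 1" and \<beta>: "\<bar>\<beta>\<bar> \<le> 2" and lm: "0 < lm" "lm \<le> 1" and \<epsilon>: "0 < \<epsilon>"
  obtains v u t where "pert (box a b) v u"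
    "\<And>y. \<bar>t y\<bar> \<le> 1" "\<And>y. cmod (v y - of_real (lm * t y) * e) \<le> \<epsilon>"
    "\<And>y. cmod (u y - of_real (lm * t y) * (of_real \<beta> * \<i> * e^2)) \<le> \<epsilon>"
    "(\<integral>y. (cmod (v y))^2 \<partial>lborel) \<ge> wave_const * lm^2 * measure lborel (cbox a b)"
proof -
  have lt: "fst a < fst b" "snd a $ 1 < snd b $ 1" "snd a $ 2 < snd b $ 2"
    using ne mem_box_spacetime(1)[of _ a b] by fastforce+
  define c where "c i = (if i = 0 then (fst a + fst b) / 2 else if i = 1 then (snd a $ 1 + snd b $ 1) / 2
     else (snd a $ 2 + snd b $ 2) / 2)" for i :: nat
  define r where "r i = (if i = 0 then (fst b - fst a) / 2 else if i = 1 then (snd b $ 1 - snd a $ 1) / 2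
     else (snd b $ 2 - snd a $ 2) / 2)" for i :: nat
  have r: "r i > 0" for i using lt by (auto simp: r_def)
  define \<sigma> where "\<sigma> = (\<lambda>a::nat. if a = 0 then - \<beta> else if a = 1 then - Im e else Re e)"
  obtain Bb where Bb: "Bb > 0" "\<And>k s. \<bar>bump k s\<bar> \<le> Bb" using bump_bounded by blast
  \<comment> \<open>A common bound for the cut-offs and their derivatives up to order three in all
    coordinates; a product of three of them is at most \<open>Q^3\<close>.\<close>
  define Q where "Q = Bb * (max 1 (max (1 / r 0) (max (1 / r 1) (1 / r 2)))) ^ 3"
  have Q0: "Q > 0" using Bb by (simp add: Q_def)
  have cutQ: "\<bar>cut (c m) (r m) i s\<bar> \<le> Q" if "m \<le> 2" "i \<le> 3" for m i s
  proof -
    have rr: "1 / r m \<le> max 1 (max (1 / r 0) (max (1 / r 1) (1 / r 2)))"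
      using that(1) by (auto simp: le_Suc_eq numeral_2_eq_2)
    have "\<bar>cut (c m) (r m) i s\<bar> = \<bar>bump i ((s - c m) / r m)\<bar> * (1 / r m) ^ i"
      using r[of m] by (simp add: cut_def power_divide abs_mult)
    also have "\<dots> \<le> Bb * (max 1 (max (1 / r 0) (max (1 / r 1) (1 / r 2)))) ^ i"
      using r[of m] Bb rr by (intro mult_mono power_mono) auto
    also have "\<dots> \<le> Q" unfolding Q_def using Bb that(2)
      by (intro mult_left_mono power_increasing) auto
    finally show ?thesis .
  qed
  define \<mu> where "\<mu> = measure lborel (cbox a b)"
  have \<mu>0: "\<mu> > 0" unfolding \<mu>_def using lt by (subst content_spacetime) auto
  \<comment> \<open>Two demands on the error: the requested accuracy, and a square below
    \<open>wave_const * lm^2\<close>.\<close>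
  define q where "q = min \<epsilon> (sqrt wave_const * lm)"
  have wc: "wave_const > 0" by (simp add: wave_const_def)
  have q0: "q > 0" using wc lm \<epsilon> by (simp add: q_def)
  \<comment> \<open>The frequency. All non-leading terms are of size \<open>Q^3 / N\<close>, and 112
    is the constant of \<open>vufam_leading\<close>.\<close>
  define N where "N = max 1 (112 * Q^3 / q)"
  have N1: "N \<ge> 1" by (simp add: N_def)
  have Nq: "112 * (Q^3 / N) \<le> q"
  proof -
    have "112 * Q^3 / q \<le> N" by (simp add: N_def)
    then show ?thesis using q0 N1 by (simp add: field_simps)
  qed
  define W where "W \<theta> = wavefam c r \<sigma> N \<theta>" for \<theta>
  have small: "\<bar>W \<theta> z i j k l\<bar> \<le> Q^3 / N" if "i + j + k + l = 3" "l \<le> 2" for \<theta> z i j k l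
  proof -
    have "N * N ^ l \<le> N ^ 3" using power_increasing[of "Suc l" 3 N] that N1 by simp
    then have n: "N ^ l / N ^ 3 \<le> 1 / N" using N1 by (simp add: field_simps)
    have "\<bar>N ^ l / N ^ 3 * sin X\<bar> \<le> 1 / N * 1" for X
      unfolding abs_mult using n N1 by (intro mult_mono) auto
    then have "\<bar>W \<theta> z i j k l\<bar> \<le> (Q * Q * Q) * (1 / N * 1)"
      unfolding W_def wavefam_def abs_mult
      by (intro mult_mono cutQ mult_nonneg_nonneg) (use that Q0 N1 n in \<open>auto simp: abs_mult\<close>)
    then show ?thesis by (simp add: power3_eq_cube)
  qed
  define \<eta> where "\<eta> z = cut (c 0) (r 0) 0 (fst z) * cut (c 1) (r 1) 0 (snd z $ 1) * cut (c 2) (r 2) 0 (snd z $ 2)"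
      for z :: spacetime
  define X where "X z = N * (\<sigma> 0 * fst z + \<sigma> 1 * snd z $ 1 + \<sigma> 2 * snd z $ 2)" for z :: spacetime
  have W3: "W \<theta> z 0 0 0 3 = \<eta> z * sin (X z + \<theta> + 3 * pi / 2)" for \<theta> z
    using N1 by (simp add: W_def wavefam_def \<eta>_def X_def)
  have cut0: "0 \<le> cut c' r' 0 s" "cut c' r' 0 s \<le> 1" for c' r' s by (simp_all add: cut_def bump0_bounds)
  have \<eta>01: "0 \<le> \<eta> z" "\<eta> z \<le> 1" for z
    unfolding \<eta>_def by (auto intro!: mult_nonneg_nonneg mult_le_one cut0)
  have out: "W \<theta> z = (\<lambda>i j k l. 0)" "\<eta> z = 0" if "z \<notin> box a b" for \<theta> z
  proof -
    have "\<bar>fst z - c 0\<bar> \<ge> r 0 \<or> \<bar>snd z $ 1 - c 1\<bar> \<ge> r 1 \<or> \<bar>snd z $ 2 - c 2\<bar> \<ge> r 2"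
      using that unfolding mem_box_spacetime c_def r_def by (simp split: abs_split) argo
    then have z: "(\<forall>i. cut (c 0) (r 0) i (fst z) = 0) \<or> (\<forall>j. cut (c 1) (r 1) j (snd z $ 1) = 0)
        \<or> (\<forall>k. cut (c 2) (r 2) k (snd z $ 2) = 0)"
      using cut_support[OF r] by blast
    then show "W \<theta> z = (\<lambda>i j k l. 0)" unfolding W_def wavefam_def by (intro ext) auto
    show "\<eta> z = 0" using z unfolding \<eta>_def by auto
  qed
  have \<eta>c: "continuous_on UNIV \<eta>"
    unfolding \<eta>_def[abs_def] by (intro continuous_intros continuous_on_compose2[OF cut_cont]) auto
  have Xc: "continuous_on UNIV X" unfolding X_def[abs_def] by (intro continuous_intros)
  have bx: "compact (cbox a b)" "z \<notin> cbox a b \<Longrightarrow> z \<notin> box a b" for z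
    using box_subset_cbox by auto
  have \<eta>int: "integrable lborel (\<lambda>z. (\<eta> z)^2)" "integrable lborel (\<lambda>z. (\<eta> z)^2 * g (X z))"
    if "continuous_on UNIV g" for g
    by (rule integrable_continuous_support[where K="cbox a b"];
        use out(2) bx \<eta>c Xc continuous_on_compose2[OF that Xc] in \<open>auto intro!: continuous_intros\<close>)+
  have lower: "(\<integral>z. (\<eta> z)^2 \<partial>lborel) \<ge> (3/4)^30 / 8 * \<mu>"
  proof -
    define a' b' where "a' = (c 0 - r 0 / 2, vector [c 1 - r 1 / 2, c 2 - r 2 / 2] :: real^2)"
      and "b' = (c 0 + r 0 / 2, vector [c 1 + r 1 / 2, c 2 + r 2 / 2] :: real^2)"
    have m: "measure lborel (cbox a' b') = \<mu> / 8"
      unfolding \<mu>_def using lt r[of 0] r[of 1] r[of 2]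
      by (subst (1 2) content_spacetime) (auto simp: a'_def b'_def r_def field_simps)
    have ge: "\<eta> z \<ge> ((3/4)^5)^3" if "z \<in> cbox a' b'" for z
    proof -
      have h: "cut c' r' 0 s \<ge> (3/4)^5" if "r' > 0" "c' - r' / 2 \<le> s" "s \<le> c' + r' / 2" for c' r' s :: real
      proof -
        have "\<bar>s - c'\<bar> \<le> r' / 2" using that by linarith
        then have "\<bar>(s - c') / r'\<bar> \<le> 1/2" using that(1) by (simp add: field_simps)
        then show ?thesis using bump0_lower by (simp add: cut_def)
      qed
      have "\<eta> z \<ge> (3/4)^5 * (3/4)^5 * (3/4)^5"
        unfolding \<eta>_def using that r[of 0] r[of 1] r[of 2] unfolding mem_box_spacetime a'_def b'_def
        by (intro mult_mono h) (auto intro!: cut0 mult_nonneg_nonneg)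
      then show ?thesis by (simp add: power3_eq_cube)
    qed
    have "(\<integral>z. (3/4)^30 * indicator (cbox a' b') z \<partial>lborel) \<le> (\<integral>z. (\<eta> z)^2 \<partial>lborel)"
    proof (rule integral_mono)
      fix z show "(3/4)^30 * indicator (cbox a' b') z \<le> (\<eta> z)^2"
      proof (cases "z \<in> cbox a' b'")
        case True
        have "(((3/4)^5)^3)^2 \<le> (\<eta> z)^2" using ge[OF True] by (intro power_mono) auto
        then show ?thesis using True by (simp add: power_mult[symmetric])
      qed auto
    qed (use \<eta>int(1)[of "\<lambda>x. x"] emeasure_bounded_finite[OF bounded_cbox, of a' b'] in
        \<open>auto intro!: integrable_real_indicator\<close>)
    then show ?thesis by (simp add: m)
  qed
  \<comment> \<open>For two phases a quarter period apart the squares of the waves add up to the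
    square of the cut-off. One of them thus carries at least half of the energy, and no averaging of
    fast oscillations is involved.\<close>
  have "(\<integral>z. (\<eta> z)^2 \<partial>lborel) = (\<integral>z. (W 0 z 0 0 0 3)^2 \<partial>lborel) + (\<integral>z. (W (pi/2) z 0 0 0 3)^2 \<partial>lborel)"
  proof -
    have i: "integrable lborel (\<lambda>z. (W \<theta> z 0 0 0 3)^2)" for \<theta>
      unfolding W3 power_mult_distrib
      by (rule \<eta>int(2)[of "\<lambda>x. (sin (x + \<theta> + 3 * pi / 2))^2"]) (intro continuous_intros)
    have "(\<eta> z)^2 = (W 0 z 0 0 0 3)^2 + (W (pi/2) z 0 0 0 3)^2" for z
    proof -
      have "sin (X z + pi/2 + 3 * pi / 2) = cos (X z + 3 * pi / 2)"
        using sin_add[of "X z + 3 * pi / 2" "pi/2"] by (simp add: add_ac)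
      then show ?thesis unfolding W3 power_mult_distrib distrib_left[symmetric] by simp
    qed
    then show ?thesis using i by simp
  qed
  then have "\<exists>\<theta>. (\<integral>z. (W \<theta> z 0 0 0 3)^2 \<partial>lborel) \<ge> (3/4)^30 / 16 * \<mu>"
  proof -
    assume h: "(\<integral>z. (\<eta> z)^2 \<partial>lborel) = (\<integral>z. (W 0 z 0 0 0 3)^2 \<partial>lborel) + (\<integral>z. (W (pi/2) z 0 0 0 3)^2 \<partial>lborel)"
    have "(3/4)^30 / 8 * \<mu> = (3/4)^30 / 16 * \<mu> + (3/4)^30 / 16 * \<mu>" by simp
    then have "(\<integral>z. (W 0 z 0 0 0 3)^2 \<partial>lborel) \<ge> (3/4)^30 / 16 * \<mu> \<or> (\<integral>z. (W (pi/2) z 0 0 0 3)^2 \<partial>lborel)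
        \<ge> (3/4)^30 / 16 * \<mu>"
      using lower h by linarith
    then show ?thesis by blast
  qed
  then obtain \<theta> where \<theta>: "(\<integral>z. (W \<theta> z 0 0 0 3)^2 \<partial>lborel) \<ge> (3/4)^30 / 16 * \<mu>" by blast
  define t where "t z = - W \<theta> z 0 0 0 3" for z
  define v where "v z = of_real lm * vfam \<sigma> (W \<theta> z)" for z
  define u where "u z = of_real lm * ufam \<sigma> (W \<theta> z)" for z
  have p: "pert (box a b) v u"
    unfolding v_def[abs_def] u_def[abs_def]
  proof (intro pert_scale pert_fam)
    show "hasD \<sigma> 3 (W \<theta>)" unfolding W_def by (rule hasD_wavefam) (rule r)
    show "continuous_on UNIV (\<lambda>z. W \<theta> z i j k l)" for i j k l unfolding W_def by (rule wavefam_cont)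
    show "bounded (box a b)" by (rule bounded_box)
  qed (use out in auto)
  have t1: "\<bar>t y\<bar> \<le> 1" for y
    unfolding t_def W3 abs_minus abs_mult using \<eta>01[of y] by (intro mult_le_one) auto
  have lead: "cmod (vfam \<sigma> (W \<theta> y) - of_real (- W \<theta> y 0 0 0 3) * e) \<le> 112 * (Q^3 / N)"
    "cmod (ufam \<sigma> (W \<theta> y) - of_real (- W \<theta> y 0 0 0 3) * (of_real \<beta> * \<i> * e^2)) \<le> 112 * (Q^3 / N)" for y
    by (rule vufam_leading[OF small e \<beta> \<sigma>_def]; assumption)+
  have vq: "cmod (v y - of_real (lm * t y) * e) \<le> lm * q" for y
  proof -
    have "v y - of_real (lm * t y) * e = of_real lm * (vfam \<sigma> (W \<theta> y) - of_real (t y) * e)"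
      by (simp add: v_def algebra_simps)
    then have "cmod (v y - of_real (lm * t y) * e) = lm * cmod (vfam \<sigma> (W \<theta> y) - of_real (t y) * e)"
      using lm by (simp add: norm_mult)
    also have "\<dots> \<le> lm * q" using lead(1)[of y] Nq lm by (intro mult_left_mono) (auto simp: t_def)
    finally show ?thesis .
  qed
  have uq: "cmod (u y - of_real (lm * t y) * (of_real \<beta> * \<i> * e^2)) \<le> lm * q" for y
  proof -
    have "u y - of_real (lm * t y) * (of_real \<beta> * \<i> * e^2)
        = of_real lm * (ufam \<sigma> (W \<theta> y) - of_real (t y) * (of_real \<beta> * \<i> * e^2))"
      by (simp add: u_def algebra_simps)
    then have "cmod (u y - of_real (lm * t y) * (of_real \<beta> * \<i> * e^2))
        = lm * cmod (ufam \<sigma> (W \<theta> y) - of_real (t y) * (of_real \<beta> * \<i> * e^2))"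
      using lm by (simp add: norm_mult)
    also have "\<dots> \<le> lm * q" using lead(2)[of y] Nq lm by (intro mult_left_mono) (auto simp: t_def)
    finally show ?thesis .
  qed
  have lq: "lm * q \<le> \<epsilon>" using lm q0 by (smt (verit) q_def mult_left_le_one_le)
  have lq2: "(lm * q)^2 \<le> wave_const * lm^2"
  proof -
    have "lm * q \<le> sqrt wave_const * lm" using lm q0 by (smt (verit) q_def mult_left_le_one_le)
    then have "(lm * q)^2 \<le> (sqrt wave_const * lm)^2" using lm q0 by (intro power_mono) auto
    then show ?thesis using wc by (simp add: power_mult_distrib)
  qed
  \<comment> \<open>From (x + y)^2 \<le> 2 x^2 + 2 y^2, with the plane wave bounded by |v| plus the
    error.\<close>
  have pw: "(cmod (v y))^2 \<ge> lm^2 / 2 * (t y)^2 - wave_const * lm^2 * indicator (cbox a b) y" for y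
  proof (cases "y \<in> cbox a b")
    case False
    then have "t y = 0" using out(2)[OF bx(2)] by (simp add: t_def W3)
    then show ?thesis using False by simp
  next
    case True
    have "lm * \<bar>t y\<bar> = cmod (of_real (lm * t y) * e)" using e lm by (simp add: norm_mult abs_mult)
    also have "\<dots> \<le> cmod (v y) + lm * q" using vq[of y] norm_triangle_ineq2[of "of_real (lm * t y) * e" "v y"]
      by (simp add: norm_minus_commute)
    finally have "(lm * \<bar>t y\<bar>)^2 \<le> (cmod (v y) + lm * q)^2" using lm by (intro power_mono) auto
    also have "\<dots> \<le> 2 * (cmod (v y))^2 + 2 * (lm * q)^2"
      using zero_le_power2[of "cmod (v y) - lm * q"] by (simp add: power2_eq_square algebra_simps)
    finally have "lm^2 * (t y)^2 \<le> 2 * (cmod (v y))^2 + 2 * (wave_const * lm^2)"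
      using lq2 by (simp add: power_mult_distrib)
    then show ?thesis using True by simp
  qed
  have tc: "continuous_on UNIV t" unfolding t_def W_def by (intro continuous_intros wavefam_cont)
  have vc: "continuous_on UNIV v" "\<And>y. y \<notin> cbox a b \<Longrightarrow> v y = 0"
    using p bx(2) unfolding pert_def by auto
  have t0: "y \<notin> cbox a b \<Longrightarrow> t y = 0" for y using out(2)[OF bx(2)] by (simp add: t_def W3)
  have it: "integrable lborel (\<lambda>y. (t y)^2)" 
    by (rule integrable_continuous_support[OF _ bx(1)]) (use t0 tc in \<open>auto intro!: continuous_intros\<close>)
  have iv: "integrable lborel (\<lambda>y. (cmod (v y))^2)" 
    by (rule integrable_continuous_support[OF _ bx(1)]) (use vc in \<open>auto intro!: continuous_intros\<close>)
  have ii: "integrable lborel (\<lambda>y. indicator (cbox a b) y :: real)"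
    using emeasure_bounded_finite[OF bounded_cbox, of a b] by (auto intro!: integrable_real_indicator)
  have "wave_const * lm^2 * \<mu> \<le> lm^2 / 2 * ((3/4)^30 / 16 * \<mu>) - wave_const * lm^2 * \<mu>"
    by (simp add: wave_const_def)
  also have "\<dots> \<le> lm^2 / 2 * (\<integral>y. (t y)^2 \<partial>lborel) - wave_const * lm^2 * \<mu>"
    using \<theta> by (intro diff_right_mono mult_left_mono) (auto simp: t_def)
  also have "\<dots> = (\<integral>y. lm^2 / 2 * (t y)^2 - wave_const * lm^2 * indicator (cbox a b) y \<partial>lborel)"
    using it ii by (simp add: \<mu>_def)
  also have "\<dots> \<le> (\<integral>y. (cmod (v y))^2 \<partial>lborel)"
    by (rule integral_mono) (use pw it ii iv in auto)
  finally have L2: "(\<integral>y. (cmod (v y))^2 \<partial>lborel) \<ge> wave_const * lm^2 * measure lborel (cbox a b)"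
    by (simp add: \<mu>_def)
  show ?thesis
    by (rule that[of v u t]) (use p t1 vq uq lq L2 order_trans in blast)+
qed

section \<open>Convex integration\<close>

text \<open>The smaller eigenvalue of \<open>I - v \<otimes> v + u\<close>.\<close>

definition defect :: "complex \<Rightarrow> complex \<Rightarrow> real" where
  "defect v u = 1 - (cmod v)^2 / 2 - cmod (u - v^2 / 2)"

lemma defect_pos_bounds:
  assumes "defect v u > 0" shows "(cmod v)^2 < 2" "cmod v < 3/2" "cmod u < 2" "2 * defect v u \<le> 2 - (cmod v)^2"
proof -
  show v2: "(cmod v)^2 < 2" using assms norm_ge_zero[of "u - v^2/2"] unfolding defect_def by linarith
  show "cmod v < 3/2"
  proof (rule ccontr)
    assume "\<not> cmod v < 3/2"
    then have "(3/2)^2 \<le> (cmod v)^2" by (intro power_mono) auto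
    then show False using v2 by (simp add: power2_eq_square)
  qed
  show "2 * defect v u \<le> 2 - (cmod v)^2" unfolding defect_def by simp
  have "cmod u \<le> cmod (u - v^2/2) + cmod (v^2/2)" using norm_triangle_ineq[of "u - v^2/2" "v^2/2"] by simp
  also have "cmod (v^2/2) = (cmod v)^2/2" by (simp add: norm_divide norm_power)
  finally show "cmod u < 2" using assms unfolding defect_def by linarith
qed

text \<open>Diagonalisation in complex form. A traceless symmetric matrix w acts as g -> w * cnj g,
  so w = |w| e^2 says that e is an eigenvector for the eigenvalue |w|.\<close>

lemma complex_sqrt_direction: "\<exists>e. cmod e = 1 \<and> w = of_real (cmod w) * e^2"
proof (cases "w = 0")
  case True then show ?thesis by (intro exI[of _ 1]) auto
next
  case False
  define e where "e = csqrt (sgn w)"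
  have e2: "e^2 = sgn w" by (simp add: e_def)
  have "(cmod e)^2 = 1" using False by (simp add: norm_power[symmetric] e2 norm_sgn)
  then have "cmod e = 1" by (simp add: power2_eq_1_iff) (use norm_ge_zero[of e] in linarith)
  moreover have "w = of_real (cmod w) * e^2" using False by (simp add: e2 sgn_eq)
  ultimately show ?thesis by blast
qed

text \<open>The direction of the wave has to be the top eigenvector of the defect tensor; then the
  perturbation uses up only part of the larger eigenvalue.\<close>

lemma defect_direction:
  assumes h: "defect v u > 0"
  defines "lm \<equiv> (2 - (cmod v)^2) / 16"
  obtains e \<beta> where "cmod e = 1" "\<bar>\<beta>\<bar> \<le> 2"
    "\<And>t. \<bar>t\<bar> \<le> 1 \<Longrightarrow> defect (v + of_real (lm * t) * e) (u + of_real (lm * t) * (of_real \<beta> * \<i> * e^2)) \<ge> defect v u / 2"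
proof -
  define w where "w = u - v^2/2"
  obtain e where e: "cmod e = 1" "w = of_real (cmod w) * e^2" using complex_sqrt_direction by blast
  define r where "r = cmod w"
  define a where "a = Re (v * cnj e)"
  \<comment> \<open>The component of \<open>v\<close> across \<open>e\<close> becomes the time
    frequency: it cancels the imaginary multiple of \<open>e^2\<close> in the first-order change of
    v^2/2. The traceless part of the defect tensor then stays a real multiple of \<open>e^2\<close>
    and only its size moves.\<close>
  define \<beta> where "\<beta> = Im (v * cnj e)"
  have ee: "e * cnj e = 1" using e(1) by (simp add: complex_norm_square[symmetric])
  have ve: "v = (of_real a + \<i> * of_real \<beta>) * e"
  proof -
    have "of_real a + \<i> * of_real \<beta> = v * cnj e" by (simp add: a_def \<beta>_def complex_eq_iff)
    then show ?thesis using ee by (simp add: mult.assoc mult.commute[of "cnj e"])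
  qed
  have vn: "cmod (v * cnj e) = cmod v" using e(1) by (simp add: norm_mult)
  note vb = defect_pos_bounds[OF h]
  have ab: "\<bar>a\<bar> \<le> 3/2" "\<bar>\<beta>\<bar> \<le> 2"
    using abs_Re_le_cmod[of "v * cnj e"] abs_Im_le_cmod[of "v * cnj e"] vb vn unfolding a_def \<beta>_def by linarith+
  have lm: "0 < lm" "lm \<le> 1/8" using vb by (auto simp: lm_def)
  have main: "defect (v + of_real (lm * t) * e) (u + of_real (lm * t) * (of_real \<beta> * \<i> * e^2)) \<ge> defect v u / 2"
      if t: "\<bar>t\<bar> \<le> 1" for t
  proof -
    define s where "s = lm * t"
    define d where "d = s * a + s^2/2"
    have sl: "\<bar>s\<bar> \<le> lm" using t lm by (simp add: s_def abs_mult mult_left_le)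
    have "\<bar>s * a\<bar> \<le> lm * (3/2)" unfolding abs_mult using sl ab lm by (intro mult_mono) auto
    moreover have "s^2 \<le> lm * (1/8)"
      using mult_mono[OF sl order_trans[OF sl lm(2)]] lm by (simp add: power2_eq_square)
    ultimately have dl: "d \<le> 2 * lm" using lm unfolding d_def by linarith
    have q: "(u + of_real s * (of_real \<beta> * \<i> * e^2)) - (v + of_real s * e)^2 / 2 = of_real (r - d) * e^2"
    proof -
      have "(u + of_real s * (of_real \<beta> * \<i> * e^2)) - (v + of_real s * e)^2 / 2
          = w + of_real s * (of_real \<beta> * \<i> * e^2) - of_real s * v * e - of_real s ^2 * e^2/2"
        by (simp add: w_def power2_eq_square algebra_simps add_divide_distrib diff_divide_distrib)
      also have "\<dots> = of_real r * e^2 - of_real s * of_real a * e^2 - of_real s ^2 * e^2/2"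
        by (subst ve, subst e(2), fold r_def) (simp add: power2_eq_square algebra_simps)
      also have "\<dots> = of_real (r - d) * e^2" by (simp add: d_def algebra_simps add_divide_distrib)
      finally show ?thesis .
    qed
    have n: "(cmod (v + of_real s * e))^2 = (cmod v)^2 + 2 * d"
    proof -
      have "v + of_real s * e = (of_real (a + s) + \<i> * of_real \<beta>) * e" by (subst ve) (simp add: algebra_simps)
      then have "(cmod (v + of_real s * e))^2 = (cmod (of_real (a + s) + \<i> * of_real \<beta>))^2"
        using e(1) by (simp add: norm_mult)
      also have "\<dots> = (a + s)^2 + \<beta>^2" by (simp add: cmod_power2)
      finally have 1: "(cmod (v + of_real s * e))^2 = (a + s)^2 + \<beta>^2" .
      have "(cmod v)^2 = a^2 + \<beta>^2" using vn cmod_power2[of "v * cnj e"] by (simp add: a_def \<beta>_def)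
      with 1 show ?thesis by (simp add: d_def power2_eq_square algebra_simps)
    qed
    have hv: "defect v u = 1 - (cmod v)^2/2 - r" by (simp add: defect_def r_def w_def)
    have ht: "defect (v + of_real s * e) (u + of_real s * (of_real \<beta> * \<i> * e^2)) = 1 - (cmod v)^2/2 - d - \<bar>r - d\<bar>"
      unfolding defect_def q n using e(1) by (simp add: norm_mult norm_power add_divide_distrib del: of_real_diff)
    have "1 - (cmod v)^2/2 = 8 * lm" by (simp add: lm_def)
    moreover have "r \<ge> 0" by (simp add: r_def)
    \<comment> \<open>If d \<le> r the defect does not change at all. Otherwise it equals 8 lm - 2 d
      + r, and d \<le> 2 lm keeps this above half of 8 lm - r, the old value.\<close>
    ultimately have "1 - (cmod v)^2/2 - d - \<bar>r - d\<bar> \<ge> defect v u / 2"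
      using dl h hv lm by (cases "d \<le> r") auto
    then show ?thesis using ht by (simp add: s_def)
  qed
  show ?thesis by (rule that[OF e(1) ab(2) main])
qed

section \<open>Perturbing a subsolution on a box\<close>

lemma defect_cont: "continuous_on S (\<lambda>p. defect (fst p) (snd p))"
  unfolding defect_def by (intro continuous_intros) auto

lemma pert_props:
  assumes "pert B v u"
  shows "continuous_on UNIV v" "continuous_on UNIV u" "y \<notin> B \<Longrightarrow> v y = 0" "y \<notin> B \<Longrightarrow> u y = 0"
    "open S \<Longrightarrow> closure B \<subseteq> S \<Longrightarrow> C1_on S \<phi> G \<Longrightarrow> (\<integral>y. v y \<bullet> cgrad (G y) \<partial>lborel) = 0"
    "open S \<Longrightarrow> closure B \<subseteq> S \<Longrightarrow> C1_on S \<phi> G \<Longrightarrow> (\<integral>y. of_real (fst (G y)) * v y + u y * cnj (cgrad (G y)) \<partial>lborel) = 0"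
  using assms unfolding pert_def by blast+

lemma continuous_times_support:
  fixes f :: "'a::topological_space \<Rightarrow> complex"
  assumes "continuous_on UNIV f" "closed K" "\<And>y. y \<notin> K \<Longrightarrow> f y = 0" "open S" "K \<subseteq> S" "continuous_on S g"
  shows "continuous_on UNIV (\<lambda>y. f y \<bullet> g y)"
proof -
  have "continuous_on UNIV (\<lambda>y. f y * cnj (g y))"
    by (rule continuous_mult_support[OF assms(1-5)]) (auto intro!: continuous_intros assms(6))
  then have "continuous_on UNIV (\<lambda>y. Re (f y * cnj (g y)))" by (rule continuous_on_Re)
  then show ?thesis by (simp add: inner_complex_def)
qed

lemma pert_integrable:
  assumes p: "pert B v u" and B: "bounded B" and S: "open S" "closure B \<subseteq> S" and C: "C1_on S \<phi> G"
  shows "integrable lborel (\<lambda>y. v y \<bullet> cgrad (G y))"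
    "integrable lborel (\<lambda>y. of_real (fst (G y)) * v y + u y * cnj (cgrad (G y)))"
proof -
  have K: "compact (closure B)" using B by (simp add: compact_closure)
  have z: "v y = 0" "u y = 0" if "y \<notin> closure B" for y
    using that closure_subset pert_props(3,4)[OF p] by blast+
  have cG: "continuous_on S G" using C by (simp add: C1_on_def)
  show "integrable lborel (\<lambda>y. v y \<bullet> cgrad (G y))"
    by (rule integrable_continuous_support[OF continuous_times_support[OF pert_props(1)[OF p] closed_closure z(1) S
        cgrad_cont[OF cG]] K])
       (auto simp: z)
  have "continuous_on UNIV (\<lambda>y. v y * of_real (fst (G y)) + u y * cnj (cgrad (G y)))"
    by (intro continuous_on_add continuous_mult_support[OF _ closed_closure _ S] pert_props(1,2)[OF p] z)
       (use cG cgrad_cont[OF cG] in \<open>auto intro!: continuous_intros\<close>)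
  then show "integrable lborel (\<lambda>y. of_real (fst (G y)) * v y + u y * cnj (cgrad (G y)))"
    by (intro integrable_continuous_support[OF _ K]) (auto simp: z mult.commute)
qed

lemma pert_add:
  assumes p: "pert B v u" "pert B v' u'" and B: "bounded B"
  shows "pert B (\<lambda>y. v y + v' y) (\<lambda>y. u y + u' y)"
  unfolding pert_def
proof (intro conjI allI impI)
  show "continuous_on UNIV (\<lambda>y. v y + v' y)" "continuous_on UNIV (\<lambda>y. u y + u' y)"
    using pert_props[OF p(1)] pert_props[OF p(2)] by (auto intro!: continuous_intros)
  show "v y + v' y = 0" "u y + u' y = 0" if "y \<notin> B" for y
    using pert_props[OF p(1)] pert_props[OF p(2)] that by auto
  fix S \<phi> G assume "open S \<and> closure B \<subseteq> S \<and> C1_on S \<phi> G"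
  then have S: "open S" "closure B \<subseteq> S" "C1_on S \<phi> G" by auto
  note i = pert_integrable[OF p(1) B S] pert_integrable[OF p(2) B S]
  note z = pert_props(5,6)[OF p(1) S] pert_props(5,6)[OF p(2) S]
  show "(\<integral>y. (v y + v' y) \<bullet> cgrad (G y) \<partial>lborel) = 0"
    unfolding inner_add_left using i z by simp
  have "(\<lambda>y. of_real (fst (G y)) * (v y + v' y) + (u y + u' y) * cnj (cgrad (G y)))
     = (\<lambda>y. (of_real (fst (G y)) * v y + u y * cnj (cgrad (G y)))
         + (of_real (fst (G y)) * v' y + u' y * cnj (cgrad (G y))))"
    by (simp add: algebra_simps)
  then show "(\<integral>y. of_real (fst (G y)) * (v y + v' y) + (u y + u' y) * cnj (cgrad (G y)) \<partial>lborel) = 0"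
    using Bochner_Integration.integral_add[OF i(2) i(4)] z by simp
qed

lemma pert_mono: "pert B v u \<Longrightarrow> B \<subseteq> B' \<Longrightarrow> pert B' v u"
  unfolding pert_def using closure_mono[of B B'] by (meson order_trans subsetD)

lemma pert_zero: "pert B (\<lambda>y. 0) (\<lambda>y. 0)" by (auto simp: pert_def)

lemma pert_sum:
  assumes "finite A" "\<And>i. i \<in> A \<Longrightarrow> pert B (v i) (u i)" "bounded B"
  shows "pert B (\<lambda>y. \<Sum>i\<in>A. v i y) (\<lambda>y. \<Sum>i\<in>A. u i y)"
  using assms by (induction A rule: finite_induct) (auto intro: pert_zero pert_add)

text \<open>Testing div v = 0 against the coordinate functions x1 and x2, which the compact support
  of \<open>v\<close> permits, gives mean zero. A block on a small cell is therefore nearly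
  orthogonal to anything that varies slowly.\<close>

lemma pert_integral_zero:
  assumes p: "pert B v u" and B: "bounded B"
  shows "integrable lborel v" "(\<integral>y. v y \<partial>lborel) = 0"
proof -
  have "v y = 0" if "y \<notin> closure B" for y using that closure_subset pert_props(3)[OF p] by blast
  then show i: "integrable lborel v"
    using B by (intro integrable_continuous_support[OF pert_props(1)[OF p], of
        "closure B"]) (simp_all add: compact_closure)
  have C: "C1_on UNIV (\<lambda>z. z \<bullet> d) (\<lambda>z. d)" for d :: spacetime
    unfolding C1_on_def by (auto intro!: derivative_eq_intros simp: inner_commute)
  show "(\<integral>y. v y \<partial>lborel) = 0"
  proof (rule integral_complex_eq_0[OF i])
    show "(\<integral>y. Re (v y) \<partial>lborel) = 0" "(\<integral>y. Im (v y) \<partial>lborel) = 0"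
      using pert_props(5)[OF p _ _ C[of "dirv 1"]] pert_props(5)[OF p _ _ C[of "dirv 2"]]
      by (auto simp: cgrad_def dirv_def inner_complex_def axis_def)
  qed
qed

text \<open>All states met in an iteration step are bounded by 4, so uniform continuity on that
  compact set yields one tolerance for the whole step.\<close>

lemma defect_uniform:
  assumes "\<mu> > 0"
  obtains \<eta> where "0 < \<eta>" "\<eta> \<le> 1"
    "\<And>v u v' u'. cmod v \<le> 4 \<Longrightarrow> cmod u \<le> 4 \<Longrightarrow> cmod v' \<le> 4 \<Longrightarrow> cmod u' \<le> 4 \<Longrightarrow>
       cmod (v' - v) + cmod (u' - u) < \<eta> \<Longrightarrow> \<bar>defect v' u' - defect v u\<bar> < \<mu>"
proof -
  let ?K = "cball (0::complex) 4 \<times> cball (0::complex) 4"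
  have "uniformly_continuous_on ?K (\<lambda>p. defect (fst p) (snd p))"
    by (intro compact_uniformly_continuous defect_cont compact_Times compact_cball)
  then obtain d where d: "d > 0" "\<And>p p'. p \<in> ?K \<Longrightarrow> p' \<in> ?K \<Longrightarrow> dist p' p < d \<Longrightarrow>
      dist (defect (fst p') (snd p')) (defect (fst p) (snd p)) < \<mu>"
    using assms unfolding uniformly_continuous_on_def by metis
  show ?thesis
  proof (rule that[of "min d 1"])
    fix v u v' u' assume b: "cmod v \<le> 4" "cmod u \<le> 4" "cmod v' \<le> 4" "cmod u' \<le> 4"
      and s: "cmod (v' - v) + cmod (u' - u) < min d 1"
    have "dist (v', u') (v, u) \<le> dist v' v + dist u' u"
      by (simp add: dist_Pair_Pair sqrt_sum_squares_le_sum)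
    then have "dist (v', u') (v, u) < d" using s by (simp add: dist_norm)
    then show "\<bar>defect v' u' - defect v u\<bar> < \<mu>" using d(2)[of "(v,u)" "(v',u')"] b by (auto simp: dist_real_def)
  qed (use d in auto)
qed

lemma common_modulus:
  fixes W :: "('a::metric_space \<Rightarrow> complex) set"
  assumes "finite W" "\<And>f. f \<in> W \<Longrightarrow> continuous_on UNIV f" "compact Q" "\<rho> > 0"
  shows "\<exists>\<delta>>0. \<forall>f\<in>W. \<forall>y\<in>Q. \<forall>y'\<in>Q. dist y' y < \<delta> \<longrightarrow> cmod (f y' - f y) < \<rho>"
  using assms(1,2)
proof (induction W rule: finite_induct)
  case empty then show ?case by (intro exI[of _ 1]) auto
next
  case (insert g W)
  then obtain \<delta> where \<delta>: "\<delta> > 0" "\<forall>f\<in>W. \<forall>y\<in>Q. \<forall>y'\<in>Q. dist y' y < \<delta> \<longrightarrow> cmod (f y' - f y) < \<rho>" by auto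
  have "uniformly_continuous_on Q g"
    by (rule compact_uniformly_continuous[OF continuous_on_subset[of UNIV g] assms(3)]) (use insert.prems in auto)
  then obtain d where d: "d > 0" "\<forall>y\<in>Q. \<forall>y'\<in>Q. dist y' y < d \<longrightarrow> cmod (g y' - g y) < \<rho>"
    using assms(4) unfolding uniformly_continuous_on_def dist_norm by metis
  show ?case by (rule exI[of _ "min \<delta> d"]) (use \<delta> d in auto)
qed

text \<open>Freeze \<open>v\<close> and \<open>w\<close> at the tags of a fine division and insert
  one \<open>wave_block\<close> in each cell. The blocks have disjoint supports, and each gains
  energy in proportion to (2 - |v|^2)^2 times its volume because \<open>defect_direction\<close>
  allows the amplitude (2 - |v|^2) / 16. Near orthogonality to \<open>W\<close> holds since each
  block has mean zero and members of \<open>W\<close> are almost constant on a cell.\<close>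

lemma perturbation_step:
  fixes a b :: spacetime
  assumes ne: "box a b \<noteq> {}" and p: "pert (box a b) v w" and h: "\<And>y. defect (v y) (u0 + w y) > 0"
    and W: "finite W" "\<And>f. f \<in> W \<Longrightarrow> continuous_on UNIV f" and \<epsilon>: "\<epsilon> > 0"
  obtains v' w' where "pert (box a b) v' w'" "\<And>y. defect (v' y) (u0 + w' y) > 0"
    "(\<integral>y. (cmod (v' y - v y))^2 \<partial>lborel)
        \<ge> wave_const / 1024 * (\<integral>y. indicator (cbox a b) y * (2 - (cmod (v y))^2)^2 \<partial>lborel)"
    "\<And>f. f \<in> W \<Longrightarrow> \<bar>\<integral>y. (v' y - v y) \<bullet> f y \<partial>lborel\<bar> \<le> \<epsilon>"
proof -
  define Q where "Q = cbox a b"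
  have cQ: "compact Q" "Q \<noteq> {}" using ne box_subset_cbox[of a b] by (auto simp: Q_def)
  have cv: "continuous_on UNIV v" and cw: "continuous_on UNIV w" using pert_props[OF p] by auto
  have hc: "continuous_on Q (\<lambda>y. defect (v y) (u0 + w y))"
    unfolding defect_def by (intro continuous_intros continuous_on_subset[OF cv] continuous_on_subset[OF cw]) auto
  obtain y0 where y0: "\<And>y. y \<in> Q \<Longrightarrow> defect (v y0) (u0 + w y0) \<le> defect (v y) (u0 + w y)"
    using continuous_attains_inf[OF cQ hc] by blast
  \<comment> \<open>The positive minimum of the defect over the closed box; the tolerances for the
    new defect are measured against it.\<close>
  define \<mu> where "\<mu> = defect (v y0) (u0 + w y0)"
  have \<mu>: "\<mu> > 0" "\<And>y. y \<in> Q \<Longrightarrow> \<mu> \<le> defect (v y) (u0 + w y)" using y0 h by (auto simp: \<mu>_def)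
  obtain \<eta> where \<eta>: "0 < \<eta>" "\<eta> \<le> 1"
    "\<And>v u v' u'. cmod v \<le> 4 \<Longrightarrow> cmod u \<le> 4 \<Longrightarrow> cmod v' \<le> 4 \<Longrightarrow> cmod u' \<le> 4 \<Longrightarrow>
       cmod (v' - v) + cmod (u' - u) < \<eta> \<Longrightarrow> \<bar>defect v' u' - defect v u\<bar> < \<mu> / 4"
    using defect_uniform[of "\<mu> / 4"] \<mu> by auto
  define c where "c = measure lborel Q"
  have c0: "c \<ge> 0" by (simp add: c_def)
  \<comment> \<open>The three bounds serve, in this order, the stability of the defect, the
    comparison of 2 - |v|^2 at a point and at its tag, and the orthogonality estimate.\<close>
  define \<rho> where "\<rho> = min (\<eta> / 8) (min (\<mu> / 4) (\<epsilon> / (c + 1)))"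
  have \<rho>: "\<rho> > 0" "\<rho> \<le> \<eta> / 8" "\<rho> \<le> \<mu> / 4" "\<rho> \<le> \<epsilon> / (c + 1)"
  proof -
    show "\<rho> > 0" unfolding \<rho>_def using \<eta>(1) \<mu>(1) \<epsilon> c0 by simp
    show "\<rho> \<le> \<eta> / 8" "\<rho> \<le> \<mu> / 4" "\<rho> \<le> \<epsilon> / (c + 1)" unfolding \<rho>_def by linarith+
  qed
  obtain \<delta> where \<delta>: "\<delta> > 0" "\<And>f y y'. f \<in> insert v (insert w W) \<Longrightarrow> y \<in> Q \<Longrightarrow> y' \<in> Q \<Longrightarrow> dist y' y < \<delta>
      \<Longrightarrow> cmod (f y' - f y) < \<rho>"
  proof -
    have "\<exists>\<delta>>0. \<forall>f\<in>insert v (insert w W). \<forall>y\<in>Q. \<forall>y'\<in>Q. dist y' y < \<delta> \<longrightarrow> cmod (f y' - f y) < \<rho>"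
      by (rule common_modulus[OF _ _ cQ(1) \<rho>(1)]) (use W cv cw in auto)
    then show thesis using that by metis
  qed
  obtain P where P: "P tagged_division_of Q" "(\<lambda>x. ball x \<delta>) fine P"
    using fine_division_exists[of "\<lambda>x. ball x \<delta>" a b] \<delta> unfolding Q_def gauge_def by auto
  have finP: "finite P" using P by auto
  have xK: "x \<in> K" "K \<subseteq> Q" "\<exists>c d. K = cbox c d" "K \<subseteq> ball x \<delta>" "x \<in> Q" if "(x, K) \<in> P" for x K
    using tagged_division_ofD(2,3,4)[OF P(1) that] P(2) that unfolding fine_def by blast+
  define lm where "lm x = (2 - (cmod (v x))^2) / 16" for x
  have lm: "0 < lm x" "lm x \<le> 1/8" for x using defect_pos_bounds[OF h[of x]] by (auto simp: lm_def)
  \<comment> \<open>The pair \<open>v'\<close>, \<open>u'\<close> is the exact plane-wave state,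
    whose defect is known; the block deviates from it by at most \<eta>/8.\<close>
  have ex: "\<exists>V U. pert (interior K) V U \<and>
      (\<forall>y. \<exists>v' u'. defect v' u' \<ge> \<mu> / 2 \<and> cmod (v' - v x) \<le> lm x \<and> cmod (u' - (u0 + w x)) \<le> 2 * lm x \<and>
          cmod (v x + V y - v') \<le> \<eta> / 8 \<and> cmod (u0 + w x + U y - u') \<le> \<eta> / 8 ) \<and>
      (\<integral>y. (cmod (V y))^2 \<partial>lborel) \<ge> wave_const * (lm x)^2 * measure lborel K" if xKP: "(x, K) \<in> P" for x K
  proof -
    have hx: "defect (v x) (u0 + w x) \<ge> \<mu>" using \<mu> xK[OF xKP] by blast
    obtain e \<beta> where e: "cmod e = 1" "\<bar>\<beta>\<bar> \<le> 2"
     "\<And>t. \<bar>t\<bar> \<le> 1 \<Longrightarrow> defect (v x + of_real (lm x * t) * e) (u0 + w x + of_real (lm x * t) * (of_real \<beta> * \<i> * e^2))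
         \<ge> defect (v x) (u0 + w x) / 2"
      using defect_direction[OF h[of x]] unfolding lm_def by blast
    obtain c' d' where K: "K = cbox c' d'" using xK[OF xKP] by blast
    show ?thesis
    proof (cases "box c' d' = {}")
      \<comment> \<open>A tagged division may contain flat cells; these have volume zero and receive
        no wave.\<close>
      case True
      then have iK: "interior K = {}" by (simp add: K)
      have "measure lborel K = 0" using True K content_eq_0_interior[of c' d'] by simp
      moreover have "\<exists>v' u'. defect v' u' \<ge> \<mu> / 2 \<and> cmod (v' - v x) \<le> lm x \<and> cmod (u' - (u0 + w x)) \<le> 2 * lm x \<and>
          cmod (v x + 0 - v') \<le> \<eta> / 8 \<and> cmod (u0 + w x + 0 - u') \<le> \<eta> / 8"
        by (rule exI[of _ "v x"], rule exI[of _ "u0 + w x"]) (use hx \<mu> lm[of x] \<eta> in auto)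
      ultimately show ?thesis using pert_zero[of "interior K"] by (intro exI[of _ "\<lambda>y. 0"]) auto
    next
      case False
      have "lm x \<le> 1" "\<eta> / 8 > 0" using lm[of x] \<eta> by auto
      from wave_block[OF False e(1,2) lm(1)[of x] this] obtain V U t where B: "pert (box c' d') V U"
        "\<And>y. \<bar>t y\<bar> \<le> 1" "\<And>y. cmod (V y - of_real (lm x * t y) * e) \<le> \<eta> / 8"
        "\<And>y. cmod (U y - of_real (lm x * t y) * (of_real \<beta> * \<i> * e^2)) \<le> \<eta> / 8"
        "(\<integral>y. (cmod (V y))^2 \<partial>lborel) \<ge> wave_const * (lm x)^2 * measure lborel (cbox c' d')" by blast
      have "\<exists>v' u'. defect v' u' \<ge> \<mu> / 2 \<and> cmod (v' - v x) \<le> lm x \<and> cmod (u' - (u0 + w x)) \<le> 2 * lm x \<and>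
          cmod (v x + V y - v') \<le> \<eta> / 8 \<and> cmod (u0 + w x + U y - u') \<le> \<eta> / 8" for y
      proof (intro exI conjI)
        show "defect (v x + of_real (lm x * t y) * e) (u0 + w x + of_real (lm x * t y) * (of_real \<beta> * \<i> * e^2))
            \<ge> \<mu> / 2"
          using e(3)[OF B(2)[of y]] hx by linarith
        have t: "lm x * \<bar>t y\<bar> \<le> lm x" using B(2)[of y] lm(1)[of x] by (simp add: mult_left_le)
        show "cmod (v x + of_real (lm x * t y) * e - v x) \<le> lm x"
          using t e lm(1)[of x] by (simp add: norm_mult abs_mult)
        have "cmod (of_real (lm x * t y) * (of_real \<beta> * \<i> * e^2)) = (lm x * \<bar>t y\<bar>) * \<bar>\<beta>\<bar>"
          using e lm(1)[of x] by (simp add: norm_mult abs_mult norm_power)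
        also have "\<dots> \<le> lm x * 2" using t e(2) lm(1)[of x] by (intro mult_mono) auto
        finally show "cmod (u0 + w x + of_real (lm x * t y) * (of_real \<beta> * \<i> * e^2) - (u0 + w x)) \<le> 2 * lm x" by simp
      qed (use B(3,4)[of y] in \<open>simp_all\<close>)
      then show ?thesis using B(1,5) by (intro exI[of _ V] exI[of _ U]) (auto simp: K)
    qed
  qed
  have "\<forall>k\<in>P. \<exists>VU. pert (interior (snd k)) (fst VU) (snd VU) \<and>
      (\<forall>y. \<exists>v' u'. defect v' u' \<ge> \<mu> / 2 \<and> cmod (v' - v (fst k)) \<le> lm (fst k) \<and> cmod (u' - (u0 + w (fst k)))
          \<le> 2 * lm (fst k) \<and>
          cmod (v (fst k) + fst VU y - v') \<le> \<eta> / 8 \<and> cmod (u0 + w (fst k) + snd VU y - u') \<le> \<eta> / 8) \<and>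
      (\<integral>y. (cmod (fst VU y))^2 \<partial>lborel) \<ge> wave_const * (lm (fst k))^2 * measure lborel (snd k)"
    using ex by fastforce
  then obtain VU where VU: "\<And>k. k \<in> P \<Longrightarrow> pert (interior (snd k)) (fst (VU k)) (snd (VU k))"
     "\<And>k y. k \<in> P \<Longrightarrow> \<exists>v' u'. defect v' u' \<ge> \<mu> / 2 \<and> cmod (v' - v (fst k)) \<le> lm (fst k) \<and> cmod (u' - (u0 + w (fst k)))
         \<le> 2 * lm (fst k) \<and>
          cmod (v (fst k) + fst (VU k) y - v') \<le> \<eta> / 8 \<and> cmod (u0 + w (fst k) + snd (VU k) y - u') \<le> \<eta> / 8"
     "\<And>k. k \<in> P \<Longrightarrow> (\<integral>y. (cmod (fst (VU k) y))^2 \<partial>lborel) \<ge> wave_const * (lm (fst k))^2 * measure lborel (snd k)"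
    by metis
  define V where "V k = fst (VU k)" for k
  define U where "U k = snd (VU k)" for k
  have pV: "pert (interior (snd k)) (V k) (U k)" if "k \<in> P" for k using VU(1)[OF that] by (simp add: V_def U_def)
  define dv where "dv y = (\<Sum>k\<in>P. V k y)" for y
  define dw where "dw y = (\<Sum>k\<in>P. U k y)" for y
  have sub: "interior (snd k) \<subseteq> box a b" if "k \<in> P" for k
    using interior_mono[OF xK(2)[of "fst k" "snd k"]] that by (simp add: Q_def)
  have bd: "bounded (interior (snd k))" if "k \<in> P" for k
    using sub[OF that] bounded_box bounded_subset by blast
  have pd: "pert (box a b) dv dw" unfolding dv_def dw_def
    by (intro pert_sum finP pert_mono[OF pV] sub bounded_box)
  have Vout: "V k y = 0" "U k y = 0" if "k \<in> P" "y \<notin> interior (snd k)" for k y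
    using pert_props(3,4)[OF pV[OF that(1)] that(2)] by auto
  have one: "dv y = V k y \<and> dw y = U k y" if k: "k \<in> P" "y \<in> interior (snd k)" for k y
  proof -
    have "V j y = 0 \<and> U j y = 0" if j: "j \<in> P - {k}" for j
    proof -
      have "interior (snd j) \<inter> interior (snd k) = {}"
        using tagged_division_ofD(5)[OF P(1), of "fst j" "snd j" "fst k" "snd k"] j k by (auto simp: prod_eq_iff)
      then show ?thesis using Vout[of j y] k j by blast
    qed
    then show ?thesis unfolding dv_def dw_def using finP k by (simp add: sum.remove[of P k])
  qed
  have none: "dv y = 0 \<and> dw y = 0" if "\<And>k. k \<in> P \<Longrightarrow> y \<notin> interior (snd k)" for y
    unfolding dv_def dw_def using Vout that by (simp add: sum.neutral)
  have osc: "cmod (f y - f (fst k)) < \<rho>" if "k \<in> P" "y \<in> snd k" "f \<in> insert v (insert w W)" for f k y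
    by (rule \<delta>(2)[OF that(3)]) (use xK[of "fst k" "snd k"] that in \<open>auto simp: dist_commute mem_ball\<close>)
  have Vsmall: "cmod (V k y) \<le> 1" if "k \<in> P" for k y
  proof -
    from VU(2)[OF that, of y] obtain v' where "cmod (v' - v (fst k)) \<le> lm (fst k)"
        "cmod (v (fst k) + V k y - v') \<le> \<eta> / 8"
      unfolding V_def by blast
    then have "cmod ((v (fst k) + V k y - v') + (v' - v (fst k))) \<le> \<eta>/8 + lm (fst k)"
      by (intro norm_triangle_mono)
    then show ?thesis using \<eta> lm(2)[of "fst k"] by simp
  qed
  have defect': "defect (v y + dv y) (u0 + (w y + dw y)) > 0" for y
  proof (cases "\<exists>k\<in>P. y \<in> interior (snd k)")
    case False
    then show ?thesis using none[of y] h[of y] by auto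
  next
    case True
    then obtain k where k: "k \<in> P" "y \<in> interior (snd k)" by blast
    then have yk: "y \<in> snd k" using interior_subset by blast
    let ?x = "fst k"
    obtain v' u' where 1: "defect v' u' \<ge> \<mu> / 2" "cmod (v' - v ?x) \<le> lm ?x" "cmod (u' - (u0 + w ?x)) \<le> 2 * lm ?x"
       "cmod (v ?x + V k y - v') \<le> \<eta> / 8" "cmod (u0 + w ?x + U k y - u') \<le> \<eta> / 8"
      using VU(2)[OF k(1), of y] unfolding V_def U_def by blast
    have o: "cmod (v y - v ?x) < \<rho>" "cmod (w y - w ?x) < \<rho>" using osc[OF k(1) yk] by auto
    note bx = defect_pos_bounds[OF h[of ?x]]
    have v'b: "cmod v' \<le> 2" using norm_triangle_mono[OF 1(2) less_imp_le[OF bx(2)]] lm(2)[of ?x] by simp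
    have u'b: "cmod u' \<le> 3" using norm_triangle_mono[OF 1(3) less_imp_le[OF bx(3)]] lm(2)[of ?x] by simp
    have vd: "cmod (v y + dv y - v') \<le> \<eta>/8 + \<rho>"
      using norm_triangle_mono[OF 1(4) less_imp_le[OF o(1)]] one[OF k] by (simp add: algebra_simps)
    have ud: "cmod (u0 + (w y + dw y) - u') \<le> \<eta>/8 + \<rho>"
      using norm_triangle_mono[OF 1(5) less_imp_le[OF o(2)]] one[OF k] by (simp add: algebra_simps)
    have "cmod (v y + dv y) \<le> 4" using norm_triangle_mono[OF vd v'b] \<rho> \<eta> by simp
    moreover have "cmod (u0 + (w y + dw y)) \<le> 4" using norm_triangle_mono[OF ud u'b] \<rho> \<eta> by simp
    \<comment> \<open>Each of the two components is off by at most \<eta>/8 + \<rho>, hence by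
      \<eta>/4, so the total stays below \<eta> and the defect loses less than \<mu>/4 from
      \<mu>/2.\<close>
    ultimately have "\<bar>defect (v y + dv y) (u0 + (w y + dw y)) - defect v' u'\<bar> < \<mu> / 4"
      using v'b u'b vd ud \<rho> \<eta>(1) by (intro \<eta>(3)) auto
    then show ?thesis using 1(1) \<mu>(1) by linarith
  qed
  have iV: "integrable lborel (\<lambda>y. (cmod (V k y))^2)" if "k \<in> P" for k
  proof -
    have "V k y = 0" if "y \<notin> closure (interior (snd k))" for y
      using Vout(1)[OF \<open>k \<in> P\<close>] that closure_subset by blast
    then show ?thesis using bd[OF that] pert_props(1)[OF pV[OF that]]
      by (intro integrable_continuous_support[where K="closure (interior (snd k))"])
         (auto simp: compact_closure intro!: continuous_intros)
  qed
  have fm: "emeasure lborel (snd k) < \<infinity>" "snd k \<in> sets borel" if "k \<in> P" for k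
    using xK(3)[of "fst k" "snd k"] that emeasure_bounded_finite[OF bounded_cbox] by auto
  have sq: "(\<integral>y. (cmod (dv y))^2 \<partial>lborel) = (\<Sum>k\<in>P. \<integral>y. (cmod (V k y))^2 \<partial>lborel)"
  proof -
    have "(cmod (dv y))^2 = (\<Sum>k\<in>P. (cmod (V k y))^2)" for y
    proof (cases "\<exists>k\<in>P. y \<in> interior (snd k)")
      case False
      then show ?thesis using none[of y] Vout(1) by (simp add: sum.neutral)
    next
      case True
      then obtain k where k: "k \<in> P" "y \<in> interior (snd k)" by blast
      have "V j y = 0" if j: "j \<in> P - {k}" for j
      proof -
        have "interior (snd j) \<inter> interior (snd k) = {}"
          using tagged_division_ofD(5)[OF P(1), of "fst j" "snd j" "fst k" "snd k"] j k by (auto simp: prod_eq_iff)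
        then show ?thesis using Vout[of j y] k j by blast
      qed
      then show ?thesis using one[OF k] finP k by (simp add: sum.remove[of P k])
    qed
    then show ?thesis using iV by simp
  qed
  have iQ: "integrable lborel (\<lambda>y. indicator Q y * (2 - (cmod (v y))^2)^2)"
  proof -
    have "continuous_on Q (\<lambda>y. (2 - (cmod (v y))^2)^2)"
      by (intro continuous_intros continuous_on_subset[OF cv]) auto
    from borel_integrable_compact[OF cQ(1) this] show ?thesis by simp
  qed
  have "(\<integral>y. indicator Q y * (2 - (cmod (v y))^2)^2 \<partial>lborel)
      \<le> (\<integral>y. (\<Sum>k\<in>P. 1024 * (lm (fst k))^2 * indicator (snd k) y) \<partial>lborel)"
  proof (rule integral_mono[OF iQ])
    show "integrable lborel (\<lambda>y. \<Sum>k\<in>P. 1024 * (lm (fst k))^2 * indicator (snd k) y)"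
      using fm by (intro Bochner_Integration.integrable_sum integrable_mult_right integrable_real_indicator) auto
    fix y
    show "indicator Q y * (2 - (cmod (v y))^2)^2 \<le> (\<Sum>k\<in>P. 1024 * (lm (fst k))^2 * indicator (snd k) y)"
    proof (cases "y \<in> Q")
      case False then show ?thesis by (simp add: sum_nonneg)
    next
      case True
      then obtain k where k: "k \<in> P" "y \<in> snd k" using tagged_division_ofD(6)[OF P(1)] by fastforce
      let ?x = "fst k"
      have xQ: "?x \<in> Q" using xK(5)[of ?x "snd k"] k by simp
      have o: "cmod (v y - v ?x) < \<rho>" using osc[OF k] by auto
      have "\<bar>cmod (v y) - cmod (v ?x)\<bar> \<le> \<rho>" using norm_triangle_ineq3[of "v y" "v ?x"] o by linarith
      moreover have "cmod (v y) + cmod (v ?x) \<le> 3"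
          using defect_pos_bounds(2)[OF h[of y]] defect_pos_bounds(2)[OF h[of ?x]] by linarith
      ultimately have "\<bar>cmod (v y) - cmod (v ?x)\<bar> * (cmod (v y) + cmod (v ?x)) \<le> \<rho> * 3" using \<rho>(1)
          by (intro mult_mono) auto
      then have "\<bar>(cmod (v y) - cmod (v ?x)) * (cmod (v y) + cmod (v ?x))\<bar> \<le> \<rho> * 3" by (simp add: abs_mult)
      then have "\<bar>(cmod (v y))^2 - (cmod (v ?x))^2\<bar> \<le> 3 * \<rho>" by (simp add: power2_eq_square algebra_simps)
      moreover have "2 * \<mu> \<le> 2 - (cmod (v ?x))^2" using defect_pos_bounds(4)[OF h[of ?x]] \<mu>(2)[OF xQ] by linarith
      \<comment> \<open>At the tag, 2 - |v|^2 is 16 lm and at least 2 \<mu>, while moving to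
        \<open>y\<close> changes it by at most 3 \<rho>, which is less. Hence the factor 32 and,
        after squaring, 1024.\<close>
      ultimately have "2 - (cmod (v y))^2 \<le> 32 * lm ?x" using \<rho>(3) \<mu>(1) unfolding lm_def by (simp add: abs_le_iff)
      then have "(2 - (cmod (v y))^2)^2 \<le> (32 * lm ?x)^2"
        using defect_pos_bounds(1)[OF h[of y]] by (intro power_mono) auto
      also have "\<dots> = 1024 * (lm ?x)^2 * indicator (snd k) y" using k by (simp add: power_mult_distrib)
      also have "\<dots> \<le> (\<Sum>k\<in>P. 1024 * (lm (fst k))^2 * indicator (snd k) y)"
        using finP k by (intro member_le_sum) auto
      finally show ?thesis using True by simp
    qed
  qed
  also have "\<dots> = (\<Sum>k\<in>P. 1024 * (lm (fst k))^2 * measure lborel (snd k))"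
    using fm by (subst Bochner_Integration.integral_sum) auto
  finally have tau: "(\<integral>y. indicator Q y * (2 - (cmod (v y))^2)^2 \<partial>lborel)
      \<le> (\<Sum>k\<in>P. 1024 * (lm (fst k))^2 * measure lborel (snd k))" .
  have wc: "wave_const > 0" by (simp add: wave_const_def)
  have E: "wave_const / 1024 * (\<integral>y. indicator Q y * (2 - (cmod (v y))^2)^2 \<partial>lborel) \<le> (\<integral>y. (cmod (dv y))^2 \<partial>lborel)"
  proof -
    have "wave_const / 1024 * (\<integral>y. indicator Q y * (2 - (cmod (v y))^2)^2 \<partial>lborel)
        \<le> wave_const / 1024 * (\<Sum>k\<in>P. 1024 * (lm (fst k))^2 * measure lborel (snd k))"
      using tau wc by (intro mult_left_mono) auto
    also have "\<dots> = (\<Sum>k\<in>P. wave_const * (lm (fst k))^2 * measure lborel (snd k))"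
      by (simp add: sum_distrib_left mult_ac)
    also have "\<dots> \<le> (\<integral>y. (cmod (dv y))^2 \<partial>lborel)"
      unfolding sq V_def by (intro sum_mono VU(3))
    finally show ?thesis .
  qed
  have orth: "\<bar>\<integral>y. dv y \<bullet> f y \<partial>lborel\<bar> \<le> \<epsilon>" if f: "f \<in> W" for f
  proof -
    have cf: "continuous_on UNIV f" using W f by blast
    have one': "integrable lborel (\<lambda>y. V k y \<bullet> f y) \<and> \<bar>\<integral>y. V k y \<bullet> f y \<partial>lborel\<bar> \<le> \<rho> * measure lborel (snd k)"
        if k: "k \<in> P" for k
    proof -
      have cl: "V k y = 0" if "y \<notin> closure (interior (snd k))" for y
        using Vout(1)[OF k] that closure_subset by blast
      have cV: "continuous_on UNIV (V k)" using pert_props(1)[OF pV[OF k]] .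
      have cp: "compact (closure (interior (snd k)))" using bd[OF k] by (simp add: compact_closure)
      have i1: "integrable lborel (\<lambda>y. V k y \<bullet> f y)"
        by (rule integrable_continuous_support[OF _ cp]) (use cV cf cl in \<open>auto intro!: continuous_intros\<close>)
      have i2: "integrable lborel (\<lambda>y. V k y \<bullet> f (fst k))"
        by (rule integrable_continuous_support[OF _ cp]) (use cV cf cl in \<open>auto intro!: continuous_intros\<close>)
      have "(\<integral>y. V k y \<bullet> f (fst k) \<partial>lborel) = 0"
        using pert_integral_zero[OF pV[OF k] bd[OF k]] by simp
      then have "(\<integral>y. V k y \<bullet> f y \<partial>lborel) = (\<integral>y. V k y \<bullet> f y - V k y \<bullet> f (fst k) \<partial>lborel)"
        using i1 i2 by simp
      then have "\<bar>\<integral>y. V k y \<bullet> f y \<partial>lborel\<bar> \<le> (\<integral>y. \<bar>V k y \<bullet> f y - V k y \<bullet> f (fst k)\<bar> \<partial>lborel)"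
        using integral_abs_bound[of lborel "\<lambda>y. V k y \<bullet> f y - V k y \<bullet> f (fst k)"] by simp
      also have "\<dots> \<le> (\<integral>y. \<rho> * indicator (snd k) y \<partial>lborel)"
      proof (rule integral_mono)
        show "integrable lborel (\<lambda>y. \<bar>V k y \<bullet> f y - V k y \<bullet> f (fst k)\<bar>)" using i1 i2 by auto
        show "integrable lborel (\<lambda>y. \<rho> * indicator (snd k) y :: real)"
          using fm[OF k] by (intro integrable_mult_right integrable_real_indicator) auto
        fix y
        show "\<bar>V k y \<bullet> f y - V k y \<bullet> f (fst k)\<bar> \<le> \<rho> * indicator (snd k) y"
        proof (cases "y \<in> interior (snd k)")
          case True
          then have yk: "y \<in> snd k" using interior_subset by blast
          have "\<bar>V k y \<bullet> (f y - f (fst k))\<bar> \<le> cmod (V k y) * cmod (f y - f (fst k))" by (rule Cauchy_Schwarz_ineq2)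
          also have "\<dots> \<le> 1 * \<rho>" using Vsmall[OF k] osc[OF k yk, of f] f by (intro mult_mono) auto
          finally show ?thesis using yk by (simp add: inner_diff_right)
        next
          case False
          then show ?thesis using Vout(1)[OF k] \<rho>(1) by simp
        qed
      qed
      also have "\<dots> = \<rho> * measure lborel (snd k)" by simp
      finally show ?thesis using i1 by blast
    qed
    have "(\<integral>y. dv y \<bullet> f y \<partial>lborel) = (\<Sum>k\<in>P. \<integral>y. V k y \<bullet> f y \<partial>lborel)"
      unfolding dv_def inner_sum_left using one' by (intro Bochner_Integration.integral_sum) auto
    also have "\<bar>\<dots>\<bar> \<le> (\<Sum>k\<in>P. \<rho> * measure lborel (snd k))"
      by (intro order_trans[OF sum_abs] sum_mono) (use one' in auto)
    also have "\<dots> = \<rho> * c"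
    proof -
      have "(\<Sum>(x, K)\<in>P. measure lborel K) = c"
        using additive_content_tagged_division[of P a b] P(1) by (simp add: Q_def c_def)
      then show ?thesis by (simp add: sum_distrib_left[symmetric] case_prod_beta)
    qed
    also have "\<dots> \<le> \<epsilon> / (c + 1) * (c + 1)" using \<rho> c0 \<epsilon> by (intro mult_mono) auto
    also have "\<dots> = \<epsilon>" using c0 by simp
    finally show ?thesis .
  qed
  show ?thesis
  proof (rule that[of "\<lambda>y. v y + dv y" "\<lambda>y. w y + dw y"])
    show "pert (box a b) (\<lambda>y. v y + dv y) (\<lambda>y. w y + dw y)" by (rule pert_add[OF p pd bounded_box])
  qed (use defect' E orth in \<open>auto simp: Q_def\<close>)
qed

text \<open>Dependent choice on triples whose third component collects all earlier iterates, so that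
  every increment is tested against each of them with the summable error (1/2)^n. The start is the
  zero perturbation, with defect 1 - |u0|.\<close>

lemma iterate_perturbations:
  fixes a b :: spacetime
  assumes ne: "box a b \<noteq> {}" and u0: "cmod u0 < 1"
  obtains V w where "\<And>n. pert (box a b) (V n) (w n)" "\<And>n y. defect (V n y) (u0 + w n y) > 0"
    "\<And>n. (\<integral>y. (cmod (V (Suc n) y - V n y))^2 \<partial>lborel)
        \<ge> wave_const / 1024 * (\<integral>y. indicator (cbox a b) y * (2 - (cmod (V n y))^2)^2 \<partial>lborel)"
    "\<And>n j. j \<le> n \<Longrightarrow> \<bar>\<integral>y. (V (Suc n) y - V n y) \<bullet> V j y \<partial>lborel\<bar> \<le> (1/2)^n"
proof -
  define Pr where "Pr s \<longleftrightarrow> (case s of (v, w, W) \<Rightarrow> pert (box a b) v w \<and> (\<forall>y. defect (v y) (u0 + w y) > 0) \<and>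
      finite W \<and> (\<forall>f\<in>W. continuous_on UNIV f))"
    for s :: "(spacetime \<Rightarrow> complex) \<times> (spacetime \<Rightarrow> complex) \<times> (spacetime \<Rightarrow> complex) set"
  define Qr where "Qr n s s' \<longleftrightarrow> (case s of (v, w, W) \<Rightarrow> case s' of (v', w', W') \<Rightarrow> W' = insert v W \<and>
     (\<integral>y. (cmod (v' y - v y))^2 \<partial>lborel)
         \<ge> wave_const / 1024 * (\<integral>y. indicator (cbox a b) y * (2 - (cmod (v y))^2)^2 \<partial>lborel) \<and>
     (\<forall>f\<in>W'. \<bar>\<integral>y. (v' y - v y) \<bullet> f y \<partial>lborel\<bar> \<le> (1/2)^n))"
    for n :: nat and s s' :: "(spacetime \<Rightarrow> complex) \<times> (spacetime \<Rightarrow> complex) \<times> (spacetime \<Rightarrow> complex) set"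
  have "\<exists>f. \<forall>n. Pr (f n) \<and> Qr n (f n) (f (Suc n))"
  proof (rule dependent_nat_choice)
    have "defect 0 u0 > 0" using u0 by (simp add: defect_def)
    then have "Pr (\<lambda>y. 0, \<lambda>y. 0, {})" by (simp add: Pr_def pert_zero)
    then show "\<exists>s. Pr s" by blast
  next
    fix s n assume "Pr s"
    then obtain v w W where s: "s = (v, w, W)" and p: "pert (box a b) v w" "\<And>y. defect (v y) (u0 + w y) > 0"
       "finite W" "\<And>f. f \<in> W \<Longrightarrow> continuous_on UNIV f" unfolding Pr_def by (cases s) auto
    have W': "finite (insert v W)" "\<And>f. f \<in> insert v W \<Longrightarrow> continuous_on UNIV f"
      using p pert_props(1)[OF p(1)] by auto
    have eps: "(1/2::real)^n > 0" by simp
    obtain v' w' where vw: "pert (box a b) v' w'" "\<And>y. defect (v' y) (u0 + w' y) > 0"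
      "(\<integral>y. (cmod (v' y - v y))^2 \<partial>lborel)
          \<ge> wave_const / 1024 * (\<integral>y. indicator (cbox a b) y * (2 - (cmod (v y))^2)^2 \<partial>lborel)"
      "\<And>f. f \<in> insert v W \<Longrightarrow> \<bar>\<integral>y. (v' y - v y) \<bullet> f y \<partial>lborel\<bar> \<le> (1/2)^n"
      by (rule perturbation_step[OF ne p(1,2) W' eps], assumption) (rule that; assumption)
    have "Pr (v', w', insert v W)" unfolding Pr_def using vw W' by auto
    moreover have "Qr n s (v', w', insert v W)" unfolding Qr_def s using vw by auto
    ultimately show "\<exists>s'. Pr s' \<and> Qr n s s'" by blast
  qed
  then obtain f where f: "\<And>n. Pr (f n)" "\<And>n. Qr n (f n) (f (Suc n))" by blast
  define V where "V n = fst (f n)" for n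
  define w where "w n = fst (snd (f n))" for n
  define W where "W n = snd (snd (f n))" for n
  have fn: "f n = (V n, w n, W n)" for n by (simp add: V_def w_def W_def)
  have W: "W (Suc n) = insert (V n) (W n)" for n using f(2)[of n] unfolding Qr_def fn by auto
  have Vin: "V j \<in> W (Suc n)" if "j \<le> n" for j n
    using that by (induction n) (auto simp: W le_Suc_eq)
  show ?thesis
  proof (rule that[of V w])
    show "pert (box a b) (V n) (w n)" "defect (V n y) (u0 + w n y) > 0" for n y
      using f(1)[of n] unfolding Pr_def fn prod.case by blast+
    show "(\<integral>y. (cmod (V (Suc n) y - V n y))^2 \<partial>lborel)
        \<ge> wave_const / 1024 * (\<integral>y. indicator (cbox a b) y * (2 - (cmod (V n y))^2)^2 \<partial>lborel)" for n
      using f(2)[of n] unfolding Qr_def fn by auto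
    show "\<bar>\<integral>y. (V (Suc n) y - V n y) \<bullet> V j y \<partial>lborel\<bar> \<le> (1/2)^n" if "j \<le> n" for n j
      using f(2)[of n] Vin[OF that] unfolding Qr_def fn by auto
  qed
qed

text \<open>Since each increment is almost orthogonal to the previous iterates, the energies add up; this
  replaces weak compactness.\<close>

lemma almost_orthogonal_Cauchy:
  fixes V :: "nat \<Rightarrow> spacetime \<Rightarrow> complex"
  assumes cV: "\<And>n. continuous_on UNIV (V n)" and out: "\<And>n y. y \<notin> cbox a b \<Longrightarrow> V n y = 0"
    and bd: "\<And>n y. (cmod (V n y))^2 \<le> 2"
    and orth: "\<And>n j. j \<le> n \<Longrightarrow> \<bar>\<integral>y. (V (Suc n) y - V n y) \<bullet> V j y \<partial>lborel\<bar> \<le> (1/2)^n"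
  shows "summable (\<lambda>n. \<integral>y. (cmod (V (Suc n) y - V n y))^2 \<partial>lborel)" (is "summable ?a")
    and "e > 0 \<Longrightarrow> \<exists>N. \<forall>i\<ge>N. \<forall>j\<ge>N. (\<integral>y. cmod (V i y - V j y) \<partial>lborel) < e"
proof -
  let ?Q = "cbox a b"
  define c where "c = measure lborel ?Q"
  have c0: "c \<ge> 0" by (simp add: c_def)
  have int2: "integrable lborel (\<lambda>y. f y \<bullet> g y)"
    if "continuous_on UNIV f" "continuous_on UNIV g" "\<And>y. y \<notin> ?Q \<Longrightarrow> f y = 0" for f g :: "spacetime \<Rightarrow> complex"
    by (rule integrable_continuous_support[where K="?Q"]) (use that in \<open>auto intro!: continuous_intros\<close>)
  have nsq: "(cmod z)^2 = z \<bullet> z" for z by (simp add: power2_norm_eq_inner)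
  have iind: "integrable lborel (\<lambda>y. indicator ?Q y :: real)"
    using emeasure_bounded_finite[OF bounded_cbox, of a b] by (auto intro!: integrable_real_indicator)
  define D where "D m n = (\<integral>y. (cmod (V n y - V m y))^2 \<partial>lborel)" for m n
  define E where "E n = (\<integral>y. (cmod (V n y))^2 \<partial>lborel)" for n
  define ip where "ip n j = (\<integral>y. (V (Suc n) y - V n y) \<bullet> V j y \<partial>lborel)" for n j
  have cd: "continuous_on UNIV (\<lambda>y. V n y - V m y)" for n m by (intro continuous_intros cV)
  have outd: "V n y - V m y = 0" if "y \<notin> ?Q" for n m y using out[OF that] by simp
  have Dstep: "D m (Suc n) = D m n + ?a n + 2 * (ip n n - ip n m)" for m n
  proof -
    have "(cmod (V (Suc n) y - V m y))^2 = (cmod (V n y - V m y))^2 + (cmod (V (Suc n) y - V n y))^2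
        + 2 * ((V (Suc n) y - V n y) \<bullet> V n y - (V (Suc n) y - V n y) \<bullet> V m y)" for y
      unfolding nsq by (simp add: inner_diff_left inner_diff_right inner_commute algebra_simps)
    then show ?thesis unfolding D_def ip_def nsq
      by (simp add: int2[OF cd cd outd] int2[OF cd cV outd])
  qed
  have Estep: "E (Suc n) = E n + ?a n + 2 * ip n n" for n
  proof -
    have "(cmod (V (Suc n) y))^2 = (cmod (V n y))^2 + (cmod (V (Suc n) y - V n y))^2
        + 2 * ((V (Suc n) y - V n y) \<bullet> V n y)" for y
      unfolding nsq by (simp add: inner_diff_left inner_diff_right inner_commute algebra_simps)
    then show ?thesis unfolding E_def ip_def nsq
      by (simp add: int2[OF cd cd outd] int2[OF cd cV outd] int2[OF cV cV out])
  qed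
  have a0: "?a n \<ge> 0" for n by simp
  have E0: "E n \<ge> 0" for n unfolding E_def by simp
  have Eb: "E n \<le> 2 * c" for n
  proof -
    have "E n \<le> (\<integral>y. 2 * indicator ?Q y \<partial>lborel)" unfolding E_def
    proof (rule integral_mono)
      show "integrable lborel (\<lambda>y. (cmod (V n y))^2)" unfolding nsq by (rule int2[OF cV cV out])
      show "integrable lborel (\<lambda>y. 2 * indicator ?Q y :: real)" using iind by simp
      show "(cmod (V n y))^2 \<le> 2 * indicator ?Q y" for y using bd[of n y] out[of y n] by (cases "y \<in> ?Q") auto
    qed
    then show ?thesis by (simp add: c_def)
  qed
  have geo: "(\<Sum>k<n. (1/2::real)^k) \<le> 2" for n
    using sum_le_suminf[OF summable_geometric[of "1/2::real"], of "{..<n}"] suminf_geometric[of "1/2::real"] by simp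
  have sb: "(\<Sum>k<n. ?a k) \<le> 2 * c + 4" for n
  proof -
    have "(\<Sum>k<n. ?a k) \<le> E n + 2 * (\<Sum>k<n. (1/2)^k)"
    proof (induction n)
      case 0 then show ?case using E0 by simp
    next
      case (Suc n)
      have "\<bar>ip n n\<bar> \<le> (1/2)^n" using orth[of n n] by (simp add: ip_def)
      then show ?case using Suc Estep[of n] by (simp add: algebra_simps abs_le_iff)
    qed
    then show ?thesis using Eb[of n] geo[of n] by linarith
  qed
  show summ: "summable ?a"
    by (rule summableI_nonneg_bounded[OF a0 sb])
  \<comment> \<open>A bound for the growth of \<open>D m\<close> at step \<open>n\<close>; the term
    4 (1/2)^n covers twice the two inner products.\<close>
  define b where "b n = ?a n + 4 * (1/2::real)^n" for n
  have summb: "summable b" unfolding b_def by (intro summable_add summ summable_mult summable_geometric) auto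
  have Db: "D m n \<le> (\<Sum>k=m..<n. b k)" if "m \<le> n" for m n
    using that
  proof (induction n rule: dec_induct)
    case base then show ?case by (simp add: D_def)
  next
    case (step n)
    have "\<bar>ip n n\<bar> \<le> (1/2)^n" "\<bar>ip n m\<bar> \<le> (1/2)^n" using orth[of n n] orth[of m n] step by (auto simp: ip_def)
    then show ?case using Dstep[of m n] step by (simp add: b_def abs_le_iff)
  qed
  show "\<exists>N. \<forall>i\<ge>N. \<forall>j\<ge>N. (\<integral>y. cmod (V i y - V j y) \<partial>lborel) < e" if e: "e > 0"
  proof -
    \<comment> \<open>For use in x \<le> s + x^2 / s: the constant part costs at most e/2 over the
      box, and the quadratic part is the small squared distance \<open>D\<close> divided by
      \<open>s\<close>.\<close>
    define s where "s = e / (2 * (c + 1))"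
    have s: "s > 0" using e c0 by (simp add: s_def)
    have "e * s / 2 > 0" using e s by simp
    then obtain N where N: "\<And>m n. m \<ge> N \<Longrightarrow> norm (\<Sum>k=m..<n. b k) < e * s / 2"
      using summb unfolding summable_Cauchy by blast
    have main: "(\<integral>y. cmod (V n y - V m y) \<partial>lborel) < e" if mn: "N \<le> m" "m \<le> n" for m n
    proof -
      have D: "D m n < e * s / 2" using Db[OF mn(2)] N[OF mn(1), of n] by simp
      have "(\<integral>y. cmod (V n y - V m y) \<partial>lborel) \<le> (\<integral>y. s * indicator ?Q y + (cmod (V n y - V m y))^2 / s \<partial>lborel)"
      proof (rule integral_mono)
        show "integrable lborel (\<lambda>y. cmod (V n y - V m y))"
          by (rule integrable_continuous_support[where K="?Q"]) (use cV out in \<open>auto intro!: continuous_intros\<close>)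
        have "integrable lborel (\<lambda>y. (cmod (V n y - V m y))^2)" unfolding nsq by (rule int2[OF cd cd outd])
        then show "integrable lborel (\<lambda>y. s * indicator ?Q y + (cmod (V n y - V m y))^2 / s)"
          using iind by simp
        fix y
        show "cmod (V n y - V m y) \<le> s * indicator ?Q y + (cmod (V n y - V m y))^2 / s"
        proof (cases "y \<in> ?Q")
          case False then show ?thesis using outd[of y n m] by simp
        next
          case True
          let ?x = "cmod (V n y - V m y)"
          have "?x \<le> s + ?x^2 / s"
          proof (cases "?x \<le> s")
            case True then show ?thesis using s by (simp add: add_increasing2)
          next
            case False
            then have "s * ?x \<le> ?x * ?x" by (intro mult_right_mono) auto
            then have "?x \<le> ?x^2 / s" using s by (simp add: field_simps power2_eq_square)
            then show ?thesis using s by linarith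
          qed
          then show ?thesis using True by simp
        qed
      qed
      also have "\<dots> = s * c + D m n / s"
        using iind int2[OF cd cd outd, of n m n m] by (simp add: c_def D_def nsq)
      also have "\<dots> < e"
      proof -
        have "D m n / s < e / 2" using D s by (simp add: field_simps)
        moreover have "s * c \<le> s * (c + 1)" using s by simp
        moreover have "s * (c + 1) = e / 2" using c0 by (simp add: s_def field_simps)
        ultimately show ?thesis by linarith
      qed
      finally show ?thesis .
    qed
    show ?thesis
    proof (intro exI allI impI)
      fix i j assume "N \<le> i" "N \<le> j"
      then show "(\<integral>y. cmod (V i y - V j y) \<partial>lborel) < e"
        using main[of j i] main[of i j] by (cases "j \<le> i") (auto simp: norm_minus_commute)
    qed
  qed
qed

text \<open>The energy increments are summable and dominate the integral of (2 - |V n|^2)^2, so the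
  limit satisfies |v|^2 = 2 almost everywhere. Positivity of the defect then squeezes
  \<open>u0 + w n\<close> towards v^2/2, which turns the linear system into the nonlinear one. The
  equations survive up to the faces of the box, so that solutions can be laid side by side.\<close>

lemma box_solution:
  fixes a b :: spacetime
  assumes ne: "box a b \<noteq> {}" and u0: "cmod u0 < 1"
  obtains v where "v \<in> borel_measurable borel" "AE y in lborel. y \<in> box a b \<longrightarrow> (cmod (v y))^2 = 2"
    "\<And>S \<phi> G. open S \<Longrightarrow> cbox a b \<subseteq> S \<Longrightarrow> C1_on S \<phi> G \<Longrightarrow>
      (\<integral>y. indicator (box a b) y *\<^sub>R (v y \<bullet> cgrad (G y)) \<partial>lborel) = 0 \<and>
      (\<integral>y. indicator (box a b) y *\<^sub>R (of_real (fst (G y)) * v y + (v y ^ 2 / 2 - u0) * cnj (cgrad (G y))) \<partial>lborel)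
          = 0"
proof -
  let ?B = "box a b" and ?Q = "cbox a b"
  obtain V w where p: "\<And>n. pert ?B (V n) (w n)" and d: "\<And>n y. defect (V n y) (u0 + w n y) > 0"
    and en: "\<And>n. (\<integral>y. (cmod (V (Suc n) y - V n y))^2 \<partial>lborel)
        \<ge> wave_const / 1024 * (\<integral>y. indicator ?Q y * (2 - (cmod (V n y))^2)^2 \<partial>lborel)"
    and orth: "\<And>n j. j \<le> n \<Longrightarrow> \<bar>\<integral>y. (V (Suc n) y - V n y) \<bullet> V j y \<partial>lborel\<bar> \<le> (1/2)^n"
    by (rule iterate_perturbations[OF ne u0]) (rule that; assumption)
  have cV: "continuous_on UNIV (V n)" and cw: "continuous_on UNIV (w n)" for n using pert_props[OF p] by auto
  have outB: "V n y = 0" "w n y = 0" if "y \<notin> ?B" for n y using pert_props(3,4)[OF p that] by auto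
  have out: "V n y = 0" if "y \<notin> ?Q" for n y using outB that box_subset_cbox by blast
  have Vm[measurable]: "V n \<in> borel_measurable borel" for n using cV by (rule borel_measurable_continuous_onI)
  note db = defect_pos_bounds[OF d]
  have summ: "summable (\<lambda>n. \<integral>y. (cmod (V (Suc n) y - V n y))^2 \<partial>lborel)"
    and Cau: "e > 0 \<Longrightarrow> \<exists>N. \<forall>i\<ge>N. \<forall>j\<ge>N. (\<integral>y. cmod (V i y - V j y) \<partial>lborel) < e" for e
    by (rule almost_orthogonal_Cauchy[of V a b, OF cV out less_imp_le[OF db(1)] orth]; assumption)+
  have Vint: "integrable lborel (V n)" for n
    by (rule integrable_continuous_support[OF cV, of ?Q]) (use out in auto)
  \<comment> \<open>Pointwise convergence along a subsequence is what allows the limit in the square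
    of the velocity.\<close>
  obtain r where r: "strict_mono r" "AE y in lborel. Cauchy (\<lambda>i. V (r i) y)"
    by (rule cauchy_L1_AE_cauchy_subseq[OF Vint Cau], assumption) (rule that; assumption)
  define v where "v y = lim (\<lambda>i. V (r i) y)" for y
  have vm[measurable]: "v \<in> borel_measurable borel" unfolding v_def[abs_def] by measurable
  have lim: "AE y in lborel. (\<lambda>i. V (r i) y) \<longlonglongrightarrow> v y"
    using r(2)
  proof eventually_elim
    case (elim y)
    then show ?case unfolding v_def by (simp add: Cauchy_convergent_iff convergent_LIMSEQ_iff)
  qed
  define iQ where "iQ = (\<lambda>y. indicator ?Q y :: real)"
  have iind: "integrable lborel iQ" unfolding iQ_def
    using emeasure_bounded_finite[OF bounded_cbox, of a b] by (auto intro!: integrable_real_indicator)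
  have iQm[measurable]: "iQ \<in> borel_measurable borel" unfolding iQ_def by measurable
  have tau0: "(\<integral>y. iQ y * (2 - (cmod (v y))^2)^2 \<partial>lborel) = 0"
  proof (rule LIMSEQ_unique)
    show "(\<lambda>n. \<integral>y. iQ y * (2 - (cmod (V (r n) y))^2)^2 \<partial>lborel) \<longlonglongrightarrow> (\<integral>y. iQ y * (2 - (cmod (v y))^2)^2 \<partial>lborel)"
    proof (rule integral_dominated_convergence[where w="\<lambda>y. 4 * iQ y"])
      show "integrable lborel (\<lambda>y. 4 * iQ y)" using iind by simp
      show "AE y in lborel. (\<lambda>n. iQ y * (2 - (cmod (V (r n) y))^2)^2) \<longlonglongrightarrow> iQ y * (2 - (cmod (v y))^2)^2"
        using lim by eventually_elim (intro tendsto_intros)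
      have "norm (iQ y * (2 - (cmod (V (r n) y))^2)^2) \<le> 4 * iQ y" for y n
      proof -
        have "(2 - (cmod (V (r n) y))^2)^2 \<le> 2^2" using db(1)[of "r n" y] by (intro power_mono) auto
        then show ?thesis by (auto simp: iQ_def indicator_def)
      qed
      then show "AE y in lborel. norm (iQ y * (2 - (cmod (V (r n) y))^2)^2) \<le> 4 * iQ y" for n by simp
    qed measurable
    let ?t = "\<lambda>n. \<integral>y. iQ y * (2 - (cmod (V n y))^2)^2 \<partial>lborel"
    have wc: "wave_const > 0" by (simp add: wave_const_def)
    have "(\<lambda>n. 1024 / wave_const * (\<integral>y. (cmod (V (Suc n) y - V n y))^2 \<partial>lborel)) \<longlonglongrightarrow> 1024 / wave_const * 0"
      by (intro tendsto_intros summable_LIMSEQ_zero[OF summ])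
    moreover have "?t n \<le> 1024 / wave_const * (\<integral>y. (cmod (V (Suc n) y - V n y))^2 \<partial>lborel)" for n
      using en[of n] wc by (simp add: field_simps iQ_def)
    moreover have "0 \<le> ?t n" for n by (auto simp: iQ_def intro!: integral_nonneg_AE)
    ultimately have "?t \<longlonglongrightarrow> 0"
      by (intro real_tendsto_sandwich[of "\<lambda>n. 0" ?t _
          "\<lambda>n. 1024 / wave_const * (\<integral>y. (cmod (V (Suc n) y - V n y))^2 \<partial>lborel)"]) auto
    then show "(\<lambda>n. ?t (r n)) \<longlonglongrightarrow> 0" using r(1) LIMSEQ_subseq_LIMSEQ[of ?t 0 r] by (simp add: o_def)
  qed
  have vb: "AE y in lborel. (cmod (v y))^2 \<le> 2"
    using lim
  proof eventually_elim
    case (elim y)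
    have "(\<lambda>n. (cmod (V (r n) y))^2) \<longlonglongrightarrow> (cmod (v y))^2" by (intro tendsto_intros elim)
    then show ?case by (rule LIMSEQ_le_const2) (use db(1) less_imp_le in blast)
  qed
  have "integrable lborel (\<lambda>y. iQ y * (2 - (cmod (v y))^2)^2)"
  proof (rule Bochner_Integration.integrable_bound[where f="\<lambda>y. 4 * iQ y"])
    show "AE y in lborel. norm (iQ y * (2 - (cmod (v y))^2)^2) \<le> norm (4 * iQ y)"
      using vb
    proof eventually_elim
      case (elim y)
      then have "(2 - (cmod (v y))^2)^2 \<le> 2^2" by (intro power_mono) auto
      then show ?case by (auto simp: iQ_def indicator_def)
    qed
  qed (use iind in auto)
  then have "AE y in lborel. iQ y * (2 - (cmod (v y))^2)^2 = 0"
    using tau0 by (subst (asm) integral_nonneg_eq_0_iff_AE) (auto simp: iQ_def)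
  then have v2: "AE y in lborel. y \<in> ?B \<longrightarrow> (cmod (v y))^2 = 2"
  proof eventually_elim
    case (elim y)
    then show ?case using box_subset_cbox[of a b] by (auto simp: iQ_def indicator_def split: if_splits)
  qed
  show ?thesis
  proof (rule that[of v])
    show "v \<in> borel_measurable borel" by (rule vm)
    show "AE y in lborel. y \<in> ?B \<longrightarrow> (cmod (v y))^2 = 2" by (rule v2)
    fix S \<phi> G assume S: "open S" "?Q \<subseteq> S" and C: "C1_on S \<phi> G"
    have S': "closure ?B \<subseteq> S" using S(2) closure_minimal[OF box_subset_cbox closed_cbox, of a b] by blast
    have cG: "continuous_on ?Q G" using C S(2) unfolding C1_on_def by (meson continuous_on_subset)
    have "compact (G ` ?Q)" by (intro compact_continuous_image cG compact_cbox)
    then obtain M where M: "\<And>y. y \<in> ?Q \<Longrightarrow> norm (G y) \<le> M"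
      using compact_imp_bounded[of "G ` ?Q"] unfolding bounded_iff by fastforce
    define M' where "M' = max M 0"
    have Mf: "\<bar>fst (G y)\<bar> \<le> M'" "cmod (cgrad (G y)) \<le> 2 * M'" if "y \<in> ?B" for y
    proof -
      have yQ: "y \<in> ?Q" using that box_subset_cbox by blast
      have n: "norm (fst (G y)) \<le> norm (G y)" "norm (snd (G y)) \<le> norm (G y)"
        using norm_fst_le[of "fst (G y)" "snd (G y)"] norm_snd_le[of "snd (G y)" "fst (G y)"] by auto
      then show "\<bar>fst (G y)\<bar> \<le> M'" using M[OF yQ] by (simp add: M'_def)
      have "cmod (cgrad (G y)) \<le> \<bar>snd (G y) $ 1\<bar> + \<bar>snd (G y) $ 2\<bar>"
        using cmod_le[of "cgrad (G y)"] by (simp add: cgrad_def)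
      also have "\<dots> \<le> 2 * norm (snd (G y))"
        using component_le_norm_cart[of "snd (G y)" 1] component_le_norm_cart[of "snd (G y)" 2] by simp
      finally show "cmod (cgrad (G y)) \<le> 2 * M'" using n M[OF yQ] by (simp add: M'_def)
    qed
    have cGB: "continuous_on ?B (\<lambda>y. fst (G y))" "continuous_on ?B (\<lambda>y. cgrad (G y))"
      by (intro continuous_on_fst cgrad_cont continuous_on_subset[OF cG box_subset_cbox])+
    define gt where "gt y = indicator ?B y *\<^sub>R fst (G y)" for y
    define gx where "gx y = indicator ?B y *\<^sub>R cgrad (G y)" for y
    have gm[measurable]: "gt \<in> borel_measurable borel" "gx \<in> borel_measurable borel"
      unfolding gt_def gx_def by (intro borel_measurable_continuous_on_indicator cGB; simp)+
    have gcm[measurable]: "(\<lambda>y. cnj (gx y)) \<in> borel_measurable borel"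
      by (rule measurable_compose[OF gm(2) borel_measurable_continuous_onI]) (intro continuous_intros)
    have gb: "\<bar>gt y\<bar> \<le> M' * iQ y" "cmod (gx y) \<le> 2 * M' * iQ y" for y
      using Mf[of y] box_subset_cbox[of a b] unfolding gt_def gx_def iQ_def
      by (auto simp: indicator_def M'_def)
    have wm[measurable]: "w n \<in> borel_measurable borel" for n using cw by (rule borel_measurable_continuous_onI)
    have Vb: "cmod (V n y) \<le> 2" and wb: "cmod (w n y) \<le> 3" for n y
    proof -
      show "cmod (V n y) \<le> 2" using db(2)[of n y] by simp
      show "cmod (w n y) \<le> 3" using db(3)[of n y] u0 norm_triangle_ineq4[of "u0 + w n y" u0] by simp
    qed
    have 1: "(\<lambda>n. \<integral>y. V (r n) y \<bullet> gx y \<partial>lborel) \<longlonglongrightarrow> (\<integral>y. v y \<bullet> gx y \<partial>lborel)"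
    proof (rule integral_dominated_convergence[where w="\<lambda>y. 4 * M' * iQ y"])
      show "integrable lborel (\<lambda>y. 4 * M' * iQ y)" using iind by simp
      show "AE y in lborel. (\<lambda>n. V (r n) y \<bullet> gx y) \<longlonglongrightarrow> v y \<bullet> gx y"
        using lim by eventually_elim (intro tendsto_intros)
      have "norm (V n y \<bullet> gx y) \<le> 4 * M' * iQ y" for n y
      proof -
        have "norm (V n y \<bullet> gx y) \<le> cmod (V n y) * cmod (gx y)" using Cauchy_Schwarz_ineq2 by simp
        also have "\<dots> \<le> 2 * (2 * M' * iQ y)" by (intro mult_mono Vb gb) auto
        finally show ?thesis by simp
      qed
      then show "AE y in lborel. norm (V (r n) y \<bullet> gx y) \<le> 4 * M' * iQ y" for n by simp
    qed measurable
    have "V n y \<bullet> gx y = V n y \<bullet> cgrad (G y)" for n y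
      using outB(1)[of y n] by (cases "y \<in> ?B") (auto simp: gx_def)
    then have "(\<integral>y. V (r n) y \<bullet> gx y \<partial>lborel) = 0" for n using pert_props(5)[OF p S(1) S' C] by simp
    with 1 have "(\<integral>y. v y \<bullet> gx y \<partial>lborel) = 0" by (simp add: LIMSEQ_const_iff)
    moreover have "v y \<bullet> gx y = indicator ?B y *\<^sub>R (v y \<bullet> cgrad (G y))" for y by (simp add: gx_def)
    ultimately have A: "(\<integral>y. indicator ?B y *\<^sub>R (v y \<bullet> cgrad (G y)) \<partial>lborel) = 0" by simp
    have 2: "(\<lambda>n. \<integral>y. of_real (gt y) * V (r n) y + w (r n) y * cnj (gx y) \<partial>lborel)
       \<longlonglongrightarrow> (\<integral>y. of_real (gt y) * v y + (v y^2/2 - u0) * cnj (gx y) \<partial>lborel)"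
    proof (rule integral_dominated_convergence[where w="\<lambda>y. 8 * M' * iQ y"])
      show "integrable lborel (\<lambda>y. 8 * M' * iQ y)" using iind by simp
      show "AE y in lborel. (\<lambda>n. of_real (gt y) * V (r n) y + w (r n) y * cnj (gx y)) \<longlonglongrightarrow> of_real (gt y) * v y
          + (v y^2/2 - u0) * cnj (gx y)"
        using lim v2
      proof eventually_elim
        case (elim y)
        show ?case
        proof (cases "y \<in> ?B")
          case False then show ?thesis by (simp add: gt_def gx_def)
        next
          case True
          then have v2: "(cmod (v y))^2 = 2" using elim by simp
          have "(\<lambda>n. 1 - (cmod (V (r n) y))^2/2) \<longlonglongrightarrow> 1 - (cmod (v y))^2/2" by (intro tendsto_intros elim) auto
          then have z: "(\<lambda>n. 1 - (cmod (V (r n) y))^2/2) \<longlonglongrightarrow> 0" using v2 by simp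
          have "cmod (u0 + w (r n) y - (V (r n) y)^2/2) \<le> 1 - (cmod (V (r n) y))^2/2" for n
            using d[of "r n" y] unfolding defect_def by simp
          then have "(\<lambda>n. u0 + w (r n) y - (V (r n) y)^2/2) \<longlonglongrightarrow> 0"
            by (intro Lim_null_comparison[OF _ z]) auto
          moreover have "(\<lambda>n. (V (r n) y)^2/2 - u0) \<longlonglongrightarrow> (v y)^2/2 - u0" by (intro tendsto_intros elim) auto
          ultimately have "(\<lambda>n. (u0 + w (r n) y - (V (r n) y)^2/2) + ((V (r n) y)^2/2 - u0)) \<longlonglongrightarrow> 0 + ((v y)^2/2 - u0)"
            by (rule tendsto_add)
          then have "(\<lambda>n. w (r n) y) \<longlonglongrightarrow> (v y)^2/2 - u0" by simp
          then show ?thesis by (intro tendsto_intros elim)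
        qed
      qed
      have "cmod (of_real (gt y) * V n y + w n y * cnj (gx y)) \<le> 8 * M' * iQ y" for n y
      proof -
        have "cmod (of_real (gt y) * V n y + w n y * cnj (gx y)) \<le> \<bar>gt y\<bar> * cmod (V n y) + cmod (w n y) * cmod (gx y)"
          using norm_triangle_ineq[of "of_real (gt y) * V n y" "w n y * cnj (gx y)"] by (simp add: norm_mult)
        also have "\<dots> \<le> (M' * iQ y) * 2 + 3 * (2 * M' * iQ y)"
          by (intro add_mono mult_mono gb Vb wb) (auto simp: M'_def iQ_def)
        finally show ?thesis by simp
      qed
      then show "AE y in lborel. norm (of_real (gt y) * V (r n) y + w (r n) y * cnj (gx y)) \<le> 8 * M' * iQ y" for n
          by simp
    qed measurable
    have "of_real (gt y) * V n y + w n y * cnj (gx y) = of_real (fst (G y)) * V n y + w n y * cnj (cgrad (G y))"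
        for n y
      using outB[of y n] by (cases "y \<in> ?B") (auto simp: gx_def gt_def)
    then have "(\<integral>y. of_real (gt y) * V (r n) y + w (r n) y * cnj (gx y) \<partial>lborel) = 0" for n
      using pert_props(6)[OF p S(1) S' C] by simp
    with 2 have "(\<integral>y. of_real (gt y) * v y + (v y^2/2 - u0) * cnj (gx y) \<partial>lborel) = 0" by (simp add: LIMSEQ_const_iff)
    moreover have "of_real (gt y) * v y + (v y^2/2 - u0) * cnj (gx y)
        = indicator ?B y *\<^sub>R (of_real (fst (G y)) * v y + (v y ^ 2 / 2 - u0) * cnj (cgrad (G y)))" for y
      by (auto simp: gt_def gx_def indicator_def)
    ultimately show "(\<integral>y. indicator ?B y *\<^sub>R (v y \<bullet> cgrad (G y)) \<partial>lborel) = 0 \<and>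
      (\<integral>y. indicator ?B y *\<^sub>R (of_real (fst (G y)) * v y + (v y ^ 2 / 2 - u0) * cnj (cgrad (G y))) \<partial>lborel) = 0"
      using A by simp
  qed
qed

section \<open>From boxes to an open set\<close>

lemma negligible_hyperplane_coordinate: "negligible {z :: spacetime. snd z $ i = c}"
proof -
  have "(0, axis i 1) \<in> (Basis :: spacetime set)" by (simp add: Basis_prod_def)
  from negligible_standard_hyperplane[OF this, of c] show ?thesis by (simp add: inner_prod_def inner_axis)
qed

text \<open>The covering lemma works in a bounded box, so \<open>\<Omega>\<close> is first cut into
  unit slabs in x1, the direction in which the turbulent zone is unbounded. Only slab walls and box
  faces are lost, which are null sets.\<close>

lemma open_box_tiling:
  fixes \<Omega> :: "spacetime set"
  assumes op: "open \<Omega>" and bd: "\<And>m::int. bounded {z \<in> \<Omega>. real_of_int m < snd z $ 1 \<and> snd z $ 1 < real_of_int m + 1}"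
  obtains \<D> where "countable \<D>" "\<And>K. K \<in> \<D> \<Longrightarrow> \<exists>a b. K = cbox a b \<and> box a b \<noteq> {}"
    "\<And>K. K \<in> \<D> \<Longrightarrow> K \<subseteq> \<Omega>" "\<And>K L. K \<in> \<D> \<Longrightarrow> L \<in> \<D> \<Longrightarrow> K \<noteq> L \<Longrightarrow> interior K \<inter> interior L = {}"
    "negligible (\<Omega> - (\<Union>K\<in>\<D>. interior K))"
proof -
  define O' where "O' m = {z \<in> \<Omega>. real_of_int m < snd z $ 1 \<and> snd z $ 1 < real_of_int m + 1}" for m :: int
  have opO: "open (O' m)" for m
  proof -
    have "open ({z :: spacetime. real_of_int m < snd z $ 1} \<inter> {z. snd z $ 1 < real_of_int m + 1})"
      by (intro open_Int open_Collect_less continuous_intros)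
    moreover have "O' m = \<Omega> \<inter> ({z. real_of_int m < snd z $ 1} \<inter> {z. snd z $ 1 < real_of_int m + 1})"
      by (auto simp: O'_def)
    ultimately show ?thesis using op by auto
  qed
  have ex: "\<exists>D. countable D \<and> (\<forall>K\<in>D. \<exists>a b. K = cbox a b \<and> box a b \<noteq> {}) \<and> (\<forall>K\<in>D. K \<subseteq> O' m) \<and>
     pairwise (\<lambda>A B. interior A \<inter> interior B = {}) D \<and> O' m \<subseteq> \<Union>D" for m
  proof -
    show ?thesis
    proof (cases "O' m = {}")
      case True
      then show ?thesis by (intro exI[of _ "{}"]) auto
    next
    case False
    obtain c where "O' m \<subseteq> box (- c) c"
      using bounded_subset_box_symmetric bd[of m] unfolding O'_def by blast
    then have c: "O' m \<subseteq> cbox (- c) c" and ne: "box (- c) c \<noteq> {}"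
      using box_subset_cbox[of "-c" c] False by blast+
    \<comment> \<open>With this gauge a box tagged at a point of the slab piece has to lie inside
      the piece.\<close>
    define g where "g x = (if x \<in> O' m then O' m else UNIV)" for x :: spacetime
    have "gauge g" unfolding gauge_def g_def using opO by auto
    from covering_lemma[OF c ne this] obtain D where D: "countable D" 
      "\<And>K. K \<in> D \<Longrightarrow> interior K \<noteq> {} \<and> (\<exists>c d. K = cbox c d)"
      "pairwise (\<lambda>A B. interior A \<inter> interior B = {}) D"
      "\<And>K. K \<in> D \<Longrightarrow> \<exists>x \<in> O' m \<inter> K. K \<subseteq> g x" "O' m \<subseteq> \<Union>D" by metis
    show ?thesis
    proof (intro exI[of _ D] conjI ballI D)
      fix K assume K: "K \<in> D"
      show "\<exists>a b. K = cbox a b \<and> box a b \<noteq> {}" using D(2)[OF K] by auto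
      show "K \<subseteq> O' m" using D(4)[OF K] unfolding g_def by auto
    qed
    qed
  qed
  then obtain DD where DD: "\<And>m. countable (DD m)" "\<And>m K. K \<in> DD m \<Longrightarrow> \<exists>a b. K = cbox a b \<and> box a b \<noteq> {}"
    "\<And>m K. K \<in> DD m \<Longrightarrow> K \<subseteq> O' m" "\<And>m. pairwise (\<lambda>A B. interior A \<inter> interior B = {}) (DD m)"
    "\<And>m. O' m \<subseteq> \<Union>(DD m)" by metis
  define D where "D = (\<Union>m. DD m)"
  have disjO: "O' m \<inter> O' n = {}" if "m \<noteq> n" for m n
  proof (rule ccontr)
    assume "O' m \<inter> O' n \<noteq> {}"
    then obtain z where "z \<in> O' m" "z \<in> O' n" by blast
    then have "real_of_int m < snd z $ 1" "snd z $ 1 < real_of_int m + 1"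
      "real_of_int n < snd z $ 1" "snd z $ 1 < real_of_int n + 1" unfolding O'_def by auto
    then have "real_of_int m < real_of_int (n + 1)" "real_of_int n < real_of_int (m + 1)" by auto
    then have "m < n + 1" "n < m + 1" by (simp_all only: of_int_less_iff)
    then show False using that by simp
  qed
  show ?thesis
  proof (rule that[of D])
    show cD: "countable D" unfolding D_def using DD(1) by auto
    show "\<exists>a b. K = cbox a b \<and> box a b \<noteq> {}" if "K \<in> D" for K using that DD(2) unfolding D_def by blast
    show "K \<subseteq> \<Omega>" if "K \<in> D" for K
    proof -
      obtain m where "K \<in> DD m" using \<open>K \<in> D\<close> unfolding D_def by blast
      then show ?thesis using DD(3)[of K m] unfolding O'_def by blast
    qed
    show "interior K \<inter> interior L = {}" if KL: "K \<in> D" "L \<in> D" "K \<noteq> L" for K L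
    proof -
      obtain m n where mn: "K \<in> DD m" "L \<in> DD n" using KL unfolding D_def by blast
      show ?thesis
      proof (cases "m = n")
        case True then show ?thesis using DD(4)[of m] mn KL(3) unfolding pairwise_def by blast
      next
        case False
        then show ?thesis using disjO[OF False] DD(3)[OF mn(1)] DD(3)[OF mn(2)] interior_subset by blast
      qed
    qed
    have "negligible ((\<Union>m::int. {z::spacetime. snd z $ 1 = real_of_int m}) \<union> (\<Union>K\<in>D. frontier K))"
    proof (intro negligible_Un)
      show "negligible (\<Union>m::int. {z::spacetime. snd z $ 1 = real_of_int m})"
        by (intro negligible_countable_Union) (auto intro: negligible_hyperplane_coordinate)
      have "negligible (frontier K)" if "K \<in> D" for K
      proof -
        obtain m where "K \<in> DD m" using \<open>K \<in> D\<close> unfolding D_def by blast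
        then obtain a b where "K = cbox a b" using DD(2) by blast
        then show ?thesis using negligible_convex_frontier[OF convex_box(1)] by simp
      qed
      then show "negligible (\<Union>K\<in>D. frontier K)"
        by (intro negligible_countable_Union) (use cD in auto)
    qed
    then show "negligible (\<Omega> - (\<Union>K\<in>D. interior K))"
    proof (rule negligible_subset)
      show "\<Omega> - (\<Union>K\<in>D. interior K) \<subseteq> (\<Union>m::int. {z::spacetime. snd z $ 1 = real_of_int m}) \<union> (\<Union>K\<in>D. frontier K)"
      proof
        fix z assume z: "z \<in> \<Omega> - (\<Union>K\<in>D. interior K)"
        show "z \<in> (\<Union>m::int. {z::spacetime. snd z $ 1 = real_of_int m}) \<union> (\<Union>K\<in>D. frontier K)"
        proof (cases "snd z $ 1 = real_of_int \<lfloor>snd z $ 1\<rfloor>")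
          case True then show ?thesis by blast
        next
          case False
          then have "real_of_int \<lfloor>snd z $ 1\<rfloor> < snd z $ 1" "snd z $ 1 < real_of_int \<lfloor>snd z $ 1\<rfloor> + 1"
            by linarith+
          then have "z \<in> O' \<lfloor>snd z $ 1\<rfloor>" using z unfolding O'_def by simp
          then obtain K where K: "K \<in> DD \<lfloor>snd z $ 1\<rfloor>" "z \<in> K" using DD(5) by blast
          then have "K \<in> D" "z \<in> frontier K" using z closure_subset unfolding D_def frontier_def by blast+
          then show ?thesis by blast
        qed
      qed
    qed
  qed
qed

text \<open>Each closed tile lies in \<open>S\<close>, so its box solution pairs to zero with
  \<open>G\<close> even if \<open>G\<close> is nonzero on the faces; countable additivity sums these
  zeros. Hence test functions may be nonzero on the boundary of \<open>\<Omega>\<close>, and only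
  averages of the velocity are felt there.\<close>

lemma open_set_solution:
  fixes \<Omega> :: "spacetime set"
  assumes op: "open \<Omega>" and bd: "\<And>m::int. bounded {z \<in> \<Omega>. real_of_int m < snd z $ 1 \<and> snd z $ 1 < real_of_int m + 1}"
    and u0: "cmod u0 < 1"
  obtains v where "v \<in> borel_measurable borel" "\<And>y. (cmod (v y))^2 = 2"
    "\<And>S \<phi> G. open S \<Longrightarrow> \<Omega> \<subseteq> S \<Longrightarrow> C1_on S \<phi> G \<Longrightarrow> integrable lborel (\<lambda>y. indicator \<Omega> y * norm (G y)) \<Longrightarrow>
      (\<integral>y. indicator \<Omega> y *\<^sub>R (v y \<bullet> cgrad (G y)) \<partial>lborel) = 0 \<and>
      (\<integral>y. indicator \<Omega> y *\<^sub>R (of_real (fst (G y)) * v y + (v y ^ 2 / 2 - u0) * cnj (cgrad (G y))) \<partial>lborel) = 0"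
proof -
  obtain D where D: "countable D" "\<And>K. K \<in> D \<Longrightarrow> \<exists>a b. K = cbox a b \<and> box a b \<noteq> {}"
    "\<And>K. K \<in> D \<Longrightarrow> K \<subseteq> \<Omega>" "\<And>K L. K \<in> D \<Longrightarrow> L \<in> D \<Longrightarrow> K \<noteq> L \<Longrightarrow> interior K \<inter> interior L = {}"
    "negligible (\<Omega> - (\<Union>K\<in>D. interior K))"
    by (rule open_box_tiling[OF op bd]) (rule that; assumption)
  define Sol where "Sol K v \<longleftrightarrow> v \<in> borel_measurable borel \<and> (AE y in lborel. y \<in> interior K \<longrightarrow> (cmod (v y))^2 = 2) \<and>
    (\<forall>S \<phi> G. open S \<longrightarrow> K \<subseteq> S \<longrightarrow> C1_on S \<phi> G \<longrightarrow>
      (\<integral>y. indicator (interior K) y *\<^sub>R (v y \<bullet> cgrad (G y)) \<partial>lborel) = 0 \<and>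
      (\<integral>y. indicator (interior K) y *\<^sub>R (of_real (fst (G y)) * v y + (v y ^ 2 / 2 - u0) * cnj (cgrad (G y))) \<partial>lborel)
          = 0)"
    for K v
  have "\<exists>v. Sol K v" if KD: "K \<in> D" for K
  proof -
    obtain a b where K: "K = cbox a b" "box a b \<noteq> {}" using D(2)[OF KD] by blast
    obtain v where v: "v \<in> borel_measurable borel" "AE y in lborel. y \<in> box a b \<longrightarrow> (cmod (v y))^2 = 2"
    "\<And>S \<phi> G. open S \<Longrightarrow> cbox a b \<subseteq> S \<Longrightarrow> C1_on S \<phi> G \<Longrightarrow>
      (\<integral>y. indicator (box a b) y *\<^sub>R (v y \<bullet> cgrad (G y)) \<partial>lborel) = 0 \<and>
      (\<integral>y. indicator (box a b) y *\<^sub>R (of_real (fst (G y)) * v y + (v y ^ 2 / 2 - u0) * cnj (cgrad (G y))) \<partial>lborel)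
          = 0"
      by (rule box_solution[OF K(2) u0]) (rule that; assumption)
    show ?thesis unfolding Sol_def K(1) interior_cbox using v by (intro exI[of _ v]) simp
  qed
  then obtain vK where Sol: "\<And>K. K \<in> D \<Longrightarrow> Sol K (vK K)" by metis
  have vK: "vK K \<in> borel_measurable borel" "AE y in lborel. y \<in> interior K \<longrightarrow> (cmod (vK K y))^2 = 2"
    if "K \<in> D" for K using Sol[OF that] unfolding Sol_def by blast+
  have vK3: "(\<integral>y. indicator (interior K) y *\<^sub>R (vK K y \<bullet> cgrad (G y)) \<partial>lborel) = 0"
      "(\<integral>y. indicator (interior K) y *\<^sub>R (of_real (fst (G y)) * vK K y
          + (vK K y ^ 2 / 2 - u0) * cnj (cgrad (G y))) \<partial>lborel) = 0"
    if "K \<in> D" "open S" "K \<subseteq> S" "C1_on S \<phi> G" for K S \<phi> G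
    using Sol[OF that(1)] that(2-4) unfolding Sol_def by blast+
  \<comment> \<open>An enumeration of the tiles; indices that belong to no tile get the empty
    set.\<close>
  define A where "A i = (if i \<in> to_nat_on D ` D then interior (from_nat_into D i) else {})" for i
  define w where "w i = (if i \<in> to_nat_on D ` D then vK (from_nat_into D i) else (\<lambda>y. 0))" for i
  have fromD: "from_nat_into D i \<in> D" if "i \<in> to_nat_on D ` D" for i
    using that D(1) by auto
  have opA: "open (A i)" for i by (simp add: A_def)
  have Am[measurable]: "A i \<in> sets borel" for i using opA by auto
  have wm[measurable]: "w i \<in> borel_measurable borel" for i
    unfolding w_def using vK(1) fromD by auto
  have UA: "(\<Union>i. A i) = (\<Union>K\<in>D. interior K)"
  proof
    show "(\<Union>i. A i) \<subseteq> (\<Union>K\<in>D. interior K)" unfolding A_def using fromD by (auto split: if_splits)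
    have "interior K = A (to_nat_on D K)" if "K \<in> D" for K using that D(1) by (simp add: A_def)
    then show "(\<Union>K\<in>D. interior K) \<subseteq> (\<Union>i. A i)" by blast
  qed
  have disj: "A i \<inter> A j = {}" if "i \<noteq> j" for i j
  proof (cases "i \<in> to_nat_on D ` D \<and> j \<in> to_nat_on D ` D")
    case True
    then have "from_nat_into D i \<noteq> from_nat_into D j"
      using that D(1) by (metis imageE from_nat_into_to_nat_on)
    then show ?thesis using D(4) fromD True by (simp add: A_def)
  qed (auto simp: A_def)
  have subA: "A i \<subseteq> \<Omega>" for i
  proof (cases "i \<in> to_nat_on D ` D")
    case True
    then show ?thesis
      using D(3)[OF fromD[OF True]] interior_subset[of "from_nat_into D i"] by (simp add: A_def)
  qed (simp add: A_def)
  define s where "s y = (\<Sum>i. indicator (A i) y *\<^sub>R w i y)" for y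
  have part: "s y = w i y" if "y \<in> A i" for i y
  proof -
    have "indicator (A j) y *\<^sub>R w j y = 0" if "j \<notin> {i}" for j
      using disj[of i j] \<open>y \<in> A i\<close> that by (auto simp: indicator_def)
    then have "s y = (\<Sum>j\<in>{i}. indicator (A j) y *\<^sub>R w j y)"
      unfolding s_def by (intro suminf_finite) auto
    then show ?thesis using \<open>y \<in> A i\<close> by simp
  qed
  have sm[measurable]: "s \<in> borel_measurable borel"
  proof (rule borel_measurable_LIMSEQ_metric[where f="\<lambda>n y. \<Sum>i<n. indicator (A i) y *\<^sub>R w i y"])
    fix y
    have "summable (\<lambda>i. indicator (A i) y *\<^sub>R w i y)"
    proof (cases "\<exists>i. y \<in> A i")
      case True
      then obtain i where i: "y \<in> A i" by blast
      have "indicator (A j) y *\<^sub>R w j y = 0" if "j \<notin> {i}" for j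
        using disj[of i j] i that by (auto simp: indicator_def)
      then show ?thesis by (intro summable_finite[of "{i}"]) auto
    next
      case False then show ?thesis by (simp add: indicator_def)
    qed
    then show "(\<lambda>n. \<Sum>i<n. indicator (A i) y *\<^sub>R w i y) \<longlonglongrightarrow> s y"
      unfolding s_def by (rule summable_LIMSEQ)
  qed measurable
  \<comment> \<open>Changed on a null set, so that |v|^2 = 2 holds at every point and the turbulent
    field takes all its values in a compact set.\<close>
  define v where "v y = (if (cmod (s y))^2 = 2 then s y else of_real (sqrt 2))" for y
  have vm[measurable]: "v \<in> borel_measurable borel" unfolding v_def[abs_def] by measurable
  have v2: "(cmod (v y))^2 = 2" for y by (simp add: v_def)
  have vw: "AE y in lborel. y \<in> A i \<longrightarrow> v y = w i y" for i
  proof (cases "i \<in> to_nat_on D ` D")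
    case True
    show ?thesis using vK(2)[OF fromD[OF True]]
    proof eventually_elim
      case (elim y)
      show ?case
      proof
        assume y: "y \<in> A i"
        then have "(cmod (w i y))^2 = 2" using elim True by (simp add: A_def w_def)
        then show "v y = w i y" using part[OF y] by (simp add: v_def)
      qed
    qed
  qed (simp add: A_def)
  have om: "\<Omega> \<in> sets borel" using op by auto
  have nullU: "AE y in lborel. y \<in> \<Omega> \<longleftrightarrow> y \<in> (\<Union>i. A i)"
  proof -
    have "(\<Omega> - (\<Union>i. A i)) \<in> null_sets lborel"
      using D(5) om unfolding UA[symmetric] negligible_iff_null_sets
      by (auto simp: null_sets_def)
    from AE_not_in[OF this] show ?thesis by eventually_elim (use subA in blast)
  qed
  show ?thesis
  proof (rule that[of v])
    show "v \<in> borel_measurable borel" by (rule vm)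
    show "(cmod (v y))^2 = 2" for y by (rule v2)
    fix S \<phi> G assume S: "open S" "\<Omega> \<subseteq> S" and C: "C1_on S \<phi> G"
      and iG: "integrable lborel (\<lambda>y. indicator \<Omega> y * norm (G y))"
    have cG: "continuous_on \<Omega> G" using C S(2) unfolding C1_on_def by (meson continuous_on_subset)
    have gm[measurable]: "(\<lambda>y. indicator \<Omega> y *\<^sub>R fst (G y)) \<in> borel_measurable borel"
      "(\<lambda>y. indicator \<Omega> y *\<^sub>R cgrad (G y)) \<in> borel_measurable borel"
      "(\<lambda>y. indicator \<Omega> y *\<^sub>R cnj (cgrad (G y))) \<in> borel_measurable borel"
      by (intro borel_measurable_continuous_on_indicator continuous_on_fst continuous_on_cnj cgrad_cont cG om)+
    have gb: "\<bar>fst (G y)\<bar> \<le> norm (G y)" "cmod (cgrad (G y)) \<le> 2 * norm (G y)" for y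
    proof -
      have n: "norm (fst (G y)) \<le> norm (G y)" "norm (snd (G y)) \<le> norm (G y)"
        using norm_fst_le[of "fst (G y)" "snd (G y)"] norm_snd_le[of "snd (G y)" "fst (G y)"] by auto
      then show "\<bar>fst (G y)\<bar> \<le> norm (G y)" by simp
      have "cmod (cgrad (G y)) \<le> \<bar>snd (G y) $ 1\<bar> + \<bar>snd (G y) $ 2\<bar>"
        using cmod_le[of "cgrad (G y)"] by (simp add: cgrad_def)
      also have "\<dots> \<le> 2 * norm (snd (G y))"
        using component_le_norm_cart[of "snd (G y)" 1] component_le_norm_cart[of "snd (G y)" 2] by simp
      finally show "cmod (cgrad (G y)) \<le> 2 * norm (G y)" using n by simp
    qed
    have vb: "cmod (v y) \<le> 2" "cmod (v y ^ 2 / 2) \<le> 1" for y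
    proof -
      have "(cmod (v y))^2 \<le> 2^2" using v2[of y] by simp
      then show "cmod (v y) \<le> 2" by (rule power2_le_imp_le) simp
      show "cmod (v y ^ 2 / 2) \<le> 1" using v2[of y] by (simp add: norm_divide norm_power)
    qed
    have main: "(\<integral>y. indicator \<Omega> y *\<^sub>R f y \<partial>lborel) = 0"
      if fm: "(\<lambda>y. indicator \<Omega> y *\<^sub>R f y) \<in> borel_measurable borel" and fb: "\<And>y. norm (f y) \<le> 8 * norm (G y)"
        and fi: "\<And>i. (\<integral>y. indicator (A i) y *\<^sub>R f y \<partial>lborel) = 0"
      for f :: "spacetime \<Rightarrow> 'b::euclidean_space"
    proof -
      have int: "integrable lborel (\<lambda>y. indicator \<Omega> y *\<^sub>R f y)"
      proof (rule Bochner_Integration.integrable_bound)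
        show "integrable lborel (\<lambda>y. 8 * (indicator \<Omega> y * norm (G y)))" using iG by simp
        show "AE y in lborel. norm (indicator \<Omega> y *\<^sub>R f y) \<le> norm (8 * (indicator \<Omega> y * norm (G y)))"
          using fb by (intro AE_I2) (auto simp: indicator_def)
      qed (use fm in simp)
      have "set_integrable lborel (\<Union>i. A i) f"
      proof -
        have "set_integrable lborel \<Omega> f" using int by (simp add: set_integrable_def)
        then show ?thesis by (rule set_integrable_subset) (use subA in auto)
      qed
      then have "(LINT y:(\<Union>i. A i)|lborel. f y) = (\<Sum>i. LINT y:(A i)|lborel. f y)"
        by (intro lebesgue_integral_countable_add) (use disj in auto)
      also have "\<dots> = 0" using fi by (simp add: set_lebesgue_integral_def)
      finally have 0: "(LINT y:(\<Union>i. A i)|lborel. f y) = 0" .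
      have "(\<integral>y. indicator \<Omega> y *\<^sub>R f y \<partial>lborel) = (\<integral>y. indicator (\<Union>i. A i) y *\<^sub>R f y \<partial>lborel)"
      proof (rule integral_cong_AE)
        have "(\<lambda>y. indicator (\<Union>i. A i) y *\<^sub>R (indicator \<Omega> y *\<^sub>R f y)) \<in> borel_measurable lborel"
          by (rule borel_measurable_scaleR[OF borel_measurable_indicator]) (use fm in simp_all)
        moreover have "(\<lambda>y. indicator (\<Union>i. A i) y *\<^sub>R (indicator \<Omega> y *\<^sub>R f y)) = (\<lambda>y. indicator (\<Union>i. A i) y *\<^sub>R f y)"
          using subA by (auto simp: indicator_def fun_eq_iff)
        ultimately show "(\<lambda>y. indicator (\<Union>i. A i) y *\<^sub>R f y) \<in> borel_measurable lborel" by simp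
        show "AE y in lborel. indicator \<Omega> y *\<^sub>R f y = indicator (\<Union>i. A i) y *\<^sub>R f y"
          using nullU by eventually_elim (auto simp: indicator_def)
      qed (use fm in simp)
      then show ?thesis using 0 by (simp add: set_lebesgue_integral_def)
    qed
    have cong: "(\<integral>y. indicator (A i) y *\<^sub>R h (v y) y \<partial>lborel) = 0"
      if hm: "(\<lambda>y. indicator \<Omega> y *\<^sub>R h (v y) y) \<in> borel_measurable borel"
          "(\<lambda>y. indicator \<Omega> y *\<^sub>R h (w i y) y) \<in> borel_measurable borel"
      and h0: "\<And>K. K \<in> D \<Longrightarrow> (\<integral>y. indicator (interior K) y *\<^sub>R h (vK K y) y \<partial>lborel) = 0"
      for h :: "complex \<Rightarrow> spacetime \<Rightarrow> 'b::euclidean_space" and i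
    proof -
      have mm: "(\<lambda>y. indicator (A i) y *\<^sub>R g y) \<in> borel_measurable lborel"
        if "(\<lambda>y. indicator \<Omega> y *\<^sub>R g y) \<in> borel_measurable borel" for g :: "spacetime \<Rightarrow> 'b"
      proof -
        have "(\<lambda>y. indicator (A i) y *\<^sub>R (indicator \<Omega> y *\<^sub>R g y)) \<in> borel_measurable lborel"
          by (rule borel_measurable_scaleR[OF borel_measurable_indicator]) (use that in simp_all)
        moreover have "(\<lambda>y. indicator (A i) y *\<^sub>R (indicator \<Omega> y *\<^sub>R g y)) = (\<lambda>y. indicator (A i) y *\<^sub>R g y)"
          using subA[of i] by (auto simp: indicator_def fun_eq_iff)
        ultimately show ?thesis by simp
      qed
      have "(\<integral>y. indicator (A i) y *\<^sub>R h (v y) y \<partial>lborel) = (\<integral>y. indicator (A i) y *\<^sub>R h (w i y) y \<partial>lborel)"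
        by (rule integral_cong_AE[OF mm[OF hm(1)] mm[OF hm(2)]])
           (use vw[of i] in \<open>eventually_elim, auto simp: indicator_def\<close>)
      also have "\<dots> = 0"
        using h0[OF fromD] by (cases "i \<in> to_nat_on D ` D") (auto simp: A_def w_def)
      finally show ?thesis .
    qed
    have split: "indicator \<Omega> y *\<^sub>R (of_real (fst (G y)) * z + (z ^ 2 / 2 - u0) * cnj (cgrad (G y)))
        = of_real (indicator \<Omega> y *\<^sub>R fst (G y)) * z + (z ^ 2 / 2 - u0) * (indicator \<Omega> y *\<^sub>R cnj (cgrad (G y)))"
      "indicator \<Omega> y *\<^sub>R (z \<bullet> cgrad (G y)) = z \<bullet> (indicator \<Omega> y *\<^sub>R cgrad (G y))" for y z
      by (auto simp: indicator_def)
    have KS: "K \<subseteq> S" if "K \<in> D" for K using D(3)[OF that] S(2) by blast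
    show "(\<integral>y. indicator \<Omega> y *\<^sub>R (v y \<bullet> cgrad (G y)) \<partial>lborel) = 0 \<and>
      (\<integral>y. indicator \<Omega> y *\<^sub>R (of_real (fst (G y)) * v y + (v y ^ 2 / 2 - u0) * cnj (cgrad (G y))) \<partial>lborel) = 0"
    proof (intro conjI main)
      show "(\<lambda>y. indicator \<Omega> y *\<^sub>R (v y \<bullet> cgrad (G y))) \<in> borel_measurable borel"
        "(\<lambda>y. indicator \<Omega> y *\<^sub>R (of_real (fst (G y)) * v y
            + (v y ^ 2 / 2 - u0) * cnj (cgrad (G y)))) \<in> borel_measurable borel"
        unfolding split by measurable
      show "norm (v y \<bullet> cgrad (G y)) \<le> 8 * norm (G y)" for y
      proof -
        have "norm (v y \<bullet> cgrad (G y)) \<le> cmod (v y) * cmod (cgrad (G y))" using Cauchy_Schwarz_ineq2 by simp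
        also have "\<dots> \<le> 2 * (2 * norm (G y))" by (intro mult_mono vb gb) auto
        finally show ?thesis using norm_ge_zero[of "G y"] by linarith
      qed
      show "norm (of_real (fst (G y)) * v y + (v y ^ 2 / 2 - u0) * cnj (cgrad (G y))) \<le> 8 * norm (G y)" for y
      proof -
        have "norm (of_real (fst (G y)) * v y + (v y ^ 2 / 2 - u0) * cnj (cgrad (G y)))
           \<le> \<bar>fst (G y)\<bar> * cmod (v y) + cmod (v y ^ 2 / 2 - u0) * cmod (cgrad (G y))"
          using norm_triangle_ineq[of "of_real (fst (G y)) * v y" "(v y ^ 2 / 2 - u0) * cnj (cgrad (G y))"]
              by (simp add: norm_mult)
        also have "\<dots> \<le> norm (G y) * 2 + 2 * (2 * norm (G y))"
        proof -
          have "cmod (v y ^ 2 / 2 - u0) \<le> 2"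
            using norm_triangle_ineq4[of "v y ^ 2 / 2" u0] vb(2)[of y] u0 by linarith
          then show ?thesis by (intro add_mono mult_mono vb gb) auto
        qed
        finally show ?thesis using norm_ge_zero[of "G y"] by linarith
      qed
      show "(\<integral>y. indicator (A i) y *\<^sub>R (v y \<bullet> cgrad (G y)) \<partial>lborel) = 0" for i
        by (rule cong[of "\<lambda>z y. z \<bullet> cgrad (G y)"])
          (unfold split, measurable, rule vK3(1)[OF _ S(1) KS C])
      show "(\<integral>y. indicator (A i) y *\<^sub>R (of_real (fst (G y)) * v y + (v y ^ 2 / 2 - u0) * cnj (cgrad (G y))) \<partial>lborel)
          = 0" for i
        by (rule cong[of "\<lambda>z y. of_real (fst (G y)) * z + (z ^ 2 / 2 - u0) * cnj (cgrad (G y))"])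
          (unfold split, measurable, rule vK3(2)[OF _ S(1) KS C])
    qed
  qed
qed

section \<open>Piecewise constant fans as weak solutions\<close>

definition strip :: "real \<Rightarrow> spacetime set" where "strip T = {0<..<T} \<times> UNIV"

text \<open>A fan is its rightmost state plus one jump on each set of this kind, so a single type of
  region has to be integrated.\<close>

definition below :: "real \<Rightarrow> real \<Rightarrow> spacetime set" where
  "below T \<nu> = {z \<in> strip T. snd z $ 2 < \<nu> * fst z}"

lemma strip_open: "open (strip T)" unfolding strip_def by (intro open_Times) auto

lemma below_open: "open (below T \<nu>)"
proof -
  have "below T \<nu> = strip T \<inter> {z. snd z $ 2 < \<nu> * fst z}" by (auto simp: below_def)
  then show ?thesis using strip_open by (auto intro!: open_Int open_Collect_less continuous_intros)
qed

lemma strip_borel[measurable]: "strip T \<in> sets borel" "below T \<nu> \<in> sets borel"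
  using strip_open below_open by auto

lemma test_function_C1: assumes "test_function T \<phi> G" shows "C1_on (strip T) \<phi> G"
  unfolding C1_on_def
proof
  show "\<forall>z\<in>strip T. (\<phi> has_derivative (\<lambda>h. G z \<bullet> h)) (at z)"
  proof
    fix z assume z: "z \<in> strip T"
    have sub: "strip T \<subseteq> {0..<T} \<times> UNIV" by (auto simp: strip_def)
    then have "(\<phi> has_derivative (\<lambda>h. G z \<bullet> h)) (at z within {0..<T} \<times> UNIV)"
      using assms z unfolding test_function_def by blast
    then have "(\<phi> has_derivative (\<lambda>h. G z \<bullet> h)) (at z within strip T)"
      using sub by (rule has_derivative_subset)
    then show "(\<phi> has_derivative (\<lambda>h. G z \<bullet> h)) (at z)"
      using at_within_open[OF z strip_open] by simp
  qed
  have "continuous_on ({0..<T} \<times> UNIV) G" using assms by (simp add: test_function_def)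
  then show "continuous_on (strip T) G" by (rule continuous_on_subset) (auto simp: strip_def)
qed

text \<open>At \<open>t = 0\<close> the gradient need not vanish off \<open>K\<close> at this point, but that is a null set.\<close>

lemma test_function_support:
  assumes tf: "test_function T \<phi> G"
  obtains K M where "compact K" "K \<subseteq> {0..<T} \<times> UNIV" "0 \<le> M"
    "\<And>z. z \<in> {0..<T} \<times> UNIV \<Longrightarrow> z \<notin> K \<Longrightarrow> \<phi> z = 0"
    "\<And>z. z \<in> {0..<T} \<times> UNIV \<Longrightarrow> \<bar>\<phi> z\<bar> \<le> M"
    "\<And>z. z \<in> strip T \<Longrightarrow> z \<notin> K \<Longrightarrow> G z = 0" "\<And>z. z \<in> strip T \<Longrightarrow> norm (G z) \<le> M * indicator K z"
proof -
  have "\<exists>K. compact K \<and> K \<subseteq> {0..<T} \<times> UNIV \<and> (\<forall>z \<in> {0..<T} \<times> UNIV - K. \<phi> z = 0)"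
    using tf unfolding test_function_def by (elim conjE)
  then obtain K where K': "compact K" "K \<subseteq> {0..<T} \<times> UNIV" "\<forall>z \<in> {0..<T} \<times> UNIV - K. \<phi> z = 0"
    by (elim exE conjE)
  note K = K'(1,2) bspec[OF K'(3)]
  have cG: "continuous_on ({0..<T} \<times> UNIV) G" using tf by (simp add: test_function_def)
  have cp: "continuous_on ({0..<T} \<times> UNIV) \<phi>"
  proof (rule differentiable_imp_continuous_on, unfold differentiable_on_def, rule ballI)
    fix z assume "z \<in> {0..<T} \<times> (UNIV :: (real^2) set)"
    then have "(\<phi> has_derivative (\<lambda>h. G z \<bullet> h)) (at z within {0..<T} \<times> UNIV)"
      using tf unfolding test_function_def by blast
    then show "\<phi> differentiable at z within {0..<T} \<times> UNIV" unfolding differentiable_def by blast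
  qed
  have "compact (G ` K)" "compact (\<phi> ` K)"
    by (intro compact_continuous_image continuous_on_subset[OF cG] continuous_on_subset[OF cp] K)+
  then have bd: "bounded (G ` K)" "bounded (\<phi> ` K)" by (simp_all add: compact_imp_bounded)
  obtain M1 where M1: "\<And>z. z \<in> K \<Longrightarrow> norm (G z) \<le> M1" using bd(1) unfolding bounded_iff by blast
  obtain M2 where M2: "\<And>z. z \<in> K \<Longrightarrow> \<bar>\<phi> z\<bar> \<le> M2" using bd(2) unfolding bounded_iff real_norm_def by blast
  note M = M1 M2
  have G0: "G z = 0" if z: "z \<in> strip T" "z \<notin> K" for z
  proof -
    have op: "open (strip T - K)" using strip_open K(1) compact_imp_closed by blast
    have "(\<phi> has_derivative (\<lambda>h. G z \<bullet> h)) (at z)"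
      using test_function_C1[OF tf] z unfolding C1_on_def by blast
    moreover have "(\<phi> has_derivative (\<lambda>h. 0)) (at z)"
    proof (rule has_derivative_transform_within_open[of "\<lambda>z. 0" _ _ _ "strip T - K"])
      show "((\<lambda>z. 0) has_derivative (\<lambda>h. 0)) (at z)" by simp
      show "0 = \<phi> x" if "x \<in> strip T - K" for x using K(3)[of x] that by (auto simp: strip_def)
    qed (use op z in auto)
    ultimately have "(\<lambda>h. G z \<bullet> h) = (\<lambda>h. 0)" by (rule has_derivative_unique)
    then have "G z \<bullet> G z = 0" by metis
    then show ?thesis by simp
  qed
  show ?thesis
  proof (rule that[of K "max 0 (max M1 M2)"])
    show "\<bar>\<phi> z\<bar> \<le> max 0 (max M1 M2)" if "z \<in> {0..<T} \<times> UNIV" for z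
      using M(2)[of z] K(3)[of z] that by (cases "z \<in> K") auto
    show "norm (G z) \<le> max 0 (max M1 M2) * indicator K z" if "z \<in> strip T" for z
      using M(1)[of z] G0[OF that] by (cases "z \<in> K") auto
  qed (use K G0 in auto)
qed

lemma test_function_integrable:
  assumes tf: "test_function T \<phi> G" and A: "A \<in> sets borel" "A \<subseteq> strip T"
  shows "integrable lborel (\<lambda>z. indicator A z *\<^sub>R G z)"
proof -
  obtain K M where K: "compact K" "0 \<le> M" "\<And>z. z \<in> strip T \<Longrightarrow> norm (G z) \<le> M * indicator K z"
    by (rule test_function_support[OF tf]) (rule that; assumption)
  have "continuous_on (strip T) G" using test_function_C1[OF tf] by (simp add: C1_on_def)
  then have m: "(\<lambda>z. indicator (strip T) z *\<^sub>R G z) \<in> borel_measurable borel"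
    by (intro borel_measurable_continuous_on_indicator) auto
  have "(\<lambda>z. indicator A z *\<^sub>R (indicator (strip T) z *\<^sub>R G z)) \<in> borel_measurable borel"
    by (rule borel_measurable_scaleR[OF borel_measurable_indicator m]) (use A in auto)
  moreover have "(\<lambda>z. indicator A z *\<^sub>R (indicator (strip T) z *\<^sub>R G z)) = (\<lambda>z. indicator A z *\<^sub>R G z)"
    using A(2) by (auto simp: indicator_def fun_eq_iff)
  ultimately have mA: "(\<lambda>z. indicator A z *\<^sub>R G z) \<in> borel_measurable borel" by simp
  show ?thesis
  proof (rule Bochner_Integration.integrable_bound)
    have "K \<in> sets borel" using K(1) by (simp add: compact_imp_closed borel_closed)
    then show "integrable lborel (\<lambda>z. M * indicator K z :: real)"
      using emeasure_bounded_finite[OF compact_imp_bounded[OF K(1)]]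
      by (intro integrable_mult_right integrable_real_indicator) auto
    have "norm (indicator A z *\<^sub>R G z) \<le> norm (M * indicator K z :: real)" for z
    proof (cases "z \<in> A")
      case True
      then show ?thesis using K(2) K(3)[of z] A(2) by auto
    qed simp
    then show "AE z in lborel. norm (indicator A z *\<^sub>R G z) \<le> norm (M * indicator K z :: real)" by simp
  qed (use mA in simp)
qed

text \<open>By the divergence theorem this is the integral of \<open>\<phi>\<close> along \<open>x\<^sub>2 = \<nu> t\<close>.\<close>

definition edge :: "real \<Rightarrow> (spacetime \<Rightarrow> spacetime) \<Rightarrow> real \<Rightarrow> real" where
  "edge T G \<nu> = (\<integral>z. indicator (below T \<nu>) z * (snd (G z) $ 2) \<partial>lborel)"

section \<open>Boundary terms of constant layers\<close>

definition zext :: "real \<Rightarrow> (spacetime \<Rightarrow> real) \<Rightarrow> spacetime \<Rightarrow> real" where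
  "zext T \<phi> z = indicator (strip T) z * \<phi> z"

text \<open>A purely spatial direction never crosses t = 0, where the zero extension may
  jump.\<close>

lemma zext_dirderiv:
  assumes tf: "test_function T \<phi> G" and w: "fst w = 0"
  shows "((\<lambda>h. zext T \<phi> (y + h *\<^sub>R w)) has_real_derivative indicator (strip T) y * (G y \<bullet> w)) (at 0)"
proof -
  have st: "indicator (strip T) (y + h *\<^sub>R w) = (indicator (strip T) y :: real)" for h
    using w by (auto simp: strip_def indicator_def mem_Times_iff)
  show ?thesis
  proof (cases "y \<in> strip T")
    case False then show ?thesis by (simp add: zext_def st)
  next
    case True
    have line: "((\<lambda>h. y + h *\<^sub>R w) has_derivative (\<lambda>h. h *\<^sub>R w)) (at 0)"
      by (auto intro!: derivative_eq_intros)
    have "(\<phi> has_derivative (\<lambda>h. G y \<bullet> h)) (at (y + 0 *\<^sub>R w))"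
      using test_function_C1[OF tf] True by (simp add: C1_on_def)
    from has_derivative_compose[OF line this]
    have "((\<lambda>h. \<phi> (y + h *\<^sub>R w)) has_derivative (\<lambda>h. G y \<bullet> (h *\<^sub>R w))) (at 0)" .
    then have "((\<lambda>h. \<phi> (y + h *\<^sub>R w)) has_real_derivative (G y \<bullet> w)) (at 0)"
      by (simp add: has_field_derivative_def mult.commute[of _ "G y \<bullet> w"] inner_scaleR_right)
    then show ?thesis using True by (simp add: zext_def st)
  qed
qed

lemma zext_props:
  assumes tf: "test_function T \<phi> G"
  shows "zext T \<phi> \<in> borel_measurable borel" "integrable lborel (zext T \<phi>)"
    "\<exists>K. compact K \<and> (\<forall>y. y \<notin> K \<longrightarrow> zext T \<phi> y = 0)"
    "\<exists>M. \<forall>y. \<bar>indicator (strip T) y * (G y \<bullet> w)\<bar> \<le> M"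
proof -
  obtain K M where K: "compact K" "0 \<le> M" "\<And>z. z \<in> {0..<T} \<times> UNIV \<Longrightarrow> z \<notin> K \<Longrightarrow> \<phi> z = 0"
     "\<And>z. z \<in> {0..<T} \<times> UNIV \<Longrightarrow> \<bar>\<phi> z\<bar> \<le> M"
     "\<And>z. z \<in> strip T \<Longrightarrow> norm (G z) \<le> M * indicator K z"
    by (rule test_function_support[OF tf]) (rule that; assumption)
  have sub: "strip T \<subseteq> {0..<T} \<times> UNIV" by (auto simp: strip_def)
  have "continuous_on (strip T) \<phi>" using C1_on_cont[OF test_function_C1[OF tf] strip_open] .
  then have m: "(\<lambda>z. indicator (strip T) z *\<^sub>R \<phi> z) \<in> borel_measurable borel"
    by (intro borel_measurable_continuous_on_indicator) auto
  then show meas: "zext T \<phi> \<in> borel_measurable borel" by (simp add: zext_def[abs_def])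
  have z0: "zext T \<phi> y = 0" if "y \<notin> K" for y using K(3)[of y] that sub by (auto simp: zext_def indicator_def)
  then show "\<exists>K. compact K \<and> (\<forall>y. y \<notin> K \<longrightarrow> zext T \<phi> y = 0)" using K(1) by blast
  show "integrable lborel (zext T \<phi>)"
  proof (rule Bochner_Integration.integrable_bound)
    have "K \<in> sets borel" using K(1) by (simp add: compact_imp_closed borel_closed)
    then show "integrable lborel (\<lambda>z. M * indicator K z :: real)"
      using emeasure_bounded_finite[OF compact_imp_bounded[OF K(1)]]
      by (intro integrable_mult_right integrable_real_indicator) auto
    have "norm (zext T \<phi> z) \<le> norm (M * indicator K z)" for z
      using K(2) K(4)[of z] z0[of z] sub by (cases "z \<in> K"; cases "z \<in> strip T") (auto simp: zext_def)
    then show "AE z in lborel. norm (zext T \<phi> z) \<le> norm (M * indicator K z)" by simp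
  qed (use meas in simp)
  have "\<bar>indicator (strip T) y * (G y \<bullet> w)\<bar> \<le> M * norm w" for y
  proof (cases "y \<in> strip T")
    case True
    have "\<bar>G y \<bullet> w\<bar> \<le> norm (G y) * norm w" by (rule Cauchy_Schwarz_ineq2)
    also have "\<dots> \<le> M * norm w" using K(2) K(5)[OF True] by (intro mult_right_mono) (cases "y \<in> K", auto)
    finally show ?thesis using True by simp
  qed (use K in simp)
  then show "\<exists>M. \<forall>y. \<bar>indicator (strip T) y * (G y \<bullet> w)\<bar> \<le> M" by blast
qed

text \<open>Moving the shift from the function to the half-space turns each difference quotient in
  x2 into an integral of \<phi> over a thin strip above x2 = \<nu> t. This sign decides the entropy
  inequality for fans.\<close>

lemma edge_nonneg:
  assumes tf: "test_function T \<phi> G" and pos: "\<And>z. z \<in> {0..<T} \<times> UNIV \<Longrightarrow> \<phi> z \<ge> 0"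
  shows "edge T G \<nu> \<ge> 0"
proof -
  let ?w = "(0, axis 2 1) :: spacetime"
  let ?f = "zext T \<phi>"
  obtain K where K: "compact K" "\<And>y. y \<notin> K \<Longrightarrow> ?f y = 0" using zext_props(3)[OF tf] by blast
  obtain M where M: "\<And>y. \<bar>indicator (strip T) y * (G y \<bullet> ?w)\<bar> \<le> M" using zext_props(4)[OF tf] by blast
  have fw: "fst ?w = 0" by simp
  note fm[measurable] = zext_props(1)[OF tf]
  define U where "U = {z :: spacetime. snd z $ 2 < \<nu> * fst z}"
  have Um[measurable]: "U \<in> sets borel" unfolding U_def
      by (auto intro!: borel_open open_Collect_less continuous_intros)
  have lim: "(\<lambda>n. \<integral>y. indicator U y * ((?f (y + (1 / real (Suc n)) *\<^sub>R ?w) - ?f y) * real (Suc n)) \<partial>lborel)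
      \<longlonglongrightarrow> (\<integral>y. indicator U y * (indicator (strip T) y * (G y \<bullet> ?w)) \<partial>lborel)"
    by (rule integral_dirderiv_limit[OF zext_dirderiv[OF tf fw] M fm K Um])
  have nonneg: "(\<integral>y. indicator U y * ((?f (y + (1 / real (Suc n)) *\<^sub>R ?w) - ?f y) * real (Suc n)) \<partial>lborel) \<ge> 0" for n
  proof -
    define h where "h = 1 / real (Suc n)"
    have h: "h > 0" by (simp add: h_def)
    have i1: "integrable lborel (\<lambda>y. indicator U y * ?f y)"
      using integrable_mult_indicator[OF _ zext_props(2)[OF tf], of U] by simp
    have m2: "(\<lambda>y. indicator U (y - h *\<^sub>R ?w) * ?f y) \<in> borel_measurable borel" by measurable
    have i2: "integrable lborel (\<lambda>y. indicator U (y - h *\<^sub>R ?w) * ?f y)"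
    proof (rule Bochner_Integration.integrable_bound[OF zext_props(2)[OF tf]])
      show "AE y in lborel. norm (indicator U (y - h *\<^sub>R ?w) * ?f y) \<le> norm (?f y)"
        by (intro AE_I2) (auto simp: indicator_def)
    qed (use m2 in simp)
    have t: "(\<integral>y. indicator U y * ?f (y + h *\<^sub>R ?w) \<partial>lborel) = (\<integral>y. indicator U (y - h *\<^sub>R ?w) * ?f y \<partial>lborel)"
      "integrable lborel (\<lambda>y. indicator U y * ?f (y + h *\<^sub>R ?w))"
      using lborel_integral_translate[OF m2, of "h *\<^sub>R ?w"] i2 by simp_all
    have "0 \<le> (\<integral>y. indicator U (y - h *\<^sub>R ?w) * ?f y - indicator U y * ?f y \<partial>lborel)"
    proof (rule integral_nonneg_AE, rule AE_I2)
      fix y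
      have f0: "?f y \<ge> 0" using pos[of y] by (auto simp: zext_def strip_def indicator_def)
      have "indicator U y \<le> (indicator U (y - h *\<^sub>R ?w) :: real)"
        using h by (auto simp: U_def indicator_def axis_def)
      then show "0 \<le> indicator U (y - h *\<^sub>R ?w) * ?f y - indicator U y * ?f y"
        using f0 by (simp add: mult_right_mono)
    qed
    also have "\<dots> = (\<integral>y. indicator U y * ?f (y + h *\<^sub>R ?w) \<partial>lborel) - (\<integral>y. indicator U y * ?f y \<partial>lborel)"
      using i1 i2 t by simp
    also have "\<dots> = (\<integral>y. indicator U y * (?f (y + h *\<^sub>R ?w) - ?f y) \<partial>lborel)"
      using i1 t by (simp add: right_diff_distrib)
    finally have "0 \<le> (\<integral>y. indicator U y * (?f (y + h *\<^sub>R ?w) - ?f y) \<partial>lborel) * real (Suc n)" by simp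
    also have "\<dots> = (\<integral>y. indicator U y * (?f (y + h *\<^sub>R ?w) - ?f y) * real (Suc n) \<partial>lborel)" 
      by (subst integral_mult_left_zero) simp
    finally show ?thesis by (simp add: h_def mult.assoc)
  qed
  have "0 \<le> (\<integral>y. indicator U y * (indicator (strip T) y * (G y \<bullet> ?w)) \<partial>lborel)"
    by (rule LIMSEQ_le_const[OF lim]) (use nonneg in blast)
  also have "(\<lambda>y. indicator U y * (indicator (strip T) y * (G y \<bullet> ?w)))
      = (\<lambda>y. indicator (below T \<nu>) y * (snd (G y) $ 2))"
    by (auto simp: fun_eq_iff indicator_def U_def below_def inner_prod_def inner_axis)
  finally show ?thesis by (simp add: edge_def)
qed

text \<open>The indicator of the region is constant along \<open>w\<close>, so it passes through the
  derivative and no boundary term arises.\<close>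

lemma edge_tangential:
  assumes tf: "test_function T \<phi> G" and U: "U \<in> sets borel" "\<And>y h. y + h *\<^sub>R w \<in> U \<longleftrightarrow> y \<in> U" and fw: "fst w = 0"
  shows "(\<integral>z. indicator (U \<inter> strip T) z * (G z \<bullet> w) \<partial>lborel) = 0"
proof -
  let ?f = "\<lambda>y. indicator U y * zext T \<phi> y"
  obtain K where K: "compact K" "\<And>y. y \<notin> K \<Longrightarrow> zext T \<phi> y = 0" using zext_props(3)[OF tf] by blast
  obtain M where M: "\<And>y. \<bar>indicator (strip T) y * (G y \<bullet> w)\<bar> \<le> M" using zext_props(4)[OF tf] by blast
  note fm[measurable] = zext_props(1)[OF tf]
  note U(1)[measurable]
  have "(\<integral>y. indicator U y * (indicator (strip T) y * (G y \<bullet> w)) \<partial>lborel) = 0"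
  proof (rule integral_dirderiv_zero[where f="?f" and w=w])
    fix y
    have "indicator U (y + h *\<^sub>R w) = (indicator U y :: real)" for h using U(2) by (simp add: indicator_def)
    then show "((\<lambda>h. ?f (y + h *\<^sub>R w)) has_real_derivative indicator U y * (indicator (strip T) y * (G y \<bullet> w))) (at
        0)"
      using DERIV_cmult[OF zext_dirderiv[OF tf fw], of "indicator U y"] by simp
    show "\<bar>indicator U y * (indicator (strip T) y * (G y \<bullet> w))\<bar> \<le> max M 0"
      using M[of y] by (auto simp: indicator_def)
    show "integrable lborel ?f"
      using integrable_mult_indicator[OF _ zext_props(2)[OF tf], of U] U(1) by simp
    show "?f \<in> borel_measurable borel" by measurable
    show "compact K" by (rule K)
    show "y \<notin> K \<Longrightarrow> ?f y = 0" using K(2) by simp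
  qed
  then show ?thesis by (simp add: indicator_inter_arith mult.assoc)
qed

text \<open>The shear (t, x) -> (t, x + t b) straightens the region into a cylinder over
  \<open>S\<close> and makes the derivative along (1, b) a time derivative. Fubini and the
  fundamental theorem of calculus leave the initial value.\<close>

lemma transport_identity:
  fixes b :: "real^2"
  assumes tf: "test_function T \<phi> G" and T: "T > 0" and S[measurable]: "S \<in> sets (borel :: (real^2) measure)"
  defines "R \<equiv> {z \<in> strip T. snd z - fst z *\<^sub>R b \<in> S}"
  shows "R \<in> sets borel" "integrable lborel (\<lambda>x. indicator S x * \<phi> (0, x))"
    "(\<integral>z. indicator R z * (G z \<bullet> (1, b)) \<partial>lborel) = - (\<integral>x. indicator S x * \<phi> (0, x) \<partial>lborel)"
proof -
  obtain K M where K: "compact K" "K \<subseteq> {0..<T} \<times> UNIV" "0 \<le> M"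
     "\<And>z. z \<in> {0..<T} \<times> UNIV \<Longrightarrow> z \<notin> K \<Longrightarrow> \<phi> z = 0"
     "\<And>z. z \<in> {0..<T} \<times> UNIV \<Longrightarrow> \<bar>\<phi> z\<bar> \<le> M"
     "\<And>z. z \<in> strip T \<Longrightarrow> z \<notin> K \<Longrightarrow> G z = 0"
     "\<And>z. z \<in> strip T \<Longrightarrow> norm (G z) \<le> M * indicator K z"
    by (rule test_function_support[OF tf]) (rule that; assumption)
  have "(\<lambda>z::spacetime. snd z - fst z *\<^sub>R b) -` S \<inter> space borel \<in> sets borel"
    by (rule measurable_sets[OF borel_measurable_continuous_onI S]) (intro continuous_intros)
  moreover have "R = strip T \<inter> ((\<lambda>z::spacetime. snd z - fst z *\<^sub>R b) -` S \<inter> space borel)" by (auto simp: R_def)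
  ultimately show Rm[measurable]: "R \<in> sets borel" by (auto intro!: sets.Int)
  have Rs: "R \<subseteq> strip T" by (auto simp: R_def)
  define F where "F z = indicator R z * (G z \<bullet> (1, b))" for z
  have Fi: "integrable lborel F"
    using integrable_inner_left[where c="(1,b)", OF test_function_integrable[OF tf Rm Rs]]
        by (simp add: F_def[abs_def])
  have Fm[measurable]: "F \<in> borel_measurable borel" using borel_measurable_integrable[OF Fi] by simp
  define sh where "sh z = (fst z, snd z + fst z *\<^sub>R b)" for z :: spacetime
  have shc: "continuous_on UNIV sh" unfolding sh_def[abs_def] by (intro continuous_intros)
  define F' where "F' z = F (sh z)" for z
  have F'm[measurable]: "F' \<in> borel_measurable borel"
    unfolding F'_def[abs_def] by (rule measurable_compose[OF borel_measurable_continuous_onI[OF shc] Fm])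
  have F'i: "integrable lborel F'"
  proof -
    define K' where "K' = (\<lambda>z::spacetime. (fst z, snd z - fst z *\<^sub>R b)) ` K"
    have K': "compact K'" unfolding K'_def by (intro compact_continuous_image K continuous_intros)
    have out: "F' z = 0" if "z \<notin> K'" for z
    proof (cases "sh z \<in> R")
      case True
      have "sh z \<notin> K"
      proof
        assume "sh z \<in> K"
        then have "(\<lambda>z::spacetime. (fst z, snd z - fst z *\<^sub>R b)) (sh z) \<in> K'" unfolding K'_def by (rule imageI)
        then show False using that by (simp add: sh_def)
      qed
      then show ?thesis using K(6)[of "sh z"] True Rs by (auto simp: F'_def F_def)
    qed (simp add: F'_def F_def)
    have bd: "\<bar>F' z\<bar> \<le> M * norm (1::real, b)" for z
    proof (cases "sh z \<in> R")
      case True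
      have "\<bar>G (sh z) \<bullet> (1, b)\<bar> \<le> norm (G (sh z)) * norm (1::real, b)" by (rule Cauchy_Schwarz_ineq2)
      also have "\<dots> \<le> M * norm (1::real, b)"
        using K(3) K(7)[of "sh z"] True Rs by (intro mult_right_mono) (cases "sh z \<in> K", auto)
      finally show ?thesis using True by (simp add: F'_def F_def)
    qed (use K(3) in \<open>simp add: F'_def F_def\<close>)
    show ?thesis
    proof (rule Bochner_Integration.integrable_bound)
      have "K' \<in> sets borel" using K' by (simp add: compact_imp_closed borel_closed)
      then show "integrable lborel (\<lambda>z. (M * norm (1::real, b)) * indicator K' z :: real)"
        using emeasure_bounded_finite[OF compact_imp_bounded[OF K']]
        by (intro integrable_mult_right integrable_real_indicator) auto
      have "norm (F' z) \<le> norm ((M * norm (1::real, b)) * indicator K' z :: real)" for z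
        using bd[of z] out[of z] K(3) by (cases "z \<in> K'") auto
      then show "AE z in lborel. norm (F' z) \<le> norm ((M * norm (1::real, b)) * indicator K' z :: real)" by simp
    qed (use F'm in simp)
  qed
  \<comment> \<open>A time after the support and before T: \<phi> vanishes there, and [0, T1] is a
    closed interval on which \<phi> is C1.\<close>
  obtain T1 where T1: "0 < T1" "T1 < T" "\<And>z. z \<in> K \<Longrightarrow> fst z < T1"
  proof (cases "K = {}")
    case True then show thesis using that[of "T/2"] T by auto
  next
    case False
    have "compact (fst ` K)" by (intro compact_continuous_image K continuous_intros)
    then obtain s where s: "s \<in> fst ` K" "\<And>r. r \<in> fst ` K \<Longrightarrow> r \<le> s"
      using compact_attains_sup[of "fst ` K"] False by auto
    then have "s < T" "0 \<le> s" using K(2) by auto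
    then show thesis using s(2) by (intro that[of "(s + T) / 2"]) force+
  qed
  have inner: "(\<integral>t. F' (t, x) \<partial>lborel) = - (indicator S x * \<phi> (0, x))" for x
  proof -
    define f' where "f' t = G (t, x + t *\<^sub>R b) \<bullet> (1, b)" for t
    have cf: "continuous_on {0..T1} f'"
    proof -
      have cG: "continuous_on ({0..<T} \<times> UNIV) G" using tf by (simp add: test_function_def)
      have "continuous_on {0..T1} (\<lambda>t. G (t, x + t *\<^sub>R b))"
        by (rule continuous_on_compose2[OF cG]) (use T1 in \<open>auto intro!: continuous_intros\<close>)
      then show ?thesis unfolding f'_def by (intro continuous_intros)
    qed
    have ftc: "integral\<^sup>L lborel (\<lambda>t. indicator {0..T1} t *\<^sub>R f' t) = \<phi> (T1, x + T1 *\<^sub>R b) - \<phi> (0, x + 0 *\<^sub>R b)"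
    proof (rule integral_FTC_Icc)
      show "0 \<le> T1" using T1 by simp
      have sub: "(\<lambda>t. (t, x + t *\<^sub>R b)) ` {0..T1} \<subseteq> {0..<T} \<times> UNIV" using T1 by auto
      fix t assume t: "0 \<le> t" "t \<le> T1"
      have l: "((\<lambda>t. (t, x + t *\<^sub>R b)) has_derivative (\<lambda>h. (h, h *\<^sub>R b))) (at t within {0..T1})"
        by (auto intro!: derivative_eq_intros)
      have "(t, x + t *\<^sub>R b) \<in> {0..<T} \<times> UNIV" using t T1 by auto
      then have "(\<phi> has_derivative (\<lambda>h. G (t, x + t *\<^sub>R b) \<bullet> h)) (at (t, x + t *\<^sub>R b) within {0..<T} \<times> UNIV)"
        using tf unfolding test_function_def by blast
      then have "(\<phi> has_derivative (\<lambda>h. G (t, x + t *\<^sub>R b) \<bullet> h)) (at (t, x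
          + t *\<^sub>R b) within (\<lambda>t. (t, x + t *\<^sub>R b)) ` {0..T1})"
        using sub by (rule has_derivative_subset)
      from has_derivative_in_compose[OF l this]
      show "((\<lambda>t. \<phi> (t, x + t *\<^sub>R b)) has_vector_derivative f' t) (at t within {0..T1})"
        unfolding has_vector_derivative_def f'_def
        by (rule has_derivative_eq_rhs) (auto simp: inner_prod_def inner_scaleR_right algebra_simps)
    next
      show "continuous_on {0..T1} f'" by (rule cf)
    qed
    have "\<phi> (T1, x + T1 *\<^sub>R b) = 0" using K(4)[of "(T1, x + T1 *\<^sub>R b)"] T1(1,2) T1(3)[of "(T1, x + T1 *\<^sub>R b)"] by auto
    then have 1: "integral\<^sup>L lborel (\<lambda>t. indicator {0..T1} t *\<^sub>R f' t) = - \<phi> (0, x)" using ftc by simp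
    have "(\<integral>t. F' (t, x) \<partial>lborel) = (\<integral>t. indicator S x * (indicator {0..T1} t *\<^sub>R f' t) \<partial>lborel)"
    proof (rule integral_cong_AE)
      show "(\<lambda>t. F' (t, x)) \<in> borel_measurable lborel"
        using measurable_compose[OF borel_measurable_continuous_onI[of "\<lambda>t. (t, x)"] F'm]
            by (simp add: continuous_intros)
      have "(\<lambda>t. indicator {0..T1} t *\<^sub>R f' t) \<in> borel_measurable borel"
        by (intro borel_measurable_continuous_on_indicator cf) auto
      then show "(\<lambda>t. indicator S x * (indicator {0..T1} t *\<^sub>R f' t)) \<in> borel_measurable lborel" by simp
      \<comment> \<open>The closed interval contains t = 0 and the open strip does not; a single
        time is negligible.\<close>
      show "AE t in lborel. F' (t, x) = indicator S x * (indicator {0..T1} t *\<^sub>R f' t)"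
        using AE_lborel_singleton[of 0]
      proof eventually_elim
        case (elim t)
        have "sh (t, x) \<in> R \<longleftrightarrow> 0 < t \<and> t < T \<and> x \<in> S" by (auto simp: sh_def R_def strip_def)
        moreover have "f' t = 0" if "T1 < t" "t < T"
        proof -
          have "(t, x + t *\<^sub>R b) \<notin> K" using T1(3)[of "(t, x + t *\<^sub>R b)"] that by auto
          moreover have "(t, x + t *\<^sub>R b) \<in> strip T" using T1 that by (simp add: strip_def)
          ultimately show ?thesis using K(6) by (simp add: f'_def)
        qed
        ultimately show ?case using elim T1 by (auto simp: F'_def F_def f'_def sh_def indicator_def)
      qed
    qed
    then show ?thesis using 1 by simp
  qed
  have F'i2: "integrable (lborel \<Otimes>\<^sub>M lborel) F'" using F'i by (simp add: lborel_prod)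
  have snd': "(\<integral>x. (\<integral>t. F' (t, x) \<partial>lborel) \<partial>lborel) = integral\<^sup>L lborel F'"
    using lborel_pair.integral_snd[of "\<lambda>t x. F' (t, x)"] F'i2 by (simp add: lborel_prod)
  have "integrable lborel (\<lambda>x. \<integral>t. F' (t, x) \<partial>lborel)"
    using lborel_pair.integrable_snd[of "\<lambda>t x. F' (t, x)"] F'i2 by simp
  then show "integrable lborel (\<lambda>x. indicator S x * \<phi> (0, x))" unfolding inner by simp
  have "integral\<^sup>L lborel F = (\<integral>t. (\<integral>x. F (t, x) \<partial>lborel) \<partial>lborel)"
    using lborel_pair.integral_fst'[of F] Fi by (simp add: lborel_prod)
  also have "\<dots> = (\<integral>t. (\<integral>x. F' (t, x) \<partial>lborel) \<partial>lborel)"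
  proof (rule Bochner_Integration.integral_cong[OF refl])
    fix t
    have "(\<lambda>x. F (t, x)) \<in> borel_measurable borel"
      using measurable_compose[OF borel_measurable_continuous_onI[of "\<lambda>x. (t, x)"] Fm]
          by (simp add: continuous_intros)
    from lborel_integral_translate(1)[OF this, of "t *\<^sub>R b"]
    show "(\<integral>x. F (t, x) \<partial>lborel) = (\<integral>x. F' (t, x) \<partial>lborel)" by (simp add: F'_def sh_def)
  qed
  also have "\<dots> = integral\<^sup>L lborel F'"
    using lborel_pair.integral_fst'[of F'] F'i by (simp add: lborel_prod)
  also have "\<dots> = - (\<integral>x. indicator S x * \<phi> (0, x) \<partial>lborel)" unfolding snd'[symmetric] inner by simp
  finally show "(\<integral>z. indicator R z * (G z \<bullet> (1, b)) \<partial>lborel) = - (\<integral>x. indicator S x * \<phi> (0, x) \<partial>lborel)"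
    by (simp add: F_def[abs_def])
qed

text \<open>The integrand of the weak form for a layer with conserved quantity \<open>q\<close> and
  fluxes \<open>a\<close>, \<open>b\<close> along x1, x2. The triple need not come from a state,
  which leaves room for the averaged turbulent zone.\<close>

definition lin :: "spacetime \<Rightarrow> 'a \<Rightarrow> 'a \<Rightarrow> 'a \<Rightarrow> 'a::real_vector" where
  "lin g q a b = fst g *\<^sub>R q + (snd g $ 1) *\<^sub>R a + (snd g $ 2) *\<^sub>R b"

lemma region_integrable:
  assumes tf: "test_function T \<phi> G" and A: "A \<in> sets borel" "A \<subseteq> strip T"
  shows "integrable lborel (\<lambda>z. indicator A z * fst (G z))"
    "integrable lborel (\<lambda>z. indicator A z * (snd (G z) $ i))"
    "integrable lborel (\<lambda>z. indicator A z * norm (G z))"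
proof -
  note I = test_function_integrable[OF tf A]
  have "integrable lborel (\<lambda>z. (indicator A z *\<^sub>R G z) \<bullet> (1, 0))"
      "integrable lborel (\<lambda>z. (indicator A z *\<^sub>R G z) \<bullet> (0, axis i 1))"
    "integrable lborel (\<lambda>z. norm (indicator A z *\<^sub>R G z))"
    using I by (intro integrable_inner_left integrable_norm; assumption)+
  then show "integrable lborel (\<lambda>z. indicator A z * fst (G z))"
      "integrable lborel (\<lambda>z. indicator A z * (snd (G z) $ i))"
    "integrable lborel (\<lambda>z. indicator A z * norm (G z))"
    by (simp_all add: inner_prod_def inner_axis)
qed

definition init_below :: "(spacetime \<Rightarrow> real) \<Rightarrow> real" where
  "init_below \<phi> = (\<integral>x. indicator {x::real^2. x $ 2 < 0} x * \<phi> (0, x) \<partial>lborel)"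

lemma lower_half_borel[measurable]: "{x::real^2. x $ 2 < 0} \<in> sets borel"
  by (intro borel_open open_Collect_less continuous_intros)

text \<open>Transport along (1, (0, \<nu>)) trades the time derivative for the x2 derivative, whose
  integral is \<open>edge\<close>, and an initial term; the x1 derivative integrates to zero. The
  factor b - \<nu> q is one side of the Rankine-Hugoniot condition for slope \<nu>.\<close>

lemma lin_integral_below:
  fixes q a b :: "'a::euclidean_space"
  assumes tf: "test_function T \<phi> G" and T: "T > 0"
  shows "integrable lborel (\<lambda>z. indicator (below T \<nu>) z *\<^sub>R lin (G z) q a b)"
    "(\<integral>z. indicator (below T \<nu>) z *\<^sub>R lin (G z) q a b \<partial>lborel) = edge T G \<nu> *\<^sub>R (b - \<nu> *\<^sub>R q) - init_below \<phi> *\<^sub>R q"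
proof -
  have sub: "below T \<nu> \<subseteq> strip T" by (auto simp: below_def)
  note I = region_integrable[OF tf strip_borel(2) sub]
  have e: "indicator (below T \<nu>) z *\<^sub>R lin (G z) q a b = (indicator (below T \<nu>) z * fst (G z)) *\<^sub>R q
     + (indicator (below T \<nu>) z * (snd (G z) $ 1)) *\<^sub>R a + (indicator (below T \<nu>) z * (snd (G z) $ 2)) *\<^sub>R b" for z
    by (simp add: lin_def scaleR_add_right)
  show "integrable lborel (\<lambda>z. indicator (below T \<nu>) z *\<^sub>R lin (G z) q a b)" unfolding e using I by auto
  have reg: "{z \<in> strip T. snd z - fst z *\<^sub>R axis 2 \<nu> \<in> {x::real^2. x $ 2 < 0}} = below T \<nu>"
    by (auto simp: below_def axis_def mult.commute)
  have ind: "(\<integral>z. indicator (below T \<nu>) z * (G z \<bullet> (1, axis 2 \<nu>)) \<partial>lborel) = - init_below \<phi>"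
    using transport_identity(3)[OF tf T lower_half_borel, of "axis 2 \<nu>"] unfolding reg init_below_def .
  have "G z \<bullet> (1, axis 2 \<nu>) = fst (G z) + \<nu> * (snd (G z) $ 2)" for z
    by (simp add: inner_prod_def inner_axis)
  then have "(\<integral>z. indicator (below T \<nu>) z * (G z \<bullet> (1, axis 2 \<nu>)) \<partial>lborel)
     = (\<integral>z. indicator (below T \<nu>) z * fst (G z) + \<nu> * (indicator (below T \<nu>) z * (snd (G z) $ 2)) \<partial>lborel)"
    by (simp add: algebra_simps)
  also have "\<dots> = (\<integral>z. indicator (below T \<nu>) z * fst (G z) \<partial>lborel) + \<nu> * edge T G \<nu>"
    using I(1) I(2)[of 2] by (simp add: edge_def)
  finally have t: "(\<integral>z. indicator (below T \<nu>) z * fst (G z) \<partial>lborel) = - init_below \<phi> - \<nu> * edge T G \<nu>"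
    using ind by simp
  define U where "U = {z :: spacetime. snd z $ 2 < \<nu> * fst z}"
  have Um: "U \<in> sets borel" unfolding U_def by (intro borel_open open_Collect_less continuous_intros)
  have US: "U \<inter> strip T = below T \<nu>" by (auto simp: U_def below_def)
  have "(\<integral>z. indicator (U \<inter> strip T) z * (G z \<bullet> (0, axis 1 1)) \<partial>lborel) = 0"
    by (rule edge_tangential[OF tf Um]) (auto simp: U_def axis_def)
  then have x1: "(\<integral>z. indicator (below T \<nu>) z * (snd (G z) $ 1) \<partial>lborel) = 0"
    unfolding US by (simp add: inner_prod_def inner_axis)
  show "(\<integral>z. indicator (below T \<nu>) z *\<^sub>R lin (G z) q a b \<partial>lborel) = edge T G \<nu> *\<^sub>R (b - \<nu> *\<^sub>R q) - init_below \<phi> *\<^sub>R q"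
  proof -
    have "(\<integral>z. indicator (below T \<nu>) z *\<^sub>R lin (G z) q a b \<partial>lborel)
      = (\<integral>z. indicator (below T \<nu>) z * fst (G z) \<partial>lborel) *\<^sub>R q
       + (\<integral>z. indicator (below T \<nu>) z * (snd (G z) $ 1) \<partial>lborel) *\<^sub>R a
       + (\<integral>z. indicator (below T \<nu>) z * (snd (G z) $ 2) \<partial>lborel) *\<^sub>R b"
      unfolding e using I(1) I(2)[of 1] I(2)[of 2] by simp
    then show ?thesis unfolding t x1 edge_def[symmetric] by (simp add: algebra_simps)
  qed
qed

lemma lin_integral_strip:
  fixes q a b :: "'a::euclidean_space"
  assumes tf: "test_function T \<phi> G" and T: "T > 0"
  shows "integrable lborel (\<lambda>z. indicator (strip T) z *\<^sub>R lin (G z) q a b)"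
    "(\<integral>z. indicator (strip T) z *\<^sub>R lin (G z) q a b \<partial>lborel) = - (\<integral>x. \<phi> (0, x) \<partial>lborel) *\<^sub>R q"
    "integrable lborel (\<lambda>x. \<phi> (0, x))" "integrable lborel (\<lambda>x. indicator {x::real^2. x $ 2 < 0} x * \<phi> (0, x))"
proof -
  note I = region_integrable[OF tf strip_borel(1) subset_refl]
  have e: "indicator (strip T) z *\<^sub>R lin (G z) q a b = (indicator (strip T) z * fst (G z)) *\<^sub>R q
     + (indicator (strip T) z * (snd (G z) $ 1)) *\<^sub>R a + (indicator (strip T) z * (snd (G z) $ 2)) *\<^sub>R b" for z
    by (simp add: lin_def scaleR_add_right)
  show "integrable lborel (\<lambda>z. indicator (strip T) z *\<^sub>R lin (G z) q a b)" unfolding e using I by auto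
  have t: "(\<integral>z. indicator (strip T) z * fst (G z) \<partial>lborel) = - (\<integral>x. \<phi> (0, x) \<partial>lborel)"
    using transport_identity(3)[OF tf T, of UNIV 0] by (simp add: inner_prod_def)
  have x: "(\<integral>z. indicator (strip T) z * (snd (G z) $ i) \<partial>lborel) = 0" for i
    using edge_tangential[OF tf, of UNIV "(0, axis i 1)"] by (simp add: inner_prod_def inner_axis)
  show "(\<integral>z. indicator (strip T) z *\<^sub>R lin (G z) q a b \<partial>lborel) = - (\<integral>x. \<phi> (0, x) \<partial>lborel) *\<^sub>R q"
    unfolding e using I(1) I(2)[of 1] I(2)[of 2] by (simp add: t x)
  show "integrable lborel (\<lambda>x. \<phi> (0, x))" using transport_identity(2)[OF tf T, of UNIV] by simp
  show "integrable lborel (\<lambda>x. indicator {x::real^2. x $ 2 < 0} x * \<phi> (0, x))"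
    by (rule transport_identity(2)[OF tf T]) measurable
qed

text \<open>Written as the rightmost state plus jumps, the integrand leaves one Rankine-Hugoniot
  defect per edge, while all initial terms cancel against the data because the jumps add up to
  \<open>q ul - q ur\<close>. The remainder \<open>h\<close> takes up the oscillation of the
  turbulent zone about its average.\<close>

lemma weak_pairing_fan:
  fixes q :: "state \<Rightarrow> 'a::euclidean_space"
  assumes tf: "test_function T \<phi> G" and T: "T > 0" and I: "finite I"
    and dec: "\<And>z. z \<in> strip T \<Longrightarrow> fst (G z) *\<^sub>R q (U z) + F (U z) (snd (G z)) = lin (G z) (q ur) ar br
      + (\<Sum>i\<in>I. indicator (below T (\<nu> i)) z *\<^sub>R lin (G z) (dq i) (da i) (db i)) + h z"
    and h: "integrable lborel (\<lambda>z. indicator (strip T) z *\<^sub>R h z)" "(\<integral>z. indicator (strip T) z *\<^sub>R h z \<partial>lborel) = 0"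
    and init: "q ul = q ur + (\<Sum>i\<in>I. dq i)"
  shows "weak_pairing T q F (riemann_data ul ur) U \<phi> G = (\<Sum>i\<in>I. edge T G (\<nu> i) *\<^sub>R (db i - \<nu> i *\<^sub>R dq i))"
proof -
  define A where "A z = indicator (strip T) z *\<^sub>R lin (G z) (q ur) ar br
      + (\<Sum>i\<in>I. indicator (below T (\<nu> i)) z *\<^sub>R lin (G z) (dq i) (da i) (db i)) + indicator (strip T) z *\<^sub>R h z" for z
  have e: "indicator ({0<..<T} \<times> UNIV) z *\<^sub>R (fst (G z) *\<^sub>R q (U z) + F (U z) (snd (G z))) = A z" for z
  proof (cases "z \<in> strip T")
    case True
    then show ?thesis using dec[OF True] unfolding A_def strip_def[symmetric] by simp
  next
    case False
    then have "z \<notin> below T (\<nu> i)" for i by (auto simp: below_def)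
    then show ?thesis using False unfolding A_def strip_def[symmetric] by simp
  qed
  have Ai: "integrable lborel A" unfolding A_def[abs_def]
    by (intro Bochner_Integration.integrable_add Bochner_Integration.integrable_sum lin_integral_strip(1)[OF tf T]
        lin_integral_below(1)[OF tf T] h)
  have "integral\<^sup>L lborel A = - (\<integral>x. \<phi> (0, x) \<partial>lborel) *\<^sub>R q ur
      + (\<Sum>i\<in>I. edge T G (\<nu> i) *\<^sub>R (db i - \<nu> i *\<^sub>R dq i) - init_below \<phi> *\<^sub>R dq i)"
    unfolding A_def[abs_def]
    by (simp add: h lin_integral_strip[OF tf T] lin_integral_below[OF tf T])
  then have 1: "integral\<^sup>L lborel A = - (\<integral>x. \<phi> (0, x) \<partial>lborel) *\<^sub>R q ur
      + (\<Sum>i\<in>I. edge T G (\<nu> i) *\<^sub>R (db i - \<nu> i *\<^sub>R dq i)) - init_below \<phi> *\<^sub>R (\<Sum>i\<in>I. dq i)"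
    by (simp add: sum_subtractf scaleR_sum_right)
  have "(LINT z : {0<..<T} \<times> UNIV | lebesgue. fst (G z) *\<^sub>R q (U z) + F (U z) (snd (G z))) = integral\<^sup>L lebesgue A"
    unfolding set_lebesgue_integral_def e ..
  also have "\<dots> = integral\<^sup>L lborel A" using Ai by (intro integral_completion) auto
  finally have 2: "(LINT z : {0<..<T} \<times> UNIV | lebesgue. fst (G z) *\<^sub>R q (U z) + F (U z) (snd (G z)))
      = integral\<^sup>L lborel A" .
  define B where "B x = \<phi> (0, x) *\<^sub>R q ur + (indicator {x::real^2. x $ 2 < 0} x * \<phi> (0, x)) *\<^sub>R (\<Sum>i\<in>I. dq i)" for x
  have Bi: "integrable lborel B" unfolding B_def[abs_def] using lin_integral_strip(3,4)[OF tf T] by auto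
  have "\<phi> (0, x) *\<^sub>R q (riemann_data ul ur x) = B x" for x
    by (auto simp: B_def riemann_data_def init scaleR_add_right)
  then have "(LINT x | lebesgue. \<phi> (0, x) *\<^sub>R q (riemann_data ul ur x)) = integral\<^sup>L lebesgue B" by simp
  also have "\<dots> = integral\<^sup>L lborel B" using Bi by (intro integral_completion) auto
  also have "\<dots> = (\<integral>x. \<phi> (0, x) \<partial>lborel) *\<^sub>R q ur + init_below \<phi> *\<^sub>R (\<Sum>i\<in>I. dq i)"
    unfolding B_def[abs_def] using lin_integral_strip(3,4)[OF tf T] by (simp add: init_below_def)
  finally show ?thesis unfolding weak_pairing_def using 1 2 by simp
qed

section \<open>Bounded fields and the wedge-shaped zone\<close>

lemma bounded_field_locally_integrable:
  assumes U: "U \<in> borel_measurable borel" "\<And>z. U z \<in> C" and C: "compact C"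
    and f: "continuous_on C f" "(\<lambda>z. f (U z)) \<in> borel_measurable borel"
  shows "locally_integrable T (\<lambda>z. f (U z))"
  unfolding locally_integrable_def
proof (intro allI impI)
  fix K :: "spacetime set" assume K: "compact K \<and> K \<subseteq> {0..<T} \<times> UNIV"
  have "compact (f ` C)" by (intro compact_continuous_image f C)
  then obtain M where M: "\<And>u. u \<in> C \<Longrightarrow> norm (f u) \<le> M"
    using compact_imp_bounded[of "f ` C"] unfolding bounded_iff by blast
  define A where "A = K \<inter> strip T"
  have Km: "K \<in> sets borel" using K by (simp add: compact_imp_closed borel_closed)
  then have Am: "A \<in> sets borel" by (simp add: A_def)
  have iA: "integrable lborel (\<lambda>z. indicator A z *\<^sub>R f (U z))"
  proof (rule Bochner_Integration.integrable_bound)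
    have "emeasure lborel A < \<infinity>" using emeasure_bounded_finite[of A] K compact_imp_bounded bounded_subset
      unfolding A_def by (metis inf_le1)
    then show "integrable lborel (\<lambda>z. max M 0 * indicator A z :: real)"
      using Am by (intro integrable_mult_right integrable_real_indicator) auto
    have "norm (indicator A z *\<^sub>R f (U z)) \<le> norm (max M 0 * indicator A z :: real)" for z
      using M[OF U(2)[of z]] by (cases "z \<in> A") auto
    then show "AE z in lborel. norm (indicator A z *\<^sub>R f (U z)) \<le> norm (max M 0 * indicator A z :: real)" by simp
    show "(\<lambda>z. indicator A z *\<^sub>R f (U z)) \<in> borel_measurable lborel"
      by (rule borel_measurable_scaleR[OF borel_measurable_indicator]) (use Am f in simp_all)
  qed
  have "integrable lebesgue (\<lambda>z. indicator A z *\<^sub>R f (U z))"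
    using integrable_completion[OF borel_measurable_integrable[OF iA]] iA by blast
  then show "set_integrable lebesgue (K \<inter> {0<..<T} \<times> UNIV) (\<lambda>z. f (U z))"
    by (simp add: set_integrable_def A_def strip_def)
qed

text \<open>On a compact set of positive states all densities and fluxes are bounded continuous
  functions, so only the weak equations and the entropy inequality remain to be checked.\<close>

lemma bounded_field_admissible:
  assumes U[measurable]: "U \<in> borel_measurable borel" and UC: "\<And>z. U z \<in> C" and C: "compact C"
    and pos: "\<And>u. u \<in> C \<Longrightarrow> positive_state u"
    and eq: "\<And>\<phi> G. test_function T \<phi> G \<Longrightarrow> weak_pairing T dens mass_flux U0 U \<phi> G = 0"
      "\<And>\<phi> G. test_function T \<phi> G \<Longrightarrow> weak_pairing T momentum momentum_flux U0 U \<phi> G = 0"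
      "\<And>\<phi> G. test_function T \<phi> G \<Longrightarrow> weak_pairing T (energy cv) (energy_flux cv) U0 U \<phi> G = 0"
      "\<And>\<phi> G. test_function T \<phi> G \<Longrightarrow> (\<And>z. z \<in> {0..<T} \<times> UNIV \<Longrightarrow> \<phi> z \<ge> 0) \<Longrightarrow>
         weak_pairing T (entropy_density cv) (entropy_flux cv) U0 U \<phi> G \<le> 0"
  shows "entropy_admissible cv T U0 U"
proof -
  have p: "0 < fst u" "0 < fst (snd u)" if "u \<in> C" for u using pos[OF that] by (auto simp: positive_state_def)
  have c: "continuous_on C (\<lambda>u. fst u)" "continuous_on C (\<lambda>u. fst (snd u))" "continuous_on C (\<lambda>u. snd (snd u))"
    by (intro continuous_intros)+
  have m1[measurable]: "(\<lambda>z. fst (U z)) \<in> borel_measurable borel"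
    by (rule measurable_compose[OF U borel_measurable_continuous_onI]) (intro continuous_intros)
  have m2[measurable]: "(\<lambda>z. fst (snd (U z))) \<in> borel_measurable borel"
    by (rule measurable_compose[OF U borel_measurable_continuous_onI]) (intro continuous_intros)
  have m3[measurable]: "(\<lambda>z. snd (snd (U z))) \<in> borel_measurable borel"
    by (rule measurable_compose[OF U borel_measurable_continuous_onI]) (intro continuous_intros)
  have m4[measurable]: "(\<lambda>z. snd (snd (U z)) $ i) \<in> borel_measurable borel" for i
    by (rule measurable_compose[OF m3 borel_measurable_continuous_onI]) (intro continuous_intros)
  note LI = bounded_field_locally_integrable[OF U UC C]
  have ln: "continuous_on C (\<lambda>u. ln (fst u))" "continuous_on C (\<lambda>u. ln (fst (snd u)))"
  proof -
    have "fst u \<noteq> 0" "fst (snd u) \<noteq> 0" if "u \<in> C" for u using p[OF that] by simp_all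
    then show "continuous_on C (\<lambda>u. ln (fst u))" "continuous_on C (\<lambda>u. ln (fst (snd u)))"
      by (intro continuous_on_ln c ballI; blast)+
  qed
  have cE: "continuous_on C (energy cv)" "continuous_on C pressure" "continuous_on C (entropy_density cv)"
    unfolding energy_def[abs_def] pressure_def[abs_def] entropy_density_def[abs_def] entropy_def internal_energy_def
    by (intro continuous_intros c ln)+
  have mE[measurable]: "(\<lambda>z. energy cv (U z)) \<in> borel_measurable borel"
      "(\<lambda>z. pressure (U z)) \<in> borel_measurable borel"
    "(\<lambda>z. entropy_density cv (U z)) \<in> borel_measurable borel"
    unfolding energy_def pressure_def entropy_density_def entropy_def internal_energy_def by measurable
  show ?thesis unfolding entropy_admissible_def
  proof (intro conjI allI impI)
    have "U \<in> borel_measurable lebesgue" using U by (simp add: measurable_completion)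
    then show "U \<in> borel_measurable (lebesgue_on ({0<..<T} \<times> UNIV))" by (rule measurable_restrict_space1)
    show "AE z in lebesgue_on ({0<..<T} \<times> UNIV). 0 < dens (U z) \<and> 0 < temp (U z)" using p UC by simp
    show "locally_integrable T (\<lambda>z. dens (U z))" by (rule LI) (use c in measurable)
    show "locally_integrable T (\<lambda>z. momentum (U z))" unfolding momentum_def
      by (rule LI) (intro continuous_intros c, measurable)
    show "locally_integrable T (\<lambda>z. dens (U z) * vel (U z) $ i * vel (U z) $ j)" for i j
      by (rule LI[of "\<lambda>u. dens u * vel u $ i * vel u $ j"]) (intro continuous_intros c, measurable)
    show "locally_integrable T (\<lambda>z. pressure (U z))" by (rule LI) (use cE in measurable)
    show "locally_integrable T (\<lambda>z. energy cv (U z))" by (rule LI) (use cE in measurable)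
    show "locally_integrable T (\<lambda>z. (energy cv (U z) + pressure (U z)) *\<^sub>R vel (U z))"
      by (rule LI[of "\<lambda>u. (energy cv u + pressure u) *\<^sub>R vel u"]) (intro continuous_intros c cE, measurable)
    show "locally_integrable T (\<lambda>z. entropy_density cv (U z))" by (rule LI) (use cE in measurable)
    show "locally_integrable T (\<lambda>z. entropy_density cv (U z) *\<^sub>R vel (U z))"
      by (rule LI[of "\<lambda>u. entropy_density cv u *\<^sub>R vel u"]) (intro continuous_intros c cE, measurable)
  qed (use eq in auto)
qed

text \<open>Half-open, as a difference of two \<open>below\<close> sets, to fit the indicator
  calculus of fans; for \<nu> > 0 it differs from the open wedge only on the plane x2 = -\<nu>
  t.\<close>

definition wedge :: "real \<Rightarrow> real \<Rightarrow> spacetime set" where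
  "wedge T \<nu> = below T \<nu> - below T (- \<nu>)"

lemma integrable_bounded_mult:
  fixes f g :: "'a::euclidean_space \<Rightarrow> real"
  assumes f: "integrable lborel f" and g: "g \<in> borel_measurable borel" "\<And>z. \<bar>g z\<bar> \<le> C"
  shows "integrable lborel (\<lambda>z. g z * f z)"
proof (rule Bochner_Integration.integrable_bound)
  show "integrable lborel (\<lambda>z. C * f z)" using f by simp
  show "(\<lambda>z. g z * f z) \<in> borel_measurable lborel" using f g by (intro borel_measurable_times) auto
  have "norm (g z * f z) \<le> norm (C * f z)" for z
    using g(2)[of z] abs_ge_zero[of "g z"] by (auto simp: abs_mult intro!: mult_right_mono)
  then show "AE z in lborel. norm (g z * f z) \<le> norm (C * f z)" by simp
qed

text \<open>Time is bounded by T and hence |x2| by \<nu> T, so the pieces of the open wedge between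
  consecutive integers in x1 are bounded and \<open>open_set_solution\<close> applies.\<close>

lemma wedge_solution:
  assumes T: "T > 0" and \<nu>: "\<nu> > 0" and u0: "cmod u0 < 1"
  obtains v where "v \<in> borel_measurable borel" "\<And>y. (cmod (v y))^2 = 2"
    "\<And>\<phi> G. test_function T \<phi> G \<Longrightarrow>
       integrable lborel (\<lambda>z. indicator (wedge T \<nu>) z * (v z \<bullet> cgrad (G z))) \<and>
       (\<integral>z. indicator (wedge T \<nu>) z * (v z \<bullet> cgrad (G z)) \<partial>lborel) = 0"
    "\<And>\<phi> G. test_function T \<phi> G \<Longrightarrow>
       integrable lborel (\<lambda>z. indicator (wedge T \<nu>) z *\<^sub>R (of_real (fst (G z)) * v z
           + (v z ^ 2 / 2 - u0) * cnj (cgrad (G z)))) \<and>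
       (\<integral>z. indicator (wedge T \<nu>) z *\<^sub>R (of_real (fst (G z)) * v z + (v z ^ 2 / 2 - u0) * cnj (cgrad (G z))) \<partial>lborel)
           = 0"
proof -
  define \<Omega> where "\<Omega> = {z \<in> strip T. \<bar>snd z $ 2\<bar> < \<nu> * fst z}"
  have op: "open \<Omega>"
  proof -
    have "\<Omega> = strip T \<inter> {z. \<bar>snd z $ 2\<bar> < \<nu> * fst z}" by (auto simp: \<Omega>_def)
    then show ?thesis using strip_open by (auto intro!: open_Int open_Collect_less continuous_intros)
  qed
  have bd: "bounded {z \<in> \<Omega>. real_of_int m < snd z $ 1 \<and> snd z $ 1 < real_of_int m + 1}" for m
  proof (rule bounded_subset[OF bounded_cbox])
    show "{z \<in> \<Omega>. real_of_int m < snd z $ 1 \<and> snd z $ 1 < real_of_int m + 1}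
      \<subseteq> cbox (0, vector [real_of_int m, - \<nu> * T]) (T, vector [real_of_int m + 1, \<nu> * T])"
    proof
      fix z assume z: "z \<in> {z \<in> \<Omega>. real_of_int m < snd z $ 1 \<and> snd z $ 1 < real_of_int m + 1}"
      then have "0 < fst z" "fst z < T" "\<bar>snd z $ 2\<bar> < \<nu> * fst z" by (auto simp: \<Omega>_def strip_def)
      moreover from this have "\<nu> * fst z \<le> \<nu> * T" using \<nu> by simp
      ultimately show "z \<in> cbox (0, vector [real_of_int m, - \<nu> * T]) (T, vector [real_of_int m + 1, \<nu> * T])"
        using z by (auto simp: mem_box_spacetime abs_less_iff)
    qed
  qed
  obtain v where v: "v \<in> borel_measurable borel" "\<And>y. (cmod (v y))^2 = 2"
    "\<And>S \<phi> G. open S \<Longrightarrow> \<Omega> \<subseteq> S \<Longrightarrow> C1_on S \<phi> G \<Longrightarrow> integrable lborel (\<lambda>y. indicator \<Omega> y * norm (G y)) \<Longrightarrow>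
      (\<integral>y. indicator \<Omega> y *\<^sub>R (v y \<bullet> cgrad (G y)) \<partial>lborel) = 0 \<and>
      (\<integral>y. indicator \<Omega> y *\<^sub>R (of_real (fst (G y)) * v y + (v y ^ 2 / 2 - u0) * cnj (cgrad (G y))) \<partial>lborel) = 0"
    by (rule open_set_solution[OF op bd u0]) (rule that; assumption)
  have \<Omega>m: "\<Omega> \<in> sets borel" using op by auto
  have \<Omega>s: "\<Omega> \<subseteq> strip T" by (auto simp: \<Omega>_def)
  have Wm[measurable]: "wedge T \<nu> \<in> sets borel" by (simp add: wedge_def)
  have Ws: "wedge T \<nu> \<subseteq> strip T" by (auto simp: wedge_def below_def)
  have AEW: "AE z in lborel. indicator (wedge T \<nu>) z = (indicator \<Omega> z :: real)"
  proof -
    have "negligible {z :: spacetime. (\<nu>, axis 2 1) \<bullet> z = 0}"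
      by (rule negligible_hyperplane) (use \<nu> in \<open>auto simp: zero_prod_def\<close>)
    moreover have "{z :: spacetime. (\<nu>, axis 2 1) \<bullet> z = 0} \<in> sets borel"
      by (intro borel_closed closed_Collect_eq continuous_intros)
    ultimately have "{z :: spacetime. (\<nu>, axis 2 1) \<bullet> z = 0} \<in> null_sets lborel"
      by (simp add: negligible_iff_null_sets null_sets_def)
    from AE_not_in[OF this] show ?thesis
    proof eventually_elim
      case (elim z)
      then have "\<nu> * fst z + snd z $ 2 \<noteq> 0" by (simp add: inner_prod_def inner_axis inner_commute)
      then show ?case by (auto simp: wedge_def below_def \<Omega>_def indicator_def abs_less_iff)
    qed
  qed
  have m[measurable]: "(\<lambda>z. Re (v z)) \<in> borel_measurable borel" "(\<lambda>z. Im (v z)) \<in> borel_measurable borel"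
    using v(1) by measurable
  have vm[measurable]: "v \<in> borel_measurable borel" by (rule v)
  have vb: "\<bar>Re (v z)\<bar> \<le> 2" "\<bar>Im (v z)\<bar> \<le> 2" "cmod (v z ^ 2 / 2 - u0) \<le> 2" for z
  proof -
    have "cmod (v z) \<le> 2" by (rule power2_le_imp_le) (simp_all add: v(2))
    then show "\<bar>Re (v z)\<bar> \<le> 2" "\<bar>Im (v z)\<bar> \<le> 2"
      using abs_Re_le_cmod[of "v z"] abs_Im_le_cmod[of "v z"] by linarith+
    have "cmod (v z ^ 2 / 2) = 1" using v(2)[of z] by (simp add: norm_divide norm_power)
    then show "cmod (v z ^ 2 / 2 - u0) \<le> 2" using norm_triangle_ineq4[of "v z ^ 2 / 2" u0] u0 by linarith
  qed
  show ?thesis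
  proof (rule that[of v])
    fix \<phi> G assume tf: "test_function T \<phi> G"
    note IW = region_integrable[OF tf Wm Ws] and I\<Omega> = region_integrable[OF tf \<Omega>m \<Omega>s]
    note Z = v(3)[OF strip_open \<Omega>s test_function_C1[OF tf] I\<Omega>(3)]
    have A1: "integrable lborel (\<lambda>z. indicator A z * (v z \<bullet> cgrad (G z)))"
      if "integrable lborel (\<lambda>z. indicator A z * (snd (G z) $ 1))"
          "integrable lborel (\<lambda>z. indicator A z * (snd (G z) $ 2))" for A
    proof -
      have "indicator A z * (v z \<bullet> cgrad (G z)) = Re (v z) * (indicator A z * (snd (G z) $ 1))
          + Im (v z) * (indicator A z * (snd (G z) $ 2))" for z
        by (simp add: inner_complex_def cgrad_def algebra_simps)
      then show ?thesis using integrable_bounded_mult[OF that(1) m(1) vb(1)] integrable_bounded_mult[OF that(2) m(2)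
          vb(2)] by simp
    qed
    show "integrable lborel (\<lambda>z. indicator (wedge T \<nu>) z * (v z \<bullet> cgrad (G z))) \<and>
       (\<integral>z. indicator (wedge T \<nu>) z * (v z \<bullet> cgrad (G z)) \<partial>lborel) = 0"
    proof
      show i: "integrable lborel (\<lambda>z. indicator (wedge T \<nu>) z * (v z \<bullet> cgrad (G z)))" by (rule A1[OF IW(2) IW(2)])
      have "(\<integral>z. indicator (wedge T \<nu>) z * (v z \<bullet> cgrad (G z)) \<partial>lborel)
          = (\<integral>z. indicator \<Omega> z * (v z \<bullet> cgrad (G z)) \<partial>lborel)"
        by (rule integral_cong_AE) (use A1[OF IW(2) IW(2)] A1[OF I\<Omega>(2) I\<Omega>(2)] AEW in auto)
      then show "(\<integral>z. indicator (wedge T \<nu>) z * (v z \<bullet> cgrad (G z)) \<partial>lborel) = 0" using Z by simp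
    qed
    have A2: "integrable lborel (\<lambda>z. indicator A z *\<^sub>R (of_real (fst (G z)) * v z
        + (v z ^ 2 / 2 - u0) * cnj (cgrad (G z))))"
      if i: "integrable lborel (\<lambda>z. indicator A z * fst (G z))"
          "\<And>i. integrable lborel (\<lambda>z. indicator A z * (snd (G z) $ i))" for A
    proof -
      define p where "p z = Re (v z ^ 2 / 2 - u0)" for z
      define r where "r z = Im (v z ^ 2 / 2 - u0)" for z
      have pm: "p \<in> borel_measurable borel" "r \<in> borel_measurable borel" unfolding p_def[abs_def] r_def[abs_def]
          by measurable
      have pb: "\<bar>p z\<bar> \<le> 2" "\<bar>r z\<bar> \<le> 2" for z
        using abs_Re_le_cmod[of "v z ^ 2 / 2 - u0"] abs_Im_le_cmod[of "v z ^ 2 / 2 - u0"] vb(3)[of z]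
        unfolding p_def r_def by linarith+
      define re where "re z = Re (v z) * (indicator A z * fst (G z)) + p z * (indicator A z * (snd (G z) $ 1))
          + r z * (indicator A z * (snd (G z) $ 2))" for z
      define im where "im z = Im (v z) * (indicator A z * fst (G z)) + r z * (indicator A z * (snd (G z) $ 1))
          - p z * (indicator A z * (snd (G z) $ 2))" for z
      have "indicator A z *\<^sub>R (of_real (fst (G z)) * v z + (v z ^ 2 / 2 - u0) * cnj (cgrad (G z))) = of_real (re z)
          + \<i> * of_real (im z)" for z
      proof -
        have eq: "v z ^ 2 / 2 - u0 = Complex (p z) (r z)" by (simp add: p_def r_def complex_eq_iff)
        show ?thesis unfolding eq by (simp add: complex_eq_iff re_def im_def cgrad_def algebra_simps)
      qed
      moreover have "integrable lborel re" "integrable lborel im" unfolding re_def[abs_def] im_def[abs_def]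
        by (intro Bochner_Integration.integrable_add Bochner_Integration.integrable_diff
             integrable_bounded_mult[OF i(1) m(1) vb(1)] integrable_bounded_mult[OF i(1) m(2) vb(2)]
             integrable_bounded_mult[OF i(2) pm(1) pb(1)] integrable_bounded_mult[OF i(2) pm(2) pb(2)])+
      ultimately show ?thesis by (auto intro!: integrable_of_real)
    qed
    show "integrable lborel (\<lambda>z. indicator (wedge T \<nu>) z *\<^sub>R (of_real (fst (G z)) * v z
        + (v z ^ 2 / 2 - u0) * cnj (cgrad (G z)))) \<and>
       (\<integral>z. indicator (wedge T \<nu>) z *\<^sub>R (of_real (fst (G z)) * v z + (v z ^ 2 / 2 - u0) * cnj (cgrad (G z))) \<partial>lborel)
           = 0"
    proof
      show i: "integrable lborel (\<lambda>z. indicator (wedge T \<nu>) z *\<^sub>R (of_real (fst (G z)) * v z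
          + (v z ^ 2 / 2 - u0) * cnj (cgrad (G z))))"
        by (rule A2[OF IW(1,2)])
      have "(\<integral>z. indicator (wedge T \<nu>) z *\<^sub>R (of_real (fst (G z)) * v z
          + (v z ^ 2 / 2 - u0) * cnj (cgrad (G z))) \<partial>lborel)
        = (\<integral>z. indicator \<Omega> z *\<^sub>R (of_real (fst (G z)) * v z + (v z ^ 2 / 2 - u0) * cnj (cgrad (G z))) \<partial>lborel)"
        by (rule integral_cong_AE) (rule borel_measurable_integrable[OF A2[OF IW(1,2)]], rule
            borel_measurable_integrable[OF A2[OF I\<Omega>(1,2)]],
            use AEW in \<open>eventually_elim, simp\<close>)
      then show "(\<integral>z. indicator (wedge T \<nu>) z *\<^sub>R (of_real (fst (G z)) * v z
          + (v z ^ 2 / 2 - u0) * cnj (cgrad (G z))) \<partial>lborel) = 0"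
        using Z by simp
    qed
  qed (use v in auto)
qed

section \<open>The turbulent solution\<close>

definition st :: "real \<Rightarrow> real \<Rightarrow> real \<Rightarrow> real \<Rightarrow> state" where
  "st r th a b = (r, th, vector [a, b])"

text \<open>The vortex sheet \<open>uL\<close>, \<open>uR\<close>; \<open>bL\<close>, \<open>bR\<close> are the states behind shocks of Mach number
  \<open>3/2\<close> and speed \<open>\<plusminus>3/4\<close>, and \<open>uM\<close> is the turbulent zone \<open>\<bar>x\<^sub>2\<bar> < 2t/5\<close>, in which \<open>\<bar>v\<bar>\<^sup>2 = 2\<close>
  and the averages of \<open>v\<close> and of the traceless part of \<open>v \<otimes> v\<close> are \<open>0\<close> and \<open>(47/96, - 4/5)\<close>.\<close>

definition "uL = st 1 (3/20) (-2) 0"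
definition "uR = st 1 (3/20) 2 0"
definition "bL = st (12/7) (287/1280) (-2) (-5/16)"
definition "bR = st (12/7) (287/1280) 2 (5/16)"
definition "uM w = st (3/8) (187/480) (Re w) (Im w)" for w :: complex

lemmas states = uL_def uR_def bL_def bR_def uM_def st_def

definition turb :: "(spacetime \<Rightarrow> complex) \<Rightarrow> field" where
  "turb v z = (if snd z $ 2 < - (3/4) * fst z then uL else if snd z $ 2 < - (2/5) * fst z then bL
     else if snd z $ 2 < 2/5 * fst z then uM (v z) else if snd z $ 2 < 3/4 * fst z then bR else uR)"

text \<open>The zone enters through the averages \<open>qm\<close>, \<open>am\<close>,
  \<open>bm\<close>, and the deviation from them is required to integrate to zero. What remains are
  the jump defects at the four slopes, with the averages standing for the state of the zone.\<close>

lemma turb_pairing: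
  fixes q :: "state \<Rightarrow> 'a::euclidean_space"
  assumes tf: "test_function T \<phi> G" and T: "T > 0"
    and F: "\<And>u \<xi>. F u \<xi> = (\<xi> $ 1) *\<^sub>R F u (axis 1 1) + (\<xi> $ 2) *\<^sub>R F u (axis 2 1)"
    and h: "\<And>z. h z = indicator (wedge T (2/5)) z *\<^sub>R (fst (G z) *\<^sub>R q (uM (v z)) + F (uM (v z)) (snd (G z))
        - lin (G z) qm am bm)"
    and hi: "integrable lborel h" "integral\<^sup>L lborel h = 0"
  shows "weak_pairing T q F (riemann_data uL uR) (turb v) \<phi> G =
     edge T G (-3/4) *\<^sub>R (F uL (axis 2 1) - F bL (axis 2 1) + (3/4) *\<^sub>R (q uL - q bL))
   + edge T G (-2/5) *\<^sub>R (F bL (axis 2 1) - bm + (2/5) *\<^sub>R (q bL - qm))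
   + edge T G (2/5) *\<^sub>R (bm - F bR (axis 2 1) - (2/5) *\<^sub>R (qm - q bR))
   + edge T G (3/4) *\<^sub>R (F bR (axis 2 1) - F uR (axis 2 1) - (3/4) *\<^sub>R (q bR - q uR))"
proof -
  let ?e1 = "axis 1 1 :: real^2" and ?e2 = "axis 2 1 :: real^2"
  define \<nu> where "\<nu> = (\<lambda>i::nat. if i = 0 then -3/4 else if i = 1 then -2/5 else if i = 2 then 2/5 else 3/4 :: real)"
  define dq where "dq = (\<lambda>i::nat. if i = 0 then q uL - q bL else if i = 1 then q bL - qm else if i = 2 then qm
      - q bR else q bR - q uR)"
  define da where "da = (\<lambda>i::nat. if i = 0 then F uL ?e1 - F bL ?e1 else if i = 1 then F bL ?e1 - am else if i
      = 2 then am - F bR ?e1 else F bR ?e1 - F uR ?e1)"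
  define db where "db = (\<lambda>i::nat. if i = 0 then F uL ?e2 - F bL ?e2 else if i = 1 then F bL ?e2 - bm else if i
      = 2 then bm - F bR ?e2 else F bR ?e2 - F uR ?e2)"
  have lin: "fst g *\<^sub>R q u + F u (snd g) = lin g (q u) (F u ?e1) (F u ?e2)" for g u
    by (subst F) (simp add: lin_def)
  have "weak_pairing T q F (riemann_data uL uR) (turb v) \<phi> G
      = (\<Sum>i\<in>{0,1,2,3}. edge T G (\<nu> i) *\<^sub>R (db i - \<nu> i *\<^sub>R dq i))"
  proof (rule weak_pairing_fan[OF tf T, where h=h and da=da and ar="F uR ?e1" and br="F uR ?e2"])
    fix z assume z: "z \<in> strip T"
    then have t: "fst z > 0" by (auto simp: strip_def)
    then have mono: "- (3/4) * fst z < - (2/5) * fst z" "- (2/5) * fst z < 2/5 * fst z" "2/5 * fst z < 3/4 * fst z"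
        by simp_all
    have b: "z \<in> below T c \<longleftrightarrow> snd z $ 2 < c * fst z" for c using z by (simp add: below_def)
    consider "snd z $ 2 < - (3/4) * fst z" | "\<not> snd z $ 2 < - (3/4) * fst z" "snd z $ 2 < - (2/5) * fst z"
      | "\<not> snd z $ 2 < - (2/5) * fst z" "snd z $ 2 < 2/5 * fst z" | "\<not> snd z $ 2 < 2/5 * fst z"
          "snd z $ 2 < 3/4 * fst z"
      | "\<not> snd z $ 2 < 3/4 * fst z" by blast
    then show "fst (G z) *\<^sub>R q (turb v z) + F (turb v z) (snd (G z)) = lin (G z) (q uR) (F uR ?e1) (F uR ?e2)
      + (\<Sum>i\<in>{0,1,2,3}. indicator (below T (\<nu> i)) z *\<^sub>R lin (G z) (dq i) (da i) (db i)) + h z"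
    proof cases
      case 1
      have "turb v z = uL" using 1 by (simp add: turb_def)
      moreover have "indicator (below T (-3/4)) z = (1::real)" "indicator (below T (-2/5)) z = (1::real)"
        "indicator (below T (2/5)) z = (1::real)" "indicator (below T (3/4)) z = (1::real)"
            "indicator (wedge T (2/5)) z = (0::real)"
        using 1 mono unfolding wedge_def indicator_def by (auto simp: b)
      ultimately show ?thesis unfolding lin h by (simp add: lin_def \<nu>_def dq_def da_def db_def algebra_simps)
    next
      case 2
      have "turb v z = bL" using 2 mono by (simp add: turb_def)
      moreover have "indicator (below T (-3/4)) z = (0::real)" "indicator (below T (-2/5)) z = (1::real)"
        "indicator (below T (2/5)) z = (1::real)" "indicator (below T (3/4)) z = (1::real)"
            "indicator (wedge T (2/5)) z = (0::real)"
        using 2 mono unfolding wedge_def indicator_def by (auto simp: b)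
      ultimately show ?thesis unfolding lin h by (simp add: lin_def \<nu>_def dq_def da_def db_def algebra_simps)
    next
      case 3
      have "turb v z = uM (v z)" using 3 mono by (simp add: turb_def)
      moreover have "indicator (below T (-3/4)) z = (0::real)" "indicator (below T (-2/5)) z = (0::real)"
        "indicator (below T (2/5)) z = (1::real)" "indicator (below T (3/4)) z = (1::real)"
            "indicator (wedge T (2/5)) z = (1::real)"
        using 3 mono unfolding wedge_def indicator_def by (auto simp: b)
      ultimately show ?thesis unfolding h lin by (simp add: lin_def \<nu>_def dq_def da_def db_def algebra_simps)
    next
      case 4
      have "turb v z = bR" using 4 mono by (simp add: turb_def)
      moreover have "indicator (below T (-3/4)) z = (0::real)" "indicator (below T (-2/5)) z = (0::real)"
        "indicator (below T (2/5)) z = (0::real)" "indicator (below T (3/4)) z = (1::real)"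
            "indicator (wedge T (2/5)) z = (0::real)"
        using 4 mono unfolding wedge_def indicator_def by (auto simp: b)
      ultimately show ?thesis unfolding lin h by (simp add: lin_def \<nu>_def dq_def da_def db_def algebra_simps)
    next
      case 5
      have "turb v z = uR" using 5 mono by (simp add: turb_def)
      moreover have "indicator (below T (-3/4)) z = (0::real)" "indicator (below T (-2/5)) z = (0::real)"
        "indicator (below T (2/5)) z = (0::real)" "indicator (below T (3/4)) z = (0::real)"
            "indicator (wedge T (2/5)) z = (0::real)"
        using 5 mono unfolding wedge_def indicator_def by (auto simp: b)
      ultimately show ?thesis unfolding lin h by (simp add: lin_def \<nu>_def dq_def da_def db_def algebra_simps)
    qed
  next
    have "indicator (strip T) z *\<^sub>R h z = h z" for z unfolding h by (auto simp: indicator_def wedge_def below_def)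
    then show "integrable lborel (\<lambda>z. indicator (strip T) z *\<^sub>R h z)"
        "(\<integral>z. indicator (strip T) z *\<^sub>R h z \<partial>lborel) = 0"
      using hi by simp_all
    show "q uL = q uR + (\<Sum>i\<in>{0,1,2,3}. dq i)" by (simp add: dq_def)
  qed simp
  then show ?thesis by (simp add: \<nu>_def dq_def db_def algebra_simps)
qed

section \<open>Fluxes, energies and entropies of the states\<close>

lemma fluxes_linear:
  "mass_flux u \<xi> = (\<xi> $ 1) *\<^sub>R mass_flux u (axis 1 1) + (\<xi> $ 2) *\<^sub>R mass_flux u (axis 2 1)"
  "momentum_flux u \<xi> = (\<xi> $ 1) *\<^sub>R momentum_flux u (axis 1 1) + (\<xi> $ 2) *\<^sub>R momentum_flux u (axis 2 1)"
  "energy_flux cv u \<xi> = (\<xi> $ 1) *\<^sub>R energy_flux cv u (axis 1 1) + (\<xi> $ 2) *\<^sub>R energy_flux cv u (axis 2 1)"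
  "entropy_flux cv u \<xi> = (\<xi> $ 1) *\<^sub>R entropy_flux cv u (axis 1 1) + (\<xi> $ 2) *\<^sub>R entropy_flux cv u (axis 2 1)"
proof -
  have i: "w \<bullet> \<xi> = (w \<bullet> axis 1 1) * (\<xi> $ 1) + (w \<bullet> axis 2 1) * (\<xi> $ 2)" for w :: "real^2"
    by (simp add: inner_vec_def UNIV_2 sum_2 axis_def)
  have x: "(axis 1 1 :: real^2) $ 1 = 1" "(axis 1 1 :: real^2) $ 2 = 0" "(axis 2 1 :: real^2) $ 1 = 0"
      "(axis 2 1 :: real^2) $ 2 = 1"
    by (simp_all add: axis_def)
  show "mass_flux u \<xi> = (\<xi> $ 1) *\<^sub>R mass_flux u (axis 1 1) + (\<xi> $ 2) *\<^sub>R mass_flux u (axis 2 1)"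
    "energy_flux cv u \<xi> = (\<xi> $ 1) *\<^sub>R energy_flux cv u (axis 1 1) + (\<xi> $ 2) *\<^sub>R energy_flux cv u (axis 2 1)"
    "entropy_flux cv u \<xi> = (\<xi> $ 1) *\<^sub>R entropy_flux cv u (axis 1 1) + (\<xi> $ 2) *\<^sub>R entropy_flux cv u (axis 2 1)"
    by (simp_all add: mass_flux_def energy_flux_def entropy_flux_def i[of "vel u"] algebra_simps)
  show "momentum_flux u \<xi> = (\<xi> $ 1) *\<^sub>R momentum_flux u (axis 1 1) + (\<xi> $ 2) *\<^sub>R momentum_flux u (axis 2 1)"
    unfolding momentum_flux_def i[of "vel u"] by (simp add: vec_eq_iff forall_2 x algebra_simps)
qed

lemma norm_vector2: "(norm (vector [a, b] :: real^2))\<^sup>2 = a\<^sup>2 + b\<^sup>2"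
  unfolding power2_norm_eq_inner by (simp add: inner_vec_def UNIV_2 sum_2 power2_eq_square)

lemma flux_normal:
  "mass_flux u (axis 2 1) = dens u * (vel u $ 2)"
  "energy_flux cv u (axis 2 1) = (energy cv u + pressure u) * (vel u $ 2)"
  "entropy_flux cv u (axis 2 1) = entropy_density cv u * (vel u $ 2)"
  "momentum_flux u (axis 2 1) = vector [dens u * (vel u $ 2) * (vel u $ 1), dens u * (vel u $ 2) * (vel u $ 2)
      + pressure u]"
proof -
  have i: "vel u \<bullet> axis 2 1 = vel u $ 2" by (simp add: inner_axis)
  show "mass_flux u (axis 2 1) = dens u * (vel u $ 2)"
  "energy_flux cv u (axis 2 1) = (energy cv u + pressure u) * (vel u $ 2)"
  "entropy_flux cv u (axis 2 1) = entropy_density cv u * (vel u $ 2)"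
  "momentum_flux u (axis 2 1) = vector [dens u * (vel u $ 2) * (vel u $ 1), dens u * (vel u $ 2) * (vel u $ 2)
      + pressure u]"
    unfolding mass_flux_def energy_flux_def entropy_flux_def momentum_flux_def i
    by (simp_all add: vec_eq_iff forall_2 axis_def)
qed

text \<open>When |w|^2 = 2, density, pressure, energy and entropy do not see the oscillation. The
  fluxes of mass, energy and entropy are then constant multiples of the velocity, and div v = 0
  settles all three laws in the zone.\<close>

lemma uM_flux:
  assumes "(cmod w)^2 = 2"
  shows "mass_flux (uM w) (snd g) = 3/8 * (w \<bullet> cgrad g)"
    "energy (3/2) (uM w) = 3/8 + 3/2 * (187/1280)" "pressure (uM w) = 187/1280"
    "energy_flux (3/2) (uM w) (snd g) = (3/8 + 3/2 * (187/1280) + 187/1280) * (w \<bullet> cgrad g)"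
    "entropy_density cv (uM w) = 3/8 * (cv * ln (187/480) - ln (3/8))"
    "entropy_flux cv (uM w) (snd g) = 3/8 * (cv * ln (187/480) - ln (3/8)) * (w \<bullet> cgrad g)"
    "dens (uM w) = 3/8"
    "vel (uM w) \<bullet> snd g = w \<bullet> cgrad g" "vel (uM w) $ 1 = Re w" "vel (uM w) $ 2 = Im w"
proof -
  have n: "(Re w)\<^sup>2 + (Im w)\<^sup>2 = 2" using assms by (simp add: cmod_power2)
  show v: "vel (uM w) \<bullet> snd g = w \<bullet> cgrad g"
    by (simp add: states inner_vec_def UNIV_2 sum_2 inner_complex_def cgrad_def)
  show d: "dens (uM w) = 3/8" "vel (uM w) $ 1 = Re w" "vel (uM w) $ 2 = Im w" by (simp_all add: states)
  have vn: "(norm (vel (uM w)))\<^sup>2 = 2" using n by (simp add: states norm_vector2)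
  show E: "energy (3/2) (uM w) = 3/8 + 3/2 * (187/1280)"
    unfolding energy_def vn by (simp add: internal_energy_def states)
  show p: "pressure (uM w) = 187/1280" by (simp add: pressure_def states)
  show s: "entropy_density cv (uM w) = 3/8 * (cv * ln (187/480) - ln (3/8))"
    by (simp add: entropy_density_def entropy_def states)
  show "mass_flux (uM w) (snd g) = 3/8 * (w \<bullet> cgrad g)" unfolding mass_flux_def v d ..
  show "energy_flux (3/2) (uM w) (snd g) = (3/8 + 3/2 * (187/1280) + 187/1280) * (w \<bullet> cgrad g)"
    unfolding energy_flux_def v E p ..
  show "entropy_flux cv (uM w) (snd g) = 3/8 * (cv * ln (187/480) - ln (3/8)) * (w \<bullet> cgrad g)"
    unfolding entropy_flux_def v s ..
qed

text \<open>Specific entropies of the data, of the fluid behind a shock (\<open>sb\<close>) and of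
  the turbulent zone (\<open>s1\<close>).\<close>

definition "s0 = 3/2 * ln (3/20 :: real)"
definition "sb = 3/2 * ln (287/1280 :: real) - ln (12/7)"
definition "s1 = 3/2 * ln (187/480 :: real) - ln (3/8)"

lemma entropies:
  "entropy_density (3/2) uL = s0" "entropy_density (3/2) uR = s0"
  "entropy_density (3/2) bL = 12/7 * sb" "entropy_density (3/2) bR = 12/7 * sb"
  "entropy_density (3/2) (uM w) = 3/8 * s1"
  by (simp_all add: entropy_density_def entropy_def states s0_def sb_def s1_def)

lemma state_comps:
  "dens uL = 1" "dens uR = 1" "dens bL = 12/7" "dens bR = 12/7"
  "vel uL $ 1 = -2" "vel uR $ 1 = 2" "vel bL $ 1 = -2" "vel bR $ 1 = 2"
  "vel uL $ 2 = 0" "vel uR $ 2 = 0" "vel bL $ 2 = -5/16" "vel bR $ 2 = 5/16"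
  "pressure uL = 3/20" "pressure uR = 3/20" "pressure bL = 123/320" "pressure bR = 123/320"
  by (simp_all add: pressure_def states)

lemma energies:
  "energy (3/2) uL = 89/40" "energy (3/2) uR = 89/40" "energy (3/2) bL = 9159/2240" "energy (3/2) bR = 9159/2240"
  by (simp_all add: energy_def internal_energy_def states norm_vector2) (simp_all add: power2_eq_square)

text \<open>Twice the specific entropy is ln (\<theta>^3 / \<rho>^2), so rational numbers are
  compared. The fluid gains entropy at the shock and again on entering the zone.\<close>

lemma entropy_order: "s0 < sb" "sb < s1"
proof -
  have l: "2 * (3/2 * ln x - ln y) = ln (x^3 / y^2)" if "x > 0" "y > 0" for x y :: real
    using that by (simp add: ln_div ln_realpow)
  have "2 * s0 = ln ((3/20)^3 / 1^2)" unfolding s0_def using l[of "3/20" 1] by simp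
  also have "\<dots> < ln ((287/1280)^3 / (12/7)^2)"
      by (subst ln_less_cancel_iff) (simp_all add: power2_eq_square power3_eq_cube)
  also have "\<dots> = 2 * sb" unfolding sb_def using l[of "287/1280" "12/7"] by simp
  finally show "s0 < sb" by simp
  have "2 * sb = ln ((287/1280)^3 / (12/7)^2)" unfolding sb_def using l[of "287/1280" "12/7"] by simp
  also have "\<dots> < ln ((187/480)^3 / (3/8)^2)"
      by (subst ln_less_cancel_iff) (simp_all add: power2_eq_square power3_eq_cube)
  also have "\<dots> = 2 * s1" unfolding s1_def using l[of "187/480" "3/8"] by simp
  finally show "sb < s1" by simp
qed

text \<open>The constants are solutions of the jump conditions, so all brackets of
  \<open>turb_pairing\<close> vanish for mass, momentum and energy. For the entropy each bracket is
  a mass flux times a drop from newer to older specific entropy, hence nonpositive.\<close>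

lemma turb_admissible:
  assumes T: "T > 0" and vm: "v \<in> borel_measurable borel" and v2: "\<And>y. (cmod (v y))^2 = 2"
    and Z1: "\<And>\<phi> G. test_function T \<phi> G \<Longrightarrow>
       integrable lborel (\<lambda>z. indicator (wedge T (2/5)) z * (v z \<bullet> cgrad (G z))) \<and>
       (\<integral>z. indicator (wedge T (2/5)) z * (v z \<bullet> cgrad (G z)) \<partial>lborel) = 0"
    and Z2: "\<And>\<phi> G. test_function T \<phi> G \<Longrightarrow>
       integrable lborel (\<lambda>z. indicator (wedge T (2/5)) z *\<^sub>R (of_real (fst (G z)) * v z
           + (v z ^ 2 / 2 - Complex (47/96) (-4/5)) * cnj (cgrad (G z)))) \<and>
       (\<integral>z. indicator (wedge T (2/5)) z *\<^sub>R (of_real (fst (G z)) * v z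
           + (v z ^ 2 / 2 - Complex (47/96) (-4/5)) * cnj (cgrad (G z))) \<partial>lborel) = 0"
  shows "entropy_admissible (3/2) T (riemann_data uL uR) (turb v)"
proof (rule bounded_field_admissible)
  note U = uM_flux[OF v2]
  let ?W = "wedge T (2/5)"
  define C where "C = {uL, bL, bR, uR} \<union> (\<lambda>w. uM w) ` cball 0 2"
  have cuM: "continuous_on S uM" for S
  proof -
    have "uM w = (3/8, 187/480, Re w *\<^sub>R axis 1 1 + Im w *\<^sub>R axis 2 1)" for w
      by (auto simp: states vec_eq_iff forall_2 axis_def)
    then show ?thesis by (auto intro!: continuous_intros)
  qed
  show "compact C" unfolding C_def by (intro compact_Un compact_continuous_image cuM compact_cball finite_imp_compact)
      auto
  show "turb v z \<in> C" for z
  proof -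
    have "cmod (v z) \<le> 2" by (rule power2_le_imp_le) (simp_all add: v2)
    then show ?thesis by (auto simp: turb_def C_def)
  qed
  show "positive_state u" if "u \<in> C" for u using that by (auto simp: C_def positive_state_def states)
  have mM: "(\<lambda>z. uM (v z)) \<in> borel_measurable borel"
    by (rule measurable_compose[OF vm borel_measurable_continuous_onI[OF cuM]])
  have S: "{z::spacetime \<in> space borel. snd z $ 2 < c * fst z} \<in> sets borel" for c
    unfolding space_borel by (intro borel_open) (simp, intro open_Collect_less continuous_intros)
  show "turb v \<in> borel_measurable borel"
    unfolding turb_def[abs_def] by (intro measurable_If S mM measurable_const UNIV_I) (simp_all add: space_borel)
  fix \<phi> G assume tf: "test_function T \<phi> G"
  note z1 = conjunct1[OF Z1[OF tf]] conjunct2[OF Z1[OF tf]]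
  have scal: "integrable lborel h \<and> integral\<^sup>L lborel h = 0"
    if "\<And>z. h z = c * (indicator ?W z * (v z \<bullet> cgrad (G z)))" for h and c :: real
    using z1 unfolding that[abs_def] by simp
  show "weak_pairing T dens mass_flux (riemann_data uL uR) (turb v) \<phi> G = 0"
  proof -
    define h where "h z = indicator ?W z *\<^sub>R (fst (G z) *\<^sub>R dens (uM (v z)) + mass_flux (uM (v z)) (snd (G z))
        - lin (G z) (3/8) 0 0)" for z
    have "h z = 3/8 * (indicator ?W z * (v z \<bullet> cgrad (G z)))" for z
      unfolding h_def U by (simp add: lin_def)
    from scal[OF this] show ?thesis
      by (subst turb_pairing[OF tf T fluxes_linear(1) h_def]) (auto simp: flux_normal state_comps)
  qed
  show "weak_pairing T (energy (3/2)) (energy_flux (3/2)) (riemann_data uL uR) (turb v) \<phi> G = 0"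
  proof -
    let ?E = "3/8 + 3/2 * (187/1280) :: real"
    define h where "h z = indicator ?W z *\<^sub>R (fst (G z) *\<^sub>R energy (3/2) (uM (v z))
        + energy_flux (3/2) (uM (v z)) (snd (G z)) - lin (G z) ?E 0 0)" for z
    have "h z = (?E + 187/1280) * (indicator ?W z * (v z \<bullet> cgrad (G z)))" for z
      unfolding h_def U by (simp add: lin_def)
    from scal[OF this] show ?thesis
      by (subst turb_pairing[OF tf T fluxes_linear(3) h_def])
         (auto simp: flux_normal energies state_comps)
  qed
  show "weak_pairing T (entropy_density (3/2)) (entropy_flux (3/2)) (riemann_data uL uR) (turb v) \<phi> G \<le> 0"
    if pos: "\<And>z. z \<in> {0..<T} \<times> UNIV \<Longrightarrow> \<phi> z \<ge> 0"
  proof -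
    define h where "h z = indicator ?W z *\<^sub>R (fst (G z) *\<^sub>R entropy_density (3/2) (uM (v z))
        + entropy_flux (3/2) (uM (v z)) (snd (G z)) - lin (G z) (3/8 * s1) 0 0)" for z
    have "h z = 3/8 * s1 * (indicator ?W z * (v z \<bullet> cgrad (G z)))" for z
      unfolding h_def U(6) entropies s1_def by (simp add: lin_def)
    note hh = scal[OF this]
    \<comment> \<open>Per unit length and time, 3/4 is the mass crossing a shock and 3/20 = 12/7 *
      (2/5 - 5/16) the mass entering the zone through one edge.\<close>
    have eq: "weak_pairing T (entropy_density (3/2)) (entropy_flux (3/2)) (riemann_data uL uR) (turb v) \<phi> G
      = edge T G (-3/4) * (3/4 * (s0 - sb)) + edge T G (-2/5) * (3/20 * (sb - s1))
        + edge T G (2/5) * (3/20 * (sb - s1)) + edge T G (3/4) * (3/4 * (s0 - sb))"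
      using hh by (subst turb_pairing[OF tf T fluxes_linear(4) h_def])
         (auto simp: flux_normal entropies state_comps field_simps)
    have e: "edge T G c \<ge> 0" for c by (rule edge_nonneg[OF tf pos])
    have "edge T G c * (k * (x - y)) \<le> 0" if "0 \<le> k" "x \<le> y" for c k x y
      using e[of c] that by (intro mult_nonneg_nonpos mult_nonneg_nonpos) auto
    from this[of "3/4" s0 sb "-3/4"] this[of "3/20" sb s1 "-2/5"] this[of "3/20" sb s1 "2/5"] this[of "3/4" s0 sb
        "3/4"]
    show ?thesis unfolding eq using entropy_order by simp
  qed
  show "weak_pairing T momentum momentum_flux (riemann_data uL uR) (turb v) \<phi> G = 0"
  proof -
    let ?p = "47/96 :: real" and ?q = "-4/5 :: real"
    \<comment> \<open>Averaged columns of the momentum flux: since |v|^2 = 2, v tensor v is the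
      identity plus its traceless part, whose average is (?p, ?q); this is multiplied by the density
      3/8, and the pressure is added on the diagonal.\<close>
    let ?am = "vector [3/8 * (1 + ?p) + 187/1280, 3/8 * ?q] :: real^2" and ?bm =
        "vector [3/8 * ?q, 3/8 * (1 - ?p) + 187/1280] :: real^2"
    define h where "h z = indicator ?W z *\<^sub>R (fst (G z) *\<^sub>R momentum (uM (v z)) + momentum_flux (uM (v z)) (snd (G z))
        - lin (G z) 0 ?am ?bm)" for z
    define g where "g z = indicator ?W z *\<^sub>R (of_real (fst (G z)) * v z
        + (v z ^ 2 / 2 - Complex ?p ?q) * cnj (cgrad (G z)))" for z
    have g: "integrable lborel g" "integral\<^sup>L lborel g = 0" using Z2[OF tf] by (simp_all add: g_def[abs_def])
    have hg: "h z = (3/8 * Re (g z)) *\<^sub>R axis 1 1 + (3/8 * Im (g z)) *\<^sub>R axis 2 1" for z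
    proof -
      obtain x y where v: "v z = Complex x y" by (cases "v z")
      have "x\<^sup>2 + y\<^sup>2 = 2" using v2[of z] unfolding cmod_power2 by (simp add: v)
      then have n: "x * x + y * y = 2" by (simp add: power2_eq_square)
      obtain g1 g2 where G12: "snd (G z) $ 1 = g1" "snd (G z) $ 2 = g2" by blast
      have vx: "vel (uM (v z)) \<bullet> snd (G z) = x * g1 + y * g2"
        unfolding U(8) by (simp add: v inner_complex_def cgrad_def G12)
      have vc: "vel (uM (v z)) $ 1 = x" "vel (uM (v z)) $ 2 = y" by (simp_all add: v states)
      define X where "X = fst (G z) *\<^sub>R momentum (uM (v z)) + momentum_flux (uM (v z)) (snd (G z))
          - lin (G z) 0 ?am ?bm"
      have X1: "X $ 1 = 3/8 * (fst (G z) * x + ((x * g1 + y * g2) * x - (1 + ?p) * g1 - ?q * g2))"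
        and X2: "X $ 2 = 3/8 * (fst (G z) * y + ((x * g1 + y * g2) * y - ?q * g1 - (1 - ?p) * g2))"
        unfolding X_def momentum_def momentum_flux_def vx U(3,7) lin_def
        by (simp_all add: vc G12 field_simps)
      \<comment> \<open>The constraint x^2 + y^2 = 2 turns the traceless diagonal entry into x^2 - 1
        or 1 - y^2, the form in which it occurs in the first and in the second momentum
        component.\<close>
      have half: "(x * x - y * y) / 2 = x * x - 1" "(x * x - y * y) / 2 = 1 - y * y" using n by simp_all
      have sq: "v z ^ 2 / 2 = Complex ((x * x - y * y) / 2) (x * y)"
        by (simp add: v power2_eq_square complex_eq_iff)
      have G1: "Re (of_real (fst (G z)) * v z + (v z ^ 2 / 2 - Complex ?p ?q) * cnj (cgrad (G z)))
         = fst (G z) * x + ((x * g1 + y * g2) * x - (1 + ?p) * g1 - ?q * g2)"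
        unfolding sq half(1) by (simp add: v cgrad_def G12 algebra_simps)
      have G2: "Im (of_real (fst (G z)) * v z + (v z ^ 2 / 2 - Complex ?p ?q) * cnj (cgrad (G z)))
         = fst (G z) * y + ((x * g1 + y * g2) * y - ?q * g1 - (1 - ?p) * g2)"
        unfolding sq half(2) by (simp add: v cgrad_def G12 algebra_simps)
      have c1: "h z $ 1 = 3/8 * Re (g z)"
        unfolding h_def g_def X_def[symmetric] vector_scaleR_component X1 scaleR_complex.sel G1 by simp
      have c2: "h z $ 2 = 3/8 * Im (g z)"
        unfolding h_def g_def X_def[symmetric] vector_scaleR_component X2 scaleR_complex.sel G2 by simp
      show ?thesis using c1 c2 by (simp add: vec_eq_iff forall_2 axis_def)
    qed
    have re: "integrable lborel (\<lambda>z. Re (g z))" "(\<integral>z. Re (g z) \<partial>lborel) = 0"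
      and im: "integrable lborel (\<lambda>z. Im (g z))" "(\<integral>z. Im (g z) \<partial>lborel) = 0"
      using g by simp_all
    have "integrable lborel h" "integral\<^sup>L lborel h = 0"
      unfolding hg[abs_def] using re im by simp_all
    then show ?thesis
      by (subst turb_pairing[OF tf T fluxes_linear(2) h_def])
         (auto simp: flux_normal momentum_def state_comps vec_eq_iff forall_2)
  qed
qed

section \<open>Entropy rates\<close>

definition sheet :: field where "sheet z = (if snd z $ 2 < 0 then uL else uR)"

lemma sheet_pairing:
  fixes q :: "state \<Rightarrow> 'a::euclidean_space"
  assumes tf: "test_function T \<phi> G" and T: "T > 0"
    and F: "\<And>u \<xi>. F u \<xi> = (\<xi> $ 1) *\<^sub>R F u (axis 1 1) + (\<xi> $ 2) *\<^sub>R F u (axis 2 1)"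
  shows "weak_pairing T q F (riemann_data uL uR) sheet \<phi> G = edge T G 0 *\<^sub>R (F uL (axis 2 1) - F uR (axis 2 1))"
proof -
  let ?e1 = "axis 1 1 :: real^2" and ?e2 = "axis 2 1 :: real^2"
  have lin: "fst g *\<^sub>R q u + F u (snd g) = lin g (q u) (F u ?e1) (F u ?e2)" for g u
    by (subst F) (simp add: lin_def)
  have "weak_pairing T q F (riemann_data uL uR) sheet \<phi> G
     = (\<Sum>i\<in>{0::nat}. edge T G 0 *\<^sub>R ((F uL ?e2 - F uR ?e2) - 0 *\<^sub>R (q uL - q uR)))"
  proof (rule weak_pairing_fan[OF tf T, where h="\<lambda>z. 0" and da="\<lambda>i. F uL ?e1 - F uR ?e1" and ar="F uR ?e1"
      and br="F uR ?e2"])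
    fix z assume z: "z \<in> strip T"
    then have b: "z \<in> below T 0 \<longleftrightarrow> snd z $ 2 < 0" by (simp add: below_def)
    show "fst (G z) *\<^sub>R q (sheet z) + F (sheet z) (snd (G z)) = lin (G z) (q uR) (F uR ?e1) (F uR ?e2)
      + (\<Sum>i\<in>{0::nat}. indicator (below T 0) z *\<^sub>R lin (G z) (q uL - q uR) (F uL ?e1 - F uR ?e1) (F uL ?e2 - F uR ?e2))
          + 0"
      unfolding lin by (cases "snd z $ 2 < 0") (simp_all add: sheet_def b lin_def algebra_simps)
  qed auto
  then show ?thesis by simp
qed

lemma sheet_admissible:
  assumes T: "T > 0"
  shows "entropy_admissible (3/2) T (riemann_data uL uR) sheet"
proof (rule bounded_field_admissible)
  show "compact {uL, uR}" by (rule finite_imp_compact) simp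
  show "sheet z \<in> {uL, uR}" for z by (simp add: sheet_def)
  show "positive_state u" if "u \<in> {uL, uR}" for u using that by (auto simp: positive_state_def states)
  have S: "{z::spacetime \<in> space borel. snd z $ 2 < 0} \<in> sets borel"
    unfolding space_borel by (intro borel_open) (simp, intro open_Collect_less continuous_intros)
  show "sheet \<in> borel_measurable borel"
    unfolding sheet_def[abs_def] by (intro measurable_If S measurable_const) (simp_all add: space_borel)
  fix \<phi> G assume tf: "test_function T \<phi> G"
  note P = sheet_pairing[OF tf T]
  show "weak_pairing T dens mass_flux (riemann_data uL uR) sheet \<phi> G = 0"
    by (subst P[OF fluxes_linear(1)]) (simp add: flux_normal state_comps)
  show "weak_pairing T momentum momentum_flux (riemann_data uL uR) sheet \<phi> G = 0"
    by (subst P[OF fluxes_linear(2)]) (simp add: flux_normal state_comps)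
  show "weak_pairing T (energy (3/2)) (energy_flux (3/2)) (riemann_data uL uR) sheet \<phi> G = 0"
    by (subst P[OF fluxes_linear(3)]) (simp add: flux_normal state_comps)
  show "weak_pairing T (entropy_density (3/2)) (entropy_flux (3/2)) (riemann_data uL uR) sheet \<phi> G \<le> 0"
    by (subst P[OF fluxes_linear(4)]) (simp add: flux_normal state_comps)
qed

lemma uL_uR_neq: "uL \<noteq> uR" using state_comps(5,6) by auto

text \<open>Provides a member of the class, so that the negative claim about all self-similar
  solutions is not vacuous.\<close>

lemma sheet_self_similar:
  assumes T: "T > 0"
  shows "self_similar_1D_solution (3/2) T uL uR sheet"
  unfolding self_similar_1D_solution_def
proof (intro conjI exI)
  define W where "W \<xi> = (if \<xi> < 0 then uL else uR)" for \<xi> :: real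
  show "entropy_admissible (3/2) T (riemann_data uL uR) sheet" by (rule sheet_admissible[OF T])
  show "\<forall>t x. 0 < t \<and> t < T \<longrightarrow> sheet (t, x) = W (x $ 2 / t)"
    by (auto simp: sheet_def W_def divide_less_0_iff)
  have l: "(W \<longlongrightarrow> uL) (at_left 0)"
    by (rule tendsto_eventually) (auto simp: eventually_at_left_field W_def intro!: exI[of _ "-1"])
  have r: "(W \<longlongrightarrow> uR) (at_right 0)"
    by (rule tendsto_eventually) (auto simp: eventually_at_right_field W_def intro!: exI[of _ "1"])
  have c: "contact_discontinuity (3/2) 0 uL uR"
    unfolding contact_discontinuity_def rankine_hugoniot_def Let_def
    using uL_uR_neq by (simp add: flux_normal state_comps)
  show "wave_fan (3/2) uL uR W" unfolding wave_fan_def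
  proof (intro exI[of _ "{0}"] conjI ballI)
    fix a :: real assume "a \<in> {0}"
    then show "\<exists>l r. (W \<longlongrightarrow> l) (at_left a) \<and> (W \<longlongrightarrow> r) (at_right a) \<and> positive_state l \<and> positive_state r \<and>
            (l = r \<or> shock (3/2) a l r \<or> contact_discontinuity (3/2) a l r)"
      using l r c by (intro exI[of _ uL] exI[of _ uR]) (auto simp: positive_state_def states)
  qed (auto simp: W_def)
qed

section \<open>Total entropy in a square\<close>

definition square :: "real \<Rightarrow> (real^2) set" where
  "square L = {x. \<bar>x $ 1\<bar> \<le> L \<and> \<bar>x $ 2\<bar> \<le> L}"

text \<open>Half-open in x2 to match the case distinction of \<open>turb\<close>.\<close>

definition band :: "real \<Rightarrow> real \<Rightarrow> (real^2) set" where
  "band L c = {x. \<bar>x $ 1\<bar> \<le> L \<and> - c \<le> x $ 2 \<and> x $ 2 < c}"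

lemma negligible_line: "negligible {x :: real^2. x $ 2 = c}"
  using negligible_standard_hyperplane[of "axis 2 1 :: real^2" c] by (simp add: inner_axis)

lemma square_measure:
  assumes "L \<ge> 0" shows "square L \<in> lmeasurable" "measure lebesgue (square L) = 4 * L^2"
proof -
  have e: "square L = cbox (vector [-L, -L]) (vector [L, L])"
    by (auto simp: square_def mem_box_cart forall_2 abs_le_iff)
  have "cbox (vector [-L, -L]) (vector [L, L] :: real^2) \<noteq> {}" using assms
      by (auto simp: interval_ne_empty_cart forall_2)
  then show "measure lebesgue (square L) = 4 * L^2" unfolding e
    by (simp add: content_cbox_cart UNIV_2 power2_eq_square)
  show "square L \<in> lmeasurable" unfolding e by simp
qed

lemma band_measure:
  assumes "L \<ge> 0" "c \<ge> 0" shows "band L c \<in> lmeasurable" "measure lebesgue (band L c) = 4 * L * c"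
proof -
  let ?B = "cbox (vector [-L, -c]) (vector [L, c]) :: (real^2) set"
  have "?B \<noteq> {}" using assms by (auto simp: interval_ne_empty_cart forall_2)
  then have m: "measure lebesgue ?B = 4 * L * c" by (simp add: content_cbox_cart UNIV_2)
  have n: "negligible ((?B - band L c) \<union> (band L c - ?B))"
    by (rule negligible_subset[OF negligible_line[of c]]) (auto simp: band_def mem_box_cart forall_2 abs_le_iff)
  show "band L c \<in> lmeasurable" using lmeasurable_negligible_symdiff[OF _ n] by simp
  show "measure lebesgue (band L c) = 4 * L * c" using measure_negligible_symdiff[OF _ n] m by simp
qed

lemma lmeasurable_indicator:
  assumes "S \<in> lmeasurable"
  shows "integrable lebesgue (indicator S :: _ \<Rightarrow> real)" "(\<integral>x. indicator S x \<partial>lebesgue) = measure lebesgue S"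
  using assms by (auto simp: fmeasurable_def intro!: integrable_real_indicator)

text \<open>As long as 3/4 t \<le> L the shocks are inside the square. The rate is mass times gain
  of specific entropy: on each side of the sheet, per unit length and time, mass 3/5 accumulates
  behind the shock and mass 3/20 in the zone.\<close>

lemma turb_square_entropy:
  assumes L: "L > 0" and t: "0 \<le> t" "3/4 * t \<le> L"
  shows "square_entropy (3/2) (riemann_data uL uR) (turb v) L t
     = s0 * (4 * L^2) + 4 * L * (6/5 * (sb - s0) / 2 + 3/10 * (s1 - s0) / 2 ) * t"
proof -
  have bs: "band L (3/4 * t) \<subseteq> square L" "band L (2/5 * t) \<subseteq> square L"
    using t by (auto simp: band_def square_def)
  have pt: "indicator (square L) x *\<^sub>R entropy_density (3/2) (if t = 0 then riemann_data uL uR x else turb v (t, x))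
     = s0 * indicator (square L) x + (12/7 * sb - s0) * indicator (band L (3/4 * t)) x
         + (3/8 * s1 - 12/7 * sb) * indicator (band L (2/5 * t)) x" for x
  proof (cases "x \<in> square L")
    case False
    then show ?thesis using bs by (auto simp: indicator_def)
  next
    case True
    then have x: "\<bar>x $ 1\<bar> \<le> L" by (simp add: square_def)
    show ?thesis
    proof (cases "t = 0")
      case True
      then show ?thesis using \<open>x \<in> square L\<close> by (auto simp: riemann_data_def entropies band_def indicator_def)
    next
      case False
      then have tp: "t > 0" using t by simp
      have "- (3/4) * t < - (2/5) * t" "- (2/5) * t < 2/5 * t" "2/5 * t < 3/4 * t" using tp by simp_all
      then show ?thesis using \<open>x \<in> square L\<close> x False
        by (auto simp: turb_def entropies band_def indicator_def)
    qed
  qed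
  have "square_entropy (3/2) (riemann_data uL uR) (turb v) L t
      = (\<integral>x. s0 * indicator (square L) x + (12/7 * sb - s0) * indicator (band L (3/4 * t)) x
      + (3/8 * s1 - 12/7 * sb) * indicator (band L (2/5 * t)) x \<partial>lebesgue)"
    unfolding square_entropy_def set_lebesgue_integral_def square_def[symmetric] pt ..
  also have "\<dots> = s0 * (4 * L^2) + (12/7 * sb - s0) * (4 * L * (3/4 * t))
      + (3/8 * s1 - 12/7 * sb) * (4 * L * (2/5 * t))"
    using lmeasurable_indicator[OF square_measure(1)[of L]] lmeasurable_indicator[OF band_measure(1)[of L "3/4 * t"]]
      lmeasurable_indicator[OF band_measure(1)[of L "2/5 * t"]] square_measure(2)[of L] band_measure(2)[of L
          "3/4 * t"] band_measure(2)[of L "2/5 * t"] L t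
    by simp
  also have "\<dots> = s0 * (4 * L^2) + 4 * L * (6/5 * (sb - s0) / 2 + 3/10 * (s1 - s0) / 2 ) * t"
    by (simp add: field_simps)
  finally show ?thesis .
qed

lemma right_derivative_affine:
  fixes f :: "real \<Rightarrow> real"
  assumes d: "d > 0" and f: "\<And>t. 0 \<le> t \<Longrightarrow> t < d \<Longrightarrow> f t = a + b * t"
  shows "(f has_real_derivative b) (at_right 0)"
proof -
  have "((\<lambda>t. a + b * t) has_real_derivative b) (at 0 within {0..})"
    by (auto intro!: derivative_eq_intros)
  then have "(f has_real_derivative b) (at 0 within {0..})"
    by (rule has_field_derivative_transform_within[OF _ d]) (auto simp: f dist_real_def)
  then show ?thesis by (rule has_field_derivative_subset) auto
qed

lemma turb_entropy_rate:
  assumes L: "L > 0"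
  shows "(square_entropy (3/2) (riemann_data uL uR) (turb v) L has_real_derivative
    4 * L * (6/5 * (sb - s0) / 2 + 3/10 * (s1 - s0) / 2)) (at_right 0)"
  by (rule right_derivative_affine[OF L]) (rule turb_square_entropy[OF L], auto)

text \<open>Both states have entropy density \<open>s0\<close>, and at each time the finitely many
  rays on which \<open>W\<close> is unknown form a null set. The total is thus constant and agrees
  with that of the data.\<close>

lemma steady_entropy_rate:
  assumes T: "T > 0" and X: "finite X" and U: "\<And>t x. 0 < t \<Longrightarrow> t < T \<Longrightarrow> U (t, x) = W (x $ 2 / t)"
    and W: "\<And>\<xi>. \<xi> \<notin> X \<Longrightarrow> W \<xi> = (if \<xi> < 0 then uL else uR)" and L: "L > 0"
  shows "(square_entropy (3/2) (riemann_data uL uR) U L has_real_derivative 0) (at_right 0)"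
proof -
  have const: "square_entropy (3/2) (riemann_data uL uR) U L t = s0 * (4 * L^2)" if t: "0 \<le> t" "t < T" for t
  proof -
    define k where "k a = (if t = 0 then 0 else entropy_density (3/2) (W a) - s0)" for a
    have n: "negligible (square L \<inter> {x. x $ 2 = a * t})" for a
      by (rule negligible_subset[OF negligible_line[of "a * t"]]) auto
    have pt: "indicator (square L) x *\<^sub>R entropy_density (3/2) (if t = 0 then riemann_data uL uR x else U (t, x))
      = s0 * indicator (square L) x + (\<Sum>a\<in>X. k a * indicator (square L \<inter> {x. x $ 2 = a * t}) x)" for x
    proof (cases "t = 0")
      case True
      then show ?thesis by (simp add: k_def riemann_data_def entropies)
    next
      case False
      then have tp: "t > 0" using t by simp
      have eq: "x $ 2 = a * t \<longleftrightarrow> a = x $ 2 / t" for a using tp by (auto simp: field_simps)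
      have "(\<Sum>a\<in>X. k a * indicator (square L \<inter> {x. x $ 2 = a * t}) x)
          = (\<Sum>a\<in>X. if a = x $ 2 / t then k a * indicator (square L) x else 0)"
        by (rule sum.cong) (auto simp: eq indicator_def)
      also have "\<dots> = (if x $ 2 / t \<in> X then k (x $ 2 / t) * indicator (square L) x else 0)"
        using X by simp
      finally show ?thesis using False tp t W[of "x $ 2 / t"] U[OF tp t(2), of x]
        by (auto simp: k_def entropies algebra_simps)
    qed
    have i: "integrable lebesgue (indicator (square L \<inter> {x. x $ 2 = a * t}) :: _ \<Rightarrow> real)"
      "(\<integral>x. indicator (square L \<inter> {x. x $ 2 = a * t}) x \<partial>lebesgue) = (0::real)" for a
    proof -
      have "square L \<inter> {x. x $ 2 = a * t} \<in> lmeasurable" "measure lebesgue (square L \<inter> {x. x $ 2 = a * t}) = 0"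
        using n[of a] by (simp_all add: negligible_imp_measurable negligible_imp_measure0)
      then show "integrable lebesgue (indicator (square L \<inter> {x. x $ 2 = a * t}) :: _ \<Rightarrow> real)"
      "(\<integral>x. indicator (square L \<inter> {x. x $ 2 = a * t}) x \<partial>lebesgue) = (0::real)"
        using lmeasurable_indicator[of "square L \<inter> {x. x $ 2 = a * t}"] by simp_all
    qed
    have "square_entropy (3/2) (riemann_data uL uR) U L t
       = (\<integral>x. s0 * indicator (square L) x + (\<Sum>a\<in>X. k a * indicator (square L \<inter> {x. x $ 2 = a * t}) x) \<partial>lebesgue)"
      unfolding square_entropy_def set_lebesgue_integral_def square_def[symmetric] pt ..
    also have "\<dots> = s0 * (4 * L^2)"
      using lmeasurable_indicator[OF square_measure(1)[of L]] square_measure(2)[of L] L i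
      by (subst Bochner_Integration.integral_add) (auto intro!: Bochner_Integration.integrable_sum)
    finally show ?thesis .
  qed
  show ?thesis by (rule right_derivative_affine[OF T, where a="s0 * (4 * L^2)"]) (simp add: const)
qed

section \<open>Uniqueness of the wave fan\<close>

text \<open>Induction on the number of wave speeds between \<open>x\<close> and \<open>y\<close>:
  cross the first speed to a point of the next gap. The speeds themselves are avoided as sample
  points, because \<open>wave_fan\<close> says nothing about the profile there.\<close>

lemma fan_propagate:
  fixes X :: "real set"
  assumes X: "finite X"
    and step: "\<And>a a' b' x y. a \<in> X \<Longrightarrow> {a'<..<a} \<inter> X = {} \<Longrightarrow> {a<..<b'} \<inter> X = {} \<Longrightarrow> a' < x \<Longrightarrow> x < a \<Longrightarrow> a < y \<Longrightarrow> y < b' \<Longrightarrow> P x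
        \<Longrightarrow> P y"
    and gap: "\<And>a b x y. {a<..<b} \<inter> X = {} \<Longrightarrow> a < x \<Longrightarrow> x < y \<Longrightarrow> y < b \<Longrightarrow> P x \<Longrightarrow> P y"
    and xy: "x \<notin> X" "y \<notin> X" "x < y" and P: "P x"
  shows "P y"
  using xy P
proof (induction "card (X \<inter> {x<..<y})" arbitrary: x rule: less_induct)
  case less
  \<comment> \<open>Together with \<open>hi\<close>, ends of an interval around \<open>z\<close>
    that contains no speed other than possibly \<open>z\<close>; the inserted z - 1 and z + 1 keep
    the sets nonempty.\<close>
  define lo where "lo z = Max (insert (z - 1) {a \<in> X. a < z})" for z
  define hi where "hi z = Min (insert (z + 1) {a \<in> X. a > z})" for z
  have lo: "lo z < z" "\<And>a. a \<in> X \<Longrightarrow> a < z \<Longrightarrow> a \<le> lo z" for z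
    using X by (auto simp: lo_def)
  have hi: "z < hi z" "\<And>a. a \<in> X \<Longrightarrow> z < a \<Longrightarrow> hi z \<le> a" for z
    using X by (auto simp: hi_def)
  show ?case
  proof (cases "X \<inter> {x<..<y} = {}")
    case True
    have "{lo x<..<hi y} \<inter> X = {}"
    proof (rule ccontr)
      assume "{lo x<..<hi y} \<inter> X \<noteq> {}"
      then obtain a where a: "a \<in> X" "lo x < a" "a < hi y" by auto
      consider "a < x" | "a = x" | "x < a" "a < y" | "a = y" | "y < a" by linarith
      then show False using a lo(2)[of a x] hi(2)[of a y] less.prems True by cases auto
    qed
    then show ?thesis using gap[of "lo x" "hi y" x y] lo(1)[of x] hi(1)[of y] less.prems by blast
  next
    case False
    define a where "a = Min (X \<inter> {x<..<y})"
    have "a \<in> X \<inter> {x<..<y}" unfolding a_def by (rule Min_in) (use X False in auto)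
    then have a: "a \<in> X" "x < a" "a < y" by auto
    have amin: "a \<le> c" if "c \<in> X" "x < c" "c < y" for c
      unfolding a_def by (rule Min_le) (use X that in auto)
    define w where "w = (a + min (hi a) y) / 2"
    have w: "a < w" "w < hi a" "w < y" using hi(1)[of a] a by (auto simp: w_def min_def)
    have noX: "{lo x<..<a} \<inter> X = {}"
    proof (rule ccontr)
      assume "{lo x<..<a} \<inter> X \<noteq> {}"
      then obtain c where c: "c \<in> X" "lo x < c" "c < a" by auto
      consider "c < x" | "c = x" | "x < c" by linarith
      then show False using c lo(2)[of c x] amin[of c] less.prems a by cases auto
    qed
    have noX2: "{a<..<hi a} \<inter> X = {}" using hi(2)[of _ a] by fastforce
    have Pw: "P w" by (rule step[OF a(1) noX noX2]) (use lo(1)[of x] a w less.prems in auto)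
    have wX: "w \<notin> X" using noX2 w by auto
    have "X \<inter> {w<..<y} \<subseteq> X \<inter> {x<..<y}" "a \<in> X \<inter> {x<..<y}" "a \<notin> X \<inter> {w<..<y}" using a w by auto
    then have "X \<inter> {w<..<y} \<subset> X \<inter> {x<..<y}" by blast
    then have "card (X \<inter> {w<..<y}) < card (X \<inter> {x<..<y})" using X by (intro psubset_card_mono) auto
    from less.hyps[OF this wX less.prems(2) w(3) Pw] show ?thesis .
  qed
qed

lemma constant_on_mono: "f constant_on S \<Longrightarrow> T \<subseteq> S \<Longrightarrow> f constant_on T"
  unfolding constant_on_def by blast

lemma rarefaction_on_mono: "rarefaction_on cv S W \<Longrightarrow> T \<subseteq> S \<Longrightarrow> rarefaction_on cv T W"
  unfolding rarefaction_on_def by (meson constant_on_mono subsetD)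

lemma sound_speed_pos: "positive_state u \<Longrightarrow> sound_speed (3/2) u > 0"
  by (simp add: sound_speed_def positive_state_def)

text \<open>\<open>wave_fan\<close> classifies only the gaps between consecutive speeds; the two
  outer regions, where the profile is constant, are absorbed here.\<close>

lemma fan_gap_cases:
  assumes X: "finite X" and left: "\<forall>\<xi>. (\<forall>a\<in>X. \<xi> < a) \<longrightarrow> W \<xi> = ul" and right: "\<forall>\<xi>. (\<forall>a\<in>X. a < \<xi>) \<longrightarrow> W \<xi> = ur"
    and mid: "\<forall>a\<in>X. \<forall>b\<in>X. a < b \<and> {a<..<b} \<inter> X = {} \<longrightarrow> W constant_on {a<..<b} \<or> rarefaction_on cv {a<..<b} W"
    and ab: "a < b" "{a<..<b} \<inter> X = {}"
  shows "W constant_on {a<..<b} \<or> rarefaction_on cv {a<..<b} W"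
proof -
  define L where "L = {x \<in> X. x \<le> a}"
  define R where "R = {x \<in> X. b \<le> x}"
  have LR: "x \<in> L \<or> x \<in> R" if "x \<in> X" for x
    using ab(2) that unfolding L_def R_def by force
  have fin: "finite L" "finite R" using X by (auto simp: L_def R_def)
  show ?thesis
  proof (cases "L = {} \<or> R = {}")
    case True
    then have "(\<forall>\<xi>\<in>{a<..<b}. W \<xi> = ul) \<or> (\<forall>\<xi>\<in>{a<..<b}. W \<xi> = ur)"
    proof
      assume "L = {}"
      then have "\<xi> < x" if "\<xi> \<in> {a<..<b}" "x \<in> X" for \<xi> x using that LR[OF that(2)] by (simp add: R_def)
      then have "\<forall>\<xi>\<in>{a<..<b}. W \<xi> = ul" using left by blast
      then show "(\<forall>\<xi>\<in>{a<..<b}. W \<xi> = ul) \<or> (\<forall>\<xi>\<in>{a<..<b}. W \<xi> = ur)" ..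
    next
      assume "R = {}"
      then have "x < \<xi>" if "\<xi> \<in> {a<..<b}" "x \<in> X" for \<xi> x using that LR[OF that(2)] by (simp add: L_def)
      then have "\<forall>\<xi>\<in>{a<..<b}. W \<xi> = ur" using right by blast
      then show "(\<forall>\<xi>\<in>{a<..<b}. W \<xi> = ul) \<or> (\<forall>\<xi>\<in>{a<..<b}. W \<xi> = ur)" ..
    qed
    then show ?thesis unfolding constant_on_def by blast
  next
    case False
    define l where "l = Max L"
    define r where "r = Min R"
    have l: "l \<in> L" "\<And>x. x \<in> L \<Longrightarrow> x \<le> l" using False fin by (auto simp: l_def)
    have r: "r \<in> R" "\<And>x. x \<in> R \<Longrightarrow> r \<le> x" using False fin by (auto simp: r_def)
    have "x \<notin> {l<..<r}" if "x \<in> X" for x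
      using LR[OF that] l(2)[of x] r(2)[of x] by auto
    then have "{l<..<r} \<inter> X = {}" by blast
    moreover have "l < r" "l \<in> X" "r \<in> X" using l(1) r(1) ab(1) by (auto simp: L_def R_def)
    ultimately have "W constant_on {l<..<r} \<or> rarefaction_on cv {l<..<r} W" using mid by blast
    moreover have "{a<..<b} \<subseteq> {l<..<r}" using l(1) r(1) by (auto simp: L_def R_def)
    ultimately show ?thesis using constant_on_mono rarefaction_on_mono by blast
  qed
qed

section \<open>Relative entropy along a wave fan\<close>

definition relv :: "state \<Rightarrow> real \<Rightarrow> real" where "relv u \<xi> = vel u $ 2 - \<xi>"

text \<open>The entropy relative to the data, which is affine in the conserved quantities up to \<open>-\<rho> s\<close>
  when \<open>v\<^sub>1\<^sup>2 = 4\<close>, and its flux through the ray of slope \<open>\<xi>\<close>.\<close>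

definition "lin_coeff = 3/2 * ln (3/20 :: real) - 5/2"

definition rel_entropy :: "state \<Rightarrow> real" where
  "rel_entropy u = - entropy_density (3/2) u + 20/3 * (energy (3/2) u - 2 * dens u) + lin_coeff * dens u + 1"

definition rel_flux :: "state \<Rightarrow> real \<Rightarrow> real" where
  "rel_flux u \<xi> = - entropy_density (3/2) u * relv u \<xi>
      + 20/3 * ((energy (3/2) u - 2 * dens u) * relv u \<xi> + pressure u * (vel u $ 2))
     + lin_coeff * dens u * relv u \<xi> - \<xi>"

lemma energy_normal:
  assumes "(vel u $ 1)^2 = 4"
  shows "energy (3/2) u - 2 * dens u = 1/2 * dens u * (vel u $ 2)^2 + 3/2 * dens u * temp u"
proof -
  have "(norm (vel u))\<^sup>2 = (vel u $ 1)^2 + (vel u $ 2)^2"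
    unfolding power2_norm_eq_inner by (simp add: inner_vec_def UNIV_2 sum_2 power2_eq_square)
  then show ?thesis using assms by (simp add: energy_def internal_energy_def algebra_simps)
qed

text \<open>With y = \<theta> / (3/20) it is a sum of nonnegative terms in y, v2 and \<rho>, each
  zero only at the value of the data. The coefficient 20/3 is the inverse temperature of the data,
  and \<open>lin_coeff\<close> balances the terms linear in \<rho>.\<close>

lemma rel_entropy_nonneg:
  assumes p: "positive_state u" and v: "(vel u $ 1)^2 = 4"
  shows "rel_entropy u \<ge> 0" "rel_entropy u = 0 \<Longrightarrow> dens u = 1 \<and> temp u = 3/20 \<and> vel u $ 2 = 0"
proof -
  define r th w where "r = dens u" and "th = temp u" and "w = vel u $ 2"
  have pos: "r > 0" "th > 0" using p by (auto simp: r_def th_def positive_state_def)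
  define y where "y = 20/3 * th"
  have y: "y > 0" using pos by (simp add: y_def)
  have lth: "ln th = ln y + ln (3/20)"
  proof -
    have "ln th = ln (y * (3/20))" by (simp add: y_def)
    also have "\<dots> = ln y + ln (3/20)" using y by (intro ln_mult_pos) auto
    finally show ?thesis .
  qed
  have lr: "ln r \<ge> 1 - 1 / r"
    using ln_le_minus_one[of "1 / r"] pos by (simp add: ln_div)
  have A: "y - 1 - ln y \<ge> 0" using ln_le_minus_one[OF y] by simp
  have B: "r * ln r - r + 1 \<ge> 0"
  proof -
    have "r * (1 - 1 / r) \<le> r * ln r" using lr pos by (intro mult_left_mono) auto
    then show ?thesis using pos by (simp add: right_diff_distrib)
  qed
  have e: "rel_entropy u = 3/2 * r * (y - 1 - ln y) + 10/3 * r * w^2 + (r * ln r - r + 1)"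
    unfolding rel_entropy_def energy_normal[OF v] entropy_density_def entropy_def
    by (fold r_def th_def w_def) (simp add: lth lin_coeff_def y_def algebra_simps)
  have c: "0 \<le> 3/2 * r * (y - 1 - ln y)" "0 \<le> 10/3 * r * w^2" using pos A by (auto intro!: mult_nonneg_nonneg)
  show "rel_entropy u \<ge> 0" unfolding e using c B by linarith
  assume "rel_entropy u = 0"
  then have z: "3/2 * r * (y - 1 - ln y) = 0" "10/3 * r * w^2 = 0" "r * ln r - r + 1 = 0"
    using c B unfolding e by linarith+
  have "ln y = y - 1" using z(1) pos by simp
  then have "y = 1" using ln_eq_minus_one[OF y] by simp
  moreover have "w = 0" using z(2) pos by simp
  moreover have "r = 1"
  proof -
    have "ln (1/r) = 1/r - 1" using z(3) pos by (simp add: ln_div field_simps)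
    then have "1/r = 1" using ln_eq_minus_one[of "1/r"] pos by simp
    then show ?thesis by simp
  qed
  ultimately show "dens u = 1 \<and> temp u = 3/20 \<and> vel u $ 2 = 0" by (simp add: r_def th_def w_def y_def)
qed

text \<open>On a rarefaction everything is a polynomial in the signed sound speed \<open>y = (\<xi> - k)/4\<close>.\<close>

lemma rarefaction_formulas:
  assumes R: "rarefaction_on (3/2) S W" and ne: "S \<noteq> {}"
  obtains \<epsilon> k m s v1 where "\<epsilon> = 1 \<or> \<epsilon> = -1" "\<And>\<xi>. \<xi> \<in> S \<Longrightarrow> positive_state (W \<xi>)"
    "\<And>\<xi>. \<xi> \<in> S \<Longrightarrow> \<epsilon> * sound_speed (3/2) (W \<xi>) = (\<xi> - k) / 4"
    "\<And>\<xi>. \<xi> \<in> S \<Longrightarrow> vel (W \<xi>) $ 2 = \<xi> - (\<xi> - k) / 4" "\<And>\<xi>. \<xi> \<in> S \<Longrightarrow> vel (W \<xi>) $ 1 = v1"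
    "\<And>\<xi>. \<xi> \<in> S \<Longrightarrow> temp (W \<xi>) = 3/5 * ((\<xi> - k) / 4)^2"
    "\<And>\<xi>. \<xi> \<in> S \<Longrightarrow> dens (W \<xi>) = m * ((\<xi> - k) / 4)^3" "\<And>\<xi>. \<xi> \<in> S \<Longrightarrow> entropy (3/2) (W \<xi>) = s"
proof -
  have "\<exists>\<epsilon>\<in>{-1, 1}. (\<forall>\<xi>\<in>S. vel (W \<xi>) $ 2 + \<epsilon> * sound_speed (3/2) (W \<xi>) = \<xi>) \<and>
        (\<lambda>\<xi>. entropy (3/2) (W \<xi>)) constant_on S \<and> (\<lambda>\<xi>. vel (W \<xi>) $ 1) constant_on S \<and>
        (\<lambda>\<xi>. vel (W \<xi>) $ 2 - \<epsilon> * 2 * (3/2) * sound_speed (3/2) (W \<xi>)) constant_on S"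
    and pos: "\<And>\<xi>. \<xi> \<in> S \<Longrightarrow> positive_state (W \<xi>)"
    using R unfolding rarefaction_on_def by blast+
  then obtain \<epsilon> where e: "\<epsilon> \<in> {-1, 1}" and c: "\<forall>\<xi>\<in>S. vel (W \<xi>) $ 2 + \<epsilon> * sound_speed (3/2) (W \<xi>) = \<xi>"
    and c2: "(\<lambda>\<xi>. entropy (3/2) (W \<xi>)) constant_on S" "(\<lambda>\<xi>. vel (W \<xi>) $ 1) constant_on S"
    "(\<lambda>\<xi>. vel (W \<xi>) $ 2 - \<epsilon> * 2 * (3/2) * sound_speed (3/2) (W \<xi>)) constant_on S"
    by (elim bexE conjE)
  have \<epsilon>: "\<epsilon> = 1 \<or> \<epsilon> = -1" using e by auto
  note c1 = bspec[OF c]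
  obtain s where s: "\<And>\<xi>. \<xi> \<in> S \<Longrightarrow> entropy (3/2) (W \<xi>) = s" using c2(1) unfolding constant_on_def by blast
  obtain v1 where v1: "\<And>\<xi>. \<xi> \<in> S \<Longrightarrow> vel (W \<xi>) $ 1 = v1" using c2(2) unfolding constant_on_def by blast
  obtain k where k: "\<And>\<xi>. \<xi> \<in> S \<Longrightarrow> vel (W \<xi>) $ 2 - \<epsilon> * 2 * (3/2) * sound_speed (3/2) (W \<xi>) = k"
    using c2(3) unfolding constant_on_def by blast
  have y: "\<epsilon> * sound_speed (3/2) (W \<xi>) = (\<xi> - k) / 4" if "\<xi> \<in> S" for \<xi>
    using c1[OF that] k[OF that] by simp
  have th: "temp (W \<xi>) = 3/5 * ((\<xi> - k) / 4)^2" if "\<xi> \<in> S" for \<xi>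
  proof -
    have "temp (W \<xi>) > 0" using pos[OF that] by (simp add: positive_state_def)
    then have "(sound_speed (3/2) (W \<xi>))^2 = 5/3 * temp (W \<xi>)" by (simp add: sound_speed_def)
    moreover have "(\<epsilon> * sound_speed (3/2) (W \<xi>))^2 = (sound_speed (3/2) (W \<xi>))^2" using \<epsilon> by auto
    ultimately show ?thesis unfolding y[OF that] by simp
  qed
  define m where "m = \<epsilon> * exp (3/2 * ln (3/5) - s)"
  have d: "dens (W \<xi>) = m * ((\<xi> - k) / 4)^3" if "\<xi> \<in> S" for \<xi>
  proof -
    define c where "c = sound_speed (3/2) (W \<xi>)"
    have cp: "c > 0" using sound_speed_pos[OF pos[OF that]] by (simp add: c_def)
    have yc: "(\<xi> - k) / 4 = \<epsilon> * c" using y[OF that] by (simp add: c_def)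
    have y2: "((\<xi> - k) / 4)^2 = c^2" and y3: "((\<xi> - k) / 4)^3 = \<epsilon> * c^3" unfolding yc using \<epsilon> by auto
    have dp: "dens (W \<xi>) > 0" using pos[OF that] by (simp add: positive_state_def)
    have "ln (dens (W \<xi>)) = 3/2 * ln (3/5 * c^2) - s"
      using s[OF that] th[OF that] unfolding entropy_def y2 by simp
    also have "\<dots> = 3/2 * ln (3/5) - s + 3 * ln c"
      using cp ln_mult_pos[of "3/5" "c^2"] by (simp add: ln_realpow)
    finally have "dens (W \<xi>) = exp (3/2 * ln (3/5) - s + 3 * ln c)" using dp by (metis exp_ln)
    also have "\<dots> = exp (3/2 * ln (3/5) - s) * c^3"
      using cp exp_of_nat_mult[of 3 "ln c"] by (simp add: exp_add)
    finally show ?thesis unfolding y3 m_def using \<epsilon> by auto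
  qed
  have v2: "vel (W \<xi>) $ 2 = \<xi> - (\<xi> - k) / 4" if "\<xi> \<in> S" for \<xi> using c1[OF that] y[OF that] by simp
  show ?thesis by (rule that[OF \<epsilon> pos y v2 v1 th d s])
qed

text \<open>The flux in a rarefaction with v2 = K + 3 Y, temperature 3/5 Y^2 and density M Y^3,
  reduced to algebra in the signed sound speed Y.\<close>

lemma rarefaction_flux_identity:
  fixes M Y S A K x :: real
  shows "- (M * Y^3 * S) * (- Y) + 20/3 * ((1/2 * (M * Y^3) * (K + 3 * Y)^2 + 3/2 * (M * Y^3) * (3/5 * Y^2)) * (- Y)
      + M * Y^3 * (3/5 * Y^2) * (K + 3 * Y)) + A * (M * Y^3) * (- Y) - x
    = M * Y^4 * (S - A) + 20/3 * (M * (- (1/2 * (K + 3 * Y)^2 + 9/10 * Y^2) * Y^4 + 3/5 * Y^5 * (K + 3 * Y))) - x"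
  by (simp add: field_simps eval_nat_numeral)

lemma rarefaction_entropy_identity:
  fixes M Y S A K :: real
  shows "- (M * Y^3 * S) + 20/3 * (1/2 * (M * Y^3) * (K + 3 * Y)^2 + 3/2 * (M * Y^3) * (3/5 * Y^2)) + A * (M * Y^3)
      + 1
    = - M * Y^3 * S + 20/3 * (1/2 * M * Y^3 * (K + 3 * Y)^2 + 9/10 * M * Y^5) + A * M * Y^3 + 1"
  by (simp add: field_simps eval_nat_numeral)

text \<open>In a smooth self-similar region an entropy \<eta> with flux f satisfies f' = \<xi>
  \<eta>', so f - \<xi> \<eta> has derivative -\<eta>. This is verified on the explicit
  polynomials.\<close>

lemma rel_flux_rarefaction_deriv:
  assumes R: "rarefaction_on (3/2) {a<..<b} W" and v: "\<And>\<xi>. \<xi> \<in> {a<..<b} \<Longrightarrow> (vel (W \<xi>) $ 1)^2 = 4" and x: "x \<in> {a<..<b}"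
  shows "((\<lambda>\<xi>. rel_flux (W \<xi>) \<xi>) has_real_derivative - rel_entropy (W x)) (at x)"
proof -
  have ne: "{a<..<b} \<noteq> {}" using x by auto
  obtain \<epsilon> k m s v1 where f: "\<epsilon> = 1 \<or> \<epsilon> = -1" "\<And>\<xi>. \<xi> \<in> {a<..<b} \<Longrightarrow> positive_state (W \<xi>)"
    "\<And>\<xi>. \<xi> \<in> {a<..<b} \<Longrightarrow> \<epsilon> * sound_speed (3/2) (W \<xi>) = (\<xi> - k) / 4"
    "\<And>\<xi>. \<xi> \<in> {a<..<b} \<Longrightarrow> vel (W \<xi>) $ 2 = \<xi> - (\<xi> - k) / 4" "\<And>\<xi>. \<xi> \<in> {a<..<b} \<Longrightarrow> vel (W \<xi>) $ 1 = v1"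
    "\<And>\<xi>. \<xi> \<in> {a<..<b} \<Longrightarrow> temp (W \<xi>) = 3/5 * ((\<xi> - k) / 4)^2"
    "\<And>\<xi>. \<xi> \<in> {a<..<b} \<Longrightarrow> dens (W \<xi>) = m * ((\<xi> - k) / 4)^3" "\<And>\<xi>. \<xi> \<in> {a<..<b} \<Longrightarrow> entropy (3/2) (W \<xi>) = s"
    by (rule rarefaction_formulas[OF R ne]) (rule that; assumption)
  define y where "y \<xi> = (\<xi> - k) / 4" for \<xi>
  define p where "p \<xi> = m * (y \<xi>)^4 * (s - lin_coeff)
      + 20/3 * (m * (- (1/2 * (k + 3 * y \<xi>)^2 + 9/10 * (y \<xi>)^2) * (y \<xi>)^4 + 3/5 * (y \<xi>)^5 * (k + 3 * y \<xi>))) - \<xi>" for \<xi>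
  have V: "vel (W \<xi>) $ 2 = k + 3 * y \<xi>" "temp (W \<xi>) = 3/5 * (y \<xi>)^2" "dens (W \<xi>) = m * (y \<xi>)^3"
      "entropy (3/2) (W \<xi>) = s"
    if "\<xi> \<in> {a<..<b}" for \<xi>
    using f(4)[OF that] f(6)[OF that] f(7)[OF that] f(8)[OF that] by (simp_all add: y_def field_simps)
  have eq: "rel_flux (W \<xi>) \<xi> = p \<xi>" if "\<xi> \<in> {a<..<b}" for \<xi>
  proof -
    have rv: "relv (W \<xi>) \<xi> = - y \<xi>" unfolding relv_def f(4)[OF that] by (simp add: y_def)
    show ?thesis unfolding rel_flux_def energy_normal[OF v[OF that]]
      unfolding rv entropy_density_def pressure_def V[OF that] p_def by (rule rarefaction_flux_identity)
  qed
  have H: "rel_entropy (W x) = - m * (y x)^3 * s + 20/3 * (1/2 * m * (y x)^3 * (k + 3 * y x)^2 + 9/10 * m * (y x)^5)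
      + lin_coeff * m * (y x)^3 + 1"
    unfolding rel_entropy_def energy_normal[OF v[OF x]]
    unfolding entropy_density_def V[OF x] by (rule rarefaction_entropy_identity)
  have dy: "(y has_real_derivative 1/4) (at x)" unfolding y_def[abs_def] by (auto intro!: derivative_eq_intros)
  have "(p has_real_derivative - rel_entropy (W x)) (at x)"
    unfolding p_def[abs_def] H
    by (rule DERIV_cong, (rule derivative_intros dy)+) (simp add: field_simps eval_nat_numeral)
  then show ?thesis
    by (rule has_field_derivative_transform_within_open[of _ _ _ "{a<..<b}"]) (use x eq in auto)
qed

lemma tendsto_rel_flux:
  assumes W: "(W \<longlongrightarrow> u) F" and g: "(g \<longlongrightarrow> x) F" and p: "positive_state u"
  shows "((\<lambda>\<xi>. rel_flux (W \<xi>) (g \<xi>)) \<longlongrightarrow> rel_flux u x) F"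
proof -
  have d: "((\<lambda>\<xi>. dens (W \<xi>)) \<longlongrightarrow> dens u) F" and t: "((\<lambda>\<xi>. temp (W \<xi>)) \<longlongrightarrow> temp u) F" and v: "((\<lambda>\<xi>. vel (W \<xi>)) \<longlongrightarrow> vel u) F"
    by (intro tendsto_intros W)+
  have ne: "dens u \<noteq> 0" "temp u \<noteq> 0" using p by (auto simp: positive_state_def)
  have s: "((\<lambda>\<xi>. entropy_density (3/2) (W \<xi>)) \<longlongrightarrow> entropy_density (3/2) u) F"
    unfolding entropy_density_def entropy_def by (intro tendsto_intros d t ne)
  have e: "((\<lambda>\<xi>. energy (3/2) (W \<xi>)) \<longlongrightarrow> energy (3/2) u) F"
    unfolding energy_def internal_energy_def by (intro tendsto_intros d t v)
  show ?thesis unfolding rel_flux_def relv_def pressure_def by (intro tendsto_intros d t v s e g)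
qed

lemma rel_flux_affine: "rel_flux u y = rel_flux u x - (y - x) * rel_entropy u"
  by (simp add: rel_flux_def rel_entropy_def relv_def field_simps)

text \<open>On a constant piece as well as in a rarefaction, the slope in \<xi> is minus the
  relative entropy.\<close>

lemma rel_flux_gap_mono:
  assumes gap: "W constant_on {a<..<b} \<or> rarefaction_on (3/2) {a<..<b} W"
    and pos: "\<And>\<xi>. \<xi> \<in> {a<..<b} \<Longrightarrow> positive_state (W \<xi>)" and v: "\<And>\<xi>. \<xi> \<in> {a<..<b} \<Longrightarrow> (vel (W \<xi>) $ 1)^2 = 4"
    and xy: "a < x" "x < y" "y < b"
  shows "rel_flux (W y) y \<le> rel_flux (W x) x"
  using gap
proof
  assume "W constant_on {a<..<b}"
  then have e: "W y = W x" using xy unfolding constant_on_def by auto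
  have "rel_entropy (W x) \<ge> 0" using rel_entropy_nonneg(1) pos v xy by auto
  then show ?thesis unfolding e rel_flux_affine[of "W x" y x] using xy by simp
next
  assume R: "rarefaction_on (3/2) {a<..<b} W"
  show ?thesis
  proof (rule DERIV_nonpos_imp_nonincreasing[where f="\<lambda>\<xi>. rel_flux (W \<xi>) \<xi>"])
    show "x \<le> y" using xy by simp
    fix z assume "x \<le> z" "z \<le> y"
    then have z: "z \<in> {a<..<b}" using xy by auto
    have "rel_entropy (W z) \<ge> 0" using rel_entropy_nonneg(1) pos[OF z] v[OF z] by auto
    then show "\<exists>d. ((\<lambda>\<xi>. rel_flux (W \<xi>) \<xi>) has_real_derivative d) (at z) \<and> d \<le> 0"
      using rel_flux_rarefaction_deriv[OF R v z] by (intro exI[of _ "- rel_entropy (W z)"]) simp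
  qed
qed

text \<open>Both sides of a wave speed \<open>a\<close> at once: \<open>F\<close> is \<open>at_left a\<close> or \<open>at_right a\<close>.\<close>

lemma gap_trace:
  assumes gap: "W constant_on S \<or> rarefaction_on (3/2) S W" and F: "F \<noteq> bot" "eventually (\<lambda>\<xi>. \<xi> \<in> S) F"
      "((\<lambda>\<xi>. \<xi>) \<longlongrightarrow> a) F"
    and lim: "(W \<longlongrightarrow> u) F" and pos: "positive_state u" and x: "x \<in> S"
  shows "positive_state (W x)" "vel (W x) $ 1 = vel u $ 1"
    "W x = u \<or> (relv (W x) x < 0 \<longleftrightarrow> relv u a < 0) \<and> relv (W x) x \<noteq> 0 \<and> relv u a \<noteq> 0"
proof -
  have "positive_state (W x) \<and> vel (W x) $ 1 = vel u $ 1 \<and>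
    (W x = u \<or> (relv (W x) x < 0 \<longleftrightarrow> relv u a < 0) \<and> relv (W x) x \<noteq> 0 \<and> relv u a \<noteq> 0)"
    using gap
  proof
    assume "W constant_on S"
    then have "\<xi> \<in> S \<Longrightarrow> W \<xi> = W x" for \<xi> using x unfolding constant_on_def by auto
    then have "eventually (\<lambda>\<xi>. W \<xi> = W x) F" using F(2) by (auto elim: eventually_mono)
    then have "(W \<longlongrightarrow> W x) F" by (rule tendsto_eventually)
    then have "W x = u" using tendsto_unique[OF F(1)] lim by blast
    then show ?thesis using pos by simp
  next
    assume R: "rarefaction_on (3/2) S W"
    have ne: "S \<noteq> {}" using x by auto
    obtain \<epsilon> k m s v1 where f: "\<epsilon> = 1 \<or> \<epsilon> = -1" "\<And>\<xi>. \<xi> \<in> S \<Longrightarrow> positive_state (W \<xi>)"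
      "\<And>\<xi>. \<xi> \<in> S \<Longrightarrow> \<epsilon> * sound_speed (3/2) (W \<xi>) = (\<xi> - k) / 4"
      "\<And>\<xi>. \<xi> \<in> S \<Longrightarrow> vel (W \<xi>) $ 2 = \<xi> - (\<xi> - k) / 4" "\<And>\<xi>. \<xi> \<in> S \<Longrightarrow> vel (W \<xi>) $ 1 = v1"
      "\<And>\<xi>. \<xi> \<in> S \<Longrightarrow> temp (W \<xi>) = 3/5 * ((\<xi> - k) / 4)^2"
      "\<And>\<xi>. \<xi> \<in> S \<Longrightarrow> dens (W \<xi>) = m * ((\<xi> - k) / 4)^3" "\<And>\<xi>. \<xi> \<in> S \<Longrightarrow> entropy (3/2) (W \<xi>) = s"
      by (rule rarefaction_formulas[OF R ne]) (rule that; assumption)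
    have "((\<lambda>\<xi>. vel (W \<xi>) $ 1) \<longlongrightarrow> vel u $ 1) F" by (intro tendsto_intros lim)
    moreover have "((\<lambda>\<xi>. vel (W \<xi>) $ 1) \<longlongrightarrow> v1) F"
      by (rule tendsto_eventually) (use F(2) f(5) in \<open>auto elim: eventually_mono\<close>)
    ultimately have v1: "vel u $ 1 = v1" using tendsto_unique[OF F(1)] by blast
    have "((\<lambda>\<xi>. vel (W \<xi>) $ 2) \<longlongrightarrow> vel u $ 2) F" by (intro tendsto_intros lim)
    moreover have "((\<lambda>\<xi>. vel (W \<xi>) $ 2) \<longlongrightarrow> a - (a - k) / 4) F"
    proof (rule tendsto_cong[THEN iffD2])
      show "eventually (\<lambda>\<xi>. vel (W \<xi>) $ 2 = \<xi> - (\<xi> - k) / 4) F" using F(2) f(4) by (auto elim: eventually_mono)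
      show "((\<lambda>\<xi>. \<xi> - (\<xi> - k) / 4) \<longlongrightarrow> a - (a - k) / 4) F" by (intro tendsto_intros F(3)) simp
    qed
    ultimately have v2: "vel u $ 2 = a - (a - k) / 4" using tendsto_unique[OF F(1)] by blast
    have "((\<lambda>\<xi>. \<epsilon> * sound_speed (3/2) (W \<xi>)) \<longlongrightarrow> \<epsilon> * sound_speed (3/2) u) F"
      unfolding sound_speed_def by (intro tendsto_intros lim)
    moreover have "((\<lambda>\<xi>. \<epsilon> * sound_speed (3/2) (W \<xi>)) \<longlongrightarrow> (a - k) / 4) F"
    proof (rule tendsto_cong[THEN iffD2])
      show "eventually (\<lambda>\<xi>. \<epsilon> * sound_speed (3/2) (W \<xi>) = (\<xi> - k) / 4) F" using F(2) f(3)
          by (auto elim: eventually_mono)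
      show "((\<lambda>\<xi>. (\<xi> - k) / 4) \<longlongrightarrow> (a - k) / 4) F" by (intro tendsto_intros F(3)) simp
    qed
    ultimately have c: "\<epsilon> * sound_speed (3/2) u = (a - k) / 4" using tendsto_unique[OF F(1)] by blast
    \<comment> \<open>In a rarefaction the fluid moves relative to the ray with exactly the sound
      speed, so the relative velocity is nonzero and keeps one sign up to the edge.\<close>
    have "relv u a = - (\<epsilon> * sound_speed (3/2) u)" "relv (W x) x = - (\<epsilon> * sound_speed (3/2) (W x))"
      unfolding relv_def v2 f(4)[OF x] c f(3)[OF x] by simp_all
    then show ?thesis
      using f(1) f(2)[OF x] f(5)[OF x] v1 sound_speed_pos[OF pos] sound_speed_pos[OF f(2)[OF x]] by auto
  qed
  then show "positive_state (W x)" "vel (W x) $ 1 = vel u $ 1"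
    "W x = u \<or> (relv (W x) x < 0 \<longleftrightarrow> relv u a < 0) \<and> relv (W x) x \<noteq> 0 \<and> relv u a \<noteq> 0" by blast+
qed

text \<open>Continuity of the mass flux preserves a negative sign of \<open>relv\<close>. With the
  tangential momentum condition it forbids a jump of v1 where fluid crosses, so v1 changes only at
  contacts. The Rankine-Hugoniot conditions make all parts of \<open>rel_flux\<close> continuous
  except the entropy part, whose jump is nonpositive at a shock and zero at a contact.\<close>

lemma jump_relations:
  assumes J: "l = r \<or> shock (3/2) a l r \<or> contact_discontinuity (3/2) a l r" and p: "positive_state l"
      "positive_state r"
  shows "relv l a < 0 \<Longrightarrow> relv r a < 0 \<and> vel r $ 1 = vel l $ 1"
    "vel r $ 1 = vel l $ 1 \<or> relv r a \<le> 0" "rel_flux r a \<le> rel_flux l a"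
proof -
  have main: "(relv l a < 0 \<longrightarrow> relv r a < 0 \<and> vel r $ 1 = vel l $ 1) \<and> (vel r $ 1 = vel l $ 1 \<or> relv r a \<le> 0)
      \<and> rel_flux r a \<le> rel_flux l a"
  proof (cases "l = r")
    case True then show ?thesis by simp
  next
    case False
    then have RH: "rankine_hugoniot (3/2) a l r" using J by (auto simp: shock_def contact_discontinuity_def)
    then have m: "a * (dens r - dens l) = dens r * vel r $ 2 - dens l * vel l $ 2"
      and e: "a * (energy (3/2) r - energy (3/2) l) = (energy (3/2) r + pressure r) * vel r $ 2
          - (energy (3/2) l + pressure l) * vel l $ 2"
      and mv: "a *\<^sub>R (momentum r - momentum l) = momentum_flux r (axis 2 1) - momentum_flux l (axis 2 1)"
      by (simp_all add: rankine_hugoniot_def Let_def flux_normal)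
    have "(a *\<^sub>R (momentum r - momentum l)) $ 1 = (momentum_flux r (axis 2 1) - momentum_flux l (axis 2 1)) $ 1"
        using mv by simp
    then have m1: "a * (dens r * vel r $ 1 - dens l * vel l $ 1) = dens r * vel r $ 2 * vel r $ 1
        - dens l * vel l $ 2 * vel l $ 1"
      by (simp add: flux_normal momentum_def)
    have M: "dens r * relv r a = dens l * relv l a" using m by (simp add: relv_def algebra_simps)
    have M1: "dens r * relv r a * vel r $ 1 = dens l * relv l a * vel l $ 1" using m1
        by (simp add: relv_def algebra_simps)
    have E: "energy (3/2) r * relv r a + pressure r * vel r $ 2 = energy (3/2) l * relv l a + pressure l * vel l $ 2"
      using e by (simp add: relv_def algebra_simps)
    have dp: "dens l > 0" "dens r > 0" using p by (auto simp: positive_state_def)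
    have fl: "rel_flux u a = - (entropy_density (3/2) u * relv u a)
        + 20/3 * (energy (3/2) u * relv u a + pressure u * vel u $ 2)
       + (lin_coeff - 40/3) * (dens u * relv u a) - a" for u
      by (simp add: rel_flux_def algebra_simps)
    have key: "rel_flux r a - rel_flux l a = entropy_density (3/2) l * relv l a - entropy_density (3/2) r * relv r a"
      unfolding fl M E by simp
    from J False consider "shock (3/2) a l r" | "contact_discontinuity (3/2) a l r" by blast
    then show ?thesis
    proof cases
      case 1
      then have ne: "relv l a \<noteq> 0" and ent: "a * (entropy_density (3/2) r - entropy_density (3/2) l)
         \<le> entropy_density (3/2) r * vel r $ 2 - entropy_density (3/2) l * vel l $ 2"
        by (simp_all add: shock_def relv_def flux_normal)
      have v1: "vel r $ 1 = vel l $ 1" using M1 unfolding M using ne dp by simp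
      have "relv r a < 0" if "relv l a < 0"
      proof -
        have "dens r * relv r a < 0" unfolding M using that dp by (simp add: mult_pos_neg)
        then show ?thesis using dp by (simp add: mult_less_0_iff)
      qed
      moreover have "rel_flux r a \<le> rel_flux l a" using key ent by (simp add: relv_def algebra_simps)
      ultimately show ?thesis using v1 by blast
    next
      case 2
      then have z: "relv l a = 0" "relv r a = 0" by (simp_all add: contact_discontinuity_def relv_def)
      then show ?thesis using key by simp
    qed
  qed
  show "relv l a < 0 \<Longrightarrow> relv r a < 0 \<and> vel r $ 1 = vel l $ 1" "vel r $ 1 = vel l $ 1 \<or> relv r a \<le> 0"
    "rel_flux r a \<le> rel_flux l a" using main by blast+
qed

text \<open>The relative entropy is controlled only where v1^2 = 4, while several contacts might a
  priori produce other tangential velocities. Going to the right, v1 is -2 until a contact changes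
  it. Beyond that contact the fluid lags behind the ray, that is \<open>relv\<close> is negative;
  this persists, excludes further contacts, and the right end state then forces v1 = 2.\<close>

lemma wave_fan_unique:
  assumes fan: "wave_fan (3/2) uL uR W"
  shows "\<exists>X. finite X \<and> (\<forall>\<xi>. \<xi> \<notin> X \<longrightarrow> W \<xi> = (if \<xi> < 0 then uL else uR))"
proof -
  obtain X where X: "finite X" and left: "\<forall>\<xi>. (\<forall>a\<in>X. \<xi> < a) \<longrightarrow> W \<xi> = uL" and right: "\<forall>\<xi>. (\<forall>a\<in>X. a < \<xi>) \<longrightarrow> W \<xi> = uR"
    and mid: "\<forall>a\<in>X. \<forall>b\<in>X. a < b \<and> {a<..<b} \<inter> X = {} \<longrightarrow> W constant_on {a<..<b} \<or> rarefaction_on (3/2) {a<..<b} W"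
    and jump: "\<forall>a\<in>X. \<exists>l r. (W \<longlongrightarrow> l) (at_left a) \<and> (W \<longlongrightarrow> r) (at_right a) \<and> positive_state l \<and> positive_state r \<and>
            (l = r \<or> shock (3/2) a l r \<or> contact_discontinuity (3/2) a l r)"
    using fan unfolding wave_fan_def by (elim exE conjE)
  have gapc: "W constant_on {a<..<b} \<or> rarefaction_on (3/2) {a<..<b} W" if "a < b" "{a<..<b} \<inter> X = {}" for a b
    by (rule fan_gap_cases[OF X left right mid that])
  have evl: "eventually (\<lambda>\<xi>. \<xi> \<in> {a'<..<a}) (at_left a)" if "a' < a" for a' a :: real
    using that by (auto simp: eventually_at_left_field intro!: exI[of _ a'])
  have evr: "eventually (\<lambda>\<xi>. \<xi> \<in> {a<..<b'}) (at_right a)" if "a < b'" for a b' :: real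
    using that by (auto simp: eventually_at_right_field intro!: exI[of _ b'])
  have sides: "\<exists>l r. positive_state l \<and> positive_state r
      \<and> (l = r \<or> shock (3/2) a l r \<or> contact_discontinuity (3/2) a l r) \<and>
       (W \<longlongrightarrow> l) (at_left a) \<and> (W \<longlongrightarrow> r) (at_right a) \<and>
       positive_state (W y) \<and> vel (W x) $ 1 = vel l $ 1 \<and> vel (W y) $ 1 = vel r $ 1 \<and>
       (relv (W x) x < 0 \<longrightarrow> relv l a < 0) \<and> (relv r a \<le> 0 \<longrightarrow> relv (W y) y < 0)"
    if a: "a \<in> X" "{a'<..<a} \<inter> X = {}" "{a<..<b'} \<inter> X = {}" "a' < x" "x < a" "a < y" "y < b'" for a a' b' x y
  proof -
    obtain l r where lr: "(W \<longlongrightarrow> l) (at_left a)" "(W \<longlongrightarrow> r) (at_right a)" "positive_state l" "positive_state r"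
       "l = r \<or> shock (3/2) a l r \<or> contact_discontinuity (3/2) a l r" using jump a(1) by blast
    have gl: "W constant_on {a'<..<a} \<or> rarefaction_on (3/2) {a'<..<a} W" using gapc a by auto
    have gr: "W constant_on {a<..<b'} \<or> rarefaction_on (3/2) {a<..<b'} W" using gapc a by auto
    have "x \<in> {a'<..<a}" "y \<in> {a<..<b'}" "a' < a" "a < b'" using a by auto
    note L = gap_trace[OF gl trivial_limit_at_left_real evl[OF this(3)] tendsto_ident_at lr(1,3) this(1)]
      and R = gap_trace[OF gr trivial_limit_at_right_real evr[OF this(4)] tendsto_ident_at lr(2,4) this(2)]
    have "relv (W x) x < 0 \<longrightarrow> relv l a < 0" using L(3) a by (auto simp: relv_def)
    moreover have "relv r a \<le> 0 \<longrightarrow> relv (W y) y < 0" using R(3) a by (auto simp: relv_def)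
    ultimately show ?thesis using lr L R by blast
  qed
  have gapv: "(positive_state (W x) \<longrightarrow> positive_state (W y)) \<and> vel (W y) $ 1 = vel (W x) $ 1
      \<and> (relv (W x) x < 0 \<longrightarrow> relv (W y) y < 0)"
    if g: "{a<..<b} \<inter> X = {}" "a < x" "x < y" "y < b" for a b x y
  proof -
    have "a < b" using g by auto
    from gapc[OF this g(1)] show ?thesis
    proof
      assume "W constant_on {a<..<b}"
      then have "W y = W x" using g unfolding constant_on_def by auto
      then show ?thesis using g by (auto simp: relv_def)
    next
      assume R: "rarefaction_on (3/2) {a<..<b} W"
      have ne: "{a<..<b} \<noteq> {}" and xy: "x \<in> {a<..<b}" "y \<in> {a<..<b}" using g by auto
      obtain \<epsilon> k m s v1 where f: "\<epsilon> = 1 \<or> \<epsilon> = -1" "\<And>\<xi>. \<xi> \<in> {a<..<b} \<Longrightarrow> positive_state (W \<xi>)"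
        "\<And>\<xi>. \<xi> \<in> {a<..<b} \<Longrightarrow> \<epsilon> * sound_speed (3/2) (W \<xi>) = (\<xi> - k) / 4"
        "\<And>\<xi>. \<xi> \<in> {a<..<b} \<Longrightarrow> vel (W \<xi>) $ 2 = \<xi> - (\<xi> - k) / 4" "\<And>\<xi>. \<xi> \<in> {a<..<b} \<Longrightarrow> vel (W \<xi>) $ 1 = v1"
        "\<And>\<xi>. \<xi> \<in> {a<..<b} \<Longrightarrow> temp (W \<xi>) = 3/5 * ((\<xi> - k) / 4)^2"
        "\<And>\<xi>. \<xi> \<in> {a<..<b} \<Longrightarrow> dens (W \<xi>) = m * ((\<xi> - k) / 4)^3" "\<And>\<xi>. \<xi> \<in> {a<..<b} \<Longrightarrow> entropy (3/2) (W \<xi>) = s"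
        by (rule rarefaction_formulas[OF R ne]) (rule that; assumption)
      have "relv (W \<xi>) \<xi> = - (\<epsilon> * sound_speed (3/2) (W \<xi>))" if "\<xi> \<in> {a<..<b}" for \<xi>
        unfolding relv_def f(4)[OF that] f(3)[OF that] by simp
      then show ?thesis using f(1) f(2)[OF xy(1)] f(2)[OF xy(2)] f(5)[OF xy(1)] f(5)[OF xy(2)]
          sound_speed_pos[OF f(2)[OF xy(1)]] sound_speed_pos[OF f(2)[OF xy(2)]] xy by auto
    qed
  qed
  \<comment> \<open>Points on both sides of \<xi> beyond all waves, where the end states are
    attained.\<close>
  have far: "\<exists>lo hi. lo \<notin> X \<and> hi \<notin> X \<and> lo < \<xi> \<and> \<xi> < hi \<and> W lo = uL \<and> W hi = uR" for \<xi>
  proof -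
    define lo where "lo = Min (insert \<xi> X) - 1"
    define hi where "hi = Max (insert \<xi> X) + 1"
    have "lo < x" if "x \<in> insert \<xi> X" for x
    proof -
      have "Min (insert \<xi> X) \<le> x" using X that by (intro Min_le) auto
      then show ?thesis unfolding lo_def by linarith
    qed
    moreover have "x < hi" if "x \<in> insert \<xi> X" for x
    proof -
      have "x \<le> Max (insert \<xi> X)" using X that by (intro Max_ge) auto
      then show ?thesis unfolding hi_def by linarith
    qed
    ultimately have "\<forall>a\<in>X. lo < a" "\<forall>a\<in>X. a < hi" "lo < \<xi>" "\<xi> < hi" by auto
    then show ?thesis using left right by (intro exI[of _ lo] exI[of _ hi]) (auto dest: bspec)
  qed
  have pos: "positive_state (W \<xi>)" if "\<xi> \<notin> X" for \<xi>
  proof -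
    obtain lo where lo: "lo \<notin> X" "lo < \<xi>" "W lo = uL" using far[of \<xi>] by blast
    show ?thesis
    proof (rule fan_propagate[where P="\<lambda>\<xi>. positive_state (W \<xi>)", OF X _ _ lo(1) that lo(2)])
      show "positive_state (W lo)" unfolding lo(3) by (simp add: positive_state_def states)
    qed (use sides gapv in blast)+
  qed
  have P1: "vel (W \<xi>) $ 1 = -2 \<or> relv (W \<xi>) \<xi> < 0" if "\<xi> \<notin> X" for \<xi>
  proof -
    obtain lo where lo: "lo \<notin> X" "lo < \<xi>" "W lo = uL" using far[of \<xi>] by blast
    show ?thesis
    proof (rule fan_propagate[where P="\<lambda>\<xi>. vel (W \<xi>) $ 1 = -2 \<or> relv (W \<xi>) \<xi> < 0", OF X _ _ lo(1) that lo(2)])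
      show "vel (W lo) $ 1 = -2 \<or> relv (W lo) lo < 0" unfolding lo(3) by (simp add: state_comps)
      fix a b x y assume g: "{a<..<b} \<inter> X = {}" "a < x" "x < y" "y < b" "vel (W x) $ 1 = -2 \<or> relv (W x) x < 0"
      then show "vel (W y) $ 1 = -2 \<or> relv (W y) y < 0" using gapv[OF g(1-4)] by auto
    next
      fix a a' b' x y assume a: "a \<in> X" "{a'<..<a} \<inter> X = {}" "{a<..<b'} \<inter> X = {}" "a' < x" "x < a" "a < y" "y < b'"
        "vel (W x) $ 1 = -2 \<or> relv (W x) x < 0"
      obtain l r where lr: "positive_state l" "positive_state r"
          "l = r \<or> shock (3/2) a l r \<or> contact_discontinuity (3/2) a l r"
        "vel (W x) $ 1 = vel l $ 1" "vel (W y) $ 1 = vel r $ 1"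
        "relv (W x) x < 0 \<longrightarrow> relv l a < 0" "relv r a \<le> 0 \<longrightarrow> relv (W y) y < 0" using sides[OF a(1-7)] by blast
      note J = jump_relations[OF lr(3,1,2)]
      show "vel (W y) $ 1 = -2 \<or> relv (W y) y < 0"
        using a(8)
      proof
        assume "vel (W x) $ 1 = -2"
        then show ?thesis using J(2) lr(4,5,7) by auto
      next
        assume "relv (W x) x < 0"
        then have "relv r a < 0" using J(1) lr(6) by blast
        then show ?thesis using lr(7) by simp
      qed
    qed
  qed
  have P2: "vel (W \<xi>) $ 1 = 2" if \<xi>: "\<xi> \<notin> X" "relv (W \<xi>) \<xi> < 0" for \<xi>
  proof -
    obtain hi where hi: "hi \<notin> X" "\<xi> < hi" "W hi = uR" using far[of \<xi>] by blast
    have "vel (W hi) $ 1 = vel (W \<xi>) $ 1 \<and> relv (W hi) hi < 0"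
    proof (rule fan_propagate[where P="\<lambda>z. vel (W z) $ 1 = vel (W \<xi>) $ 1 \<and> relv (W z) z < 0", OF X _ _ \<xi>(1) hi(1,2)])
      show "vel (W \<xi>) $ 1 = vel (W \<xi>) $ 1 \<and> relv (W \<xi>) \<xi> < 0" using \<xi> by simp
      fix a b x y assume g: "{a<..<b} \<inter> X = {}" "a < x" "x < y" "y < b"
          "vel (W x) $ 1 = vel (W \<xi>) $ 1 \<and> relv (W x) x < 0"
      then show "vel (W y) $ 1 = vel (W \<xi>) $ 1 \<and> relv (W y) y < 0" using gapv[OF g(1-4)] by auto
    next
      fix a a' b' x y assume a: "a \<in> X" "{a'<..<a} \<inter> X = {}" "{a<..<b'} \<inter> X = {}" "a' < x" "x < a" "a < y" "y < b'"
        "vel (W x) $ 1 = vel (W \<xi>) $ 1 \<and> relv (W x) x < 0"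
      obtain l r where lr: "positive_state l" "positive_state r"
          "l = r \<or> shock (3/2) a l r \<or> contact_discontinuity (3/2) a l r"
        "vel (W x) $ 1 = vel l $ 1" "vel (W y) $ 1 = vel r $ 1"
        "relv (W x) x < 0 \<longrightarrow> relv l a < 0" "relv r a \<le> 0 \<longrightarrow> relv (W y) y < 0" using sides[OF a(1-7)] by blast
      have "relv r a < 0 \<and> vel r $ 1 = vel l $ 1" using jump_relations(1)[OF lr(3,1,2)] lr(6) a(8) by blast
      then show "vel (W y) $ 1 = vel (W \<xi>) $ 1 \<and> relv (W y) y < 0" using lr a(8) by auto
    qed
    then show ?thesis unfolding hi(3) by (simp add: state_comps)
  qed
  have v4: "(vel (W \<xi>) $ 1)^2 = 4" if "\<xi> \<notin> X" for \<xi> using P1[OF that] P2[OF that] by auto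
  have gm: "rel_flux (W y) y \<le> rel_flux (W x) x" if g: "{a<..<b} \<inter> X = {}" "a < x" "x < y" "y < b" for a b x y
  proof -
    have nX: "\<xi> \<notin> X" if "\<xi> \<in> {a<..<b}" for \<xi> using g(1) that by auto
    show ?thesis by (rule rel_flux_gap_mono[of W a b]) (use gapc[of a b] g pos nX v4 in auto)
  qed
  have mono: "rel_flux (W y) y \<le> rel_flux (W x) x" if xy: "x \<notin> X" "y \<notin> X" "x < y" for x y
  proof (rule fan_propagate[where P="\<lambda>z. rel_flux (W z) z \<le> rel_flux (W x) x", OF X _ _ xy order_refl])
    fix a b z z' assume "{a<..<b} \<inter> X = {}" "a < z" "z < z'" "z' < b" "rel_flux (W z) z \<le> rel_flux (W x) x"
    then show "rel_flux (W z') z' \<le> rel_flux (W x) x" using gm[of a b z z'] by linarith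
  next
    fix a a' b' z z' assume a: "a \<in> X" "{a'<..<a} \<inter> X = {}" "{a<..<b'} \<inter> X = {}" "a' < z" "z < a" "a < z'" "z' < b'"
      and Pz: "rel_flux (W z) z \<le> rel_flux (W x) x"
    obtain l r where lr: "positive_state l" "positive_state r"
        "l = r \<or> shock (3/2) a l r \<or> contact_discontinuity (3/2) a l r"
      "(W \<longlongrightarrow> l) (at_left a)" "(W \<longlongrightarrow> r) (at_right a)" using sides[OF a(1-7)] by blast
    \<comment> \<open>Monotonicity in the adjacent gaps passes to the one-sided limits, and these
      are compared by the jump inequality.\<close>
    have "rel_flux l a \<le> rel_flux (W z) z"
    proof (rule tendsto_upperbound[OF tendsto_rel_flux[OF lr(4) tendsto_ident_at lr(1)]])
      show "eventually (\<lambda>\<xi>. rel_flux (W \<xi>) \<xi> \<le> rel_flux (W z) z) (at_left a)"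
        using evl[OF a(5)] by eventually_elim (use gm[of a' a z] a in auto)
    qed simp
    moreover have "rel_flux (W z') z' \<le> rel_flux r a"
    proof (rule tendsto_lowerbound[OF tendsto_rel_flux[OF lr(5) tendsto_ident_at lr(2)]])
      show "eventually (\<lambda>\<xi>. rel_flux (W z') z' \<le> rel_flux (W \<xi>) \<xi>) (at_right a)"
        using evr[OF a(6)] by eventually_elim (use gm[of a b' _ z'] a in auto)
    qed simp
    ultimately show "rel_flux (W z') z' \<le> rel_flux (W x) x" using jump_relations(3)[OF lr(3,1,2)] Pz by linarith
  qed
  have base: "rel_flux uL \<xi> = 0" "rel_flux uR \<xi> = 0" for \<xi>
    by (simp_all add: rel_flux_def relv_def entropies energies state_comps lin_coeff_def s0_def algebra_simps)
  have q0: "rel_flux (W \<xi>) \<xi> = 0" if "\<xi> \<notin> X" for \<xi>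
  proof -
    obtain lo hi where f: "lo \<notin> X" "hi \<notin> X" "lo < \<xi>" "\<xi> < hi" "W lo = uL" "W hi = uR" using far[of \<xi>] by blast
    have "rel_flux (W \<xi>) \<xi> \<le> 0" using mono[OF f(1) that f(3)] base f by simp
    moreover have "0 \<le> rel_flux (W \<xi>) \<xi>" using mono[OF that f(2) f(4)] base f by simp
    ultimately show ?thesis by simp
  qed
  \<comment> \<open>The flux is zero on a whole neighbourhood of \<xi>, and its slope there is minus
    the relative entropy.\<close>
  have H0: "rel_entropy (W \<xi>) = 0" if \<xi>: "\<xi> \<notin> X" for \<xi>
  proof -
    have "open (- X)" using X finite_imp_closed by blast
    then obtain d where d: "d > 0" "ball \<xi> d \<subseteq> - X" using \<xi> open_contains_ball by (metis ComplI)
    let ?a = "\<xi> - d" and ?b = "\<xi> + d"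
    have sub: "{?a<..<?b} \<inter> X = {}" using d(2) by (auto simp: ball_def dist_real_def subset_iff abs_less_iff)
    have nX: "z \<notin> X" if "z \<in> {?a<..<?b}" for z using sub that by auto
    from gapc[OF _ sub] d(1) consider "W constant_on {?a<..<?b}" | "rarefaction_on (3/2) {?a<..<?b} W" by auto
    then show ?thesis
    proof cases
      case 1
      have in2: "\<xi> + d/2 \<in> {?a<..<?b}" "\<xi> \<in> {?a<..<?b}" using d(1) by auto
      then have "W (\<xi> + d/2) = W \<xi>" using 1 unfolding constant_on_def by auto
      then have "rel_flux (W \<xi>) (\<xi> + d/2) = 0" using q0[OF nX[OF in2(1)]] by simp
      then show ?thesis using q0[OF \<xi>] rel_flux_affine[of "W \<xi>" "\<xi> + d/2" \<xi>] d(1) by simp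
    next
      case 2
      have in2: "\<xi> \<in> {?a<..<?b}" using d(1) by auto
      have "((\<lambda>z. rel_flux (W z) z) has_real_derivative - rel_entropy (W \<xi>)) (at \<xi>)"
        by (rule rel_flux_rarefaction_deriv[OF 2 v4[OF nX] in2])
      moreover have "((\<lambda>z. rel_flux (W z) z) has_real_derivative 0) (at \<xi>)"
        by (rule has_field_derivative_transform_within_open[of "\<lambda>z. 0" _ _ "{?a<..<?b}"]) (use in2 q0 nX in auto)
      ultimately have "- rel_entropy (W \<xi>) = 0" by (rule DERIV_unique)
      then show ?thesis by simp
    qed
  qed
  show ?thesis
  \<comment> \<open>The slope 0 joins the exceptional set: with v2 = 0 the sign of
    \<open>relv\<close> is that of -\<xi>, which tells the two sides of the sheet apart only for
    \<xi> \<noteq> 0.\<close>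
  proof (intro exI[of _ "insert 0 X"] conjI allI impI)
    show "finite (insert 0 X)" using X by simp
    fix \<xi> assume "\<xi> \<notin> insert 0 X"
    then have \<xi>: "\<xi> \<notin> X" "\<xi> \<noteq> 0" by auto
    have c: "dens (W \<xi>) = 1" "temp (W \<xi>) = 3/20" "vel (W \<xi>) $ 2 = 0"
      using rel_entropy_nonneg(2)[OF pos[OF \<xi>(1)] v4[OF \<xi>(1)] H0[OF \<xi>(1)]] by auto
    have rv: "relv (W \<xi>) \<xi> = - \<xi>" by (simp add: relv_def c)
    have v1: "vel (W \<xi>) $ 1 = (if \<xi> < 0 then -2 else 2)"
      using P1[OF \<xi>(1)] P2[OF \<xi>(1)] \<xi>(2) unfolding rv by auto
    show "W \<xi> = (if \<xi> < 0 then uL else uR)"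
      using c v1 by (auto simp: prod_eq_iff states vec_eq_iff forall_2)
  qed
qed

theorem theorem2p1:
  fixes cv T :: real
  assumes "cv = 3/2" and "T > 0"
  shows "\<exists>ul ur :: state. positive_state ul \<and> positive_state ur \<and>
           (\<exists>U. self_similar_1D_solution cv T ul ur U) \<and>
           (\<forall>U. self_similar_1D_solution cv T ul ur U \<longrightarrow>
                 \<not> entropy_rate_admissible cv T (riemann_data ul ur) U)"
proof (rule exI[of _ uL], rule exI[of _ uR], intro conjI allI impI)
  note T = assms(2)
  show "positive_state uL" "positive_state uR" by (simp_all add: positive_state_def states)
  show "\<exists>U. self_similar_1D_solution cv T uL uR U" unfolding assms(1) using sheet_self_similar[OF T] by blast
  fix U assume "self_similar_1D_solution cv T uL uR U"
  then obtain W where W: "wave_fan (3/2) uL uR W" and UW: "\<And>t x. 0 < t \<Longrightarrow> t < T \<Longrightarrow> U (t, x) = W (x $ 2 / t)"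
    unfolding self_similar_1D_solution_def assms(1) by blast
  obtain X where X: "finite X" "\<And>\<xi>. \<xi> \<notin> X \<Longrightarrow> W \<xi> = (if \<xi> < 0 then uL else uR)" using wave_fan_unique[OF W] by blast
  \<comment> \<open>Positive definiteness of the averaged v tensor v in the zone, whose eigenvalues
    are 1 plus and minus this modulus.\<close>
  have "(47/96)^2 + (-4/5)^2 < (1::real)" by (simp add: power2_eq_square)
  then have u0: "cmod (Complex (47/96) (-4/5)) < 1" unfolding cmod_def by (simp add: real_sqrt_lt_1_iff)
  have "(0::real) < 2/5" by simp
  from wedge_solution[OF T this u0] obtain v where v: "v \<in> borel_measurable borel" "\<And>y. (cmod (v y))^2 = 2"
    "\<And>\<phi> G. test_function T \<phi> G \<Longrightarrow>
       integrable lborel (\<lambda>z. indicator (wedge T (2/5)) z * (v z \<bullet> cgrad (G z))) \<and>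
       (\<integral>z. indicator (wedge T (2/5)) z * (v z \<bullet> cgrad (G z)) \<partial>lborel) = 0"
    "\<And>\<phi> G. test_function T \<phi> G \<Longrightarrow>
       integrable lborel (\<lambda>z. indicator (wedge T (2/5)) z *\<^sub>R (of_real (fst (G z)) * v z + (v z ^ 2 / 2 - Complex (47/96) (-4/5)) * cnj (cgrad (G z)))) \<and>
       (\<integral>z. indicator (wedge T (2/5)) z *\<^sub>R (of_real (fst (G z)) * v z + (v z ^ 2 / 2 - Complex (47/96) (-4/5)) * cnj (cgrad (G z))) \<partial>lborel) = 0"
    by blast
  have adm: "entropy_admissible (3/2) T (riemann_data uL uR) (turb v)" by (rule turb_admissible[OF T v])
  have "entropy_rate_less (3/2) T (riemann_data uL uR) U (turb v)"
    unfolding entropy_rate_less_def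
  \<comment> \<open>The comparison takes place at \<tau> = 0, where both solutions start from the
    data and the condition on earlier times is empty. The bound L0 = 1 only ensures that the side
    length is positive.\<close>
  proof (rule exI[of _ 0], intro conjI, (use T in auto)[3], rule exI[of _ 1], intro allI impI)
    fix L :: real assume L: "1 \<le> L"
    define d where "d = 4 * L * (6/5 * (sb - s0) / 2 + 3/10 * (s1 - s0) / 2)"
    have "d > 0" unfolding d_def using L entropy_order by (intro mult_pos_pos add_pos_pos) auto
    moreover have "(square_entropy (3/2) (riemann_data uL uR) U L has_real_derivative 0) (at_right 0)"
      by (rule steady_entropy_rate[OF T X(1) UW X(2)]) (use L in auto)
    moreover have "(square_entropy (3/2) (riemann_data uL uR) (turb v) L has_real_derivative d) (at_right 0)"
      unfolding d_def by (rule turb_entropy_rate) (use L in auto)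
    ultimately show "\<exists>d d'. (square_entropy (3/2) (riemann_data uL uR) U L has_real_derivative d) (at_right 0) \<and>
            (square_entropy (3/2) (riemann_data uL uR) (turb v) L has_real_derivative d') (at_right 0) \<and> d < d'" by blast
  qed
  then show "\<not> entropy_rate_admissible cv T (riemann_data uL uR) U"
    unfolding entropy_rate_admissible_def assms(1) using adm by blast
qed

end
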